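(* Incremental $(1+\epsilon)$-approximate all-pairs shortest paths in unweighted directed graphs with a predicted sequence of edge updates can be solved by a deterministic algorithm with $O(n^{(3+\omega)/2}\log^2 n)$ preprocessing time and $O(\log n)$ worst-case edge insertion time, such that each query asked between the $i$-th and $(i+1)$-th insertion requires $O(\bar\eta_i^2\log\log n)=O(\eta_\infty^2\log\log n)$ time, where $\bar\eta_i = i-\max\{j : \{\hat e_1,\dots,\hat e_j\}\subseteq\{e_1,\dots,e_i\}\}$.
   Context: Problem: on a vertex set $V$ with $|V|=n$, the algorithm first receives (offline) a predicted sequence $\hat e_1,\dots,\hat e_m$ of distinct directed edges. Starting from the empty graph, it then receives online an interleaved sequence of edge insertions $e_1,\dots,e_m$ (the same edges, in some order) and queries $(s,t)\in V\times V$; each query must return a number in $[d(s,t),(1+\epsilon)d(s,t)]$, where $d(s,t)$ is the current unweighted shortest-path distance from $s$ to $t$. $\omega$ is the matrix multiplication exponent. With $t(e)=i$ if $e=e_i$ and $\hat t(e)=j$ if $e=\hat e_j$, $\eta_\infty=\max_e|t(e)-\hat t(e)|$.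
   Formalization: In the query bounds the errors η̄_i and η_∞ are read as max(1, η̄_i) and max(1, η_∞), since at error 0 the literal bound would be 0 time; ω is any exponent for which n×n matrices with O(log n)-bit integer entries can be multiplied in O(n^ω) time. *)

theory Defs
  imports Complex_Main "HOL-Library.Extended_Real" "HOL-Library.Multiset"
begin

section \<open>Word RAM\<close>

text \<open>
  Deterministic unit-cost random access machine, presented as structured programs over registers
  and an indirectly addressed memory.  The parameter \<open>W\<close> of the semantics bounds the absolute
  value of every computed word: a program that exceeds it, or that uses a negative address, has
  no execution.  With \<open>W = (n + 2) ^ c\<close> for a constant \<open>c\<close>, words have \<open>O(log n)\<close> bits.
\<close>

record ram_state =
  reg :: "nat \<Rightarrow> int"
  mem :: "nat \<Rightarrow> int"

datatype binop = Add | Sub | Mul | Div | And | Or | Xor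

fun eval_binop :: "binop \<Rightarrow> int \<Rightarrow> int \<Rightarrow> int" where
  "eval_binop Add x y = x + y"
| "eval_binop Sub x y = x - y"
| "eval_binop Mul x y = x * y"
| "eval_binop Div x y = x div y"
| "eval_binop And x y = and x y"
| "eval_binop Or x y = or x y"
| "eval_binop Xor x y = xor x y"

datatype ram_com =
    Skip
  | Const nat int
  | Op binop nat nat nat
  | Load nat nat
  | Store nat nat
  | Seq ram_com ram_com
  | IfPos nat ram_com ram_com
  | WhilePos nat ram_com

definition set_reg :: "nat \<Rightarrow> int \<Rightarrow> ram_state \<Rightarrow> ram_state" where
  "set_reg r v s = s\<lparr>reg := (reg s)(r := v)\<rparr>"

definition set_mem :: "nat \<Rightarrow> int \<Rightarrow> ram_state \<Rightarrow> ram_state" where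
  "set_mem a v s = s\<lparr>mem := (mem s)(a := v)\<rparr>"

text \<open>\<open>exec W P s t s'\<close>: started in \<open>s\<close>, program \<open>P\<close> halts after exactly \<open>t\<close> steps in \<open>s'\<close>.\<close>

inductive exec :: "int \<Rightarrow> ram_com \<Rightarrow> ram_state \<Rightarrow> nat \<Rightarrow> ram_state \<Rightarrow> bool" for W :: int where
  exec_Skip: "exec W Skip s 1 s"
| exec_Const: "\<bar>k\<bar> < W \<Longrightarrow> exec W (Const r k) s 1 (set_reg r k s)"
| exec_Op: "v = eval_binop f (reg s a) (reg s b) \<Longrightarrow> \<bar>v\<bar> < W \<Longrightarrow>
    exec W (Op f r a b) s 1 (set_reg r v s)"
| exec_Load: "reg s a \<ge> 0 \<Longrightarrow> exec W (Load r a) s 1 (set_reg r (mem s (nat (reg s a))) s)"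
| exec_Store: "reg s a \<ge> 0 \<Longrightarrow> exec W (Store a r) s 1 (set_mem (nat (reg s a)) (reg s r) s)"
| exec_Seq: "exec W P s t s' \<Longrightarrow> exec W Q s' t' s'' \<Longrightarrow> exec W (Seq P Q) s (t + t') s''"
| exec_IfTrue: "reg s r > 0 \<Longrightarrow> exec W P s t s' \<Longrightarrow> exec W (IfPos r P Q) s (t + 1) s'"
| exec_IfFalse: "reg s r \<le> 0 \<Longrightarrow> exec W Q s t s' \<Longrightarrow> exec W (IfPos r P Q) s (t + 1) s'"
| exec_WhileFalse: "reg s r \<le> 0 \<Longrightarrow> exec W (WhilePos r P) s 1 s"
| exec_WhileTrue: "reg s r > 0 \<Longrightarrow> exec W P s t s' \<Longrightarrow> exec W (WhilePos r P) s' t' s'' \<Longrightarrow>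
    exec W (WhilePos r P) s (t + t' + 1) s''"

inductive_cases exec_SkipE: "exec W Skip s t s'"
inductive_cases exec_ConstE: "exec W (Const r k) s t s'"
inductive_cases exec_OpE: "exec W (Op f r a b) s t s'"
inductive_cases exec_LoadE: "exec W (Load r a) s t s'"
inductive_cases exec_StoreE: "exec W (Store a r) s t s'"
inductive_cases exec_SeqE: "exec W (Seq P Q) s t s'"
inductive_cases exec_IfE: "exec W (IfPos r P Q) s t s'"
inductive_cases exec_WhileE: "exec W (WhilePos r P) s t s'"

lemma exec_deterministic:
  "exec W P s t s' \<Longrightarrow> exec W P s u s'' \<Longrightarrow> t = u \<and> s' = s''"
proof (induction arbitrary: u s'' rule: exec.induct)
  case exec_Skip
  from exec_Skip.prems show ?case by (rule exec_SkipE) simp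
next
  case exec_Const
  from exec_Const.prems show ?case by (rule exec_ConstE) simp
next
  case exec_Op
  from exec_Op.prems show ?case by (rule exec_OpE) (simp add: exec_Op.hyps)
next
  case exec_Load
  from exec_Load.prems show ?case by (rule exec_LoadE) simp
next
  case exec_Store
  from exec_Store.prems show ?case by (rule exec_StoreE) simp
next
  case (exec_Seq P s t s' Q t' s0)
  from exec_Seq.prems obtain u1 s1 u2
    where *: "u = u1 + u2" "exec W P s u1 s1" "exec W Q s1 u2 s''"
    by (rule exec_SeqE)
  from exec_Seq.IH(1)[OF *(2)] have eq: "t = u1" "s' = s1" by blast+
  from exec_Seq.IH(2)[OF *(3)[folded eq(2)]] eq(1) *(1) show ?case by simp
next
  case (exec_IfTrue s r P t s' Q)
  from exec_IfTrue.prems show ?case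
  proof (rule exec_IfE)
    fix v assume *: "u = Suc v" "exec W P s v s''"
    from exec_IfTrue.IH[OF *(2)] *(1) show ?thesis by simp
  next
    assume "reg s r \<le> 0"
    with exec_IfTrue.hyps show ?thesis by linarith
  qed
next
  case (exec_IfFalse s r Q t s' P)
  from exec_IfFalse.prems show ?case
  proof (rule exec_IfE)
    assume "0 < reg s r"
    with exec_IfFalse.hyps show ?thesis by linarith
  next
    fix v assume *: "u = Suc v" "exec W Q s v s''"
    from exec_IfFalse.IH[OF *(2)] *(1) show ?thesis by simp
  qed
next
  case (exec_WhileFalse s r P)
  from exec_WhileFalse.prems show ?case
  proof (rule exec_WhileE)
    assume "u = Suc 0" "s'' = s"
    then show ?thesis by simp
  next
    assume "0 < reg s r"
    with exec_WhileFalse.hyps show ?thesis by linarith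
  qed
next
  case (exec_WhileTrue s r P t s' t' s0)
  from exec_WhileTrue.prems show ?case
  proof (rule exec_WhileE)
    assume "reg s r \<le> 0"
    with exec_WhileTrue.hyps show ?thesis by linarith
  next
    fix u1 s1 u2
    assume *: "u = Suc (u1 + u2)" "exec W P s u1 s1" "exec W (WhilePos r P) s1 u2 s''"
    from exec_WhileTrue.IH(1)[OF *(2)] have eq: "t = u1" "s' = s1" by blast+
    from exec_WhileTrue.IH(2)[OF *(3)[folded eq(2)]] eq(1) *(1) show ?thesis by simp
  qed
qed


section \<open>Matrix multiplication exponent\<close>

text \<open>
  Register 0 holds \<open>n\<close>; the two matrices are stored row by row from address 0 on, and the product
  is expected right behind them.
\<close>

definition matmul_input :: "nat \<Rightarrow> (nat \<Rightarrow> nat \<Rightarrow> int) \<Rightarrow> (nat \<Rightarrow> nat \<Rightarrow> int) \<Rightarrow> ram_state" where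
  "matmul_input n A B =
     \<lparr>reg = (\<lambda>_. 0)(0 := int n),
      mem = (\<lambda>a. if a < n\<^sup>2 then A (a div n) (a mod n)
                 else if a < 2 * n\<^sup>2 then B ((a - n\<^sup>2) div n) ((a - n\<^sup>2) mod n)
                 else 0)\<rparr>"

text \<open>
  \<open>n \<times> n\<close> integer matrices with \<open>O(log n)\<close>-bit entries can be multiplied in time \<open>O(n\<^sup>\<omega>)\<close>.
  This is the sense in which running times are stated in terms of \<open>n\<^sup>\<omega>\<close>; it does not presuppose
  that the infimum of these \<open>\<omega>\<close> is itself attained.
\<close>

definition matmul_exponent :: "real \<Rightarrow> bool" where
  "matmul_exponent \<omega> \<longleftrightarrow>
    (\<forall>k::nat. \<exists>(P::ram_com) (c::nat) (C::real). \<forall>n\<ge>1. \<forall>A B.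
      (\<forall>i<n. \<forall>j<n. \<bar>A i j\<bar> \<le> int n ^ k \<and> \<bar>B i j\<bar> \<le> int n ^ k) \<longrightarrow>
      (\<exists>t s. exec ((int n + 2) ^ c) P (matmul_input n A B) t s \<and>
             real t \<le> C * real n powr \<omega> \<and>
             (\<forall>i<n. \<forall>j<n. mem s (2 * n\<^sup>2 + i * n + j) = (\<Sum>l<n. A i l * B l j))))"


section \<open>Incremental shortest paths with predicted updates\<close>

type_synonym edge = "nat \<times> nat"

definition graph_dist :: "edge set \<Rightarrow> nat \<Rightarrow> nat \<Rightarrow> enat" where
  "graph_dist E s t = (INF k\<in>{k. (s, t) \<in> E ^^ k}. enat k)"

datatype request = Insert nat nat | Query nat nat

fun insertions :: "request list \<Rightarrow> edge list" where
  "insertions [] = []"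
| "insertions (Insert u v # rs) = (u, v) # insertions rs"
| "insertions (Query s t # rs) = insertions rs"

definition valid_prediction :: "nat \<Rightarrow> edge list \<Rightarrow> bool" where
  "valid_prediction n pred \<longleftrightarrow> distinct pred \<and> set pred \<subseteq> {..<n} \<times> {..<n}"

definition valid_requests :: "nat \<Rightarrow> edge list \<Rightarrow> request list \<Rightarrow> bool" where
  "valid_requests n pred rs \<longleftrightarrow>
     mset (insertions rs) = mset pred \<and> (\<forall>s t. Query s t \<in> set rs \<longrightarrow> s < n \<and> t < n)"

definition time_of :: "edge list \<Rightarrow> edge \<Rightarrow> nat" where
  "time_of es e = (THE i. i \<in> {1..length es} \<and> es ! (i - 1) = e)"

text \<open>The inserted 0 only serves to make the maximum well defined for the empty edge sequence.\<close>

definition eta_inf :: "edge list \<Rightarrow> edge list \<Rightarrow> nat" where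
  "eta_inf pred es =
     Max (insert 0 ((\<lambda>e. nat \<bar>int (time_of es e) - int (time_of pred e)\<bar>) ` set es))"

definition eta_bar :: "edge list \<Rightarrow> edge list \<Rightarrow> nat \<Rightarrow> nat" where
  "eta_bar pred es i =
     i - Max {j. j \<le> length pred \<and> set (take j pred) \<subseteq> set (take i es)}"

text \<open>
  An algorithm consists of three programs working on the same memory: one for preprocessing, one
  for processing an insertion and one for answering a query.
\<close>

record algorithm =
  preprocess :: ram_com
  on_insert :: ram_com
  on_query :: ram_com

definition prediction_input :: "nat \<Rightarrow> edge list \<Rightarrow> ram_state" where
  "prediction_input n pred =
     \<lparr>reg = (\<lambda>_. 0)(0 := int n, 1 := int (length pred)),
      mem = (\<lambda>a. if a < 2 * length pred
                 then int (if even a then fst (pred ! (a div 2)) else snd (pred ! (a div 2)))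
                 else 0)\<rparr>"

text \<open>The two vertices of a request are passed in registers 0 and 1.\<close>

fun handle :: "int \<Rightarrow> algorithm \<Rightarrow> request \<Rightarrow> ram_state \<Rightarrow> nat \<Rightarrow> ram_state \<Rightarrow> bool" where
  "handle W A (Insert u v) s t s' \<longleftrightarrow>
     exec W (on_insert A) (set_reg 1 (int v) (set_reg 0 (int u) s)) t s'"
| "handle W A (Query u v) s t s' \<longleftrightarrow>
     exec W (on_query A) (set_reg 1 (int v) (set_reg 0 (int u) s)) t s'"

text \<open>
  The answer to a query is the fraction of the contents of registers 0 and 1, where denominator 0
  encodes \<open>\<infinity>\<close>.
\<close>

definition answer :: "ram_state \<Rightarrow> ereal" where
  "answer s = (if reg s 1 = 0 then \<infinity> else ereal (real_of_int (reg s 0) / real_of_int (reg s 1)))"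

definition approx_dist :: "real \<Rightarrow> enat \<Rightarrow> ereal \<Rightarrow> bool" where
  "approx_dist \<epsilon> d x \<longleftrightarrow> ereal_of_enat d \<le> x \<and> x \<le> ereal (1 + \<epsilon>) * ereal_of_enat d"

text \<open>
  \<open>A\<close> is correct for every \<open>n\<close>; the time bounds, which may depend on the current insertion count
  \<open>i\<close>, the predicted and the actual edge sequence, are required for \<open>n \<ge> N\<close>.  Since execution is
  deterministic, the \<open>k\<close>-th state \<open>\<sigma> k\<close> depends on the first \<open>k\<close> requests only.
\<close>

definition solves_incremental_APSP ::
  "real \<Rightarrow> algorithm \<Rightarrow> nat \<Rightarrow> nat \<Rightarrow> (nat \<Rightarrow> real) \<Rightarrow> (nat \<Rightarrow> real) \<Rightarrow>
   (nat \<Rightarrow> edge list \<Rightarrow> edge list \<Rightarrow> nat \<Rightarrow> nat \<Rightarrow> bool) \<Rightarrow> bool" where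
  "solves_incremental_APSP \<epsilon> A c N pre_time ins_time query_time_ok \<longleftrightarrow>
    (\<forall>n pred. valid_prediction n pred \<longrightarrow>
      (\<exists>t0 s0. exec ((int n + 2) ^ c) (preprocess A) (prediction_input n pred) t0 s0 \<and>
        (n \<ge> N \<longrightarrow> real t0 \<le> pre_time n) \<and>
        (\<forall>rs. valid_requests n pred rs \<longrightarrow>
          (\<exists>\<sigma> \<tau>. \<sigma> 0 = s0 \<and>
            (\<forall>k<length rs.
              handle ((int n + 2) ^ c) A (rs ! k) (\<sigma> k) (\<tau> k) (\<sigma> (Suc k)) \<and>
              (case rs ! k of
                 Insert u v \<Rightarrow> n \<ge> N \<longrightarrow> real (\<tau> k) \<le> ins_time n
               | Query s t \<Rightarrow>
                   approx_dist \<epsilon> (graph_dist (set (insertions (take k rs))) s t) (answer (\<sigma> (Suc k))) \<and>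
                   (n \<ge> N \<longrightarrow>
                     query_time_ok n pred (insertions rs) (length (insertions (take k rs))) (\<tau> k))))))))"

end

theory Submission
 imports Defs
begin

text \<open>
 For every threshold \<open>L\<close> let \<open>T\<^sub>L(x,y)\<close> be the least \<open>j\<close> such that the first \<open>j\<close> predicted edges contain a path of length
 at most \<open>L\<close> from \<open>x\<close> to \<open>y\<close>.  Then \<open>T\<^sub>2\<^sub>L\<close> is the (min,max)-product of \<open>T\<^sub>L\<close> with itself, and \<open>O(log n)\<close> thresholds with ratio
 at most \<open>1 + 1/M\<close> suffice, each obtained from earlier ones by a single product.  A (min,max)-product is the minimum of two half
 products, in which one factor attains the maximum: sort the entries of that factor, cut them into chunks, find by Boolean matrix
 multiplication the first chunk that contains a witness and scan it.  Since the time of the given multiplication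
 program is not computable from \<open>\<omega>\<close>, its step counter is measured, and the chunk size \<open>h\<close> is doubled whenever a
 multiplication took more than \<open>n h\<^sup>2\<close> steps; this gives time \<open>O(n\<^bsup>(3+\<omega>)/2\<^esup> log n)\<close> because \<open>\<omega> \<ge> 2\<close> (the output
 has to be written).

 An insertion updates the maximal runs of consecutive inserted indices.  A query takes the longest inserted prefix, in which
 distances are found by binary search over the thresholds, and runs Dijkstra's algorithm on the \<open>\<eta>\<close> inserted edges outside it.

 All programs are written in a small structured language with arrays, which is compiled to the word RAM; the multiplication program is
 embedded by relocating its memory and clearing its registers.
\<close>

section \<open>A structured language\<close>

text \<open>The condition \<open>B k j <= A i k\<close> is not by itself a Boolean product, because
  its threshold varies with the entry of \<open>A\<close>. So the sorted entries are cut twice,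
  along rows and along columns. The least value of a column chunk is a common threshold for its
  members; the pairs \<open>(k, j)\<close> whose \<open>B k j\<close> exceeds the least but not the
  greatest value of a column chunk are settled by scanning that chunk, at most once per pair.
  Entries are handled in batches of \<open>n h\<close>, which have at most \<open>2 n\<close> chunks
  of either kind, so a batch needs one product of dimension \<open>2 n\<close>. The
  \<open>n / h\<close> products balance the scans of total size \<open>n^2 h\<close> when one
  product takes \<open>n h^2\<close> steps, whence the doubling rule. One logarithm in the
  preprocessing time counts thresholds, the other doublings. The multiplication program is a black
  box that may leave anything in its memory, and erasing all it can reach could exceed the time
  bound. Every product therefore gets a fresh window of zero cells, of polynomial size because the
  word bound limits the addresses.\<close>

datatype expr = Num nat | Var nat | Plus expr expr | Minus expr expr | Times expr expr
 | Quot expr expr | Less expr expr | Rd nat expr | Pos expr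

record st =
 vr :: "nat => nat"
 ar :: "nat => nat => nat"
 pm :: "nat => int"
 ck :: nat

primrec val :: "expr => st => nat" where
 "val (Num k) s = k"
| "val (Var x) s = vr s x"
| "val (Plus a b) s = val a s + val b s"
| "val (Minus a b) s = val a s - val b s"
| "val (Times a b) s = val a s * val b s"
| "val (Quot a b) s = val a s div val b s"
| "val (Less a b) s = of_bool (val a s < val b s)"
| "val (Rd x a) s = ar s x (val a s)"
| "val (Pos a) s = of_bool (pm s (val a s) > 0)"

definition Leq :: "expr => expr => expr" where "Leq a b = Minus (Num 1) (Less b a)"
definition Conj :: "expr => expr => expr" where "Conj a b = Times a b"
definition Neg :: "expr => expr" where "Neg a = Minus (Num 1) a"
definition Equal :: "expr => expr => expr" where "Equal a b = Conj (Leq a b) (Leq b a)"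

lemma val_derived [simp]:
 "val (Leq a b) s = of_bool (val a s <= val b s)"
 "val (Conj a b) s = val a s * val b s"
 "val (Neg a) s = 1 - val a s"
 "val (Equal a b) s = of_bool (val a s = val b s)"
 by (auto simp: Leq_def Conj_def Equal_def Neg_def)

text \<open>All loops are counted, so termination is structural and \<open>run\<close> can be
  primitive recursive. \<open>Mult\<close> embeds a foreign RAM program; besides it,
  \<open>PSet\<close> is the only way to write into the signed array \<open>pm\<close> on which such
  a program works.\<close>

datatype com =
  Asg nat expr
 | Sto nat expr expr
 | PSet expr
 | Inp nat expr
 | Sq com com
 | Cond expr com com
 | For nat nat com
 | Mult ram_com nat
 | Nop

notation Sq (infixr ";;" 60)

text \<open>The variables through which \<open>Mult\<close> communicates: the dimension, the
  measured number of steps, and the first cell of its window in \<open>pm\<close>.\<close>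

abbreviation (input) "vN2 \<equiv> 2 :: nat"
abbreviation (input) "vTM \<equiv> 3 :: nat"
abbreviation (input) "vPO \<equiv> 4 :: nat"

definition setv :: "nat => nat => st => st" where
 "setv x k s = s\<lparr>vr := (vr s)(x := k), ck := Suc (ck s)\<rparr>"

definition seta :: "nat => nat => nat => st => st" where
 "seta a i k s = s\<lparr>ar := (ar s)(a := (ar s a)(i := k)), ck := Suc (ck s)\<rparr>"

definition setp :: "nat => st => st" where
 "setp i s = s\<lparr>pm := (pm s)(i := 1), ck := Suc (ck s)\<rparr>"

definition tck :: "st => st" where
 "tck s = s\<lparr>ck := Suc (ck s)\<rparr>"

lemma set_simps [simp]:
 "vr (setv x k s) = (vr s)(x := k)" "ar (setv x k s) = ar s" "pm (setv x k s) = pm s" "ck (setv x k s) = Suc (ck s)"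
 "vr (seta a i k s) = vr s" "ar (seta a i k s) = (ar s)(a := (ar s a)(i := k))" "pm (seta a i k s) = pm s" "ck (seta a i k s) = Suc (ck s)"
 "vr (setp i s) = vr s" "ar (setp i s) = ar s" "pm (setp i s) = (pm s)(i := 1)" "ck (setp i s) = Suc (ck s)"
 "vr (tck s) = vr s" "ar (tck s) = ar s" "pm (tck s) = pm s" "ck (tck s) = Suc (ck s)"
 by (simp_all add: setv_def seta_def setp_def tck_def)

primrec iterr :: "(nat => 'a => 'a => bool) => nat => 'a => 'a => bool" where
 "iterr R 0 s s' = (s' = s)"
| "iterr R (Suc k) s s' = (\<exists>u. iterr R k s u & R k u s')"

definition mult_input :: "st => ram_state" where
 "mult_input s = matmul_input (vr s vN2) (\<lambda>i j. pm s (vr s vPO + i * vr s vN2 + j))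
   (\<lambda>i j. pm s (vr s vPO + (vr s vN2)\<^sup>2 + i * vr s vN2 + j))"

text \<open>Bits in the two factors and zeros behind them: the window then looks exactly like an
  initial memory of \<open>matmul_input\<close>.\<close>

definition mult_ready :: "st => bool" where
 "mult_ready s \<longleftrightarrow> vr s vN2 \<ge> 1 & (\<forall>x. x < 2 * (vr s vN2)\<^sup>2 --> pm s (vr s vPO + x) \<in> {0, 1}) &
   (\<forall>x\<ge>2 * (vr s vN2)\<^sup>2. pm s (vr s vPO + x) = 0)"

text \<open>
 \<open>B\<close> bounds every value that is assigned, \<open>J\<close> is the read-only input.  The clock \<open>ck\<close> is a ghost:
 compiled code runs in time proportional to it.
\<close>

primrec run :: "nat => nat list => com => st => st => bool" where
 "run B J (Asg x e) s s' = (val e s <= B & s' = setv x (val e s) s)"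
| "run B J (Sto a d e) s s' = (val e s <= B & s' = seta a (val d s) (val e s) s)"
| "run B J (PSet d) s s' = (s' = setp (val d s) s)"
| "run B J (Inp x e) s s' = (val e s < length J & s' = setv x (J ! val e s) s)"
| "run B J (Sq c d) s s' = (\<exists>u. run B J c s u & run B J d u s')"
| "run B J (Cond e c d) s s' = (if val e s > 0 then run B J c (tck s) s' else run B J d (tck s) s')"
| "run B J (For x y c) s s' =
   (\<exists>u. iterr (\<lambda>k u w. run B J c (setv x k u) w) (vr s y) s u & s' = setv x (vr s y) u)"
| "run B J (Mult P d) s s' =
   (mult_ready s & 1 <= d & (vr s vN2 + 2) ^ d <= B &
   (\<exists>t f. t <= B & exec ((int (vr s vN2) + 2) ^ d) P (mult_input s) t f &
    s' = s\<lparr>vr := (vr s)(vTM := t), pm := (\<lambda>x. if x < vr s vPO then pm s x else mem f (x - vr s vPO)),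
        ck := Suc (ck s + t)\<rparr>))"
| "run B J Nop s s' = (s' = tck s)"

text \<open>\<open>mv\<close>, \<open>ma\<close> and \<open>mp\<close> over-approximate what a
  command may change: variables, arrays, window memory. By \<open>run_frame\<close>, specifications
  state only what is computed; everything else is recovered from the text of the command.\<close>

primrec mv :: "com => nat set" where
 "mv (Asg x e) = {x}"
| "mv (Sto a d e) = {}"
| "mv (PSet d) = {}"
| "mv (Inp x e) = {x}"
| "mv (Sq c d) = mv c \<union> mv d"
| "mv (Cond e c d) = mv c \<union> mv d"
| "mv (For x y c) = insert x (mv c)"
| "mv (Mult P d) = {vTM}"
| "mv Nop = {}"

primrec ma :: "com => nat set" where
 "ma (Asg x e) = {}"
| "ma (Sto a d e) = {a}"
| "ma (PSet d) = {}"
| "ma (Inp x e) = {}"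
| "ma (Sq c d) = ma c \<union> ma d"
| "ma (Cond e c d) = ma c \<union> ma d"
| "ma (For x y c) = ma c"
| "ma (Mult P d) = {}"
| "ma Nop = {}"

primrec mp :: "com => bool" where
 "mp (Asg x e) = False"
| "mp (Sto a d e) = False"
| "mp (PSet d) = True"
| "mp (Inp x e) = False"
| "mp (Sq c d) = (mp c \<or> mp d)"
| "mp (Cond e c d) = (mp c \<or> mp d)"
| "mp (For x y c) = mp c"
| "mp (Mult P d) = True"
| "mp Nop = False"

definition frame :: "com => st => st => bool" where
 "frame c s s' \<longleftrightarrow> (\<forall>x. x \<notin> mv c --> vr s' x = vr s x) & (\<forall>a. a \<notin> ma c --> ar s' a = ar s a) &
   (\<not> mp c --> pm s' = pm s) & ck s <= ck s'"

lemma frame_refl [simp]: "frame c s s"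
 by (simp add: frame_def)

lemma frameD:
 "frame c s s' ==> x \<notin> mv c ==> vr s' x = vr s x"
 "frame c s s' ==> a \<notin> ma c ==> ar s' a = ar s a"
 "frame c s s' ==> \<not> mp c ==> pm s' = pm s"
 "frame c s s' ==> ck s <= ck s'"
 by (auto simp: frame_def)

lemma iterr_frame:
 assumes "\<And>k u w. R k u w ==> frame c u w" and "iterr R k s u"
 shows "frame c s u"
 using assms(2)
proof (induction k arbitrary: u)
 case (Suc k)
 then obtain w where "iterr R k s w" "R k w u" by auto
 then have "frame c s w" "frame c w u" using Suc.IH assms(1) by blast+
 then show ?case by (auto simp: frame_def)
qed simp

lemma run_frame: "run B J c s s' ==> frame c s s'"
proof (induction c arbitrary: s s')
 case (Sq c d)
 then obtain u where "frame c s u" "frame d u s'" by (auto, blast)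
 then show ?case by (auto simp: frame_def)
next
 case (Cond e c d)
 then have "frame c (tck s) s' \<or> frame d (tck s) s'" by (auto split: if_splits)
 then show ?case by (auto simp: frame_def)
next
 case (For x y c)
 from For.prems obtain u where u: "iterr (\<lambda>k u w. run B J c (setv x k u) w) (vr s y) s u" "s' = setv x (vr s y) u"
  by auto
 have "frame (For x y c) s u"
 proof (rule iterr_frame[OF _ u(1)])
  fix k u w assume "run B J c (setv x k u) w"
  then have "frame c (setv x k u) w" by (rule For.IH)
  then show "frame (For x y c) u w" by (auto simp: frame_def)
 qed
 then show ?case using u(2) by (auto simp: frame_def)
qed (auto simp: frame_def)

section \<open>Weakest preconditions\<close>

definition wp :: "nat => nat list => com => (st => bool) => st => bool" where
 "wp B J c Q s \<longleftrightarrow> (\<exists>s'. run B J c s s' & Q s')"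

lemma wp_simps [simp]:
 "wp B J (Asg x e) Q s \<longleftrightarrow> val e s <= B & Q (setv x (val e s) s)"
 "wp B J (Sto a e1 e) Q s \<longleftrightarrow> val e s <= B & Q (seta a (val e1 s) (val e s) s)"
 "wp B J (PSet e1) Q s \<longleftrightarrow> Q (setp (val e1 s) s)"
 "wp B J (Inp x e) Q s \<longleftrightarrow> val e s < length J & Q (setv x (J ! val e s) s)"
 "wp B J (Sq c d) Q s \<longleftrightarrow> wp B J c (wp B J d Q) s"
 "wp B J (Cond e c d) Q s \<longleftrightarrow> (if val e s > 0 then wp B J c Q (tck s) else wp B J d Q (tck s))"
 "wp B J Nop Q s \<longleftrightarrow> Q (tck s)"
 by (auto simp: wp_def)

lemma wp_conseq:
 assumes "wp B J c Q s" and "\<And>s'. Q s' ==> frame c s s' ==> R s'"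
 shows "wp B J c R s"
 using assms run_frame unfolding wp_def by blast

text \<open>\<open>I k\<close> is required before the counter is set to \<open>k\<close>. Every
  round may use the frame of the whole loop relative to its start, which keeps invariants
  short.\<close>

lemma wp_For:
 assumes "I 0 s"
  and step: "\<And>k u. k < vr s y ==> I k u ==> frame (For x y c) s u ==> wp B J c (I (Suc k)) (setv x k u)"
  and fin: "\<And>u. I (vr s y) u ==> frame (For x y c) s u ==> Q (setv x (vr s y) u)"
 shows "wp B J (For x y c) Q s"
proof -
 let ?R = "\<lambda>k u w. run B J c (setv x k u) w"
 have fr: "frame (For x y c) u w" if "run B J c (setv x k u) w" for k u w
  using run_frame[OF that] by (auto simp: frame_def)
 have "\<exists>u. iterr ?R k s u & I k u" if "k <= vr s y" for k
  using that
 proof (induction k)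
  case 0
  then show ?case using assms(1) by simp
 next
  case (Suc k)
  then obtain u where u: "iterr ?R k s u" "I k u" by auto
  have "frame (For x y c) s u" using iterr_frame[OF _ u(1)] fr by blast
  then have "wp B J c (I (Suc k)) (setv x k u)" using step u(2) Suc.prems by auto
  then show ?case using u(1) by (auto simp: wp_def)
 qed
 then obtain u where u: "iterr ?R (vr s y) s u" "I (vr s y) u" by blast
 have "frame (For x y c) s u" using iterr_frame[OF _ u(1)] fr by blast
 then show ?thesis using u fin by (auto simp: wp_def)
qed

section \<open>Compilation\<close>

text \<open>Registers are divided by residue modulo 3: \<open>3 * x\<close> holds variable
  \<open>x\<close>, \<open>3 * d + 1\<close> the temporary of expression depth \<open>d\<close>, and
  \<open>3 * r + 2\<close> register \<open>r\<close> of an embedded program. Register 4, the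
  temporary of depth 1, keeps the length of the input, so expressions are evaluated from depth 2
  on.\<close>

abbreviation tr :: "nat => nat" where "tr d \<equiv> 3 * d + 1"

text \<open>Cell \<open>i\<close> of array \<open>a\<close> lies at address
  \<open>L + 64 * i + a\<close>, where \<open>L\<close> is the input length in register 4. Thus 64
  interleaved unbounded arrays share the memory behind the input; number 63 is
  \<open>pm\<close>.\<close>

definition addr :: "nat => nat => ram_com" where
 "addr a d = Seq (Const (tr (Suc d)) 64) (Seq (Op Mul (tr d) (tr d) (tr (Suc d)))
   (Seq (Const (tr (Suc d)) (int a)) (Seq (Op Add (tr d) (tr d) (tr (Suc d))) (Op Add (tr d) (tr d) 4))))"

primrec cexp :: "expr => nat => ram_com" where
 "cexp (Num k) d = Const (tr d) (int k)"
| "cexp (Var x) d = Op Or (tr d) (3 * x) (3 * x)"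
| "cexp (Plus a b) d = Seq (cexp a d) (Seq (cexp b (Suc d)) (Op Add (tr d) (tr d) (tr (Suc d))))"
| "cexp (Minus a b) d = Seq (cexp a d) (Seq (cexp b (Suc d)) (Seq (Op Sub (tr d) (tr d) (tr (Suc d)))
   (IfPos (tr d) Skip (Const (tr d) 0))))"
| "cexp (Times a b) d = Seq (cexp a d) (Seq (cexp b (Suc d)) (Op Mul (tr d) (tr d) (tr (Suc d))))"
| "cexp (Quot a b) d = Seq (cexp a d) (Seq (cexp b (Suc d)) (Op Div (tr d) (tr d) (tr (Suc d))))"
| "cexp (Less a b) d = Seq (cexp a d) (Seq (cexp b (Suc d)) (Seq (Op Sub (tr d) (tr (Suc d)) (tr d))
   (IfPos (tr d) (Const (tr d) 1) (Const (tr d) 0))))"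
| "cexp (Rd x a) d = Seq (cexp a d) (Seq (addr x d) (Load (tr d) (tr d)))"
| "cexp (Pos a) d = Seq (cexp a d) (Seq (addr 63 d) (Seq (Load (tr d) (tr d))
   (IfPos (tr d) (Const (tr d) 1) (Const (tr d) 0))))"

text \<open>A crude number above every register that occurs; it tells how many registers must be
  cleared before an embedded program starts.\<close>

primrec rbd :: "ram_com => nat" where
 "rbd Skip = 0"
| "rbd (Const r k) = Suc r"
| "rbd (Op f r a b) = Suc (r + a + b)"
| "rbd (Load r a) = Suc (r + a)"
| "rbd (Store a r) = Suc (r + a)"
| "rbd (Seq P Q) = rbd P + rbd Q"
| "rbd (IfPos r P Q) = Suc (r + rbd P + rbd Q)"
| "rbd (WhilePos r P) = Suc (r + rbd P)"

text \<open>Register 9 is variable 3, so the count of simulated steps becomes the value of a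
  variable.\<close>

definition tick :: ram_com where "tick = Seq (Const 7 1) (Op Add 9 9 7)"

text \<open>There is one \<open>tick\<close> for each unit step of the original. A loop pays one
  step per test, hence it ticks once in front and once after each execution of the body. Memory
  accesses are shifted by register 12, which is variable 4.\<close>

primrec reloc :: "ram_com => ram_com" where
 "reloc Skip = tick"
| "reloc (Const r k) = Seq (Const (3 * r + 2) k) tick"
| "reloc (Op f r a b) = Seq (Op f (3 * r + 2) (3 * a + 2) (3 * b + 2)) tick"
| "reloc (Load r a) = Seq (Op Add 7 (3 * a + 2) 12) (Seq (addr 63 2) (Seq (Load (3 * r + 2) 7) tick))"
| "reloc (Store a r) = Seq (Op Add 7 (3 * a + 2) 12) (Seq (addr 63 2) (Seq (Store 7 (3 * r + 2)) tick))"
| "reloc (Seq P Q) = Seq (reloc P) (reloc Q)"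
| "reloc (IfPos r P Q) = Seq tick (IfPos (3 * r + 2) (reloc P) (reloc Q))"
| "reloc (WhilePos r P) = Seq tick (WhilePos (3 * r + 2) (Seq (reloc P) tick))"

primrec zero_regs :: "nat => ram_com" where
 "zero_regs 0 = Const 9 0"
| "zero_regs (Suc r) = Seq (zero_regs r) (Const (3 * r + 2) 0)"

primrec comp :: "com => ram_com" where
 "comp (Asg x e) = Seq (cexp e 2) (Op Or (3 * x) 7 7)"
| "comp (Sto a d e) = Seq (cexp d 2) (Seq (addr a 2) (Seq (cexp e 3) (Store 7 10)))"
| "comp (PSet d) = Seq (cexp d 2) (Seq (addr 63 2) (Seq (Const 10 1) (Store 7 10)))"
| "comp (Inp x e) = Seq (cexp e 2) (Seq (Load 7 7) (Op Or (3 * x) 7 7))"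
| "comp (Sq c d) = Seq (comp c) (comp d)"
| "comp (Cond e c d) = Seq (cexp e 2) (IfPos 7 (comp c) (comp d))"
| "comp (For x y c) = Seq (Const (3 * x) 0) (Seq (Op Sub 7 (3 * y) (3 * x))
   (WhilePos 7 (Seq (comp c) (Seq (Const 7 1) (Seq (Op Add (3 * x) (3 * x) 7) (Op Sub 7 (3 * y) (3 * x)))))))"
| "comp (Mult P d) = Seq (zero_regs (Suc (rbd P))) (Seq (Op Or 2 6 6) (reloc P))"
| "comp Nop = Skip"

primrec wfe :: "expr => bool" where
 "wfe (Num k) = True"
| "wfe (Var x) = True"
| "wfe (Plus a b) = (wfe a & wfe b)"
| "wfe (Minus a b) = (wfe a & wfe b)"
| "wfe (Times a b) = (wfe a & wfe b)"
| "wfe (Quot a b) = (wfe a & wfe b)"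
| "wfe (Less a b) = (wfe a & wfe b)"
| "wfe (Rd x a) = (x < 63 & wfe a)"
| "wfe (Pos a) = wfe a"

lemma wfe_derived [simp]:
 "wfe (Leq a b) \<longleftrightarrow> wfe a & wfe b" "wfe (Conj a b) \<longleftrightarrow> wfe a & wfe b"
 "wfe (Neg a) \<longleftrightarrow> wfe a" "wfe (Equal a b) \<longleftrightarrow> wfe a & wfe b"
 by (auto simp: Leq_def Conj_def Neg_def Equal_def)

text \<open>The compiled loop keeps its counter in \<open>x\<close> and reads the bound
  \<open>y\<close> again in every round, whereas \<open>run\<close> reads it once; the two agree if
  the body changes neither.\<close>

primrec wf_com :: "com => bool" where
 "wf_com (Asg x e) = wfe e"
| "wf_com (Sto a d e) = (a < 63 & wfe d & wfe e)"
| "wf_com (PSet d) = wfe d"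
| "wf_com (Inp x e) = wfe e"
| "wf_com (Sq c d) = (wf_com c & wf_com d)"
| "wf_com (Cond e c d) = (wfe e & wf_com c & wf_com d)"
| "wf_com (For x y c) = (x \<noteq> y & x \<notin> mv c & y \<notin> mv c & wf_com c)"
| "wf_com (Mult P d) = True"
| "wf_com Nop = True"

text \<open>If all stored values are at most \<open>B\<close>, then \<open>e\<close> evaluates below
  \<open>B ^ dg e\<close>. The summand 9 for array accesses leaves room for the address, which by
  \<open>address_bound\<close> costs eight more powers of \<open>B\<close> than the index.\<close>

primrec dg :: "expr => nat" where
 "dg (Num k) = Suc k"
| "dg (Var x) = 2"
| "dg (Plus a b) = Suc (dg a + dg b)"
| "dg (Minus a b) = Suc (dg a + dg b)"
| "dg (Times a b) = Suc (dg a + dg b)"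
| "dg (Quot a b) = Suc (dg a + dg b)"
| "dg (Less a b) = Suc (dg a + dg b)"
| "dg (Rd x a) = dg a + 9"
| "dg (Pos a) = dg a + 9"

section \<open>Simulation of expressions\<close>

definition rel :: "nat list => st => ram_state => bool" where
 "rel J s S \<longleftrightarrow> (\<forall>x. reg S (3 * x) = int (vr s x)) & reg S 4 = int (length J) &
   (\<forall>a<63. \<forall>i. mem S (length J + 64 * i + a) = int (ar s a i)) &
   (\<forall>i. mem S (length J + 64 * i + 63) = pm s i) &
   (\<forall>i<length J. mem S i = int (J ! i))"

definition bounded :: "nat => st => bool" where
 "bounded B s \<longleftrightarrow> (\<forall>x. vr s x <= B) & (\<forall>a i. ar s a i <= B)"

definition ex :: "int => ram_com => ram_state => (ram_state => bool) => bool" where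
 "ex W P S Q \<longleftrightarrow> (\<exists>t S'. exec W P S t S' & Q S')"

lemmas exec_sintros = exec.intros[simplified]

lemma ex_simps [simp]:
 "ex W Skip S Q \<longleftrightarrow> Q S"
 "ex W (Const r k) S Q \<longleftrightarrow> \<bar>k\<bar> < W & Q (set_reg r k S)"
 "ex W (Op f r a b) S Q \<longleftrightarrow> \<bar>eval_binop f (reg S a) (reg S b)\<bar> < W & Q (set_reg r (eval_binop f (reg S a) (reg S b)) S)"
 "ex W (Load r a) S Q \<longleftrightarrow> reg S a \<ge> 0 & Q (set_reg r (mem S (nat (reg S a))) S)"
 "ex W (Store a r) S Q \<longleftrightarrow> reg S a \<ge> 0 & Q (set_mem (nat (reg S a)) (reg S r) S)"
 "ex W (Seq P P') S Q \<longleftrightarrow> ex W P S (\<lambda>S'. ex W P' S' Q)"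
 "ex W (IfPos r P P') S Q \<longleftrightarrow> (if reg S r > 0 then ex W P S Q else ex W P' S Q)"
 unfolding ex_def
 by (auto intro: exec_sintros elim!: exec_SkipE exec_ConstE exec_OpE exec_LoadE exec_StoreE exec_SeqE exec_IfE)
   (use exec_sintros in \<open>metis linorder_not_less\<close>)+

lemma set_reg_simps [simp]:
 "reg (set_reg r v s) = (reg s)(r := v)" "mem (set_reg r v s) = mem s"
 "reg (set_mem a v s) = reg s" "mem (set_mem a v s) = (mem s)(a := v)"
 by (simp_all add: set_reg_def set_mem_def)

lemma ex_conseq: "ex W P S Q ==> (\<And>S'. Q S' ==> R S') ==> ex W P S R"
 unfolding ex_def by blast

lemma exec_mono: "exec W P s t s' ==> W <= W' ==> exec W' P s t s'"
 by (induction rule: exec.induct) (auto intro: exec_sintros)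

text \<open>Code without loops takes at most as many steps as it has instructions, so the time of
  expressions and assignments is a constant of the program text.\<close>

primrec loopfree :: "ram_com => bool" where
 "loopfree Skip = True"
| "loopfree (Const r k) = True"
| "loopfree (Op f r a b) = True"
| "loopfree (Load r a) = True"
| "loopfree (Store a r) = True"
| "loopfree (Seq P Q) = (loopfree P & loopfree Q)"
| "loopfree (IfPos r P Q) = (loopfree P & loopfree Q)"
| "loopfree (WhilePos r P) = False"

primrec len :: "ram_com => nat" where
 "len Skip = 1"
| "len (Const r k) = 1"
| "len (Op f r a b) = 1"
| "len (Load r a) = 1"
| "len (Store a r) = 1"
| "len (Seq P Q) = len P + len Q"
| "len (IfPos r P Q) = Suc (len P + len Q)"
| "len (WhilePos r P) = 0"

lemma loopfree_time: "exec W P s t s' ==> loopfree P ==> t <= len P"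
 by (induction rule: exec.induct) auto

lemma ex_loopfreeD:
 "ex W P S Q ==> loopfree P ==> \<exists>t S'. exec W P S t S' & t <= len P & Q S'"
 unfolding ex_def using loopfree_time by blast

lemma loopfree_addr [simp]: "loopfree (addr a d)" "len (addr a d) = 5"
 by (simp_all add: addr_def)

lemma loopfree_cexp [simp]: "loopfree (cexp e d)"
 by (induction e arbitrary: d) auto

text \<open>Evaluation at depth \<open>d\<close> overwrites only temporaries of depth at least
  \<open>d\<close>. The left operand of an operator thus survives while the right one is evaluated
  at depth \<open>Suc d\<close>.\<close>

definition touch :: "nat => ram_state => ram_state => bool" where
 "touch d S S' \<longleftrightarrow> mem S' = mem S & (\<forall>r. (\<forall>d'\<ge>d. r \<noteq> tr d') --> reg S' r = reg S r)"

lemma touch_refl [simp]: "touch d S S"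
 by (simp add: touch_def)

lemma touch_set_reg [simp]: "touch d S S' ==> d <= d' ==> r = tr d' ==> touch d S (set_reg r v S')"
 by (auto simp: touch_def)

lemma touch_set_regs [simp]:
 assumes "touch d S S'"
 shows "touch d S (set_reg (Suc (3 * d)) v S')" "touch d S (set_reg (Suc (d * 3)) v S')"
  "touch d S (set_reg (4 + 3 * d) v S')" "touch d S (set_reg (4 + d * 3) v S')"
  "touch d S (set_reg (Suc (3 + 3 * d)) v S')"
 using touch_set_reg[OF assms, of d] touch_set_reg[OF assms, of "Suc d"] by (auto simp: mult.commute)

lemma touch_trans: "touch d S S' ==> touch d' S' S'' ==> d <= d' ==> touch d S S''"
 by (auto simp: touch_def)

lemma touch_temp: "touch (Suc d) S S' ==> reg S' (tr d) = reg S (tr d)"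
 by (auto simp: touch_def)

lemma mod3_neq [simp]: "3 * x \<noteq> Suc (3 * d)" "Suc (3 * d) \<noteq> 3 * (x::nat)" "3 * x \<noteq> Suc (Suc (3 * d))" "Suc (Suc (3 * d)) \<noteq> 3 * (x::nat)"
  "Suc (3 * x) \<noteq> Suc (Suc (3 * d))" "Suc (Suc (3 * d)) \<noteq> Suc (3 * (x::nat))"
 by presburger+

lemma touch_rel: "touch d S S' ==> 2 <= d ==> rel J s S ==> rel J s S'"
proof -
 assume *: "touch d S S'" "2 <= d" "rel J s S"
 have "reg S' (3 * x) = reg S (3 * x)" for x using * by (auto simp: touch_def)
 moreover have "reg S' 4 = reg S 4" using * by (auto simp: touch_def)
 moreover have "mem S' = mem S" using * by (auto simp: touch_def)
 ultimately show ?thesis using *(3) by (simp add: rel_def)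
qed

text \<open>As \<open>B\<close> is at least 2, the factor 64 is absorbed by six powers of
  \<open>B\<close>, and adding the input length by one more.\<close>

lemma address_bound:
 fixes B :: nat
 assumes "i < B ^ D" "a < 64" "L <= B" "2 <= B"
 shows "L + 64 * i + a < B ^ (D + 8)" "64 * i < B ^ (D + 8)" "64 * i + a < B ^ (D + 8)" "64 < B ^ (D + 8)" "a < B ^ (D + 8)"
proof -
 have b6: "64 <= B ^ 6" using power_mono[of 2 B 6] assms by simp
 have "64 * i + a < 64 * B ^ D" using assms by auto
 also have "\<dots> <= B ^ (D + 6)" using mult_right_mono[OF b6, of "B ^ D"] by (simp add: power_add mult.commute)
 finally have 1: "64 * i + a < B ^ (D + 6)" .
 have 2: "B ^ 1 <= B ^ (D + 6)" using assms by (intro power_increasing) auto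
 have "2 * B ^ (D + 6) <= B * B ^ (D + 6)" using assms(4) by (rule mult_right_mono) simp
 then have 3: "2 * B ^ (D + 6) <= B ^ (D + 7)" by (simp add: eval_nat_numeral)
 have 4: "B ^ (D + 7) <= B ^ (D + 8)" using assms by (intro power_increasing) auto
 have 5: "64 <= B ^ (D + 6)" using b6 power_increasing[of 6 "D+6" B] assms by linarith
 show "L + 64 * i + a < B ^ (D + 8)" using 1 2 3 4 assms(3) unfolding power_one_right by linarith
 show "64 * i < B ^ (D + 8)" using 1 2 3 4 assms(3) unfolding power_one_right by linarith
 show "64 * i + a < B ^ (D + 8)" using 1 2 3 4 assms(3) unfolding power_one_right by linarith
 show "64 < B ^ (D + 8)" using 5 3 4 by linarith
 show "a < B ^ (D + 8)" using 5 3 4 assms(2) by linarith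
qed

lemma addr_ok:
 assumes "reg S (tr d) = int i" "i < B ^ D" "a < 64" "reg S 4 = int L" "L <= B" "2 <= B" "2 <= d"
  and W: "int B ^ (D + 8) <= W"
 shows "ex W (addr a d) S (\<lambda>S'. touch d S S' & reg S' (tr d) = int (L + 64 * i + a))"
proof -
 note b = address_bound[OF assms(2,3,5,6)]
 have W: "int x < W" if "x < B ^ (D + 8)" for x
  using that W by (metis less_le_trans of_nat_less_iff of_nat_power)
 have W1: "int (L + 64 * i + a) < W" "int (64 * i) < W" "int (64 * i + a) < W" "int a < W" "64 < W"
  using W[OF b(1)] W[OF b(2)] W[OF b(3)] W[OF b(4)] W[OF b(5)] by simp_all
 then show ?thesis using assms(1,3,4,7)
  by (auto simp: addr_def algebra_simps)
qed

lemma val_less: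
 assumes "bounded B s" "2 <= B"
 shows "val e s < B ^ dg e"
proof (induction e)
 case (Num k)
 have "k < 2 ^ Suc k" by (meson less_exp less_SucI less_trans lessI power_strict_increasing one_less_numeral_iff semiring_norm(76))
 also have "2 ^ Suc k <= B ^ Suc k" using assms by (intro power_mono) auto
 finally show ?case by simp
next
 case (Var x)
 have "vr s x <= B" using assms by (simp add: bounded_def)
 also have "B < B ^ 2" using assms by (simp add: power2_eq_square)
 finally show ?case by simp
next
 case (Rd x a)
 have "ar s x (val a s) <= B" using assms by (simp add: bounded_def)
 also have "B < B ^ 2" using assms by (simp add: power2_eq_square)
 also have "\<dots> <= B ^ (dg a + 9)" using assms by (intro power_increasing) auto
 finally show ?case by simp
next
 case (Pos a)
 have "1 < B" using assms by auto
 then have "1 < B ^ (dg a + 9)" by (intro one_less_power) auto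
 then show ?case using assms by (auto simp del: one_less_power)
next
 case (Plus a b)
 have "val a s + val b s < B ^ dg a * B ^ dg b * 2"
 proof -
  have "B ^ dg a <= B ^ dg a * B ^ dg b" "B ^ dg b <= B ^ dg a * B ^ dg b" using assms by (auto simp: Suc_le_eq)
  then show ?thesis using Plus by linarith
 qed
 also have "\<dots> <= B ^ dg a * B ^ dg b * B" using assms by (intro mult_left_mono) auto
 finally show ?case by (simp add: power_add mult.commute mult.left_commute)
next
 case (Minus a b)
 have "val a s - val b s < B ^ dg a" using Minus by auto
 also have "\<dots> <= B ^ Suc (dg a + dg b)" using assms by (intro power_increasing) auto
 finally show ?case by simp
next
 case (Times a b)
 have "val a s * val b s < B ^ dg a * B ^ dg b" using Times assms by (intro mult_strict_mono) auto
 also have "\<dots> <= B ^ Suc (dg a + dg b)" unfolding power_add[symmetric] using assms by (intro power_increasing) auto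
 finally show ?case by simp
next
 case (Quot a b)
 have "val a s div val b s < B ^ dg a" using Quot by (meson div_le_dividend le_less_trans)
 also have "\<dots> <= B ^ Suc (dg a + dg b)" using assms by (intro power_increasing) auto
 finally show ?case by simp
next
 case (Less a b)
 have "1 < B" using assms by auto
 then have "1 < B ^ (Suc (dg a + dg b))" by (intro one_less_power) auto
 then show ?case using assms by (auto simp del: one_less_power)
qed

lemma ex_two:
 assumes "ex W P S (\<lambda>S'. touch d S S' & reg S' (tr d) = x)"
  and "\<And>S1. touch d S S1 ==> ex W P' S1 (\<lambda>S'. touch (Suc d) S1 S' & reg S' (tr (Suc d)) = y)"
  and "\<And>S2. touch d S S2 ==> reg S2 (tr d) = x ==> reg S2 (tr (Suc d)) = y ==> ex W P'' S2 Q"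
 shows "ex W (Seq P (Seq P' P'')) S Q"
 unfolding ex_simps
proof (rule ex_conseq[OF assms(1)], goal_cases)
 case (1 S1)
 show ?case
 proof (rule ex_conseq[OF assms(2)], goal_cases)
  case (2 S2)
  then show ?case using 1 assms(3)[of S2] touch_trans[of d S S1 "Suc d" S2] touch_temp[of d S1 S2] by auto
 qed (use 1 in auto)
qed

text \<open>The part common to all binary operators: the code \<open>P\<close> that combines the
  operands may assume that both operands and the result lie below the word bound.\<close>

lemma cexp_binary:
 assumes b: "bounded B s" "2 <= B" and W: "int B ^ dg e <= W" and ab: "dg a <= dg e" "dg b <= dg e" "0 < dg e" and d: "2 <= d" and r: "rel J s S"
  and IH: "\<And>d S. rel J s S ==> int B ^ dg a <= W ==> 2 <= d ==> ex W (cexp a d) S (\<lambda>S'. touch d S S' & reg S' (tr d) = int (val a s))"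
   "\<And>d S. rel J s S ==> int B ^ dg b <= W ==> 2 <= d ==> ex W (cexp b d) S (\<lambda>S'. touch d S S' & reg S' (tr d) = int (val b s))"
  and P: "\<And>S2. touch d S S2 ==> reg S2 (tr d) = int (val a s) ==> reg S2 (tr (Suc d)) = int (val b s) ==>
   int (val a s) < W ==> int (val b s) < W ==> int (val e s) < W ==> 1 < W ==> ex W P S2 Q"
 shows "ex W (Seq (cexp a d) (Seq (cexp b (Suc d)) P)) S Q"
proof -
 have i: "int B ^ dg a <= W" "int B ^ dg b <= W" by (rule order_trans[OF power_increasing W]; use b ab in simp)+
 have v: "int (val x s) < int B ^ dg x" for x using val_less[OF b] by (metis of_nat_less_iff of_nat_power)
 have l: "int (val a s) < W" "int (val b s) < W" "int (val e s) < W" using i W v[of a] v[of b] v[of e] by linarith+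
 have "1 < int B ^ dg e" by (rule one_less_power) (use b ab in auto)
 then have "1 < W" using W by linarith
 then show ?thesis using ex_two[OF IH(1)[OF r i(1) d] IH(2)[OF touch_rel[OF _ d r] i(2)] P] l d by simp
qed

lemma cexp_ok:
 assumes "bounded B s" "2 <= B" "length J <= B"
 shows "rel J s S ==> int B ^ dg e <= W ==> wfe e ==> 2 <= d ==>
  ex W (cexp e d) S (\<lambda>S'. touch d S S' & reg S' (tr d) = int (val e s))"
proof (induction e arbitrary: d S)
 case (Num k)
 have "int k < int B ^ dg (Num k)" using val_less[OF assms(1,2), of "Num k"] by (metis of_nat_less_iff of_nat_power val.simps(1))
 then show ?case using Num by auto
next
 case (Var x)
 have "int (vr s x) < int B ^ dg (Var x)" using val_less[OF assms(1,2), of "Var x"] by (metis of_nat_less_iff of_nat_power val.simps(2))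
 then have "int (vr s x) < W" using Var.prems(2) by (meson less_le_trans)
 then show ?case using Var by (auto simp: rel_def)
next
 case (Rd x a)
 have "int B ^ dg a <= int B ^ dg (Rd x a)" using assms by (intro power_increasing) auto
 then have "ex W (cexp a d) S (\<lambda>S'. touch d S S' & reg S' (tr d) = int (val a s))" using Rd by auto
 then show ?case
  unfolding cexp.simps ex_simps(6)
 proof (rule ex_conseq, goal_cases)
  case (1 S1)
  have r: "rel J s S1" using 1 Rd.prems touch_rel by blast
  have "ex W (addr x d) S1 (\<lambda>S'. touch d S1 S' & reg S' (tr d) = int (length J + 64 * val a s + x))"
  proof (rule addr_ok[OF _ val_less[OF assms(1,2)]])
   show "int B ^ (dg a + 8) <= W" using Rd.prems(2) assms power_increasing[of "dg a + 8" "dg (Rd x a)" "int B"] unfolding dg.simps by linarith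
  qed (use 1 r Rd.prems assms in \<open>auto simp: rel_def\<close>)
  then show ?case
  proof (rule ex_conseq, goal_cases)
   case (1 S2)
   have "rel J s S2" using 1 r Rd.prems touch_rel by blast
   then have "mem S2 (length J + 64 * val a s + x) = int (ar s x (val a s))" using Rd.prems by (simp add: rel_def)
   moreover have "nat (reg S2 (tr d)) = length J + 64 * val a s + x" using 1 by simp
   moreover have "touch d S S2" using 1 \<open>touch d S S1 & _\<close> touch_trans by blast
   ultimately show ?case using 1 by auto
  qed
 qed
next
 case (Pos a)
 have "1 < int B" using assms by auto
 then have "1 < int B ^ dg (Pos a)" by (intro one_less_power) auto
 then have W1: "1 < W" using Pos.prems by linarith
 have "int B ^ dg a <= int B ^ dg (Pos a)" using assms by (intro power_increasing) auto
 then have "ex W (cexp a d) S (\<lambda>S'. touch d S S' & reg S' (tr d) = int (val a s))" using Pos by auto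
 then show ?case
  unfolding cexp.simps ex_simps(6)
 proof (rule ex_conseq, goal_cases)
  case (1 S1)
  have r: "rel J s S1" using 1 Pos.prems touch_rel by blast
  have "ex W (addr 63 d) S1 (\<lambda>S'. touch d S1 S' & reg S' (tr d) = int (length J + 64 * val a s + 63))"
  proof (rule addr_ok[OF _ val_less[OF assms(1,2)]])
   show "int B ^ (dg a + 8) <= W" using Pos.prems(2) assms power_increasing[of "dg a + 8" "dg (Pos a)" "int B"] unfolding dg.simps by linarith
  qed (use 1 r Pos.prems assms in \<open>auto simp: rel_def\<close>)
  then show ?case
  proof (rule ex_conseq, goal_cases)
   case (1 S2)
   have "rel J s S2" using 1 r Pos.prems touch_rel by blast
   then have "mem S2 (length J + 64 * val a s + 63) = pm s (val a s)" using Pos.prems by (simp add: rel_def)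
   moreover have "nat (reg S2 (tr d)) = length J + 64 * val a s + 63" using 1 by simp
   moreover have "touch d S S2" using 1 \<open>touch d S S1 & _\<close> touch_trans by blast
   ultimately show ?case using 1 W1 by auto
  qed
 qed
next
 case (Plus a b)
 show ?case unfolding cexp.simps
  by (rule cexp_binary[OF assms(1,2) Plus.prems(2) _ _ _ Plus.prems(4,1)]) (use Plus in \<open>auto simp: zdiv_int of_nat_diff simp del: power_Suc\<close>)
next
 case (Minus a b)
 show ?case unfolding cexp.simps
  by (rule cexp_binary[OF assms(1,2) Minus.prems(2) _ _ _ Minus.prems(4,1)]) (use Minus in \<open>auto simp: zdiv_int of_nat_diff simp del: power_Suc\<close>)
next
 case (Times a b)
 show ?case unfolding cexp.simps
  by (rule cexp_binary[OF assms(1,2) Times.prems(2) _ _ _ Times.prems(4,1)]) (use Times in \<open>auto simp: zdiv_int of_nat_diff simp del: power_Suc\<close>)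
next
 case (Quot a b)
 show ?case unfolding cexp.simps
  by (rule cexp_binary[OF assms(1,2) Quot.prems(2) _ _ _ Quot.prems(4,1)]) (use Quot in \<open>auto simp flip: zdiv_int simp del: power_Suc\<close>)
next
 case (Less a b)
 show ?case unfolding cexp.simps
  by (rule cexp_binary[OF assms(1,2) Less.prems(2) _ _ _ Less.prems(4,1)]) (use Less in \<open>auto simp: zdiv_int of_nat_diff simp del: power_Suc\<close>)
qed

section \<open>Relocation of an embedded program\<close>

definition keep :: "nat => nat => ram_state => ram_state => bool" where
 "keep L off \<mu> \<mu>' \<longleftrightarrow> (\<forall>x. x \<noteq> 3 --> reg \<mu>' (3 * x) = reg \<mu> (3 * x)) & reg \<mu>' 4 = reg \<mu> 4 &
   (\<forall>a. (\<forall>x. a \<noteq> L + 64 * (off + x) + 63) --> mem \<mu>' a = mem \<mu> a)"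

text \<open>The memory of the embedded program becomes a tail of the interleaved array 63, so it
  stays unbounded; \<open>R\<close> lies above all registers that the program mentions.\<close>

definition psim :: "nat => nat => nat => ram_state => ram_state => bool" where
 "psim R L off S \<mu> \<longleftrightarrow> (\<forall>r<R. reg \<mu> (3 * r + 2) = reg S r) &
   (\<forall>x. mem \<mu> (L + 64 * (off + x) + 63) = mem S x) & reg \<mu> 4 = int L & reg \<mu> 12 = int off"

lemma keep_refl [simp]: "keep L off \<mu> \<mu>"
 by (simp add: keep_def)

lemma keep_trans: "keep L off \<mu> \<mu>' ==> keep L off \<mu>' \<mu>'' ==> keep L off \<mu> \<mu>''"
 by (simp add: keep_def)

lemma mod3_facts: "(3 * x = 5) = False" "(3 * x = 8) = False" "(5 = 3 * x) = False" "(8 = 3 * x) = False" "(3 * x = 7) = False" "(3 * x = 10) = False" "(3 * x = 4) = False" "(Suc (Suc (3 * x)) = 7) = False"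
  "(Suc (Suc (3 * x)) = 9) = False" "(Suc (Suc (3 * x)) = 10) = False" "(Suc (Suc (3 * x)) = 4) = False" "(Suc (Suc (3 * x)) = 12) = False"
  "(3 * x = 9) = (x = 3)" "(3 * x = 2) = False"
  "(7 = 3 * x) = False" "(10 = 3 * x) = False" "(4 = 3 * x) = False" "(7 = Suc (Suc (3 * x))) = False"
  "(9 = Suc (Suc (3 * x))) = False" "(10 = Suc (Suc (3 * x))) = False" "(4 = Suc (Suc (3 * x))) = False" "(12 = Suc (Suc (3 * x))) = False"
  "(9 = 3 * x) = (x = 3)" "(2 = 3 * x) = False" for x :: nat
 by presburger+

lemma touch2:
 assumes "touch 2 \<mu> \<mu>'"
 shows "psim R L off S \<mu> ==> psim R L off S \<mu>'" "keep L off \<mu> \<mu>'" "reg \<mu>' 9 = reg \<mu> 9"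
  "reg \<mu>' (Suc (Suc (3 * r))) = reg \<mu> (Suc (Suc (3 * r)))" "reg \<mu>' 12 = reg \<mu> 12" "reg \<mu>' 4 = reg \<mu> 4"
proof -
 have *: "reg \<mu>' r = reg \<mu> r" if "\<forall>d'\<ge>2. r \<noteq> tr d'" for r using assms that by (auto simp: touch_def)
 have "reg \<mu>' (3 * r + 2) = reg \<mu> (3 * r + 2)" "reg \<mu>' 4 = reg \<mu> 4" "reg \<mu>' 12 = reg \<mu> 12" "reg \<mu>' 9 = reg \<mu> 9" "reg \<mu>' (3 * r) = reg \<mu> (3 * r)" for r
  by (rule *, presburger)+
 moreover have "mem \<mu>' = mem \<mu>" using assms by (simp add: touch_def)
 ultimately show "psim R L off S \<mu> ==> psim R L off S \<mu>'" "keep L off \<mu> \<mu>'" "reg \<mu>' 9 = reg \<mu> 9"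
   "reg \<mu>' (Suc (Suc (3 * r))) = reg \<mu> (Suc (Suc (3 * r)))" "reg \<mu>' 12 = reg \<mu> 12" "reg \<mu>' 4 = reg \<mu> 4"
  by (auto simp: psim_def keep_def numeral_2_eq_2)
qed

definition small :: "int => ram_state => bool" where
 "small W S \<longleftrightarrow> (\<forall>r. \<bar>reg S r\<bar> < W) & (\<forall>x. \<bar>mem S x\<bar> < W)"

text \<open>A program with word bound \<open>W\<close> cannot form an address from \<open>W\<close>
  on, hence it leaves all those cells alone. This limits the part of a window that a product can
  soil.\<close>

lemma exec_small: "exec W P S t S' ==> small W S ==> small W S' & (\<forall>x. W <= int x --> mem S' x = mem S x)"
proof (induction rule: exec.induct)
 case (exec_Store s a r)
 have "int x \<noteq> reg s a" if "W <= int x" for x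
 proof -
  have "\<bar>reg s a\<bar> < W" using exec_Store.prems unfolding small_def by blast
  then show ?thesis using that by linarith
 qed
 then have "x \<noteq> nat (reg s a)" if "W <= int x" for x using that exec_Store.hyps by (metis nat_0_le)
 then show ?case using exec_Store by (auto simp: small_def)
qed (auto simp: small_def)

text \<open>The factor 12 covers the longest translation, a memory access with its address
  computation. The condition on \<open>x + t\<close> keeps the step counter itself below the word
  bound.\<close>

lemma reloc_ok:
 assumes "2 <= B" "L <= B" "off <= B" "V <= int B" "int B ^ 12 <= W"
 shows "exec V P S t S' ==> small V S ==> rbd P <= R ==> psim R L off S \<mu> ==> reg \<mu> 9 = int x ==> int (x + t) < W ==>
  \<exists>u \<mu>'. exec W (reloc P) \<mu> u \<mu>' & u <= 12 * t & psim R L off S' \<mu>' & keep L off \<mu> \<mu>' & reg \<mu>' 9 = int (x + t)"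
proof -
 have BW: "int B < W"
 proof -
  have "int B ^ 1 < int B ^ 12" using assms by (intro power_strict_increasing) auto
  then show ?thesis using assms(5) unfolding power_one_right by linarith
 qed
 have W1: "1 < W" using BW assms by linarith
 have VW: "V < W" using BW assms by linarith
 have BB: "2 * B < B ^ 3"
 proof -
  have "2 * B <= B * B" using assms(1) by (rule mult_right_mono) simp
  moreover have "B * B * 1 < B * B * B" using assms(1) by (intro mult_strict_left_mono) auto
  ultimately have "2 * B < B * B * B" by linarith
  then show ?thesis by (simp add: eval_nat_numeral)
 qed
 have B11: "int B ^ (3 + 8) <= W"
 proof -
  have "int B ^ (3 + 8) <= int B ^ 12" using assms by (intro power_increasing) auto
  then show ?thesis using assms(5) by linarith
 qed
 have BB2: "2 * int B < W"
 proof -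
  have "int (2 * B) < int (B ^ 3)" using BB by (simp only: of_nat_less_iff)
  then have "2 * int B < int B ^ 3" by simp
  also have "\<dots> <= int B ^ 12" using assms by (intro power_increasing) auto
  finally show ?thesis using assms(5) by linarith
 qed
 have fin: "\<exists>u \<mu>'. exec W Q \<mu> u \<mu>' & u <= 12 * t & psim R L off S' \<mu>' & keep L off \<mu> \<mu>' & reg \<mu>' 9 = int (x + t)"
  if "ex W Q \<mu> (\<lambda>\<mu>'. psim R L off S' \<mu>' & keep L off \<mu> \<mu>' & reg \<mu>' 9 = int (x + t))" "loopfree Q" "len Q <= 12 * t" for Q \<mu> S' x t
  using ex_loopfreeD[OF that(1,2)] that(3) le_trans by blast
 have adr: "ex W (Seq (Op Add 7 (3 * a + 2) 12) (addr 63 2)) \<mu>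
   (\<lambda>\<mu>'. touch 2 \<mu> \<mu>' & reg \<mu>' 7 = int (L + 64 * (off + nat (reg S a)) + 63))"
  if "psim R L off S \<mu>" "small V S" "a < R" "reg S a \<ge> 0" for a \<mu> S
 proof -
  have "\<bar>reg S a\<bar> < V" using that(2) unfolding small_def by blast
  then have aB: "reg S a < int B" using assms by linarith
  let ?\<mu> = "set_reg 7 (reg S a + int off) \<mu>"
  have t: "touch 2 \<mu> ?\<mu>" by (rule touch_set_reg[of _ _ _ 2]) auto
  have "ex W (addr 63 2) ?\<mu> (\<lambda>\<mu>'. touch 2 ?\<mu> \<mu>' & reg \<mu>' (tr 2) = int (L + 64 * (off + nat (reg S a)) + 63))"
  \<comment> \<open>Offset and embedded address are both at most \<open>B\<close>, so the shifted
    index is below \<open>B ^ 3\<close> and its address below \<open>B ^ 11\<close>.\<close>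
  proof (rule addr_ok[where D=3 and B=B])
   show "off + nat (reg S a) < B ^ 3" using aB assms BB by linarith
  qed (use that assms B11 in \<open>auto simp: psim_def\<close>)
  then have e: "ex W (addr 63 2) ?\<mu> (\<lambda>\<mu>'. touch 2 \<mu> \<mu>' & reg \<mu>' 7 = int (L + 64 * (off + nat (reg S a)) + 63))"
   by (rule ex_conseq) (use t touch_trans in auto)
  have "reg \<mu> (3 * a + 2) = reg S a" "reg \<mu> 12 = int off" using that by (auto simp: psim_def)
  then show ?thesis using e aB BB2 assms that by simp
 qed
 have tickx: "exec W tick \<mu> (1 + 1) (set_reg 9 (int (x + 1)) (set_reg 7 1 \<mu>))" if "reg \<mu> 9 = int x" "int (x + 1) < W" for \<mu> x
  unfolding tick_def by (rule exec_Seq[OF exec_Const exec_Op]) (use that W1 in auto)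
 show "exec V P S t S' ==> small V S ==> rbd P <= R ==> psim R L off S \<mu> ==> reg \<mu> 9 = int x ==> int (x + t) < W ==>
  \<exists>u \<mu>'. exec W (reloc P) \<mu> u \<mu>' & u <= 12 * t & psim R L off S' \<mu>' & keep L off \<mu> \<mu>' & reg \<mu>' 9 = int (x + t)"
 proof (induction arbitrary: \<mu> x rule: exec.induct)
  case (exec_Skip s)
  then show ?case by (intro fin) (auto simp: tick_def psim_def keep_def mod3_facts W1)
 next
  case (exec_Const k r s)
  then show ?case using VW by (intro fin) (auto simp: tick_def psim_def keep_def mod3_facts W1)
 next
  case (exec_Op v f s a b r)
  then show ?case using VW by (intro fin) (auto simp: tick_def psim_def keep_def mod3_facts W1)
 next
  case (exec_Load s a r)
  have "ex W (reloc (Load r a)) \<mu> (\<lambda>\<mu>'. psim R L off (set_reg r (mem s (nat (reg s a))) s) \<mu>' & keep L off \<mu> \<mu>' & reg \<mu>' 9 = int (x + 1))"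
   unfolding reloc.simps ex_simps(6)
  proof (rule ex_conseq[OF adr[OF exec_Load.prems(3,1) _ exec_Load.hyps(1), unfolded ex_simps(6)]], goal_cases)
   case (2 S1)
   then show ?case
   proof (rule ex_conseq, goal_cases)
    case (1 \<mu>1)
    then have t: "touch 2 \<mu> \<mu>1" and e: "reg \<mu>1 7 = int (L + 64 * (off + nat (reg s a)) + 63)" by auto
    have p: "psim R L off s \<mu>1" using touch2(1)[OF t] exec_Load.prems by blast
    have n: "nat (reg \<mu>1 7) = L + 64 * (off + nat (reg s a)) + 63" unfolding e by (rule nat_int)
    have g: "0 <= reg \<mu>1 7" unfolding e by simp
    have m: "mem \<mu>1 (L + 64 * (off + nat (reg s a)) + 63) = mem s (nat (reg s a))" using p by (simp add: psim_def)
    have k: "keep L off \<mu> \<mu>1" using touch2(2)[OF t] .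
    have x: "reg \<mu>1 9 = int x" using touch2(3)[OF t] exec_Load.prems by simp
    have r: "reg \<mu>1 (3 * r + 2) = reg s r" using p exec_Load.prems by (simp add: psim_def)
    show ?case using g p k x W1 exec_Load.prems unfolding ex_simps n m r
     by (auto simp: tick_def psim_def keep_def mod3_facts)
   qed
  qed (use exec_Load.prems in auto)
  then show ?case by (intro fin) (auto simp: tick_def)
 next
  case (exec_Store s a r)
  have "ex W (reloc (Store a r)) \<mu> (\<lambda>\<mu>'. psim R L off (set_mem (nat (reg s a)) (reg s r) s) \<mu>' & keep L off \<mu> \<mu>' & reg \<mu>' 9 = int (x + 1))"
   unfolding reloc.simps ex_simps(6)
  proof (rule ex_conseq[OF adr[OF exec_Store.prems(3,1) _ exec_Store.hyps(1), unfolded ex_simps(6)]], goal_cases)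
   case (2 S1)
   then show ?case
   proof (rule ex_conseq, goal_cases)
    case (1 \<mu>1)
    then have t: "touch 2 \<mu> \<mu>1" and e: "reg \<mu>1 7 = int (L + 64 * (off + nat (reg s a)) + 63)" by auto
    have p: "psim R L off s \<mu>1" using touch2(1)[OF t] exec_Store.prems by blast
    have n: "nat (reg \<mu>1 7) = L + 64 * (off + nat (reg s a)) + 63" unfolding e by (rule nat_int)
    have g: "0 <= reg \<mu>1 7" unfolding e by simp
    have m: "mem \<mu>1 (L + 64 * (off + nat (reg s a)) + 63) = mem s (nat (reg s a))" using p by (simp add: psim_def)
    have k: "keep L off \<mu> \<mu>1" using touch2(2)[OF t] .
    have x: "reg \<mu>1 9 = int x" using touch2(3)[OF t] exec_Store.prems by simp
    have r: "reg \<mu>1 (3 * r + 2) = reg s r" using p exec_Store.prems by (simp add: psim_def)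
    show ?case using g p k x W1 exec_Store.prems unfolding ex_simps n m r
     by (auto simp: tick_def psim_def keep_def mod3_facts)
   qed
  qed (use exec_Store.prems in auto)
  then show ?case by (intro fin) (auto simp: tick_def)
 next
  case (exec_Seq P s t s' Q t' s'')
  from exec_Seq.IH(1)[of \<mu> x] exec_Seq.prems obtain u \<mu>1 where
   1: "exec W (reloc P) \<mu> u \<mu>1" "u <= 12 * t" "psim R L off s' \<mu>1" "keep L off \<mu> \<mu>1" "reg \<mu>1 9 = int (x + t)" by auto
  have "small V s'" using exec_small[OF exec_Seq.hyps(1)] exec_Seq.prems by blast
  from exec_Seq.IH(2)[OF this _ 1(3,5)] exec_Seq.prems obtain u' \<mu>2 where
   2: "exec W (reloc Q) \<mu>1 u' \<mu>2" "u' <= 12 * t'" "psim R L off s'' \<mu>2" "keep L off \<mu>1 \<mu>2" "reg \<mu>2 9 = int (x + t + t')" by auto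
  have "exec W (reloc (Seq P Q)) \<mu> (u + u') \<mu>2" using 1 2 by (auto intro: exec.intros)
  then show ?case using 1 2 keep_trans by (intro exI[of _ "u + u'"] exI[of _ \<mu>2]) (auto intro: keep_trans simp: add.assoc)
 next
  case (exec_IfTrue s r P t s' Q)
  let ?\<mu> = "set_reg 9 (int (x + 1)) (set_reg 7 1 \<mu>)"
  have tk: "exec W tick \<mu> (1 + 1) ?\<mu>" using exec_IfTrue.prems by (intro tickx) auto
  have "psim R L off s ?\<mu>" using exec_IfTrue.prems by (auto simp: psim_def mod3_facts)
  from exec_IfTrue.IH[OF exec_IfTrue.prems(1) _ this, of "x + 1"] exec_IfTrue.prems obtain u \<mu>1 where
   1: "exec W (reloc P) ?\<mu> u \<mu>1" "u <= 12 * t" "psim R L off s' \<mu>1" "keep L off ?\<mu> \<mu>1" "reg \<mu>1 9 = int (x + 1 + t)" by auto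
  have "reg ?\<mu> (3 * r + 2) > 0" using exec_IfTrue.prems exec_IfTrue.hyps(1) by (simp add: psim_def mod3_facts)
  then have "exec W (reloc (IfPos r P Q)) \<mu> (1 + 1 + (u + 1)) \<mu>1" unfolding reloc.simps using 1(1) by (intro exec_Seq[OF tk] exec.exec_IfTrue)
  moreover have "keep L off \<mu> ?\<mu>" by (auto simp: keep_def mod3_facts)
  ultimately show ?case using 1 by (intro exI[of _ "1 + 1 + (u + 1)"] exI[of _ \<mu>1]) (auto intro: keep_trans)
 next
  case (exec_IfFalse s r Q t s' P)
  let ?\<mu> = "set_reg 9 (int (x + 1)) (set_reg 7 1 \<mu>)"
  have tk: "exec W tick \<mu> (1 + 1) ?\<mu>" using exec_IfFalse.prems by (intro tickx) auto
  have "psim R L off s ?\<mu>" using exec_IfFalse.prems by (auto simp: psim_def mod3_facts)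
  from exec_IfFalse.IH[OF exec_IfFalse.prems(1) _ this, of "x + 1"] exec_IfFalse.prems obtain u \<mu>1 where
   1: "exec W (reloc Q) ?\<mu> u \<mu>1" "u <= 12 * t" "psim R L off s' \<mu>1" "keep L off ?\<mu> \<mu>1" "reg \<mu>1 9 = int (x + 1 + t)" by auto
  have "reg ?\<mu> (3 * r + 2) <= 0" using exec_IfFalse.prems exec_IfFalse.hyps(1) by (simp add: psim_def mod3_facts)
  then have "exec W (reloc (IfPos r P Q)) \<mu> (1 + 1 + (u + 1)) \<mu>1" unfolding reloc.simps using 1(1) by (intro exec_Seq[OF tk] exec.exec_IfFalse)
  moreover have "keep L off \<mu> ?\<mu>" by (auto simp: keep_def mod3_facts)
  ultimately show ?case using 1 by (intro exI[of _ "1 + 1 + (u + 1)"] exI[of _ \<mu>1]) (auto intro: keep_trans)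
 next
  case (exec_WhileFalse s r P)
  let ?\<mu> = "set_reg 9 (int (x + 1)) (set_reg 7 1 \<mu>)"
  have tk: "exec W tick \<mu> (1 + 1) ?\<mu>" using exec_WhileFalse.prems by (intro tickx) auto
  have "psim R L off s ?\<mu>" using exec_WhileFalse.prems by (auto simp: psim_def mod3_facts)
  moreover have "reg ?\<mu> (3 * r + 2) <= 0" using exec_WhileFalse.prems exec_WhileFalse.hyps(1) by (simp add: psim_def mod3_facts)
  then have "exec W (reloc (WhilePos r P)) \<mu> (1 + 1 + 1) ?\<mu>" unfolding reloc.simps by (intro exec_Seq[OF tk] exec.exec_WhileFalse)
  moreover have "keep L off \<mu> ?\<mu>" by (auto simp: keep_def mod3_facts)
  ultimately show ?case by (intro exI[of _ "1 + 1 + 1"] exI[of _ ?\<mu>]) auto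
 next
  case (exec_WhileTrue s r P t s' t' s'')
  let ?\<mu> = "set_reg 9 (int (x + 1)) (set_reg 7 1 \<mu>)"
  let ?W = "WhilePos (3 * r + 2) (Seq (reloc P) tick)"
  have tk: "exec W tick \<mu> (1 + 1) ?\<mu>" using exec_WhileTrue.prems by (intro tickx) auto
  have "psim R L off s ?\<mu>" using exec_WhileTrue.prems by (auto simp: psim_def mod3_facts)
  from exec_WhileTrue.IH(1)[OF exec_WhileTrue.prems(1) _ this, of "x + 1"] exec_WhileTrue.prems obtain u \<mu>1 where
   1: "exec W (reloc P) ?\<mu> u \<mu>1" "u <= 12 * t" "psim R L off s' \<mu>1" "keep L off ?\<mu> \<mu>1" "reg \<mu>1 9 = int (x + 1 + t)" by auto
  have sm: "small V s'" using exec_small[OF exec_WhileTrue.hyps(2)] exec_WhileTrue.prems by blast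
  from exec_WhileTrue.IH(2)[OF sm exec_WhileTrue.prems(2) 1(3,5)] exec_WhileTrue.prems obtain v \<mu>2 where
   2: "exec W (reloc (WhilePos r P)) \<mu>1 v \<mu>2" "v <= 12 * t'" "psim R L off s'' \<mu>2" "keep L off \<mu>1 \<mu>2" "reg \<mu>2 9 = int (x + 1 + t + t')" by auto
  \<comment> \<open>The induction hypothesis concerns the translated loop including its leading
    \<open>tick\<close>; split off, this \<open>tick\<close> becomes the one at the end of the
    present round.\<close>
  from 2(1) obtain v1 \<mu>m v2 where v: "v = v1 + v2" "exec W tick \<mu>1 v1 \<mu>m" "exec W ?W \<mu>m v2 \<mu>2"
   by (auto elim: exec_SeqE)
  have "reg ?\<mu> (3 * r + 2) > 0" using exec_WhileTrue.prems exec_WhileTrue.hyps(1) by (simp add: psim_def mod3_facts)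
  moreover have "exec W (Seq (reloc P) tick) ?\<mu> (u + v1) \<mu>m" using 1 v by (auto intro: exec_Seq)
  ultimately have "exec W ?W ?\<mu> (u + v1 + v2 + 1) \<mu>2" using v by (intro exec.exec_WhileTrue)
  then have "exec W (reloc (WhilePos r P)) \<mu> (1 + 1 + (u + v1 + v2 + 1)) \<mu>2" unfolding reloc.simps by (rule exec_Seq[OF tk])
  moreover have "keep L off \<mu> ?\<mu>" by (auto simp: keep_def mod3_facts)
  then have "keep L off \<mu> \<mu>2" using 1 2 keep_trans by blast
  ultimately show ?case using 1 2 v(1) by (intro exI[of _ "1 + 1 + (u + v1 + v2 + 1)"] exI[of _ \<mu>2]) (auto simp: add_ac)
 qed
qed

section \<open>Simulation of commands\<close>

lemma rel_set_reg:
 assumes "rel J s S"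
 shows "rel J (setv x k s) (set_reg (3 * x) (int k) S)" "rel J s (set_reg 7 v S)" "rel J s (set_reg 10 v S)" "rel J (tck s) S"
 using assms by (auto simp: rel_def mod3_facts)

lemma rel_set_mem:
 assumes "rel J s S"
 shows "a < 63 ==> rel J (seta a i k s) (set_mem (length J + 64 * i + a) (int k) S)"
  "rel J (setp i s) (set_mem (length J + 64 * i + 63) 1 S)"
proof -
 have eq: "(length J + 64 * i' + a' = length J + 64 * i + a) = (i' = i & a' = a)" if "a < 64" "a' < 64" for i i' a a' :: nat
 proof -
  have "(64 * i + a) div 64 = i" "(64 * i' + a') div 64 = i'" using that by simp_all
  then have "i' = i" if "64 * i' + a' = 64 * i + a" using that by (simp only:)
  then show ?thesis by auto
 qed
 show "a < 63 ==> rel J (seta a i k s) (set_mem (length J + 64 * i + a) (int k) S)"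
  using assms by (auto simp: rel_def eq)
 show "rel J (setp i s) (set_mem (length J + 64 * i + 63) 1 S)"
  using assms by (auto simp: rel_def eq)
qed

lemma bounded_set:
 assumes "bounded B s"
 shows "k <= B ==> bounded B (setv x k s)" "k <= B ==> bounded B (seta a i k s)" "bounded B (setp i s)" "bounded B (tck s)"
 using assms by (auto simp: bounded_def)

text \<open>Degree \<open>D\<close> and factor \<open>K\<close> depend on the command alone, so a
  single power of \<open>B\<close> and a single constant serve for all inputs.\<close>

definition compiles :: "nat => nat => com => bool" where
 "compiles D K c \<longleftrightarrow> (\<forall>B J s s' S W. 2 <= B --> length J <= B --> (\<forall>x\<in>set J. x <= B) --> bounded B s --> rel J s S -->
   run B J c s s' --> int B ^ D <= W -->
   (\<exists>t S'. exec W (comp c) S t S' & rel J s' S' & bounded B s' & t <= K * (ck s' - ck s)))"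

lemma power_W: "int B ^ D <= W ==> 2 <= B ==> D' <= D ==> int B ^ D' <= W"
 using power_increasing[of D' D "int B"] by linarith

lemma base_W:
 assumes "2 <= B" "int B ^ D <= W" "2 <= D"
 shows "x <= B ==> int x < W" "1 < W"
proof -
 have "int B ^ 1 < int B ^ D" using assms by (intro power_strict_increasing) auto
 then have *: "int B < W" using assms(2) unfolding power_one_right by linarith
 then show "x <= B ==> int x < W" by linarith
 show "1 < W" using * assms by linarith
qed

text \<open>Since the clock advances at least once, the length of the code bounds its time, and only
  the final state remains to be examined.\<close>

lemma compiles_loopfree:
 assumes "loopfree (comp c)"
  and "\<And>B J s s' S W. 2 <= B ==> length J <= B ==> (\<forall>x\<in>set J. x <= B) ==> bounded B s ==> rel J s S ==> run B J c s s' ==> int B ^ D <= W ==>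
   ex W (comp c) S (\<lambda>S'. rel J s' S') & bounded B s' & ck s < ck s'"
 shows "compiles D (len (comp c)) c"
 unfolding compiles_def
proof (intro allI impI, goal_cases)
 case (1 B J s s' S W)
 from assms(2)[OF this] have *: "ex W (comp c) S (\<lambda>S'. rel J s' S')" "bounded B s'" "ck s < ck s'" by auto
 from ex_loopfreeD[OF *(1) assms(1)] obtain t S' where "exec W (comp c) S t S'" "t <= len (comp c)" "rel J s' S'" by auto
 moreover have "len (comp c) <= len (comp c) * (ck s' - ck s)" using *(3) mult_le_mono2[of 1 "ck s' - ck s" "len (comp c)"] by linarith
 ultimately show ?case using *(2) by (meson le_trans)
qed

lemma compiles_Asg: "wf_com (Asg x e) ==> compiles (dg e + 9) (len (comp (Asg x e))) (Asg x e)"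
proof (rule compiles_loopfree, goal_cases)
 case (2 B J s s' S W)
 have "ex W (cexp e 2) S (\<lambda>S'. touch 2 S S' & reg S' (tr 2) = int (val e s))"
  using 2 power_W[OF 2(8,2)] by (intro cexp_ok) auto
 then have "ex W (comp (Asg x e)) S (rel J s')"
  unfolding comp.simps ex_simps(6)
  by (rule ex_conseq) (use 2 touch_rel base_W(1)[OF 2(2,8)] rel_set_reg(1) in \<open>auto\<close>)
 then show ?case using 2 bounded_set by auto
qed auto

lemma compiles_Inp: "wf_com (Inp x e) ==> compiles (dg e + 9) (len (comp (Inp x e))) (Inp x e)"
proof (rule compiles_loopfree, goal_cases)
 case (2 B J s s' S W)
 have v: "val e s < length J" "s' = setv x (J ! val e s) s" using 2 by auto
 have le: "J ! val e s <= B" using v 2 nth_mem by blast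
 have "ex W (cexp e 2) S (\<lambda>S'. touch 2 S S' & reg S' (tr 2) = int (val e s))"
  using 2 power_W[OF 2(8,2)] by (intro cexp_ok) auto
 then have "ex W (comp (Inp x e)) S (rel J s')"
  unfolding comp.simps ex_simps(6)
 proof (rule ex_conseq, goal_cases)
  case (1 S1)
  then have r: "rel J s S1" using 2 touch_rel by blast
  then have "mem S1 (val e s) = int (J ! val e s)" using v by (simp add: rel_def)
  moreover have "int (J ! val e s) < W" using base_W(1)[OF 2(2,8)] le by auto
  moreover have "rel J s' (set_reg (3 * x) (int (J ! val e s)) (set_reg 7 (int (J ! val e s)) S1))"
   unfolding v(2) using r by (intro rel_set_reg)
  ultimately show ?case using 1 by simp
 qed
 then show ?case using 2 bounded_set le v by auto
qed auto

lemma addr2_ok: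
 assumes "reg S 7 = int (val d s)" "bounded B s" "2 <= B" "length J <= B" "rel J s S" "int B ^ (dg d + 8) <= W" "a < 64"
 shows "ex W (addr a 2) S (\<lambda>S'. touch 2 S S' & reg S' 7 = int (length J + 64 * val d s + a))"
 using addr_ok[of S 2 "val d s" B "dg d" a "length J" W] val_less[OF assms(2,3)] assms by (auto simp: rel_def)

lemma compiles_PSet: "wf_com (PSet d) ==> compiles (dg d + 9) (len (comp (PSet d))) (PSet d)"
proof (rule compiles_loopfree, goal_cases)
 case (2 B J s s' S W)
 have "ex W (cexp d 2) S (\<lambda>S'. touch 2 S S' & reg S' (tr 2) = int (val d s))"
  using 2 power_W[OF 2(8,2)] by (intro cexp_ok) auto
 then have "ex W (comp (PSet d)) S (rel J s')"
  unfolding comp.simps ex_simps(6)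
 proof (rule ex_conseq, goal_cases)
  case (1 S1)
  then have r: "rel J s S1" using 2 touch_rel by blast
  have "ex W (addr 63 2) S1 (\<lambda>S'. touch 2 S1 S' & reg S' 7 = int (length J + 64 * val d s + 63))"
   by (rule addr2_ok) (use 1 2 r power_W[OF 2(8,2)] in auto)
  then show ?case
  proof (rule ex_conseq, goal_cases)
   case (1 S2)
   then have "rel J s S2" using r touch_rel by blast
   then have "rel J s (set_reg 10 1 S2)" by (rule rel_set_reg)
   from rel_set_mem(2)[OF this] show ?case using 1 base_W(2)[OF 2(2,8)] 2(7) by (simp add: nat_add_distrib nat_mult_distrib)
  qed
 qed
 then show ?case using 2 bounded_set by auto
qed auto

lemma compiles_Sto: "wf_com (Sto a d e) ==> compiles (dg d + dg e + 9) (len (comp (Sto a d e))) (Sto a d e)"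
proof (rule compiles_loopfree, goal_cases)
 case (2 B J s s' S W)
 have "ex W (cexp d 2) S (\<lambda>S'. touch 2 S S' & reg S' (tr 2) = int (val d s))"
  using 2 power_W[OF 2(8,2)] by (intro cexp_ok) auto
 then have "ex W (comp (Sto a d e)) S (rel J s')"
  unfolding comp.simps ex_simps(6)
 proof (rule ex_conseq, goal_cases)
  case (1 S1)
  then have r: "rel J s S1" using 2 touch_rel by blast
  have "ex W (addr a 2) S1 (\<lambda>S'. touch 2 S1 S' & reg S' 7 = int (length J + 64 * val d s + a))"
   by (rule addr2_ok) (use 1 2 r power_W[OF 2(8,2)] in auto)
  then show ?case
  proof (rule ex_conseq, goal_cases)
   case (1 S2)
   then have r2: "rel J s S2" using r touch_rel by blast
   have "ex W (cexp e 3) S2 (\<lambda>S'. touch 3 S2 S' & reg S' (tr 3) = int (val e s))"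
    using 2 power_W[OF 2(8,2)] r2 by (intro cexp_ok) auto
   then show ?case
   proof (rule ex_conseq, goal_cases)
    case (1 S3)
    then have "rel J s S3" using r2 touch_rel by force
    from rel_set_mem(1)[OF this, of a "val d s" "val e s"] show ?case
     using 1 touch_temp[of 2 S2 S3] \<open>touch 2 S1 S2 & _\<close> 2 by (simp add: nat_add_distrib nat_mult_distrib)
   qed
  qed
 qed
 then show ?case using 2 bounded_set by auto
qed auto

lemma compilesE:
 assumes "compiles D K c" "2 <= B" "length J <= B" "\<forall>x\<in>set J. x <= B" "bounded B s" "rel J s S" "run B J c s s'" "int B ^ D <= W"
 obtains t S' where "exec W (comp c) S t S'" "rel J s' S'" "bounded B s'" "t <= K * (ck s' - ck s)"
 using assms unfolding compiles_def by blast

lemma compiles_Sq: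
 assumes "compiles D K c" "compiles D' K' d"
 shows "compiles (D + D') (K + K') (Sq c d)"
 unfolding compiles_def
proof (intro allI impI, goal_cases)
 case (1 B J s s' S W)
 then obtain u where u: "run B J c s u" "run B J d u s'" by auto
 obtain t1 S1 where 2: "exec W (comp c) S t1 S1" "rel J u S1" "bounded B u" "t1 <= K * (ck u - ck s)"
  by (rule compilesE[OF assms(1) 1(1,2,3,4,5) u(1) power_W[OF 1(7,1)]]) auto
 obtain t2 S2 where 3: "exec W (comp d) S1 t2 S2" "rel J s' S2" "bounded B s'" "t2 <= K' * (ck s' - ck u)"
  by (rule compilesE[OF assms(2) 1(1,2,3) 2(3,2) u(2) power_W[OF 1(7,1)]]) auto
 have "ck s <= ck u" "ck u <= ck s'" using u run_frame frameD(4) by blast+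
 then have "K * (ck u - ck s) <= K * (ck s' - ck s)" "K' * (ck s' - ck u) <= K' * (ck s' - ck s)" by (auto intro!: mult_le_mono2 diff_le_mono diff_le_mono2)
 then have "t1 + t2 <= (K + K') * (ck s' - ck s)" using 2(4) 3(4) unfolding add_mult_distrib by linarith
 moreover have "exec W (comp (Sq c d)) S (t1 + t2) S2" unfolding comp.simps using 2(1) 3(1) by (rule exec_Seq)
 ultimately show ?case using 3 by blast
qed

lemma cond_time:
 fixes Y :: nat
 assumes "t1 <= L" "t2 <= K * Y"
 shows "t1 + (t2 + 1) <= (L + 1 + K + K') * Suc Y"
proof -
 have "(L + 1 + K + K') * Suc Y = L + 1 + K + K' + (L + 1 + K') * Y + K * Y" by (simp add: algebra_simps)
 then show ?thesis using assms by linarith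
qed

lemma compiles_Cond:
 assumes "compiles D K c" "compiles D' K' d" "wfe e"
 shows "compiles (dg e + D + D') (len (cexp e 2) + 1 + K + K') (Cond e c d)"
 unfolding compiles_def
proof (intro allI impI, goal_cases)
 case (1 B J s s' S W)
 have "ex W (cexp e 2) S (\<lambda>S'. touch 2 S S' & reg S' (tr 2) = int (val e s))"
  using 1 power_W[OF 1(7,1)] assms by (intro cexp_ok) auto
 from ex_loopfreeD[OF this] obtain t1 S1 where
  2: "exec W (cexp e 2) S t1 S1" "t1 <= len (cexp e 2)" "touch 2 S S1" "reg S1 7 = int (val e s)" by auto
 have r: "rel J (tck s) S1" using 1 2 touch_rel rel_set_reg(4) by blast
 have b: "bounded B (tck s)" using 1 bounded_set by blast
 show ?case
 proof (cases "val e s > 0")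
  case True
  then have "run B J c (tck s) s'" using 1 by simp
  from compilesE[OF assms(1) 1(1,2,3) b r this power_W[OF 1(7,1)]] obtain t2 S2 where
   3: "exec W (comp c) S1 t2 S2" "rel J s' S2" "bounded B s'" "t2 <= K * (ck s' - ck (tck s))" by auto
  have "ck (tck s) <= ck s'" using \<open>run B J c (tck s) s'\<close> run_frame frameD(4) by blast
  then have "t1 + (t2 + 1) <= (len (cexp e 2) + 1 + K + K') * (ck s' - ck s)"
  proof -
   assume "ck (tck s) <= ck s'"
   then have "ck s' - ck s = Suc (ck s' - ck (tck s))" by simp
   then show ?thesis using cond_time[OF 2(2) 3(4), of K'] by (simp only: )
  qed
  moreover have "exec W (comp (Cond e c d)) S (t1 + (t2 + 1)) S2" unfolding comp.simps by (intro exec_Seq[OF 2(1)] exec_IfTrue) (use 2 3 True in auto)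
  ultimately show ?thesis using 3 by blast
 next
  case False
  then have "run B J d (tck s) s'" using 1 by simp
  from compilesE[OF assms(2) 1(1,2,3) b r this power_W[OF 1(7,1)]] obtain t2 S2 where
   3: "exec W (comp d) S1 t2 S2" "rel J s' S2" "bounded B s'" "t2 <= K' * (ck s' - ck (tck s))" by auto
  have "ck (tck s) <= ck s'" using \<open>run B J d (tck s) s'\<close> run_frame frameD(4) by blast
  then have "t1 + (t2 + 1) <= (len (cexp e 2) + 1 + K + K') * (ck s' - ck s)"
  proof -
   assume "ck (tck s) <= ck s'"
   then have "ck s' - ck s = Suc (ck s' - ck (tck s))" by simp
   then show ?thesis using cond_time[OF 2(2) 3(4), of K] by (simp only: add.assoc add.commute[of K' K])
  qed
  moreover have "exec W (comp (Cond e c d)) S (t1 + (t2 + 1)) S2" unfolding comp.simps by (intro exec_Seq[OF 2(1)] exec_IfFalse) (use 2 3 False in auto)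
  ultimately show ?thesis using 3 by blast
 qed
qed

lemma zero_regs_ok:
 "0 < W ==> \<exists>S'. exec W (zero_regs R) S (Suc R) S' & mem S' = mem S & (\<forall>r<R. reg S' (3 * r + 2) = 0) & reg S' 9 = 0 &
   (\<forall>x. x \<noteq> 3 --> reg S' (3 * x) = reg S (3 * x)) & reg S' 4 = reg S 4"
proof (induction R)
 case 0
 then have "exec W (zero_regs 0) S 1 (set_reg 9 0 S)" unfolding zero_regs.simps by (intro exec_Const) auto
 then show ?case by (intro exI[of _ "set_reg 9 0 S"]) (auto simp: mod3_facts)
next
 case (Suc R)
 then obtain S' where *: "exec W (zero_regs R) S (Suc R) S'" "mem S' = mem S" "\<forall>r<R. reg S' (3 * r + 2) = 0" "reg S' 9 = 0"
   "\<forall>x. x \<noteq> 3 --> reg S' (3 * x) = reg S (3 * x)" "reg S' 4 = reg S 4" by auto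
 have "exec W (zero_regs (Suc R)) S (Suc R + 1) (set_reg (3 * R + 2) 0 S')"
  unfolding zero_regs.simps using Suc by (intro exec_Seq[OF *(1)] exec_Const) auto
 then show ?case using * by (intro exI[of _ "set_reg (3 * R + 2) 0 S'"]) (auto simp: mod3_facts less_Suc_eq)
qed

text \<open>Every memory that vanishes behind two factors is the initial memory of some
  multiplication; matrices can therefore be multiplied where they were built.\<close>

lemma matmul_input_mem:
 fixes f :: "nat => int"
 assumes "\<forall>x\<ge>2 * n\<^sup>2. f x = 0" "n \<ge> 1"
 shows "mem (matmul_input n (\<lambda>i j. f (i * n + j)) (\<lambda>i j. f (n\<^sup>2 + i * n + j))) = f"
proof
 fix x
 have 1: "x div n * n + x mod n = x" by simp
 have 2: "n\<^sup>2 + (x - n\<^sup>2) div n * n + (x - n\<^sup>2) mod n = x" if "\<not> x < n\<^sup>2" using that by (simp add: add.assoc)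
 show "mem (matmul_input n (\<lambda>i j. f (i * n + j)) (\<lambda>i j. f (n\<^sup>2 + i * n + j))) x = f x"
  using assms 1 2 by (auto simp: matmul_input_def simp del: div_mult_mod_eq mod_mult_div_eq)
qed

text \<open>The clock already advances by the \<open>t\<close> steps of the embedded program. The
  constant covers the factor 12 of the relocation and the clearing of registers.\<close>

lemma compiles_Mult: "compiles 12 (rbd P + 15) (Mult P d)"
 unfolding compiles_def
proof (intro allI impI, goal_cases)
 case (1 B J s s' S W)
 let ?N = "vr s 2" and ?off = "vr s 4" and ?L = "length J"
 let ?V = "(int ?N + 2) ^ d"
 let ?R = "Suc (rbd P)"
 from 1(6) obtain t f where rdy: "mult_ready s" "1 <= d" "(?N + 2) ^ d <= B" and t: "t <= B" "exec ?V P (mult_input s) t f" and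
  s': "s' = s\<lparr>vr := (vr s)(3 := t), pm := (\<lambda>x. if x < ?off then pm s x else mem f (x - ?off)), ck := Suc (ck s + t)\<rparr>" by auto
 have VB: "?V <= int B" using rdy(3) by (metis of_nat_add of_nat_le_iff of_nat_numeral of_nat_power)
 have W0: "0 < W" "1 < W" "int t < W" using base_W[OF 1(1,7)] t(1) by auto
 obtain S1 where z: "exec W (zero_regs ?R) S (Suc ?R) S1" "mem S1 = mem S" "\<forall>r<?R. reg S1 (3 * r + 2) = 0" "reg S1 9 = 0"
   "\<forall>x. x \<noteq> 3 --> reg S1 (3 * x) = reg S (3 * x)" "reg S1 4 = reg S 4"
  using zero_regs_ok[OF W0(1), of ?R S] by auto
 have r6: "reg S1 6 = int ?N" "reg S1 12 = int ?off" using z(5)[rule_format, of 2] z(5)[rule_format, of 4] 1(5) by (auto simp: rel_def dest: spec[of _ 2] spec[of _ 4])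
 have NB: "?N <= B" using 1(4) by (simp add: bounded_def)
 let ?\<mu> = "set_reg 2 (int ?N) S1"
 have e2: "exec W (Op Or 2 6 6) S1 1 ?\<mu>" using r6 base_W(1)[OF 1(1,7) _ NB] by (intro exec_Op) auto
 have mi: "mem (mult_input s) = (\<lambda>x. pm s (?off + x))"
 proof -
  have "\<forall>x\<ge>2 * ?N\<^sup>2. pm s (?off + x) = 0" "1 <= ?N" using rdy(1) by (auto simp: mult_ready_def)
  from matmul_input_mem[of ?N "\<lambda>x. pm s (?off + x)", OF this] show ?thesis
   by (simp add: mult_input_def add.assoc)
 qed
 have ri: "reg (mult_input s) = (\<lambda>_. 0)(0 := int ?N)" by (simp add: mult_input_def matmul_input_def)
 have ps: "psim ?R ?L ?off (mult_input s) ?\<mu>"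
  unfolding psim_def
 proof (intro conjI allI impI)
  fix r assume "r < ?R" then show "reg ?\<mu> (3 * r + 2) = reg (mult_input s) r" using z(3) by (auto simp: ri)
 next
  fix x show "mem ?\<mu> (?L + 64 * (?off + x) + 63) = mem (mult_input s) x"
  proof -
   have "mem S (?L + 64 * (?off + x) + 63) = pm s (?off + x)" using 1(5) unfolding rel_def by blast
   then show ?thesis using z(2) by (simp add: mi)
  qed
 qed (use z(6) 1(5) r6 in \<open>auto simp: rel_def\<close>)
 have V2: "int ?N < ?V" "2 <= ?V"
 proof -
  have "(int ?N + 2) ^ 1 <= ?V" using rdy(2) by (intro power_increasing) auto
  then show "int ?N < ?V" "2 <= ?V" by auto
 qed
 have sm: "small ?V (mult_input s)"
  unfolding small_def
 proof (intro conjI allI)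
  fix r show "\<bar>reg (mult_input s) r\<bar> < ?V" using V2 by (auto simp: ri)
 next
  fix x
  have "pm s (?off + x) \<in> {0, 1}" using rdy(1) by (cases "x < 2 * ?N\<^sup>2") (auto simp: mult_ready_def)
  then show "\<bar>mem (mult_input s) x\<bar> < ?V" using V2 by (auto simp: mi)
 qed
 have "\<exists>u \<mu>'. exec W (reloc P) ?\<mu> u \<mu>' & u <= 12 * t & psim ?R ?L ?off f \<mu>' & keep ?L ?off ?\<mu> \<mu>' & reg \<mu>' 9 = int (0 + t)"
  by (rule reloc_ok[OF 1(1,2) _ VB 1(7) t(2) sm _ ps]) (use 1(4) z(4) W0 in \<open>auto simp: bounded_def\<close>)
 then obtain u \<mu>' where e3: "exec W (reloc P) ?\<mu> u \<mu>'" "u <= 12 * t" "psim ?R ?L ?off f \<mu>'" "keep ?L ?off ?\<mu> \<mu>'" "reg \<mu>' 9 = int t" by auto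
 have ex: "exec W (comp (Mult P d)) S (Suc ?R + (1 + u)) \<mu>'"
  unfolding comp.simps by (intro exec_Seq[OF z(1)] exec_Seq[OF e2] e3(1))
 \<comment> \<open>Behind the input, window cells have residue 63 modulo 64 and index at least the
   offset, so the arrays and the earlier part of \<open>pm\<close> survive.\<close>
 have ne: "\<forall>x. ?L + 64 * i + a \<noteq> ?L + 64 * (?off + x) + 63" if "a < 63 \<or> i < ?off" "a <= 63" for a i
 proof
  fix x
  have dm: "(64 * y + b) div 64 = y" "(64 * y + b) mod 64 = b" if "b <= 63" for y b :: nat using that by simp_all
  note dm[OF that(2), of i] dm[of 63 "?off + x", OF order_refl]
  then have "i = ?off + x & a = 63" if "64 * i + a = 64 * (?off + x) + 63" using that by (simp only:)
  then show "?L + 64 * i + a \<noteq> ?L + 64 * (?off + x) + 63" using that by (auto simp del: add_mult_distrib2)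
 qed
 have "rel J s' \<mu>'"
  unfolding rel_def
 proof (intro conjI allI impI)
  fix x show "reg \<mu>' (3 * x) = int (vr s' x)"
  proof (cases "x = 3")
   case True then show ?thesis using e3(5) s' by simp
  next
   case False
   then have "reg \<mu>' (3 * x) = reg S (3 * x)" using e3(4) z(5) by (auto simp: keep_def mod3_facts)
   then show ?thesis using 1(5) False s' by (simp add: rel_def)
  qed
 next
  show "reg \<mu>' 4 = int ?L" using e3(3) by (simp add: psim_def)
 next
  fix a i :: nat assume "a < 63"
  then have "mem \<mu>' (?L + 64 * i + a) = mem S (?L + 64 * i + a)" using e3(4) z(2) ne[of a i] by (simp add: keep_def)
  then show "mem \<mu>' (?L + 64 * i + a) = int (ar s' a i)" using 1(5) \<open>a < 63\<close> s' by (simp add: rel_def)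
 next
  fix i
  show "mem \<mu>' (?L + 64 * i + 63) = pm s' i"
  proof (cases "i < ?off")
   case True
   then have "mem \<mu>' (?L + 64 * i + 63) = mem S (?L + 64 * i + 63)" using e3(4) z(2) ne[of 63 i] by (simp add: keep_def)
   then show ?thesis using 1(5) True s' by (simp add: rel_def)
  next
   case False
   then have "?off + (i - ?off) = i" by simp
   then have "mem \<mu>' (?L + 64 * i + 63) = mem f (i - ?off)" using e3(3) unfolding psim_def by metis
   then show ?thesis using False s' by simp
  qed
 next
  fix i assume i: "i < ?L"
  have "\<forall>x. i \<noteq> ?L + 64 * (?off + x) + 63" using i by auto
  then have "mem \<mu>' i = mem S i" using e3(4) z(2) by (auto simp: keep_def)
  then show "mem \<mu>' i = int (J ! i)" using 1(5) i by (simp add: rel_def)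
 qed
 moreover have "bounded B s'" using 1(4) t(1) s' by (simp add: bounded_def)
 moreover have "Suc ?R + (1 + u) <= (rbd P + 15) * (ck s' - ck s)" using e3(2) s' by (simp add: algebra_simps)
 ultimately show ?case using ex by blast
qed

lemma compiles_For:
 assumes c: "compiles D K c" and wf: "wf_com (For x y c)"
 shows "compiles (D + 2) (K + 6) (For x y c)"
 unfolding compiles_def
proof (intro allI impI, goal_cases)
 case (1 B J s s' S W)
 let ?N = "vr s y"
 let ?R = "\<lambda>k u w. run B J c (setv x k u) w"
 from 1(6) obtain u where u: "iterr ?R ?N s u" "s' = setv x ?N u" by auto
 have N: "?N <= B" using 1(4) by (simp add: bounded_def)
 note bW = base_W[OF 1(1,7), simplified]
 have WD: "int B ^ D <= W" using power_W[OF 1(7,1)] by simp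
 let ?body = "Seq (comp c) (Seq (Const 7 1) (Seq (Op Add (3 * x) (3 * x) 7) (Op Sub 7 (3 * y) (3 * x))))"
 let ?W = "WhilePos 7 ?body"
 let ?S0 = "set_reg 7 (int ?N) (set_reg (3 * x) 0 S)"
 have xy: "x \<noteq> y" "x \<notin> mv c" "y \<notin> mv c" using wf by auto
 have r0: "rel J (setv x 0 s) ?S0" using rel_set_reg(1)[OF 1(5), of x 0] by (auto intro: rel_set_reg)
 \<comment> \<open>The last clause is in continuation form: any execution of the loop from the state
   after \<open>k\<close> rounds extends to one from the initial state at the price of
   \<open>t\<close> further steps.\<close>
 have step: "\<exists>t Sk. rel J (setv x k w) Sk & reg Sk 7 = int ?N - int k & bounded B w & vr w y = ?N & ck s <= ck w &
   t <= (K + 6) * (ck w - ck s) &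
   (\<forall>t' S'. exec W ?W Sk t' S' --> exec W ?W ?S0 (t + t') S')"
  if "iterr ?R k s w" "k <= ?N" for k w using that
 proof (induction k arbitrary: w)
  case 0
  then show ?case using r0 1(4) by (intro exI[of _ 0] exI[of _ ?S0]) auto
 next
  case (Suc k)
  then obtain v where v: "iterr ?R k s v" "run B J c (setv x k v) w" by auto
  from Suc.IH[OF v(1)] Suc.prems obtain t Sk where
   a: "rel J (setv x k v) Sk" "reg Sk 7 = int ?N - int k" "bounded B v" "vr v y = ?N" "ck s <= ck v" "t <= (K + 6) * (ck v - ck s)"
    "\<forall>t' S'. exec W ?W Sk t' S' --> exec W ?W ?S0 (t + t') S'" by auto
  have b: "bounded B (setv x k v)" using a(3) N Suc.prems by (intro bounded_set) auto
  obtain t2 S2 where e: "exec W (comp c) Sk t2 S2" "rel J w S2" "bounded B w" "t2 <= K * (ck w - ck (setv x k v))"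
   by (rule compilesE[OF c 1(1,2,3) b a(1) v(2) WD])
  have fr: "frame c (setv x k v) w" using v(2) run_frame by blast
  have wx: "vr w x = k" "vr w y = ?N" using frameD(1)[OF fr xy(2)] frameD(1)[OF fr xy(3)] xy(1) a(4) by auto
  have wc: "Suc (ck v) <= ck w" using frameD(4)[OF fr] by simp
  have rx: "reg S2 (3 * x) = int k" "reg S2 (3 * y) = int ?N" using e(2) wx by (auto simp: rel_def)
  let ?S3 = "set_reg 7 (int ?N - int (Suc k)) (set_reg (3 * x) (int (Suc k)) (set_reg 7 1 S2))"
  have "exec W ?body Sk (t2 + (1 + (1 + 1))) ?S3"
  proof (intro exec_Seq[OF e(1)] exec_Seq)
   show "exec W (Const 7 1) S2 1 (set_reg 7 1 S2)" using bW by (intro exec_Const) auto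
   show "exec W (Op Add (3 * x) (3 * x) 7) (set_reg 7 1 S2) 1 (set_reg (3 * x) (int (Suc k)) (set_reg 7 1 S2))"
    using rx bW(1)[of "Suc k"] N Suc.prems by (intro exec_Op) (auto simp: mod3_facts)
   show "exec W (Op Sub 7 (3 * y) (3 * x)) (set_reg (3 * x) (int (Suc k)) (set_reg 7 1 S2)) 1 ?S3"
    using rx bW(1)[of ?N] N Suc.prems xy(1) by (intro exec_Op) (auto simp: mod3_facts)
  qed
  then have "exec W ?W Sk (t2 + (1 + (1 + 1)) + t' + 1) S'" if "exec W ?W ?S3 t' S'" for t' S'
   using that a(2) Suc.prems by (intro exec_WhileTrue) auto
  then have "\<forall>t' S'. exec W ?W ?S3 t' S' --> exec W ?W ?S0 (t + t2 + 4 + t') S'"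
   using a(7)
  proof (intro allI impI)
   fix t' S' assume "exec W ?W ?S3 t' S'"
   then have "exec W ?W ?S0 (t + (t2 + (1 + (1 + 1)) + t' + 1)) S'"
    using a(7) \<open>\<And>t' S'. exec W ?W ?S3 t' S' ==> _\<close> by blast
   moreover have "t + (t2 + (1 + (1 + 1)) + t' + 1) = t + t2 + 4 + t'" by simp
   ultimately show "exec W ?W ?S0 (t + t2 + 4 + t') S'" by (simp only:)
  qed
  moreover have "rel J (setv x (Suc k) w) ?S3" using rel_set_reg(1)[OF rel_set_reg(2)[OF e(2)], of x "Suc k" 1] by (rule rel_set_reg)
  moreover have "t + t2 + 4 <= (K + 6) * (ck w - ck s)"
  proof -
   have "t + t2 + 4 <= (K + 6) * (ck v - ck s) + K * (ck w - Suc (ck v)) + (K + 6)" using a(6) e(4) by simp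
   also have "\<dots> <= (K + 6) * (ck v - ck s) + (K + 6) * (ck w - Suc (ck v)) + (K + 6)" by simp
   also have "\<dots> = (K + 6) * (ck v - ck s + (ck w - Suc (ck v)) + 1)" by (simp only: distrib_left mult_1_right)
   also have "ck v - ck s + (ck w - Suc (ck v)) + 1 = ck w - ck s" using wc a(5) by simp
   finally show ?thesis .
  qed
  ultimately show ?case using e(3) wx wc a(5) by (intro exI[of _ "t + t2 + 4"] exI[of _ ?S3]) auto
 qed
 from step[OF u(1)] obtain t Sk where
  f: "rel J (setv x ?N u) Sk" "reg Sk 7 = int ?N - int ?N" "bounded B u" "ck s <= ck u" "t <= (K + 6) * (ck u - ck s)"
   "\<forall>t' S'. exec W ?W Sk t' S' --> exec W ?W ?S0 (t + t') S'" by auto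
 have "exec W ?W Sk 1 Sk" using f(2) by (intro exec_WhileFalse) auto
 then have ew: "exec W ?W ?S0 (t + 1) Sk" using f(6) by blast
 have "exec W (comp (For x y c)) S (1 + (1 + (t + 1))) Sk"
  unfolding comp.simps
 proof (rule exec_Seq, rule_tac[2] exec_Seq, rule_tac[3] ew)
  show "exec W (Const (3 * x) 0) S 1 (set_reg (3 * x) 0 S)" using bW by (intro exec_Const) auto
  have "reg S (3 * y) = int ?N" using 1(5) by (simp add: rel_def)
  then show "exec W (Op Sub 7 (3 * y) (3 * x)) (set_reg (3 * x) 0 S) 1 ?S0" using bW(1)[OF N] xy by (intro exec_Op) auto
 qed
 moreover have "1 + (1 + (t + 1)) <= (K + 6) * (ck s' - ck s)"
  using f(4,5) u(2) by (simp add: Suc_diff_le algebra_simps)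
 moreover have "bounded B s'" using f(3) u(2) N bounded_set by blast
 ultimately show ?case using f(1) u(2) by blast
qed

theorem compiles: "wf_com c ==> \<exists>D K. compiles D K c"
proof (induction c)
 case Nop
 have "compiles 0 (len (comp Nop)) Nop" by (rule compiles_loopfree) (auto intro: rel_set_reg bounded_set)
 then show ?case by blast
next
 case (For x y c)
 then show ?case using compiles_For by (metis wf_com.simps(7))
next
 case (Cond e c d)
 then show ?case using compiles_Cond by (metis wf_com.simps(6))
qed (use compiles_Asg compiles_Sto compiles_PSet compiles_Inp compiles_Sq compiles_Mult in \<open>(metis wf_com.simps)+\<close>)

section \<open>Chunks\<close>

text \<open>Variables 15, 16, 17 are the offsets of the two factors and of the result in array 0, and 18, 19 their strides, which are swapped
 in the transposed half; 26, 27, 31 are the indices \<open>i\<close>, \<open>k\<close>, \<open>j\<close>.\<close>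

abbreviation eA :: expr where "eA \<equiv> Plus (Var 15) (Plus (Times (Var 26) (Var 18)) (Times (Var 27) (Var 19)))"
abbreviation eB :: expr where "eB \<equiv> Plus (Var 16) (Plus (Times (Var 27) (Var 18)) (Times (Var 31) (Var 19)))"
abbreviation eC :: expr where "eC \<equiv> Plus (Var 17) (Plus (Times (Var 26) (Var 18)) (Times (Var 31) (Var 19)))"

text \<open>Tries \<open>A i k\<close> as a value for entry \<open>(i, j)\<close>; it is a
  legitimate candidate when \<open>B k j\<close> does not exceed it.\<close>

definition relax :: com where
 "relax = Asg 28 (Rd 0 eA);; Cond (Conj (Leq (Rd 0 eB) (Var 28)) (Less (Var 28) (Rd 0 eC))) (Sto 0 eC (Var 28)) Nop"

lemma mv_relax [simp]: "mv relax = {28}" "ma relax = {0}" "mp relax = False" "wf_com relax"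
 by (auto simp: relax_def)

text \<open>Array \<open>q\<close> maps a key to its open chunk; arrays \<open>q+1\<close> to \<open>q+5\<close> hold the key, size, elements, least and greatest value of a chunk.
 Earlier chunks of the same key hold smaller values.\<close>

definition chunks :: "st => nat => nat => nat => nat => nat => (nat => nat => nat) => nat => nat => nat => bool" where
 "chunks s q n nn nx h w lb ub cnt \<longleftrightarrow> n <= nx &
   (\<forall>r<nx. ar s (q+1) r < n & r <= ar s q (ar s (q+1) r) & ar s (q+2) r <= cnt & ar s (q+2) r <= h &
    (ar s (q+2) r = 0 --> ar s (q+4) r = 0 & ar s (q+5) r = 0) & (0 < ar s (q+2) r --> lb <= ar s (q+4) r) &
    ar s (q+5) r <= ub &
    (\<forall>x<ar s (q+2) r. ar s (q+3) (r * nn + x) < n & ar s (q+4) r <= w (ar s (q+1) r) (ar s (q+3) (r * nn + x)) &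
      w (ar s (q+1) r) (ar s (q+3) (r * nn + x)) <= ar s (q+5) r)) &
   (\<forall>k<n. ar s q k < nx & ar s (q+1) (ar s q k) = k) &
   (\<forall>r r'. r < r' --> r' < nx --> ar s (q+1) r = ar s (q+1) r' --> 0 < ar s (q+2) r --> 0 < ar s (q+2) r' -->
    ar s (q+5) r <= ar s (q+4) r') &
   (nx - n) * h + (\<Sum>k<n. ar s (q+2) (ar s q k)) = cnt"

text \<open>A full chunk is replaced only when its key receives another element, so an open chunk
  with room exists whenever \<open>chunk_push\<close> is reached.\<close>

definition chunk_open :: "nat => nat => nat => nat => com" where
 "chunk_open q nx vk r = Asg r (Rd q (Var vk));;
   Cond (Leq (Var 20) (Rd (q+2) (Var r)))
    (Asg r (Var nx);; Sto q (Var vk) (Var r);; Sto (q+1) (Var r) (Var vk);; Sto (q+2) (Var r) (Num 0);;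
    Sto (q+4) (Var r) (Num 0);; Sto (q+5) (Var r) (Num 0);; Asg nx (Plus (Var nx) (Num 1)))
    Nop"

definition chunk_push :: "nat => nat => nat => com" where
 "chunk_push q vm r = Cond (Equal (Rd (q+2) (Var r)) (Num 0)) (Sto (q+4) (Var r) (Var 28)) Nop;;
   Sto (q+5) (Var r) (Var 28);;
   Sto (q+3) (Plus (Times (Var r) (Var 7)) (Rd (q+2) (Var r))) (Var vm);;
   Sto (q+2) (Var r) (Plus (Rd (q+2) (Var r)) (Num 1))"

lemma sum_upd_one:
 fixes f g :: "nat => nat"
 assumes "k < n" "\<And>i. i < n ==> i \<noteq> k ==> g i = f i"
 shows "(\<Sum>i<n. g i) + f k = (\<Sum>i<n. f i) + g k"
proof -
 have "(\<Sum>i<n. g i) = g k + (\<Sum>i\<in>{..<n}-{k}. g i)" "(\<Sum>i<n. f i) = f k + (\<Sum>i\<in>{..<n}-{k}. f i)"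
  using assms(1) by (simp_all add: sum.remove)
 moreover have "(\<Sum>i\<in>{..<n}-{k}. g i) = (\<Sum>i\<in>{..<n}-{k}. f i)" using assms(2) by (intro sum.cong) auto
 ultimately show ?thesis by simp
qed

text \<open>All chunks except the \<open>n\<close> open ones are full. The \<open>nx - n\<close>
  closed chunks thus account for \<open>(nx - n) * h\<close> of the \<open>cnt\<close> elements,
  which bounds the number of chunks.\<close>

lemma chunks_le:
 assumes "chunks s q n nn nx h w lb ub cnt"
 shows "(nx - n) * h <= cnt" "n <= nx" "k < n ==> ar s q k < nx" "k < n ==> ar s (q+1) (ar s q k) = k"
  "r < nx ==> ar s (q+1) r < n" "r < nx ==> ar s (q+2) r <= h" "r < nx ==> ar s (q+2) r <= cnt"
 using assms unfolding chunks_def by auto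

lemma chunk_open_wp:
 assumes ch: "chunks s q n nn nx h w lb ub cnt"
  and v: "vr s vx = nx" "vr s vk = k" "k < n" "vr s 20 = h" "0 < h" "vx \<noteq> r" "vx \<noteq> vk" "r \<noteq> vk" "r \<noteq> 20" "vx \<noteq> 20"
  and B: "nx + 1 <= B"
 shows "wp B J (chunk_open q vx vk r) (\<lambda>s'. \<exists>nx'. vr s' vx = nx' & vr s' r = ar s' q k & nx <= nx' & ar s' (q+2) (ar s' q k) < h &
   chunks s' q n nn nx' h w lb ub cnt & ck s' <= ck s + 9 & ar s' (q+3) = ar s (q+3) &
   (\<forall>r<nx. ar s' (q+1) r = ar s (q+1) r & ar s' (q+2) r = ar s (q+2) r)) s"
proof (cases "h <= ar s (q+2) (ar s q k)")
 case False
 have "ar s q k < nx" using chunks_le(3)[OF ch v(3)] .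
 then show ?thesis using False v ch B by (auto simp: chunk_open_def chunks_def)
next
 case True
 note c = chunks_le[OF ch]
 let ?r = "ar s q k"
 have rk: "?r < nx" "ar s (q+1) ?r = k" using c(3,4) v by auto
 have full: "ar s (q+2) ?r = h" using True c(6)[OF rk(1)] by simp
 let ?f = "(ar s)(q := (ar s q)(k := nx), q+1 := (ar s (q+1))(nx := k), q+2 := (ar s (q+2))(nx := 0),
   q+4 := (ar s (q+4))(nx := 0), q+5 := (ar s (q+5))(nx := 0))"
 have main: "chunks s' q n nn (Suc nx) h w lb ub cnt" if e: "ar s' = ?f" for s'
 proof -
  have sum: "(\<Sum>i<n. ar s' (q+2) (ar s' q i)) + ar s (q+2) ?r = (\<Sum>i<n. ar s (q+2) (ar s q i)) + ar s' (q+2) (ar s' q k)"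
  proof (rule sum_upd_one[where g = "\<lambda>i. ar s' (q+2) (ar s' q i)" and f = "\<lambda>i. ar s (q+2) (ar s q i)"])
   fix i assume "i < n" "i \<noteq> k"
   then have "ar s q i < nx" using c(3) by auto
   then show "ar s' (q+2) (ar s' q i) = ar s (q+2) (ar s q i)" using \<open>i \<noteq> k\<close> by (auto simp: e)
  qed (use v in auto)
  have new: "ar s' (q+2) (ar s' q k) = 0" by (simp add: e)
  \<comment> \<open>Closing a chunk moves its \<open>h\<close> elements from the sum over open
    chunks into the term for the closed ones.\<close>
  have cnt: "(Suc nx - n) * h + (\<Sum>i<n. ar s' (q+2) (ar s' q i)) = cnt"
   using sum full new ch c(2) unfolding chunks_def by (simp add: Suc_diff_le)
  show ?thesis
   unfolding chunks_def
  proof (intro conjI)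
   show "n <= Suc nx" using c(2) by simp
   show "\<forall>k<n. ar s' q k < Suc nx & ar s' (q + 1) (ar s' q k) = k"
    using c(3,4) by (auto simp: e less_SucI)
   show "(Suc nx - n) * h + (\<Sum>k<n. ar s' (q + 2) (ar s' q k)) = cnt" by (rule cnt)
   show "\<forall>r r'. r < r' --> r' < Suc nx --> ar s' (q + 1) r = ar s' (q + 1) r' -->
    0 < ar s' (q + 2) r --> 0 < ar s' (q + 2) r' --> ar s' (q + 5) r <= ar s' (q + 4) r'"
    using ch unfolding chunks_def by (auto simp: e less_Suc_eq)
   show "\<forall>r<Suc nx. ar s' (q + 1) r < n & r <= ar s' q (ar s' (q + 1) r) & ar s' (q + 2) r <= cnt & ar s' (q + 2) r <= h &
    (ar s' (q + 2) r = 0 --> ar s' (q + 4) r = 0 & ar s' (q + 5) r = 0) & (0 < ar s' (q + 2) r --> lb <= ar s' (q + 4) r) &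
    ar s' (q + 5) r <= ub &
    (\<forall>x<ar s' (q + 2) r. ar s' (q + 3) (r * nn + x) < n &
      ar s' (q + 4) r <= w (ar s' (q + 1) r) (ar s' (q + 3) (r * nn + x)) &
      w (ar s' (q + 1) r) (ar s' (q + 3) (r * nn + x)) <= ar s' (q + 5) r)"
    using ch v(3) unfolding chunks_def by (auto simp: e less_Suc_eq)
  qed
 qed
 show ?thesis
  using True v B main rk(1) c(2) by (auto simp: chunk_open_def)
qed

text \<open>Elements arrive in nondecreasing order of value, as \<open>ub <= w k y\<close> says: the
  new element is always the greatest of its chunk, and it is the least exactly when the chunk was
  empty or held only equal values.\<close>

lemma chunk_push_wp:
 assumes ch: "chunks s q n nn nx h w lb ub cnt"
  and v: "k < n" "vr s r = ar s q k" "ar s (q+2) (ar s q k) < h" "vr s vm = y" "y < n" "vr s 28 = w k y" "ub <= w k y" "lb <= ub"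
   "cnt < nn" "vr s 7 = nn"
  and B: "w k y <= B" "y <= B" "cnt + 1 <= B"
 shows "wp B J (chunk_push q vm r) (\<lambda>s'. chunks s' q n nn nx h w lb (w k y) (cnt + 1) & ck s' <= ck s + 5 &
   ar s' (q+1) = ar s (q+1) & (\<exists>x<ar s' (q+2) (ar s q k). ar s' (q+3) (ar s q k * nn + x) = y) &
   (\<forall>r<nx. ar s (q+2) r <= ar s' (q+2) r & (\<forall>x<ar s (q+2) r. ar s' (q+3) (r * nn + x) = ar s (q+3) (r * nn + x)))) s"
proof -
 note c = chunks_le[OF ch]
 let ?r = "ar s q k"
 let ?l = "ar s (q+2) ?r"
 have rk: "?r < nx" "ar s (q+1) ?r = k" using c(3,4) v by auto
 have l: "?l <= cnt" using c(7)[OF rk(1)] .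
 let ?f = "(ar s)(q+5 := (ar s (q+5))(?r := w k y), q+3 := (ar s (q+3))(?r * nn + ?l := y), q+2 := (ar s (q+2))(?r := ?l + 1),
   q+4 := (ar s (q+4))(?r := if ?l = 0 then w k y else ar s (q+4) ?r))"
 \<comment> \<open>A chunk holds at most \<open>cnt\<close> elements, fewer than \<open>nn\<close>,
   so the segments of length \<open>nn\<close> in array \<open>q + 3\<close> do not overlap.\<close>
 have idx: "(r * nn + x = ?r * nn + ?l) = (r = ?r & x = ?l)" if "x < nn" for r x
 proof -
  have "(r * nn + x) div nn = r" "(?r * nn + ?l) div nn = ?r" using that l v(9) by auto
  then show ?thesis by auto
 qed
 have main: "chunks s' q n nn nx h w lb (w k y) (cnt + 1)" if e: "ar s' = ?f" for s'
 proof -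
  have "(\<Sum>i<n. ar s' (q+2) (ar s' q i)) + ?l = (\<Sum>i<n. ar s (q+2) (ar s q i)) + ar s' (q+2) (ar s' q k)"
  proof (rule sum_upd_one[where g = "\<lambda>i. ar s' (q+2) (ar s' q i)" and f = "\<lambda>i. ar s (q+2) (ar s q i)"])
   fix i assume "i < n" "i \<noteq> k"
   then have "ar s q i \<noteq> ?r" using c(4) v(1) by metis
   then show "ar s' (q+2) (ar s' q i) = ar s (q+2) (ar s q i)" by (auto simp: e)
  qed (use v in auto)
  then have cnt: "(nx - n) * h + (\<Sum>i<n. ar s' (q+2) (ar s' q i)) = cnt + 1"
   using ch unfolding chunks_def by (simp add: e)
  have mono: "ar s (q+2) r <= cnt" "ar s (q+5) r <= w k y" if "r < nx" for r
   using ch that v(7) unfolding chunks_def by auto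
  have last: "r < ?r" if "r < nx" "r \<noteq> ?r" "ar s (q+1) r = k" for r
   using ch that unfolding chunks_def by (metis le_neq_implies_less)
  show ?thesis
   unfolding chunks_def
  proof (intro conjI)
   show "n <= nx" using c(2) .
   show "\<forall>k<n. ar s' q k < nx & ar s' (q + 1) (ar s' q k) = k" using c(3,4) by (auto simp: e)
   show "(nx - n) * h + (\<Sum>k<n. ar s' (q + 2) (ar s' q k)) = cnt + 1" by (rule cnt)
   show "\<forall>r r'. r < r' --> r' < nx --> ar s' (q + 1) r = ar s' (q + 1) r' -->
    0 < ar s' (q + 2) r --> 0 < ar s' (q + 2) r' --> ar s' (q + 5) r <= ar s' (q + 4) r'"
   proof (intro allI impI)
    fix r r' assume a: "r < r'" "r' < nx" "ar s' (q + 1) r = ar s' (q + 1) r'" "0 < ar s' (q + 2) r" "0 < ar s' (q + 2) r'"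
    have own: "ar s (q+1) r = ar s (q+1) r'" using a(3) by (simp add: e)
    have "r \<noteq> ?r" using last[of r'] a own rk(2) by auto
    then have r: "0 < ar s (q+2) r" "ar s' (q+5) r = ar s (q+5) r" using a by (auto simp: e)
    have old: "ar s (q+5) r <= ar s (q+4) r'" if "0 < ar s (q+2) r'"
     using ch a(1,2) own r(1) that unfolding chunks_def by blast
    show "ar s' (q + 5) r <= ar s' (q + 4) r'"
     using old r(2) mono(2)[of r] a by (cases "r' = ?r") (auto simp: e)
   qed
   show "\<forall>r<nx. ar s' (q + 1) r < n & r <= ar s' q (ar s' (q + 1) r) & ar s' (q + 2) r <= cnt + 1 & ar s' (q + 2) r <= h &
    (ar s' (q + 2) r = 0 --> ar s' (q + 4) r = 0 & ar s' (q + 5) r = 0) & (0 < ar s' (q + 2) r --> lb <= ar s' (q + 4) r) &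
    ar s' (q + 5) r <= w k y &
    (\<forall>x<ar s' (q + 2) r. ar s' (q + 3) (r * nn + x) < n &
      ar s' (q + 4) r <= w (ar s' (q + 1) r) (ar s' (q + 3) (r * nn + x)) &
      w (ar s' (q + 1) r) (ar s' (q + 3) (r * nn + x)) <= ar s' (q + 5) r)"
   proof (intro allI impI)
    fix r assume r: "r < nx"
    have old: "ar s (q + 1) r < n" "r <= ar s q (ar s (q + 1) r)" "ar s (q + 2) r <= cnt" "ar s (q + 2) r <= h"
     "ar s (q + 2) r = 0 --> ar s (q + 4) r = 0 & ar s (q + 5) r = 0" "0 < ar s (q + 2) r --> lb <= ar s (q + 4) r"
     "ar s (q + 5) r <= ub"
     "\<forall>x<ar s (q + 2) r. ar s (q + 3) (r * nn + x) < n &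
      ar s (q + 4) r <= w (ar s (q + 1) r) (ar s (q + 3) (r * nn + x)) &
      w (ar s (q + 1) r) (ar s (q + 3) (r * nn + x)) <= ar s (q + 5) r"
     using ch r unfolding chunks_def by blast+
    have keep: "ar s' (q+3) (r * nn + x) = (if r = ?r & x = ?l then y else ar s (q+3) (r * nn + x))" if "x < nn" for x
     using idx[OF that, of r] by (simp add: e)
    show "ar s' (q + 1) r < n & r <= ar s' q (ar s' (q + 1) r) & ar s' (q + 2) r <= cnt + 1 & ar s' (q + 2) r <= h &
     (ar s' (q + 2) r = 0 --> ar s' (q + 4) r = 0 & ar s' (q + 5) r = 0) & (0 < ar s' (q + 2) r --> lb <= ar s' (q + 4) r) &
     ar s' (q + 5) r <= w k y &
     (\<forall>x<ar s' (q + 2) r. ar s' (q + 3) (r * nn + x) < n &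
      ar s' (q + 4) r <= w (ar s' (q + 1) r) (ar s' (q + 3) (r * nn + x)) &
      w (ar s' (q + 1) r) (ar s' (q + 3) (r * nn + x)) <= ar s' (q + 5) r)"
    proof (cases "r = ?r")
     case False
     then have eq: "ar s' (q+1) r = ar s (q+1) r" "ar s' (q+2) r = ar s (q+2) r" "ar s' (q+4) r = ar s (q+4) r" "ar s' (q+5) r = ar s (q+5) r"
      by (simp_all add: e)
     have q: "ar s' q = ar s q" by (simp add: e)
     have "ar s' (q+3) (r * nn + x) = ar s (q+3) (r * nn + x)" if "x < ar s (q+2) r" for x
      using keep[of x] that old(3) v(9) False by simp
     then show ?thesis using old v(7) unfolding eq q by auto
    next
     case True
     have eq: "ar s' (q+1) r = k" "ar s' (q+2) r = ?l + 1" "ar s' (q+5) r = w k y" "ar s' q = ar s q"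
      "ar s' (q+4) r = (if ?l = 0 then w k y else ar s (q+4) ?r)" using rk(2) True by (auto simp: e)
     have "ar s' (q + 3) (r * nn + x) < n & ar s' (q + 4) r <= w k (ar s' (q + 3) (r * nn + x)) &
       w k (ar s' (q + 3) (r * nn + x)) <= w k y" if "x < ?l + 1" for x
     proof (cases "x = ?l")
      case x: True
      have "ar s (q+4) ?r <= w k y"
      proof (cases "?l = 0")
       case True then show ?thesis using old(5) \<open>r = ?r\<close> by simp
      next
       case False
       then have "ar s (q+4) ?r <= ar s (q+5) ?r" using old(8)[rule_format, of 0] True order_trans by auto
       then show ?thesis using mono(2)[OF r] True by simp
      qed
      moreover have "ar s' (q+3) (r * nn + x) = y" using keep[of x] l v(9) True x by simp
      ultimately show ?thesis using v(5) by (simp add: eq(5))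
     next
      case False
      then have "x < ar s (q+2) r" using that True by simp
      then have o: "ar s (q + 3) (r * nn + x) < n" "ar s (q + 4) r <= w k (ar s (q + 3) (r * nn + x))"
       "w k (ar s (q + 3) (r * nn + x)) <= ar s (q + 5) r" using old(8) rk(2) True by auto
      have "ar s' (q+3) (r * nn + x) = ar s (q+3) (r * nn + x)" using keep[of x] that l v(9) False by simp
      moreover have "ar s' (q+4) r = ar s (q+4) r" using eq(5) that False True by auto
      ultimately show ?thesis using o mono(2)[OF r] by simp
     qed
     then show ?thesis using old True v unfolding eq by auto
    qed
   qed
  qed
 qed
 have keep: "\<exists>x<Suc ?l. (if ?r * nn + x = ?r * nn + ?l then y else z x) = y" for z by (rule exI[of _ ?l]) auto
 have k2: "x \<noteq> ?l \<or> r \<noteq> ?r" if "x < ar s (q+2) r" for r x using that by auto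
 have k3: "x < nn" if "r < nx" "x < ar s (q+2) r" for r x using c(7)[OF that(1)] that(2) v(9) by simp
 show ?thesis
  using v B main l keep idx k2 k3 by (auto simp: chunk_push_def fun_upd_twist)
qed

text \<open>Chunks are visited in order of creation. For each key and column the flag admits only
  the hit chunk that comes earliest, which is the one with the smallest values.\<close>

definition scan :: "nat => nat => nat => nat => nat => expr => com" where
 "scan q nx vo vm fl e = Asg 36 (Times (Var nx) (Var 5));;
   For 35 36 (Asg 29 (Quot (Var 35) (Var 5));; Asg 31 (Minus (Var 35) (Times (Var 29) (Var 5)));; Asg vo (Rd (q+1) (Var 29));;
    Cond (Conj e (Equal (Rd fl (Plus (Times (Var vo) (Var 5)) (Var 31))) (Num 0)))
     (Sto fl (Plus (Times (Var vo) (Var 5)) (Var 31)) (Num 1);; Asg 37 (Rd (q+2) (Var 29));;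
     For 32 37 (Asg vm (Rd (q+3) (Plus (Times (Var 29) (Var 7)) (Var 32)));; relax))
     Nop)"

lemma mv_scan [simp]: "mv (scan q nx vo vm fl e) = {36,35,29,31,vo,37,32,vm,28}" "ma (scan q nx vo vm fl e) = {fl, 0}" "mp (scan q nx vo vm fl e) = False"
 by (auto simp: scan_def)

text \<open>\<open>A\<close> is the factor that attains the maximum. The strides let one program
  treat both halves: the second is the transposed problem, with the factors exchanged and all
  matrices read with exchanged strides. The value \<open>inf\<close> stands for
  \<open>never\<close>.\<close>

locale half =
 fixes B :: nat and J :: "nat list" and n :: nat and A Bm :: "nat => nat => nat" and bA bB bC s1 s2 inf :: nat
 assumes strides: "(s1 = n & s2 = 1) \<or> (s1 = 1 & s2 = n)"
  and disj: "bA + n * n <= bC" "bB + n * n <= bC"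
  and Ainf: "\<And>i k. i < n ==> k < n ==> A i k <= inf" and Binf: "\<And>i k. i < n ==> k < n ==> Bm i k <= inf"
  and infB: "inf + 2 <= B" and nB: "2 * (n * n) + 1 <= B" and n1: "1 <= n"
begin

lemma nleB: "n <= B" "n * n <= B"
proof -
 have "n <= n * n" by simp
 then show "n <= B" "n * n <= B" using nB by linarith+
qed

definition env :: "st => bool" where
 "env s \<longleftrightarrow> vr s 5 = n & vr s 7 = n * n & vr s 8 = inf & vr s 15 = bA & vr s 16 = bB & vr s 17 = bC & vr s 18 = s1 & vr s 19 = s2 &
   (\<forall>i<n. \<forall>k<n. ar s 0 (bA + (i * s1 + k * s2)) = A i k & ar s 0 (bB + (i * s1 + k * s2)) = Bm i k)"

definition cc :: "st => nat => nat => nat" where "cc s i j = ar s 0 (bC + (i * s1 + j * s2))"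

text \<open>Entries below \<open>inf\<close> have a witness, so no entry ever drops below the true
  product. The scans have to establish the opposite inequality.\<close>

definition sound :: "st => bool" where
 "sound s \<longleftrightarrow> (\<forall>i<n. \<forall>j<n. cc s i j <= inf & (cc s i j = inf \<or> (\<exists>k<n. A i k <= cc s i j & Bm k j <= cc s i j)))"

definition okC :: "st => st => bool" where
 "okC s u \<longleftrightarrow> env u & sound u & (\<forall>i<n. \<forall>j<n. cc u i j <= cc s i j) & (\<forall>x. x < bC \<or> bC + n * n <= x --> ar u 0 x = ar s 0 x)"

lemma ix_less: "i < n ==> j < n ==> i * s1 + j * s2 < n * n"
proof -
 assume "i < n" "j < n"
 have *: "a * n + b < n * n" if "a < n" "b < n" for a b
 proof -
  have "a * n + b < (a + 1) * n" using that by simp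
  also have "\<dots> <= n * n" using that by (intro mult_right_mono) auto
  finally show ?thesis .
 qed
 show ?thesis using strides *[of i j] *[of j i] \<open>i < n\<close> \<open>j < n\<close> by auto
qed

lemma ix_inj: "i < n ==> j < n ==> i' < n ==> j' < n ==> i * s1 + j * s2 = i' * s1 + j' * s2 \<longleftrightarrow> i = i' & j = j'"
proof -
 have *: "a * n + b = a' * n + b' \<longleftrightarrow> a = a' & b = b'" if "b < n" "b' < n" for a b a' b'
 proof
  assume e: "a * n + b = a' * n + b'"
  have "(a * n + b) div n = a" "(a' * n + b') div n = a'" using that by auto
  then show "a = a' & b = b'" using e by auto
 qed auto
 assume "i < n" "j < n" "i' < n" "j' < n"
 then show ?thesis using strides *[of j j' i i'] *[of i i' j j'] by (auto simp: add.commute)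
qed

lemma okC_refl: "env s ==> sound s ==> okC s s" by (simp add: okC_def)
lemma okC_trans: "okC s u ==> okC u w ==> okC s w" unfolding okC_def by simp (meson order_trans)

lemma env_cong: "env s ==> (\<forall>x\<in>{5,7,8,15,16,17,18,19}. vr u x = vr s x) ==> ar u 0 = ar s 0 ==> env u"
 by (simp add: env_def)

lemma cc_cong: "ar u 0 = ar s 0 ==> cc u = cc s" by (simp add: cc_def fun_eq_iff)

lemma okC_cong: "okC s u ==> (\<forall>x\<in>{5,7,8,15,16,17,18,19}. vr w x = vr u x) ==> ar w 0 = ar u 0 ==> okC s w"
 using env_cong[of u w] cc_cong[of w u] by (simp add: okC_def sound_def)

lemma relax_wp:
 assumes e: "env s" and sd: "sound s" and v: "vr s 26 = i" "vr s 27 = k" "vr s 31 = j" "i < n" "k < n" "j < n"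
 shows "wp B J relax (\<lambda>s'. okC s s' & (Bm k j <= A i k --> cc s' i j <= A i k) & ck s' <= ck s + 3) s"
proof -
 have a: "ar s 0 (bA + (i * s1 + k * s2)) = A i k" "ar s 0 (bB + (k * s1 + j * s2)) = Bm k j" using e v by (auto simp: env_def)
 have AB: "A i k <= B" using Ainf[of i k] v infB by simp
 let ?x = "bC + (i * s1 + j * s2)"
 have ok: "okC s s'" if s': "ar s' = (ar s)(0 := (ar s 0)(?x := A i k))" "\<And>x. x \<noteq> 28 ==> vr s' x = vr s x" and le: "Bm k j <= A i k" "A i k < cc s i j" for s'
 proof -
  have c: "cc s' i' j' = (if i' = i & j' = j then A i k else cc s i' j')" if "i' < n" "j' < n" for i' j'
   using ix_inj[OF that v(4,6)] by (auto simp: cc_def s')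
  have "ar s' 0 x = ar s 0 x" if "x < bC \<or> bC + n * n <= x" for x using that ix_less[OF v(4,6)] by (auto simp: s')
  moreover have "env s'"
   unfolding env_def
  proof (intro conjI allI impI)
   fix i k assume "i < n" "k < n"
   then have "bA + (i * s1 + k * s2) < bC" "bB + (i * s1 + k * s2) < bC" using ix_less[of i k] disj by auto
   then show "ar s' 0 (bA + (i * s1 + k * s2)) = A i k" "ar s' 0 (bB + (i * s1 + k * s2)) = Bm i k"
    using e \<open>i < n\<close> \<open>k < n\<close> by (auto simp: env_def s')
  qed (use e in \<open>auto simp: env_def s'(2)\<close>)
  moreover have "sound s'" using sd le v(5) Ainf[OF v(4,5)] unfolding sound_def by (auto simp: c)
  ultimately show ?thesis using le c unfolding okC_def by auto
 qed
 have ok2: "okC s s'" if "ar s' = ar s" "\<And>x. x \<noteq> 28 ==> vr s' x = vr s x" for s'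
  using okC_cong[OF okC_refl[OF e sd], of s'] that by auto
 have x: "val eA s = bA + (i * s1 + k * s2)" "val eC s = ?x" "val eB s = bB + (k * s1 + j * s2)" using e v by (auto simp: env_def)
 have vv: "vr s 15 = bA" "vr s 16 = bB" "vr s 17 = bC" "vr s 18 = s1" "vr s 19 = s2" using e by (auto simp: env_def)
 show ?thesis
  using ok ok2 AB a unfolding relax_def by (auto simp: v(1-3) vv cc_def)
qed

text \<open>The number of flags set, used as the potential that pays for scanning: flags are only
  switched on, and each scan of a chunk switches on one.\<close>

definition flag_sum :: "nat => st => nat" where "flag_sum fl s = (\<Sum>x<n*n. ar s fl x)"

text \<open>\<open>pr\<close> puts key and member of a chunk into the order row, column; row chunks
  and column chunks have the two in opposite roles.\<close>

definition scanned :: "nat => (nat => nat => nat \<times> nat) => st => nat => nat => bool" where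
 "scanned q pr s r j \<longleftrightarrow> (\<forall>x<ar s (q+2) r. case pr (ar s (q+1) r) (ar s (q+3) (r * (n * n) + x)) of (i, k) =>
   Bm k j <= A i k --> cc s i j <= A i k)"

lemma scanned_mono:
 assumes "scanned q pr s r j" "okC s u" "ar u (q+1) = ar s (q+1)" "ar u (q+2) = ar s (q+2)" "ar u (q+3) = ar s (q+3)" "j < n"
  and "\<And>x. x < ar s (q+2) r ==> fst (pr (ar s (q+1) r) (ar s (q+3) (r * (n * n) + x))) < n"
 shows "scanned q pr u r j"
 unfolding scanned_def assms(3-5)
proof (intro allI impI)
 fix x assume x: "x < ar s (q + 2) r"
 obtain i k where ik: "pr (ar s (q + 1) r) (ar s (q + 3) (r * (n * n) + x)) = (i, k)" by (cases "pr (ar s (q + 1) r) (ar s (q + 3) (r * (n * n) + x))") auto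
 have "i < n" using assms(7)[OF x] ik by simp
 then have "cc u i j <= cc s i j" using assms(2,6) by (simp add: okC_def)
 moreover have "Bm k j <= A i k --> cc s i j <= A i k" using assms(1) x ik unfolding scanned_def by fastforce
 ultimately show "case pr (ar s (q + 1) r) (ar s (q + 3) (r * (n * n) + x)) of (i, k) => Bm k j <= A i k --> cc u i j <= A i k"
  using ik by auto
qed

lemma inner_scan_wp:
 assumes e: "env s" "sound s" and vv: "(vo = 26 & vm = 27 & pr = (\<lambda>x y. (x, y))) \<or> (vo = 27 & vm = 26 & pr = (\<lambda>x y. (y, x)))"
  and v: "vr s 29 = r" "vr s 31 = j" "j < n" "vr s vo = ar s (q+1) r" "ar s (q+1) r < n" "vr s 37 = ar s (q+2) r"
  and m: "\<And>x. x < ar s (q+2) r ==> ar s (q+3) (r * (n * n) + x) < n" and q: "0 < q"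
 shows "wp B J (For 32 37 (Asg vm (Rd (q+3) (Plus (Times (Var 29) (Var 7)) (Var 32)));; relax))
   (\<lambda>s'. okC s s' & scanned q pr s' r j & ck s' <= ck s + 1 + 5 * ar s (q+2) r) s"
proof (rule wp_For[where I = "\<lambda>l u. okC s u & ck u <= ck s + 5 * l &
  (\<forall>x<l. case pr (ar s (q+1) r) (ar s (q+3) (r * (n * n) + x)) of (i, k) => Bm k j <= A i k --> cc u i j <= A i k)"], goal_cases)
 case 1
 then show ?case using okC_refl[OF e] by simp
next
 case (2 l u)
 note f = 2(3)[unfolded frame_def]
 have vm: "vm \<in> {26, 27}" "vo \<in> {26,27}" "vo \<noteq> vm" using vv by auto
 have u: "vr u 29 = r" "vr u 31 = j" "vr u vo = ar s (q+1) r" "vr u 7 = n * n"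
  "\<And>a. a \<noteq> 0 ==> ar u a = ar s a" using f v vm e(1) by (auto simp: env_def)
 let ?y = "ar s (q+3) (r * (n * n) + l)"
 have y: "?y < n" using m[of l] 2(1) v by simp
 let ?u = "setv vm ?y (setv 32 l u)"
 obtain i k where ik: "pr (ar s (q+1) r) ?y = (i, k)" by (cases "pr (ar s (q+1) r) ?y") auto
 have ik': "vr ?u 26 = i" "vr ?u 27 = k" "i < n" "k < n" using vv ik u(3) y v(5) by auto
 have "okC s ?u" using 2(2) okC_cong[of s u ?u] vm by auto
 then have eu: "env ?u" "sound ?u" by (auto simp: okC_def)
 have "wp B J relax (\<lambda>s'. okC ?u s' & (Bm k j <= A i k --> cc s' i j <= A i k) & ck s' <= ck ?u + 3) ?u"
  using relax_wp[OF eu ik'(1,2) _ ik'(3,4) v(3)] u(2) vm by auto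
 then have "wp B J relax (\<lambda>u. okC s u & ck u <= ck s + 5 * Suc l &
   (\<forall>x<Suc l. case pr (ar s (q+1) r) (ar s (q+3) (r * (n * n) + x)) of (i, k) => Bm k j <= A i k --> cc u i j <= A i k)) ?u"
 proof (rule wp_conseq)
  fix s' assume s': "okC ?u s' & (Bm k j <= A i k --> cc s' i j <= A i k) & ck s' <= ck ?u + 3"
  have "case pr (ar s (q+1) r) (ar s (q+3) (r * (n * n) + x)) of (i, k) => Bm k j <= A i k --> cc s' i j <= A i k" if "x < Suc l" for x
  proof (cases "x = l")
   case True then show ?thesis using s' ik by simp
  next
   case False
   then have "x < l" using that by simp
   obtain i' k' where ik2: "pr (ar s (q+1) r) (ar s (q+3) (r * (n * n) + x)) = (i', k')" by (cases "pr (ar s (q+1) r) (ar s (q+3) (r * (n * n) + x))") auto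
   have "i' < n" using m[of x] \<open>x < l\<close> 2(1) v ik2 vv by auto
   then have "cc s' i' j <= cc u i' j" using s' v(3) cc_cong[of ?u u] unfolding okC_def by simp
   then show ?thesis using 2(2) \<open>x < l\<close> ik2 order_trans by fastforce
  qed
  then show "okC s s' & ck s' <= ck s + 5 * Suc l &
   (\<forall>x<Suc l. case pr (ar s (q+1) r) (ar s (q+3) (r * (n * n) + x)) of (i, k) => Bm k j <= A i k --> cc s' i j <= A i k)"
   using s' okC_trans[OF \<open>okC s ?u\<close>, of s'] 2(2) by auto
 qed
 moreover have "?y <= B" using y nleB by linarith
 moreover have "val (Rd (q+3) (Plus (Times (Var 29) (Var 7)) (Var 32))) (setv 32 l u) = ?y" using u(1,4) u(5)[of "q+3"] by simp
 ultimately show ?case unfolding wp_simps by (simp only: simp_thms)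
next
 case (3 u)
 note f = 3(2)[unfolded frame_def]
 have "vm \<in> {26, 27}" using vv by auto
 have "\<And>a. a \<noteq> 0 ==> ar u a = ar s a" using f by auto
 then show ?case using 3(1) v okC_cong[of s u "setv 32 (vr s 37) u"] cc_cong[of "setv 32 (vr s 37) u" u] q
  by (auto simp: scanned_def)
qed

text \<open>Each scan of a chunk is charged to a flag that was unset. The last two conclusions trace
  every new flag to a hit chunk that was scanned, and answer every hit by a scan of the same or an
  earlier chunk of its key unless the flag was set beforehand.\<close>

lemma scan_wp:
 assumes e: "env s" "sound s" and vv: "(vo = 26 & vm = 27 & pr = (\<lambda>x y. (x, y))) \<or> (vo = 27 & vm = 26 & pr = (\<lambda>x y. (y, x)))"
  and ch: "chunks s q n (n*n) nx h w lb ub cnt" and nx: "vr s vx = nx" "nx * n <= B" "vx \<notin> {36,35,29,31,26,27,37,32,28}" and hB: "h <= B"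
  and fl: "fl \<noteq> 0" "fl \<notin> {q..q+5}" "0 < q" "\<forall>x<n*n. ar s fl x <= 1"
  and H: "\<And>u r j. r < nx ==> j < n ==> env u ==> (\<forall>x. x \<notin> {36,35,29,31,26,27,37,32,28} --> vr u x = vr s x) ==>
    (\<forall>a. a \<notin> {fl, 0} --> ar u a = ar s a) ==> pm u = pm s ==> vr u 29 = r ==> vr u 31 = j ==> vr u vo = ar s (q+1) r ==>
    val c u = of_bool (H r j)"
 shows "wp B J (scan q vx vo vm fl c) (\<lambda>u. okC s u & (\<forall>x<n*n. ar u fl x <= 1) & flag_sum fl s <= flag_sum fl u &
   ck u <= ck s + 3 + 6 * (nx * n) + (8 + 5 * h) * (flag_sum fl u - flag_sum fl s) &
   (\<forall>k j. k < n --> j < n --> ar u fl (k * n + j) = 1 --> ar s fl (k * n + j) = 1 \<or>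
     (\<exists>r<nx. ar s (q+1) r = k & H r j & scanned q pr u r j)) &
   (\<forall>r j. r < nx --> j < n --> H r j --> ar s fl (ar s (q+1) r * n + j) = 1 \<or>
     (\<exists>r'\<le>r. ar s (q+1) r' = ar s (q+1) r & H r' j & scanned q pr u r' j))) s"
proof -
 note c = chunks_le[OF ch]
 have vm: "vm \<in> {26, 27}" "vo \<in> {26,27}" "vo \<noteq> vm" using vv by auto
 have n0: "0 < n" using n1 by simp
 have lt: "k * n + j < n * n" if "k < n" "j < n" for k j
 proof -
  have "k * n + j < (k + 1) * n" using that by simp
  also have "\<dots> <= n * n" using that by (intro mult_right_mono) auto
  finally show ?thesis .
 qed
 have inj: "(k * n + j = k' * n + j') = (k = k' & j = j')" if "j < n" "j' < n" for k j k' j'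
 proof
  assume e: "k * n + j = k' * n + j'"
  have "(k * n + j) div n = k" "(k' * n + j') div n = k'" using that by auto
  then show "k = k' & j = j'" using e by auto
 qed auto
 have mem: "ar s (q+3) (r * (n * n) + x) < n" if "r < nx" "x < ar s (q+2) r" for r x
  using ch that unfolding chunks_def by blast
 let ?s = "setv 36 (nx * n) s"
 \<comment> \<open>The pair \<open>(r, j)\<close> is visited in round \<open>r * n + j\<close>, so
   \<open>r * n + j < l\<close> selects the pairs already treated.\<close>
 define I where "I l u \<longleftrightarrow> okC s u & (\<forall>x<n*n. ar u fl x <= 1) & flag_sum fl s <= flag_sum fl u &
   ck u <= ck s + 1 + 6 * l + (8 + 5 * h) * (flag_sum fl u - flag_sum fl s) &
   (\<forall>k j. k < n --> j < n --> ar u fl (k * n + j) = 1 --> ar s fl (k * n + j) = 1 \<or>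
     (\<exists>r<nx. r * n + j < l & ar s (q+1) r = k & H r j & scanned q pr u r j)) &
   (\<forall>r j. r < nx --> j < n --> r * n + j < l --> H r j --> ar s fl (ar s (q+1) r * n + j) = 1 \<or>
     (\<exists>r'\<le>r. ar s (q+1) r' = ar s (q+1) r & H r' j & scanned q pr u r' j))" for l u
 show ?thesis
  unfolding scan_def wp_simps
 proof (intro conjI, goal_cases)
  case 1
  then show ?case using nx e by (simp add: env_def)
 next
  case 2
  have s36: "setv 36 (val (Times (Var vx) (Var 5)) s) s = ?s" using nx e by (simp add: env_def)
  show ?case unfolding s36
  proof (rule wp_For[where I = I], goal_cases)
   case 1
   have "okC s ?s" using okC_cong[OF okC_refl[OF e], of ?s] by auto
   then show ?case using fl by (auto simp: I_def flag_sum_def)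
  next
   case (2 l u)
   note f = 2(3)[unfolded frame_def]
   define r where "r = l div n"
   define j where "j = l mod n"
   have l: "l < nx * n" using 2(1) by simp
   have rj: "l = r * n + j" "j < n" "r < nx" using n0 l by (auto simp: r_def j_def less_mult_imp_div_less)
   have ar: "ar u a = ar s a" if "a \<notin> {fl, 0}" for a using f that by auto
   have vru: "vr u x = vr s x" if "x \<notin> {36,35,29,31,26,27,37,32,28}" for x using f that vm by auto
   have pmu: "pm u = pm s" using f by auto
   have I: "I l u" by (rule 2(2))
   have okU: "okC s u" using I by (simp add: I_def)
   have eu: "vr u 5 = n" "vr u 7 = n * n" using okU by (auto simp: okC_def env_def)
   let ?k = "ar s (q+1) r"
   have k: "?k < n" using c(5) rj by auto
   let ?u = "setv vo ?k (setv 31 j (setv 29 r (setv 35 l u)))"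
   have okU': "okC s ?u" using okC_cong[OF okU, of ?u] vm by auto
   have envu: "env (tck ?u)" using okC_cong[OF okU, of "tck ?u"] vm by (auto simp: okC_def)
   have arq: "ar u (q+1) = ar s (q+1)" "ar u (q+2) = ar s (q+2)" "ar u (q+3) = ar s (q+3)" using ar fl by auto
   have cv: "val c ?u = of_bool (H r j)"
    by (rule H) (use rj envu vm in \<open>auto simp: ar vru pmu env_def\<close>)
   have small: "l <= B" "r <= B" "j <= B" "?k <= B"
   proof -
    show "l <= B" using l nx by simp
    show "j <= B" "?k <= B" using rj k nleB by auto
    have "r <= l" by (simp add: r_def)
    then show "r <= B" using \<open>l <= B\<close> by simp
   qed
   have sc: "scanned q pr w r' j'" if "scanned q pr u r' j'" "okC u w" "\<And>a. a \<notin> {fl, 0} ==> ar w a = ar u a" "r' < nx" "j' < n" for r' j' w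
   proof (rule scanned_mono[OF that(1,2)])
    show "fst (pr (ar u (q + 1) r') (ar u (q + 3) (r' * (n * n) + x))) < n" if "x < ar u (q + 2) r'" for x
     using vv c(5)[OF \<open>r' < nx\<close>] mem[of r' x] that \<open>r' < nx\<close> unfolding arq by auto
   qed (use that fl in auto)
   have v1: "val (Quot (Var 35) (Var 5)) (setv 35 l u) = r" by (simp add: eu r_def)
   have v2: "val (Minus (Var 35) (Times (Var 29) (Var 5))) (setv 29 r (setv 35 l u)) = j" using rj by (simp add: eu)
   have v3: "val (Rd (q+1) (Var 29)) (setv 31 j (setv 29 r (setv 35 l u))) = ?k" using arq(1) by simp
   have v4: "val (Plus (Times (Var vo) (Var 5)) (Var 31)) ?u = ?k * n + j" "val (Plus (Times (Var vo) (Var 5)) (Var 31)) (tck ?u) = ?k * n + j"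
    using vm by (auto simp: eu)
   have v5: "val (Conj c (Equal (Rd fl (Plus (Times (Var vo) (Var 5)) (Var 31))) (Num 0))) ?u = of_bool (H r j) * of_bool (ar u fl (?k * n + j) = 0)"
    using cv v4(1) by simp
   have v8: "val (Rd (q+2) (Var 29)) (seta fl (?k * n + j) 1 (tck ?u)) = ar s (q+2) r" using arq(2) vm fl by auto
   show ?case
   proof (cases "H r j & ar u fl (?k * n + j) = 0")
    case False
    have nz: "H r j ==> ar u fl (?k * n + j) = 1" using False I lt[OF k rj(2)] unfolding I_def by (metis le_neq_implies_less less_one)
    have "I (Suc l) (tck (tck ?u))"
    proof -
     let ?w = "tck (tck ?u)"
     have okw: "okC s ?w" using okC_cong[OF okU, of ?w] vm by auto
     have okuw: "okC u ?w" using okC_cong[OF okC_refl, of u ?w] okU vm by (auto simp: okC_def)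
     have scw: "scanned q pr ?w r' j' = scanned q pr u r' j'" for r' j'
      using cc_cong[of ?w u] by (simp add: scanned_def)
     have fs: "flag_sum fl ?w = flag_sum fl u" by (simp add: flag_sum_def)
     \<comment> \<open>A hit that finds its flag set owes this to the state before the scan or to an
       earlier chunk of the same key; either alternative is what the invariant demands for the new
       pair.\<close>
     have new: "ar s fl (?k * n + j) = 1 \<or> (\<exists>r'\<le>r. ar s (q+1) r' = ?k & H r' j & scanned q pr u r' j)" if "H r j"
     proof -
      have "ar s fl (?k * n + j) = 1 \<or> (\<exists>r'<nx. r' * n + j < l & ar s (q+1) r' = ?k & H r' j & scanned q pr u r' j)"
       using I nz[OF that] k rj(2) unfolding I_def by blast
      moreover have "r' <= r" if "r' * n + j < l" for r' using that rj n0 by simp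
      ultimately show ?thesis by blast
     qed
     have old: "r' * n + j' < l \<or> (r' = r & j' = j)" if "r' * n + j' < Suc l" "j' < n" for r' j'
      using that inj[of j' j r' r] rj by (auto simp: less_Suc_eq)
     show ?thesis
      unfolding I_def fs scw
     proof (intro conjI allI impI)
      show "okC s ?w" by (rule okw)
      fix r' j' assume a: "r' < nx" "j' < n" "r' * n + j' < Suc l" "H r' j'"
      then show "ar s fl (ar s (q + 1) r' * n + j') = 1 \<or> (\<exists>r''\<le>r'. ar s (q + 1) r'' = ar s (q + 1) r' & H r'' j' & scanned q pr u r'' j')"
       using old[OF a(3,2)] I new unfolding I_def by blast
     next
      fix k' j' assume "k' < n" "j' < n" "ar ?w fl (k' * n + j') = 1"
      then have "ar s fl (k' * n + j') = 1 \<or> (\<exists>r<nx. r * n + j' < l & ar s (q + 1) r = k' & H r j' & scanned q pr u r j')"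
       using I unfolding I_def by simp
      then show "ar s fl (k' * n + j') = 1 \<or> (\<exists>r<nx. r * n + j' < Suc l & ar s (q + 1) r = k' & H r j' & scanned q pr u r j')"
       using less_SucI by blast
     next
      show "ck ?w <= ck s + 1 + 6 * Suc l + (8 + 5 * h) * (flag_sum fl u - flag_sum fl s)" using I unfolding I_def by simp
     qed (use I in \<open>auto simp: I_def\<close>)
    qed
    then show ?thesis unfolding wp_simps v1 v2 v3 v5 using False small by auto
   next
    case True
    let ?w = "setv 37 (ar s (q+2) r) (seta fl (?k * n + j) 1 (tck ?u))"
    have okw: "okC s ?w" using okC_cong[OF okU, of ?w] vm fl by auto
    then have ew: "env ?w" "sound ?w" by (auto simp: okC_def)
    have okuw: "okC u ?w" using okC_cong[OF okC_refl, of u ?w] okU vm fl by (auto simp: okC_def)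
    have q: "q+1 \<noteq> fl" "q+2 \<noteq> fl" "q+3 \<noteq> fl" using fl by auto
    have arw: "ar ?w (q+1) = ar s (q+1)" "ar ?w (q+2) = ar s (q+2)" "ar ?w (q+3) = ar s (q+3)" using arq q by auto
    have "wp B J (For 32 37 (Asg vm (Rd (q+3) (Plus (Times (Var 29) (Var 7)) (Var 32)));; relax))
     (\<lambda>s'. okC ?w s' & scanned q pr s' r j & ck s' <= ck ?w + 1 + 5 * ar ?w (q+2) r) ?w"
    proof (rule inner_scan_wp[OF ew vv])
     show "vr ?w vo = ar ?w (q+1) r" using vm arw by auto
     show "vr ?w 29 = r" "vr ?w 31 = j" using vm by auto
     show "vr ?w 37 = ar ?w (q+2) r" using arw by auto
     show "ar ?w (q+1) r < n" unfolding arw using k .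
     show "ar ?w (q+3) (r * (n * n) + x) < n" if "x < ar ?w (q+2) r" for x using mem[OF rj(3)] that unfolding arw by auto
    qed (use rj fl in auto)
    then have "wp B J (For 32 37 (Asg vm (Rd (q+3) (Plus (Times (Var 29) (Var 7)) (Var 32)));; relax)) (I (Suc l)) ?w"
    proof (rule wp_conseq)
     fix s' assume s': "okC ?w s' & scanned q pr s' r j & ck s' <= ck ?w + 1 + 5 * ar ?w (q+2) r"
      and fr: "frame (For 32 37 (Asg vm (Rd (q+3) (Plus (Times (Var 29) (Var 7)) (Var 32)));; relax)) ?w s'"
     have ars: "ar s' a = ar ?w a" if "a \<noteq> 0" for a using fr that by (auto simp: frame_def)
     have oks: "okC s s'" using okC_trans[OF okw] s' by blast
     have okus: "okC u s'" using okC_trans[OF okuw] s' by blast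
     have fls: "ar s' fl = (ar u fl)(?k * n + j := 1)" using ars[of fl] fl by simp
     have fsum: "flag_sum fl s' = flag_sum fl u + 1"
      using sum_upd_one[of "?k * n + j" "n * n" "ar s' fl" "ar u fl"] lt[OF k rj(2)] True fls by (simp add: flag_sum_def)
     have arn: "ar s' a = ar u a" if "a \<notin> {fl, 0}" for a using ars[of a] that by auto
     note sc' = sc[OF _ okus arn]
     have old: "r' * n + j' < l \<or> (r' = r & j' = j)" if "r' * n + j' < Suc l" "j' < n" for r' j'
      using that inj[of j' j r' r] rj by (auto simp: less_Suc_eq)
     show "I (Suc l) s'"
      unfolding I_def
     proof (intro conjI allI impI)
      show "okC s s'" by (rule oks)
      show "ar s' fl x <= 1" if "x < n * n" for x using I that unfolding I_def fls by auto
      show "flag_sum fl s <= flag_sum fl s'" using I fsum unfolding I_def by simp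
      have "ar ?w (q+2) r <= h" using c(6)[OF rj(3)] arw by simp
      then have "ck s' <= ck u + 8 + 5 * h" using s' by simp
      moreover have "(8 + 5 * h) * (flag_sum fl s' - flag_sum fl s) = (8 + 5 * h) * (flag_sum fl u - flag_sum fl s) + (8 + 5 * h)"
       using I unfolding I_def fsum by (simp add: Suc_diff_le)
      ultimately show "ck s' <= ck s + 1 + 6 * Suc l + (8 + 5 * h) * (flag_sum fl s' - flag_sum fl s)" using I unfolding I_def by simp
     next
      fix k' j' assume a: "k' < n" "j' < n" "ar s' fl (k' * n + j') = 1"
      show "ar s fl (k' * n + j') = 1 \<or> (\<exists>r<nx. r * n + j' < Suc l & ar s (q + 1) r = k' & H r j' & scanned q pr s' r j')"
      proof (cases "k' = ?k & j' = j")
       case True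
       then show ?thesis using rj s' \<open>H r j & _\<close> by (intro disjI2 exI[of _ r]) auto
      next
       case False
       then have "ar u fl (k' * n + j') = 1" using a inj[OF a(2) rj(2), of k' ?k] unfolding fls by auto
       then have "ar s fl (k' * n + j') = 1 \<or> (\<exists>r<nx. r * n + j' < l & ar s (q + 1) r = k' & H r j' & scanned q pr u r j')"
        using I a unfolding I_def by simp
       then show ?thesis using sc' a(2) less_SucI by blast
      qed
     next
      fix r' j' assume a: "r' < nx" "j' < n" "r' * n + j' < Suc l" "H r' j'"
      show "ar s fl (ar s (q + 1) r' * n + j') = 1 \<or> (\<exists>r''\<le>r'. ar s (q + 1) r'' = ar s (q + 1) r' & H r'' j' & scanned q pr s' r'' j')"
      proof (cases "r' = r & j' = j")
       case True
       then show ?thesis using a s' by (intro disjI2 exI[of _ r]) auto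
      next
       case False
       then have "ar s fl (ar s (q + 1) r' * n + j') = 1 \<or> (\<exists>r''\<le>r'. ar s (q + 1) r'' = ar s (q + 1) r' & H r'' j' & scanned q pr u r'' j')"
        using I a old[OF a(3,2)] unfolding I_def by blast
       then show ?thesis using sc' a(1,2) le_less_trans by blast
      qed
     qed
    qed
    moreover have "ar s (q+2) r <= B" using c(6)[OF rj(3)] hB by simp
    moreover have "1 <= B" using nB by linarith
    ultimately show ?thesis unfolding wp_simps v1 v2 v3 v5 v4 val.simps(1) v8 using True small by simp
   qed
  next
   case (3 u)
   have eq: "setv 35 (vr ?s 36) u = setv 35 (nx * n) u" by simp
   let ?w = "setv 35 (nx * n) u"
   have lt2: "r * n + j < nx * n" if "r < nx" "j < n" for r j
   proof -
    have "r * n + j < (r + 1) * n" using that by simp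
    also have "\<dots> <= nx * n" using that by (intro mult_right_mono) auto
    finally show ?thesis .
   qed
   have scw: "scanned q pr ?w r' j' = scanned q pr u r' j'" for r' j'
    using cc_cong[of ?w u] by (simp add: scanned_def)
   have fs: "flag_sum fl ?w = flag_sum fl u" by (simp add: flag_sum_def)
   have I: "I (nx * n) u" using 3(1) by simp
   have ok: "okC s ?w" using okC_cong[of s u ?w] I unfolding I_def by auto
   show ?case unfolding eq scw fs using I ok lt2 unfolding I_def by simp blast
  qed
 qed
qed

end

section \<open>Counting sort\<close>

definition geta :: com where
 "geta = Asg 26 (Quot (Var 35) (Var 5));; Asg 27 (Minus (Var 35) (Times (Var 26) (Var 5)));; Asg 28 (Rd 0 eA)"

text \<open>Counters are kept one place to the right of their value. After the prefix sums, cell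
  \<open>v\<close> of array 10 therefore counts the strictly smaller entries, which is the position
  where the first entry of value \<open>v\<close> belongs.\<close>

definition csort :: com where
 "csort = Asg 36 (Plus (Var 8) (Num 2));; For 35 36 (Sto 10 (Var 35) (Num 0));;
   For 35 7 (geta;; Sto 10 (Plus (Var 28) (Num 1)) (Plus (Rd 10 (Plus (Var 28) (Num 1))) (Num 1)));;
   Asg 36 (Plus (Var 8) (Num 1));;
   For 35 36 (Sto 10 (Plus (Var 35) (Num 1)) (Plus (Rd 10 (Plus (Var 35) (Num 1))) (Rd 10 (Var 35))));;
   For 35 7 (geta;; Sto 11 (Rd 10 (Var 28)) (Var 35);; Sto 10 (Var 28) (Plus (Rd 10 (Var 28)) (Num 1)))"

lemma mv_csort [simp]: "mv csort = {36,35,26,27,28}" "ma csort = {10,11}" "mp csort = False" "wf_com csort"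
 by (auto simp: csort_def geta_def)

lemma mv_geta [simp]: "mv geta = {26,27,28}" "ma geta = {}" "mp geta = False"
 by (auto simp: geta_def)

text \<open>The position of \<open>e\<close> in the stable order: the second summand counts the
  earlier entries of equal value, which are those already placed when \<open>e\<close> is
  reached.\<close>

definition sort_rank :: "nat => (nat => nat) => nat => nat" where
 "sort_rank N w e = card {e'. e' < N & w e' < w e} + card {e'. e' < e & w e' = w e}"

lemma sort_rank_card:
 assumes "e < N"
 shows "sort_rank N w e = card {e'. e' < N & (w e' < w e \<or> w e' = w e & e' < e)}" (is "_ = card ?R")
proof -
 have "?R = {e'. e' < N & w e' < w e} \<union> {e'. e' < e & w e' = w e}" using assms by auto
 moreover have "{e'. e' < N & w e' < w e} \<inter> {e'. e' < e & w e' = w e} = {}" by auto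
 ultimately show ?thesis unfolding sort_rank_def by (simp add: card_Un_disjoint)
qed

lemma sort_rank_less:
 assumes "w e < w e' \<or> w e = w e' & e < e'" "e < N" "e' < N"
 shows "sort_rank N w e < sort_rank N w e'"
proof -
 let ?R = "\<lambda>e. {e'. e' < N & (w e' < w e \<or> w e' = w e & e' < e)}"
 have "?R e \<subseteq> ?R e'" "e \<in> ?R e'" "e \<notin> ?R e" using assms by auto
 then have "?R e \<subset> ?R e'" by blast
 then show ?thesis unfolding sort_rank_card[OF assms(2)] sort_rank_card[OF assms(3)] by (intro psubset_card_mono) auto
qed

text \<open>The rank is injective and takes values below \<open>N\<close>, hence it permutes the
  indices; an array inverse to it lists them in sorted order.\<close>

lemma sort_rank:
 assumes "\<And>e. e < N ==> f (sort_rank N w e) = e"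
 shows "bij_betw f {..<N} {..<N}" "\<And>p p'. p <= p' ==> p' < N ==> w (f p) <= w (f p')"
proof -
 let ?R = "\<lambda>e. {e'. e' < N & (w e' < w e \<or> w e' = w e & e' < e)}"
 note r = sort_rank_card and less = sort_rank_less
 have inj: "inj_on (sort_rank N w) {..<N}"
 proof (rule inj_onI)
  fix x y assume "x \<in> {..<N}" "y \<in> {..<N}" "sort_rank N w x = sort_rank N w y"
  then show "x = y" using less[of w x y N] less[of w y x N] by (metis lessThan_iff less_irrefl linorder_neqE_nat)
 qed
 have lt: "sort_rank N w e < N" if "e < N" for e
 proof -
  have "?R e \<subset> {..<N}" using that by auto
  then have "card (?R e) < card {..<N}" by (intro psubset_card_mono) auto
  then show ?thesis using r[OF that] by simp
 qed
 have img: "sort_rank N w ` {..<N} = {..<N}"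
  using lt card_image[OF inj] by (intro card_subset_eq) auto
 have fin: "f p < N & sort_rank N w (f p) = p" if "p < N" for p
 proof -
  from that img obtain e where "e < N" "p = sort_rank N w e" by (metis imageE lessThan_iff)
  then show ?thesis using assms by auto
 qed
 show "bij_betw f {..<N} {..<N}"
  by (rule bij_betw_byWitness[where f' = "sort_rank N w"]) (use fin assms lt in auto)
 show "w (f p) <= w (f p')" if "p <= p'" "p' < N" for p p'
 proof (rule ccontr)
  assume "\<not> w (f p) <= w (f p')"
  then have "sort_rank N w (f p') < sort_rank N w (f p)" using fin[of p] fin[of p'] that by (intro less) auto
  then show False using fin[of p] fin[of p'] that by auto
 qed
qed

lemma card_less_Suc_filter: "card {e'. e' < Suc e & P e'} = card {e'. e' < e & P e'} + (if P e then 1 else 0)"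
proof -
 have "{e'. e' < Suc e & P e'} = (if P e then insert e {e'. e' < e & P e'} else {e'. e' < e & P e'})" by (auto simp: less_Suc_eq)
 then show ?thesis by simp
qed

lemma card_filter_le: "card {e'. e' < N & P e'} <= N"
 using card_mono[of "{..<N}" "{e'. e' < N & P e'}"] by auto

context half
begin

definition w :: "nat => nat" where "w e = A (e div n) (e mod n)"

lemma e_dm: "e < n * n ==> e div n < n & e mod n < n" using n1 by (simp add: less_mult_imp_div_less)

lemma w_le: "e < n * n ==> w e <= inf" using Ainf e_dm by (simp add: w_def)

lemma geta_wp:
 assumes "env s" "vr s 35 = e" "e < n * n" "Q (setv 28 (w e) (setv 27 (e mod n) (setv 26 (e div n) s)))"
 shows "wp B J geta Q s"
proof -
 have v: "vr s 5 = n" "vr s 15 = bA" "vr s 18 = s1" "vr s 19 = s2" using assms(1) by (auto simp: env_def)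
 have "e div n < n" "e mod n < n" using e_dm assms by auto
 then have a: "ar s 0 (bA + (e div n * s1 + e mod n * s2)) = w e" using assms(1) by (auto simp: env_def w_def)
 have "e div n <= B" "e mod n <= B" "w e <= B" using \<open>e div n < n\<close> \<open>e mod n < n\<close> nleB w_le[OF assms(3)] infB by linarith+
 moreover have "e - e div n * n = e mod n" by (simp add: minus_div_mult_eq_mod)
 ultimately show ?thesis using assms(2,4) a by (simp add: geta_def v)
qed

lemma csort_wp:
 assumes e: "env s"
 shows "wp B J csort (\<lambda>s'. bij_betw (ar s' 11) {..<n*n} {..<n*n} &
   (\<forall>p p'. p <= p' --> p' < n*n --> w (ar s' 11 p) <= w (ar s' 11 p')) & ck s' <= ck s + 20 + 20 * (n * n) + 10 * inf) s" (is "wp _ _ _ ?Q _")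
proof -
 let ?N = "n * n"
 have v: "vr s 8 = inf" "vr s 7 = ?N" using e by (auto simp: env_def)
 have env': "env u" if "\<And>x. x \<notin> {36,35,26,27,28} ==> vr u x = vr s x" "ar u 0 = ar s 0" for u
  using env_cong[OF e, of u] that by auto
 have small: "card {e'. e' < ?N & P e'} <= B" for P using card_filter_le[of ?N P] nleB by linarith
 define S0 where "S0 u \<longleftrightarrow> (\<forall>x. x \<notin> {36,35,26,27,28} --> vr u x = vr s x) & (\<forall>a. a \<notin> {10,11} --> ar u a = ar s a)" for u :: st
 have S0env: "S0 u ==> env u" for u using env'[of u] by (simp add: S0_def)
 define I1 where "I1 l u \<longleftrightarrow> (\<forall>v<l. ar u 10 v = 0) & ck u <= ck s + 1 + 2 * l" for l and u :: st
 define I2 where "I2 l u \<longleftrightarrow> (\<forall>v\<le>inf+1. ar u 10 v = card {e'. e' < l & w e' + 1 = v}) & ck u <= ck s + 2 + 2 * (inf + 2) + 5 * l" for l and u :: st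
 \<comment> \<open>Cells up to \<open>l\<close> already hold prefix sums, later ones still the plain
   counts.\<close>
 define I3 where "I3 l u \<longleftrightarrow> (\<forall>v\<le>inf+1. ar u 10 v = (if v <= l then card {e'. e' < ?N & w e' < v} else card {e'. e' < ?N & w e' + 1 = v})) &
   ck u <= ck s + 4 + 2 * (inf + 2) + 5 * ?N + 2 * l" for l and u :: st
 define I4 where "I4 l u \<longleftrightarrow> (\<forall>v\<le>inf+1. ar u 10 v = card {e'. e' < ?N & w e' < v} + card {e'. e' < l & w e' = v}) &
   (\<forall>e<l. ar u 11 (sort_rank ?N w e) = e) & ck u <= ck s + 6 + 2 * (inf + 2) + 5 * ?N + 2 * (inf + 1) + 6 * l" for l and u :: st
 have L4: "wp B J (For 35 7 (geta;; Sto 11 (Rd 10 (Var 28)) (Var 35);; Sto 10 (Var 28) (Plus (Rd 10 (Var 28)) (Num 1))))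
   (\<lambda>s'. bij_betw (ar s' 11) {..<n*n} {..<n*n} &
   (\<forall>p p'. p <= p' --> p' < n*n --> w (ar s' 11 p) <= w (ar s' 11 p')) & ck s' <= ck s + 20 + 20 * (n * n) + 10 * inf) u0"
  if u0: "S0 u0" "I4 0 u0" for u0
 proof (rule wp_For[where I = I4], goal_cases)
  case 1 show ?case by (rule u0)
 next
  case (2 l u)
  have l: "l < ?N" using 2(1) u0(1) v by (simp add: S0_def)
  have S: "S0 (setv 35 l u)" using 2(3) u0(1) by (auto simp: frame_def S0_def)
  have wl: "w l <= inf" using w_le[OF l] .
  have c: "ar u 10 (w l) = card {e'. e' < ?N & w e' < w l} + card {e'. e' < l & w e' = w l}"
   using 2(2) wl by (simp add: I4_def)
  then have rk: "ar u 10 (w l) = sort_rank ?N w l" by (simp add: sort_rank_def)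
  have cb: "Suc (sort_rank ?N w l) <= B"
  proof -
   have "sort_rank ?N w l <= ?N + ?N" unfolding sort_rank_def
    using card_filter_le[of ?N "\<lambda>e'. w e' < w l"] card_filter_le[of l "\<lambda>e'. w e' = w l"] l by linarith
   then show ?thesis using nB by linarith
  qed
  show ?case unfolding wp_simps(5)
  proof (rule geta_wp[OF S0env[OF S] _ l], goal_cases)
   case 2
   have ne: "sort_rank ?N w e \<noteq> sort_rank ?N w l" if "e < l" for e
    using sort_rank_less[of w e l ?N] sort_rank_less[of w l e ?N] that l by (metis less_irrefl less_trans linorder_neqE_nat)
   let ?z = "seta 10 (w l) (Suc (ar u 10 (w l))) (seta 11 (ar u 10 (w l)) l (setv 28 (w l) (setv 27 (l mod n) (setv 26 (l div n) (setv 35 l u)))))"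
   have "I4 (Suc l) ?z"
    unfolding I4_def
   proof (intro conjI allI impI)
    fix v assume "v <= inf + 1"
    then have "ar u 10 v = card {e'. e' < ?N & w e' < v} + card {e'. e' < l & w e' = v}" using \<open>I4 l u\<close> by (simp add: I4_def)
    then show "ar ?z 10 v = card {e'. e' < ?N & w e' < v} + card {e'. e' < Suc l & w e' = v}"
     unfolding card_less_Suc_filter by auto
   next
    fix e assume "e < Suc l"
    then show "ar ?z 11 (sort_rank ?N w e) = e" using \<open>I4 l u\<close> ne[of e] rk by (cases "e = l") (auto simp: I4_def)
   next
    show "ck ?z <= ck s + 6 + 2 * (inf + 2) + 5 * ?N + 2 * (inf + 1) + 6 * Suc l" using \<open>I4 l u\<close> by (simp add: I4_def)
   qed
   moreover have "Suc (ar u 10 (w l)) <= B" "l <= B" using cb rk l nleB by auto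
   ultimately show ?case by simp
  qed simp
 next
  case (3 u)
  have "I4 ?N u" using 3(1) u0(1) v by (simp add: S0_def)
  then show ?case using sort_rank[of ?N "ar u 11" w] by (auto simp: I4_def)
 qed
 have L3: "wp B J (For 35 36 (Sto 10 (Plus (Var 35) (Num 1)) (Plus (Rd 10 (Plus (Var 35) (Num 1))) (Rd 10 (Var 35))))) (\<lambda>u. S0 u & I4 0 u) u0"
  if u0: "S0 u0" "I3 0 u0" "vr u0 36 = inf + 1" for u0
 proof (rule wp_For[where I = I3], goal_cases)
  case 1 show ?case by (rule u0)
 next
  case (2 l u)
  have l: "l <= inf" using 2(1) u0 by simp
  have "{e'. e' < ?N & w e' < Suc l} = {e'. e' < ?N & w e' < l} \<union> {e'. e' < ?N & w e' + 1 = Suc l}" by auto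
  moreover have "{e'. e' < ?N & w e' < l} \<inter> {e'. e' < ?N & w e' + 1 = Suc l} = {}" by auto
  ultimately have c: "card {e'. e' < ?N & w e' < Suc l} = card {e'. e' < ?N & w e' < l} + card {e'. e' < ?N & w e' + 1 = Suc l}"
   by (simp add: card_Un_disjoint)
  have u: "ar u 10 (Suc l) = card {e'. e' < ?N & w e' + 1 = Suc l}" "ar u 10 l = card {e'. e' < ?N & w e' < l}"
   using 2(2) l by (auto simp: I3_def)
  have "ar u 10 (Suc l) + ar u 10 l <= B" using small[of "\<lambda>e'. w e' < Suc l"] unfolding c u by linarith
  moreover have "ar u 10 (Suc l) + ar u 10 l = card {e'. e' < ?N & w e' < Suc l}" unfolding c u by simp
  ultimately show ?case using 2(2) l by (auto simp: I3_def)
 next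
  case (3 u)
  have "I3 (inf + 1) u" using 3(1) u0 by simp
  moreover have "S0 (setv 35 (vr u0 36) u)" using 3(2) u0(1) by (auto simp: frame_def S0_def)
  ultimately show ?case by (auto simp: I3_def I4_def)
 qed
 \<comment> \<open>The clock is set back by one because leaving the loop costs one step that the
   invariant does not count.\<close>
 have L2: "wp B J (For 35 7 (geta;; Sto 10 (Plus (Var 28) (Num 1)) (Plus (Rd 10 (Plus (Var 28) (Num 1))) (Num 1)))) (\<lambda>u. S0 u & I2 ?N (u\<lparr>ck := ck u - 1\<rparr>) & 1 <= ck u) u0"
  if u0: "S0 u0" "I2 0 u0" for u0
 proof (rule wp_For[where I = I2], goal_cases)
  case 1 show ?case by (rule u0)
 next
  case (2 l u)
  have l: "l < ?N" using 2(1) u0(1) v by (simp add: S0_def)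
  have S: "S0 (setv 35 l u)" using 2(3) u0(1) by (auto simp: frame_def S0_def)
  have wl: "w l <= inf" using w_le[OF l] .
  have c: "ar u 10 (Suc (w l)) = card {e'. e' < l & w e' + 1 = w l + 1}" using 2(2) wl by (simp add: I2_def)
  have "ar u 10 (Suc (w l)) <= l" unfolding c by (rule card_filter_le)
  then have cb: "Suc (ar u 10 (Suc (w l))) <= B" using l nleB by linarith
  show ?case unfolding wp_simps(5)
  proof (rule geta_wp[OF S0env[OF S] _ l], goal_cases)
   case 2
   then show ?case using \<open>I2 l u\<close> cb c unfolding I2_def by (auto simp: card_less_Suc_filter)
  qed simp
 next
  case (3 u)
  have "I2 ?N u" using 3(1) u0(1) v by (simp add: S0_def)
  moreover have "S0 (setv 35 (vr u0 7) u)" using 3(2) u0(1) by (auto simp: frame_def S0_def)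
  ultimately show ?case by (auto simp: I2_def)
 qed
 have L1: "wp B J (For 35 36 (Sto 10 (Var 35) (Num 0))) (\<lambda>u. S0 u & I2 0 u) u0"
  if u0: "S0 u0" "I1 0 u0" "vr u0 36 = inf + 2" for u0
 proof (rule wp_For[where I = I1], goal_cases)
  case 1 show ?case by (rule u0)
 next
  case (2 l u)
  then show ?case by (auto simp: I1_def less_Suc_eq)
 next
  case (3 u)
  have "I1 (inf + 2) u" using 3(1) u0 by simp
  moreover have "S0 (setv 35 (vr u0 36) u)" using 3(2) u0(1) by (auto simp: frame_def S0_def)
  ultimately show ?case by (auto simp: I1_def I2_def)
 qed
 have S: "S0 (setv 36 (inf + 2) s)" "I1 0 (setv 36 (inf + 2) s)" by (auto simp: S0_def I1_def)
 show ?thesis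
  unfolding csort_def
 proof (subst wp_simps(5), subst wp_simps(1), intro conjI)
  show "val (Plus (Var 8) (Num 2)) s <= B" using v infB by simp
  have e1: "val (Plus (Var 8) (Num 2)) s = inf + 2" using v by simp
  show "wp B J (For 35 36 (Sto 10 (Var 35) (Num 0));;
   For 35 7 (geta;; Sto 10 (Plus (Var 28) (Num 1)) (Plus (Rd 10 (Plus (Var 28) (Num 1))) (Num 1)));;
   Asg 36 (Plus (Var 8) (Num 1));;
   For 35 36 (Sto 10 (Plus (Var 35) (Num 1)) (Plus (Rd 10 (Plus (Var 35) (Num 1))) (Rd 10 (Var 35))));;
   For 35 7 (geta;; Sto 11 (Rd 10 (Var 28)) (Var 35);; Sto 10 (Var 28) (Plus (Rd 10 (Var 28)) (Num 1)))) ?Q (setv 36 (val (Plus (Var 8) (Num 2)) s) s)"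
   unfolding e1 wp_simps(5)
  proof (rule wp_conseq[OF L1[OF S]], simp, rule wp_conseq[OF L2], blast, blast, goal_cases)
   case (1 u1 u2)
   have u2: "vr u2 8 = inf" using 1(3) v by (auto simp: S0_def)
   have "S0 (setv 36 (inf + 1) u2)" using 1(3) by (auto simp: S0_def)
   moreover have "{e'. e' < ?N & w e' < 0} = {}" "{e'. e' < ?N & w e' + 1 = 0} = {}" by auto
   then have "I3 0 (setv 36 (inf + 1) u2)" using 1(3) by (auto simp: I2_def I3_def)
   ultimately have "wp B J (For 35 36 (Sto 10 (Plus (Var 35) (Num 1)) (Plus (Rd 10 (Plus (Var 35) (Num 1))) (Rd 10 (Var 35))))) (\<lambda>u. S0 u & I4 0 u) (setv 36 (inf + 1) u2)"
    by (rule L3) simp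
   then have "wp B J (For 35 36 (Sto 10 (Plus (Var 35) (Num 1)) (Plus (Rd 10 (Plus (Var 35) (Num 1))) (Rd 10 (Var 35)))))
    (wp B J (For 35 7 (geta;; Sto 11 (Rd 10 (Var 28)) (Var 35);; Sto 10 (Var 28) (Plus (Rd 10 (Var 28)) (Num 1))))
     (\<lambda>s'. bij_betw (ar s' 11) {..<n*n} {..<n*n} &
      (\<forall>p p'. p <= p' --> p' < n*n --> w (ar s' 11 p) <= w (ar s' 11 p')) & ck s' <= ck s + 20 + 20 * (n * n) + 10 * inf)) (setv 36 (inf + 1) u2)"
    by (rule wp_conseq) (use L4 in blast)
   then show ?case using u2 infB by simp
  qed
 qed
qed

end

section \<open>Half of the (min,max)-product\<close>

lemma mult_input_mem:
 assumes "mult_ready s"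
 shows "mem (mult_input s) = (\<lambda>x. pm s (vr s 4 + x))"
proof -
 have "\<forall>x\<ge>2 * (vr s 2)\<^sup>2. pm s (vr s 4 + x) = 0" "1 <= vr s 2" using assms by (auto simp: mult_ready_def)
 from matmul_input_mem[of "vr s 2" "\<lambda>x. pm s (vr s 4 + x)", OF this] show ?thesis
  by (simp add: mult_input_def add.assoc)
qed

lemma mult_input_small:
 assumes "mult_ready s" "1 <= d"
 shows "small ((int (vr s 2) + 2) ^ d) (mult_input s)"
proof -
 let ?V = "(int (vr s 2) + 2) ^ d"
 have "(int (vr s 2) + 2) ^ 1 <= ?V" using assms(2) by (intro power_increasing) auto
 then have V2: "int (vr s 2) < ?V" "2 <= ?V" by auto
 have ri: "reg (mult_input s) = (\<lambda>_. 0)(0 := int (vr s 2))" by (simp add: mult_input_def matmul_input_def)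
 have "pm s (vr s 4 + x) \<in> {0, 1}" for x using assms(1) by (cases "x < 2 * (vr s 2)\<^sup>2") (auto simp: mult_ready_def)
 then have "\<bar>pm s (vr s 4 + x)\<bar> <= 1" for x by (metis abs_0 abs_1 insertE order_refl singletonD zero_le_one)
 then have "\<bar>pm s (vr s 4 + x)\<bar> < ?V" for x using V2 by (meson le_less_trans less_le_trans one_less_numeral_iff semiring_norm(76))
 then show ?thesis unfolding small_def mult_input_mem[OF assms(1)] using V2 by (auto simp: ri)
qed

lemma sum_of_bool_pos: "(\<Sum>l<N. of_bool (X l) * of_bool (Y l) :: int) > 0 \<longleftrightarrow> (\<exists>l<N. X l & Y l)" for N :: nat
proof
 assume "(\<Sum>l<N. of_bool (X l) * of_bool (Y l) :: int) > 0"
 then have "\<exists>l\<in>{..<N}. of_bool (X l) * of_bool (Y l) \<noteq> (0::int)" by (metis (no_types, lifting) less_irrefl sum.neutral)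
 then show "\<exists>l<N. X l & Y l" by auto
next
 assume "\<exists>l<N. X l & Y l"
 then obtain l where l: "l < N" "X l" "Y l" by auto
 have "(of_bool (X l) * of_bool (Y l) :: int) <= (\<Sum>l<N. of_bool (X l) * of_bool (Y l))"
  using l by (intro member_le_sum) auto
 then show "(\<Sum>l<N. of_bool (X l) * of_bool (Y l) :: int) > 0" using l by simp
qed

locale halfm = half +
 fixes P :: ram_com and d TM Sd :: nat
 assumes mm: "\<And>A' B'. (\<forall>i<2*n. \<forall>j<2*n. \<bar>A' i j\<bar> <= 1 & \<bar>B' i j\<bar> <= 1) ==>
   \<exists>t f. exec ((int (2*n) + 2) ^ d) P (matmul_input (2*n) A' B') t f & t <= TM &
    (\<forall>i<2*n. \<forall>j<2*n. mem f (2 * (2*n)\<^sup>2 + i * (2*n) + j) = (\<Sum>l<2*n. A' i l * B' l j))"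
  and d1: "1 <= d" and Sd: "Sd = 2 * (2*n)\<^sup>2 + (2*n + 2) ^ d" and SdB: "Sd <= B" and TMB: "TM <= B"
begin

text \<open>Bits are multiplied over the integers, where positivity of an entry is the Boolean
  product. The zeros behind the window are what the next product starts from.\<close>

lemma mult_wp:
 assumes v: "vr s 2 = 2 * n" "vr s 4 = po"
  and X: "\<forall>i<2*n. \<forall>j<2*n. pm s (po + i * (2*n) + j) = of_bool (X i j)"
  and Y: "\<forall>i<2*n. \<forall>j<2*n. pm s (po + (2*n)\<^sup>2 + i * (2*n) + j) = of_bool (Y i j)"
  and Z: "\<forall>x\<ge>2 * (2*n)\<^sup>2. pm s (po + x) = 0"
 shows "wp B J (Mult P d) (\<lambda>u. \<exists>t\<le>TM. vr u = (vr s)(3 := t) & ar u = ar s & ck u = Suc (ck s + t) &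
   (\<forall>i<2*n. \<forall>j<2*n. pm u (po + 2 * (2*n)\<^sup>2 + i * (2*n) + j) > 0 \<longleftrightarrow> (\<exists>l<2*n. X i l & Y l j)) & (\<forall>x\<ge>po + Sd. pm u x = 0)) s"
proof -
 let ?N = "2 * n"
 have bits: "pm s (po + x) \<in> {0, 1}" if "x < 2 * ?N\<^sup>2" for x
 proof (cases "x < ?N\<^sup>2")
  case True
  then have "x div ?N < ?N" "x mod ?N < ?N" using n1 by (auto simp: power2_eq_square less_mult_imp_div_less)
  then have "pm s (po + x div ?N * ?N + x mod ?N) \<in> {0, 1}" using X by auto
  then show ?thesis by (simp only: add.assoc div_mult_mod_eq)
 next
  case False
  let ?x = "x - ?N\<^sup>2"
  have "?x < ?N * ?N" using False that by (simp add: power2_eq_square)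
  then have "?x div ?N < ?N" "?x mod ?N < ?N" using n1 by (auto simp: less_mult_imp_div_less)
  then have "pm s (po + ?N\<^sup>2 + ?x div ?N * ?N + ?x mod ?N) \<in> {0, 1}" using Y by auto
  moreover have "po + ?N\<^sup>2 + ?x div ?N * ?N + ?x mod ?N = po + x" using False by (simp only: add.assoc div_mult_mod_eq)
  ultimately show ?thesis by (simp only:)
 qed
 have rdy: "mult_ready s" using bits Z n1 v unfolding mult_ready_def by auto
 have mi: "mult_input s = matmul_input ?N (\<lambda>i j. pm s (po + i * ?N + j)) (\<lambda>i j. pm s (po + ?N\<^sup>2 + i * ?N + j))"
  by (simp add: mult_input_def v)
 have "\<exists>t f. exec ((int ?N + 2) ^ d) P (mult_input s) t f & t <= TM &
    (\<forall>i<?N. \<forall>j<?N. mem f (2 * ?N\<^sup>2 + i * ?N + j) = (\<Sum>l<?N. pm s (po + i * ?N + l) * pm s (po + ?N\<^sup>2 + l * ?N + j)))"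
  unfolding mi by (rule mm) (use X Y in auto)
 then obtain t f where f: "exec ((int ?N + 2) ^ d) P (mult_input s) t f" "t <= TM"
   "\<And>i j. i < ?N ==> j < ?N ==> mem f (2 * ?N\<^sup>2 + i * ?N + j) = (\<Sum>l<?N. pm s (po + i * ?N + l) * pm s (po + ?N\<^sup>2 + l * ?N + j))" by blast
 let ?u = "s\<lparr>vr := (vr s)(3 := t), pm := (\<lambda>x. if x < po then pm s x else mem f (x - po)), ck := Suc (ck s + t)\<rparr>"
 have "(?N + 2) ^ d <= B" using Sd SdB by simp
 then have "run B J (Mult P d) s ?u" using rdy d1 f TMB v by (auto intro!: exI[of _ t] exI[of _ f])
 moreover have "pm ?u (po + 2 * ?N\<^sup>2 + i * ?N + j) > 0 \<longleftrightarrow> (\<exists>l<?N. X i l & Y l j)" if "i < ?N" "j < ?N" for i j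
 proof -
  have "pm ?u (po + 2 * ?N\<^sup>2 + i * ?N + j) = (\<Sum>l<?N. pm s (po + i * ?N + l) * pm s (po + ?N\<^sup>2 + l * ?N + j))"
   using f(3)[OF that] by (simp add: add.assoc)
  also have "\<dots> = (\<Sum>l<?N. of_bool (X i l) * of_bool (Y l j))" using X Y that by (intro sum.cong) auto
  finally show ?thesis using sum_of_bool_pos by simp
 qed
 moreover have "pm ?u x = 0" if "po + Sd <= x" for x
 proof -
  have x: "po <= x" "2 * ?N\<^sup>2 <= x - po" "(?N + 2) ^ d <= x - po" using that Sd by auto
  then have "int ((?N + 2) ^ d) <= int (x - po)" by (simp only: of_nat_le_iff)
  then have V: "(int ?N + 2) ^ d <= int (x - po)" by (simp add: add.commute)
  have "mem f (x - po) = mem (mult_input s) (x - po)"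
   using exec_small[OF f(1)] mult_input_small[OF rdy d1] V v by auto
  also have "\<dots> = pm s (po + (x - po))" using mult_input_mem[OF rdy] v by simp
  also have "\<dots> = 0" using Z x by blast
  finally show ?thesis using x by simp
 qed
 ultimately show ?thesis using f(2) unfolding wp_def by (intro exI[of _ ?u]) auto
qed

end

section \<open>Closing a batch\<close>

definition fillY :: com where
 "fillY = Asg 36 (Times (Var 23) (Var 5));; For 35 36 (Asg 30 (Quot (Var 35) (Var 5));; Asg 31 (Minus (Var 35) (Times (Var 30) (Var 5)));;
   Asg 27 (Rd 31 (Var 30));;
   Cond (Leq (Rd 0 eB) (Rd 34 (Var 30))) (PSet (Plus (Var 4) (Plus (Times (Var 2) (Var 2)) (Plus (Times (Var 30) (Var 2)) (Var 31))))) Nop)"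

definition condF :: expr where
 "condF = Pos (Plus (Var 4) (Plus (Times (Num 2) (Times (Var 2) (Var 2))) (Plus (Times (Var 29) (Var 2)) (Var 31))))"

text \<open>The pairs that the threshold of \<open>fillY\<close> cannot decide: the entry of the
  second factor lies above the least but not above the greatest value of the column chunk.\<close>

definition condG :: expr where
 "condG = Conj (Less (Rd 34 (Var 29)) (Rd 0 eB)) (Leq (Rd 0 eB) (Rd 35 (Var 29)))"

text \<open>Old members of chunks stay in memory, hidden by size 0; restoring one empty open chunk
  per key takes only linear time.\<close>

definition resetc :: "nat => com" where
 "resetc q = For 35 5 (Sto q (Var 35) (Var 35);; Sto (q+1) (Var 35) (Var 35);; Sto (q+2) (Var 35) (Num 0);;
   Sto (q+4) (Var 35) (Num 0);; Sto (q+5) (Var 35) (Num 0))"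

definition reset :: com where
 "reset = Asg 22 (Var 5);; Asg 23 (Var 5);; Asg 21 (Num 0);; resetc 20;; resetc 30"

definition flush :: "ram_com => nat => com" where
 "flush P d = fillY;; Mult P d;; scan 20 22 26 27 12 condF;; scan 30 23 27 26 13 condG;; Asg 4 (Plus (Var 4) (Var 9));;
   Cond (Less (Times (Var 5) (Times (Var 20) (Var 20))) (Var 3)) (Asg 20 (Times (Num 2) (Var 20))) Nop;; reset"

lemma mv_flush [simp]:
 "mv fillY = {36,35,30,31,27}" "ma fillY = {}" "mp fillY"
 "mv (resetc q) = {35}" "ma (resetc q) = {q,q+1,q+2,q+4,q+5}" "mp (resetc q) = False"
 "mv reset = {22,23,21,35}" "ma reset = {20,21,22,24,25,30,31,32,34,35}" "mp reset = False"
 "mv (flush P d) = {36,35,30,31,27,3,29,26,37,32,28,4,20,22,23,21}" "ma (flush P d) = {0,12,13,20,21,22,24,25,30,31,32,34,35}"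
 by (auto simp: fillY_def resetc_def reset_def flush_def)

lemma wf_flush [simp]: "wf_com (flush P d)"
 by (auto simp: fillY_def resetc_def reset_def flush_def scan_def condF_def condG_def)

lemma chunks_cong:
 assumes "\<And>a. a \<in> {q..q+5} ==> ar u a = ar s a"
 shows "chunks u q n nn nx h w lb ub cnt = chunks s q n nn nx h w lb ub cnt"
 unfolding chunks_def by (simp add: assms)

lemma resetc_wp:
 assumes "vr s 5 = n" "n <= B"
 shows "wp B J (resetc q) (\<lambda>u. chunks u q n nn n h w lb ub 0 & ck u <= ck s + 1 + 6 * n) s"
proof (unfold resetc_def, rule wp_For[where I = "\<lambda>l u. ck u <= ck s + 6 * l &
  (\<forall>k<l. ar u q k = k & ar u (q+1) k = k & ar u (q+2) k = 0 & ar u (q+4) k = 0 & ar u (q+5) k = 0)"], goal_cases)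
 case (2 l u)
 then show ?case using assms by (auto simp: less_Suc_eq)
next
 case (3 u)
 then have "chunks u q n nn n h w lb ub 0" using assms unfolding chunks_def by auto
 then have "chunks (setv 35 (vr s 5) u) q n nn n h w lb ub 0" using chunks_cong[of q "setv 35 (vr s 5) u" u] by simp
 then show ?case using 3 assms by simp
qed simp

lemma reset_wp:
 assumes "vr s 5 = n" "n <= B"
 shows "wp B J reset (\<lambda>u. chunks u 20 n nn n h w lb ub 0 & chunks u 30 n nn n h w' lb ub 0 & vr u 22 = n & vr u 23 = n & vr u 21 = 0 &
  ck u <= ck s + 5 + 12 * n) s"
proof -
 let ?s = "setv 21 0 (setv 23 n (setv 22 n s))"
 have "wp B J (resetc 20) (wp B J (resetc 30) (\<lambda>u. chunks u 20 n nn n h w lb ub 0 & chunks u 30 n nn n h w' lb ub 0 & vr u 22 = n & vr u 23 = n & vr u 21 = 0 &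
  ck u <= ck s + 5 + 12 * n)) ?s"
 proof (rule wp_conseq[OF resetc_wp[of ?s n B J 20 nn h w lb ub]], goal_cases)
  case (3 u)
  then have u: "vr u 5 = n" using assms by (auto simp: frame_def)
  show ?case
  proof (rule wp_conseq[OF resetc_wp[OF u assms(2), of J 30 nn h w' lb ub]], goal_cases)
   case (1 z)
   have "chunks z 20 n nn n h w lb ub 0" using chunks_cong[of 20 z u] 3 1 by (auto simp: frame_def)
   then show ?case using 1 3 by (auto simp: frame_def)
  qed
 qed (use assms in auto)
 then show ?thesis using assms by (simp add: reset_def)
qed

context halfm
begin

text \<open>The least value of a column chunk serves as threshold for its row of the second Boolean
  matrix: an entry of the second factor up to this value admits every member of the chunk as a
  candidate.\<close>

lemma fillY_wp:
 assumes e: "env s" and v: "vr s 23 = nc" "vr s 2 = 2 * n" "vr s 4 = po" and nc: "nc <= 2 * n"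
  and own: "\<forall>c<nc. ar s 31 c < n"
 shows "wp B J fillY (\<lambda>u. ck u <= ck s + 2 + 6 * (nc * n) &
   pm u = (\<lambda>x. if \<exists>c<nc. \<exists>j<n. x = po + ((2*n)\<^sup>2 + (c * (2*n) + j)) & Bm (ar s 31 c) j <= ar s 34 c then 1 else pm s x)) s"
proof -
 have v5: "vr s 5 = n" using e by (simp add: env_def)
 have n0: "0 < n" using n1 by simp
 have ncB: "nc * n <= B"
 proof -
  have "nc * n <= 2 * n * n" using nc by (rule mult_right_mono) simp
  then show ?thesis using nB by linarith
 qed
 define PP where "PP l = (\<lambda>x. if \<exists>l'<l. x = po + ((2*n)\<^sup>2 + (l' div n * (2*n) + l' mod n)) & Bm (ar s 31 (l' div n)) (l' mod n) <= ar s 34 (l' div n) then 1 else pm s x)" for l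
 have "wp B J (For 35 36 (Asg 30 (Quot (Var 35) (Var 5));; Asg 31 (Minus (Var 35) (Times (Var 30) (Var 5)));;
   Asg 27 (Rd 31 (Var 30));;
   Cond (Leq (Rd 0 eB) (Rd 34 (Var 30))) (PSet (Plus (Var 4) (Plus (Times (Var 2) (Var 2)) (Plus (Times (Var 30) (Var 2)) (Var 31))))) Nop))
   (\<lambda>u. ck u <= ck s + 2 + 6 * (nc * n) & pm u = PP (nc * n)) (setv 36 (nc * n) s)"
 proof (rule wp_For[where I = "\<lambda>l u. ck u <= ck s + 1 + 6 * l & pm u = PP l"], goal_cases)
  case 1 then show ?case by (auto simp: PP_def)
 next
  case (2 l u)
  have l: "l < nc * n" using 2(1) by simp
  let ?c = "l div n" and ?j = "l mod n"
  have cj: "?c < nc" "?j < n" using l n0 by (auto simp: less_mult_imp_div_less)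
  let ?k = "ar s 31 ?c"
  have k: "?k < n" using own cj by auto
  have u: "ar u = ar s" "vr u 5 = n" "vr u 2 = 2 * n" "vr u 4 = po" "vr u 16 = bB" "vr u 18 = s1" "vr u 19 = s2"
   using 2(3) v v5 e by (auto simp: frame_def env_def)
  have b: "ar s 0 (bB + (?k * s1 + ?j * s2)) = Bm ?k ?j" using e k cj by (auto simp: env_def)
  have B: "?c <= B" "?j <= B" "?k <= B" using cj k nleB ncB l div_le_dividend[of l n] by linarith+
  have j: "l - ?c * n = ?j" by (simp add: minus_div_mult_eq_mod)
  have upd: "PP (Suc l) = (if Bm ?k ?j <= ar s 34 ?c then (PP l)(po + ((2*n)\<^sup>2 + (?c * (2*n) + ?j)) := 1) else PP l)"
   by (auto simp: PP_def fun_eq_iff less_Suc_eq)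
  show ?case using 2(2) B
   by (auto simp: u j b upd power2_eq_square)
 next
  case (3 u)
  then show ?case by simp
 qed
 moreover have "PP (nc * n) = (\<lambda>x. if \<exists>c<nc. \<exists>j<n. x = po + ((2*n)\<^sup>2 + (c * (2*n) + j)) & Bm (ar s 31 c) j <= ar s 34 c then 1 else pm s x)"
 proof -
  have "(\<exists>l'<nc*n. R (l' div n) (l' mod n)) \<longleftrightarrow> (\<exists>c<nc. \<exists>j<n. R c j)" for R
  proof
   assume "\<exists>l'<nc*n. R (l' div n) (l' mod n)"
   then show "\<exists>c<nc. \<exists>j<n. R c j" using n0 by (metis less_mult_imp_div_less mod_less_divisor)
  next
   assume "\<exists>c<nc. \<exists>j<n. R c j"
   then obtain c j where cj: "c < nc" "j < n" "R c j" by auto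
   have "c * n + j < (c + 1) * n" using cj by simp
   also have "\<dots> <= nc * n" using cj by (intro mult_right_mono) auto
   finally have "c * n + j < nc * n" .
   moreover have "(c * n + j) div n = c" "(c * n + j) mod n = j" using cj by auto
   ultimately show "\<exists>l'<nc*n. R (l' div n) (l' mod n)" using cj by metis
  qed
  note * = this[of "\<lambda>c j. _ = po + ((2*n)\<^sup>2 + (c * (2*n) + j)) & Bm (ar s 31 c) j <= ar s 34 c"]
  show ?thesis unfolding PP_def * ..
 qed
 ultimately show ?thesis using ncB v v5 by (simp add: fillY_def)
qed

text \<open>\<open>X\<close> is the first Boolean matrix, a set of pairs of a row chunk and a column
  chunk that share an entry. \<open>lb\<close> separates the values of earlier batches from those of
  the present one, whose greatest value is bounded by \<open>ub\<close>. The last two conditions are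
  the reason why flags may persist between batches: a flagged entry of the result is already at most
  every value of the batch, and a flagged entry of the second factor is at most every threshold of
  its nonempty column chunks.\<close>

definition part :: "st => nat => nat => nat => nat => nat => nat => (nat \<times> nat) set => bool" where
 "part s nr nc h lb ub cnt X \<longleftrightarrow> env s & sound s & vr s 22 = nr & vr s 23 = nc & vr s 20 = h & vr s 21 = cnt & vr s 2 = 2 * n & vr s 9 = Sd &
   chunks s 20 n (n*n) nr h A lb ub cnt & chunks s 30 n (n*n) nc h (\<lambda>k i. A i k) lb ub cnt &
   (\<forall>r c. (r, c) \<in> X --> r < nr & c < nc & (\<exists>x<ar s 22 r. ar s 23 (r * (n * n) + x) = ar s 31 c) &
    (\<exists>x<ar s 32 c. ar s 33 (c * (n * n) + x) = ar s 21 r)) &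
   (\<forall>x\<ge>vr s 4. pm s x = of_bool (\<exists>r c. (r, c) \<in> X & x = vr s 4 + (r * (2 * n) + c))) &
   cnt <= n * h & 0 < h & (\<forall>x<n*n. ar s 12 x <= 1 & ar s 13 x <= 1) & lb <= ub &
   (\<forall>i<n. \<forall>j<n. ar s 12 (i * n + j) = 1 --> cc s i j <= lb) & (\<forall>k<n. \<forall>j<n. ar s 13 (k * n + j) = 1 --> Bm k j <= lb)"

text \<open>Let \<open>(i, k)\<close> belong to the batch and \<open>B k j <= A i k\<close>. If
  \<open>B k j\<close> is at most the least value of its column chunk, the product reports a hit for
  its row chunk, and the flag, an earlier hit chunk of the row or the scan itself guarantees a
  result of at most \<open>A i k\<close>. Otherwise the column chunk is hit directly; sortedness
  excludes an old flag and an earlier hit for \<open>(k, j)\<close>, so this very chunk is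
  scanned.\<close>

lemma flush_wp:
 assumes p: "part s nr nc h lb ub cnt X" and hB: "2 * h <= B" "vr s 4 + Sd <= B"
 shows "wp B J (flush P d) (\<lambda>u. \<exists>h' t. t <= TM & h' = (if n * (h * h) < t then 2 * h else h) & part u n n h' ub ub 0 {} &
   vr u 4 = vr s 4 + Sd & okC s u &
   (\<forall>r c j. (r, c) \<in> X --> j < n --> Bm (ar s 31 c) j <= A (ar s 21 r) (ar s 31 c) --> cc u (ar s 21 r) j <= A (ar s 21 r) (ar s 31 c)) &
   flag_sum 12 s <= flag_sum 12 u & flag_sum 13 s <= flag_sum 13 u &
   ck u <= ck s + t + 100 * (n * n) + (8 + 5 * h) * ((flag_sum 12 u - flag_sum 12 s) + (flag_sum 13 u - flag_sum 13 s))) s" (is "wp B J _ ?Q s")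
proof -
 let ?N = "2 * n" and ?po = "vr s 4"
 have e: "env s" "sound s" and v: "vr s 22 = nr" "vr s 23 = nc" "vr s 20 = h" "vr s 21 = cnt" "vr s 2 = ?N" "vr s 9 = Sd"
  and cr: "chunks s 20 n (n*n) nr h A lb ub cnt" and cc': "chunks s 30 n (n*n) nc h (\<lambda>k i. A i k) lb ub cnt"
  and h: "cnt <= n * h" "0 < h" "lb <= ub"
  and X: "\<And>r c. (r, c) \<in> X ==> r < nr & c < nc & (\<exists>x<ar s 22 r. ar s 23 (r * (n * n) + x) = ar s 31 c) &
    (\<exists>x<ar s 32 c. ar s 33 (c * (n * n) + x) = ar s 21 r)"
  and fl: "\<forall>x<n*n. ar s 12 x <= 1" "\<forall>x<n*n. ar s 13 x <= 1"
  and F1: "\<And>i j. i < n ==> j < n ==> ar s 12 (i * n + j) = 1 ==> cc s i j <= lb"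
  and F2: "\<And>k j. k < n ==> j < n ==> ar s 13 (k * n + j) = 1 ==> Bm k j <= lb"
  and pms: "\<And>x. ?po <= x ==> pm s x = of_bool (\<exists>r c. (r, c) \<in> X & x = ?po + (r * ?N + c))"
  using p unfolding part_def by blast+
 have n0: "0 < n" using n1 by simp
 \<comment> \<open>Since \<open>cnt <= n * h\<close>, at most \<open>n\<close> closed chunks exist
   besides the \<open>n\<close> open ones.\<close>
 have cap: "nx <= ?N" if "chunks s q n (n*n) nx h w lb ub cnt" for q nx w
 proof -
  have "(nx - n) * h <= n * h" using chunks_le(1)[OF that] h(1) by linarith
  then have "nx - n <= n" using h(2) by simp
  then show ?thesis by simp
 qed
 have nr: "nr <= ?N" and nc: "nc <= ?N" using cap cr cc' by blast+
 have capB: "nx * n <= B" "nx * n <= 2 * (n * n)" if "nx <= ?N" for nx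
 proof -
  show "nx * n <= 2 * (n * n)" using mult_right_mono[OF that, of n] by simp
  then show "nx * n <= B" using nB by linarith
 qed
 have lt: "a * ?N + b < ?N\<^sup>2" if "a < ?N" "b < ?N" for a b
 proof -
  have "a * ?N + b < (a + 1) * ?N" using that by simp
  also have "\<dots> <= ?N * ?N" using that by (intro mult_right_mono) auto
  finally show ?thesis by (simp add: power2_eq_square)
 qed
 have inj: "(a * ?N + b = a' * ?N + b') = (a = a' & b = b')" if "b < ?N" "b' < ?N" for a b a' b'
 proof
  assume e: "a * ?N + b = a' * ?N + b'"
  have "(a * ?N + b) div ?N = a" "(a' * ?N + b') div ?N = a'" using that by (simp_all del: mult_2)
  then show "a = a' & b = b'" using e by auto
 qed auto
 define own_r where "own_r = ar s 21"
 define own_c where "own_c = ar s 31"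
 define Y where "Y c j \<longleftrightarrow> c < nc & j < n & Bm (own_c c) j <= ar s 34 c" for c j
 define H1 where "H1 r j \<longleftrightarrow> (\<exists>l<?N. (r, l) \<in> X & Y l j)" for r j
 define H2 where "H2 c j \<longleftrightarrow> ar s 34 c < Bm (own_c c) j & Bm (own_c c) j <= ar s 35 c" for c j
 have own: "\<And>r. r < nr ==> own_r r < n" "\<And>c. c < nc ==> own_c c < n"
  using chunks_le(5)[OF cr] chunks_le(5)[OF cc'] by (auto simp: own_r_def own_c_def)
 have crD: "ar s 23 (r * (n * n) + x) < n" "ar s 24 r <= A (own_r r) (ar s 23 (r * (n * n) + x))" "A (own_r r) (ar s 23 (r * (n * n) + x)) <= ar s 25 r"
   "lb <= ar s 24 r" "ar s 25 r <= ub"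
  if "r < nr" "x < ar s 22 r" for r x
  using cr that unfolding chunks_def own_r_def by auto
 have ccD: "ar s 33 (c * (n * n) + x) < n" "ar s 34 c <= A (ar s 33 (c * (n * n) + x)) (own_c c)" "A (ar s 33 (c * (n * n) + x)) (own_c c) <= ar s 35 c"
   "lb <= ar s 34 c" "ar s 35 c <= ub"
  if "c < nc" "x < ar s 32 c" for c x
  using cc' that unfolding chunks_def own_c_def by auto
 have cr_ord: "ar s 25 r <= ar s 24 r'" if "r < r'" "r' < nr" "own_r r = own_r r'" "0 < ar s 22 r" "0 < ar s 22 r'" for r r'
  using cr that unfolding chunks_def own_r_def by auto
 have cc_ord: "ar s 35 c <= ar s 34 c'" if "c < c'" "c' < nc" "own_c c = own_c c'" "0 < ar s 32 c" "0 < ar s 32 c'" for c c'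
  using cc' that unfolding chunks_def own_c_def by auto
 have cc_empty: "ar s 32 c = 0 ==> ar s 34 c = 0 & ar s 35 c = 0" if "c < nc" for c
  using cc' that unfolding chunks_def by auto
 text \<open>A hit chunk contains a column whose entry is a valid candidate.\<close>
 have hit: "cc u (own_r r) j <= ar s 25 r & 0 < ar s 22 r" if "r < nr" "j < n" "H1 r j" and
   sc: "\<forall>x<ar s 22 r. Bm (ar s 23 (r * (n * n) + x)) j <= A (own_r r) (ar s 23 (r * (n * n) + x)) -->
    cc u (own_r r) j <= A (own_r r) (ar s 23 (r * (n * n) + x))" for u r j
 proof -
  from that(3) obtain l where l: "(r, l) \<in> X" "Y l j" by (auto simp: H1_def)
  obtain x where x: "x < ar s 22 r" "ar s 23 (r * (n * n) + x) = own_c l" using X[OF l(1)] by (auto simp: own_c_def)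
  obtain y where y: "y < ar s 32 l" "ar s 33 (l * (n * n) + y) = own_r r" using X[OF l(1)] by (auto simp: own_r_def)
  have "Bm (own_c l) j <= A (own_r r) (own_c l)" using l(2) ccD(2)[of l y] y X[OF l(1)] by (auto simp: Y_def)
  then have "cc u (own_r r) j <= A (own_r r) (own_c l)" using sc x by auto
  then show ?thesis using crD(3)[OF that(1) x(1)] x by auto
 qed
 show ?thesis
  unfolding flush_def wp_simps(5)
 proof (rule wp_conseq[OF fillY_wp[OF e(1) v(2,5) refl nc]], goal_cases)
  case 1
  then show ?case using own(2) by (simp add: own_c_def)
 next
  case (2 u1)
  have u1: "ar u1 = ar s" "\<And>x. x \<notin> {36,35,30,31,27} ==> vr u1 x = vr s x" using 2(2) by (auto simp: frame_def)
  have ck1: "ck u1 <= ck s + 2 + 6 * (nc * n)" using 2(1) by simp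
  have pm1: "pm u1 x = (if \<exists>c j. Y c j & x = ?po + (?N\<^sup>2 + (c * ?N + j)) then 1 else pm s x)" for x
  proof -
   have "(\<exists>c<nc. \<exists>j<n. x = ?po + (?N\<^sup>2 + (c * ?N + j)) & Bm (ar s 31 c) j <= ar s 34 c) = (\<exists>c j. Y c j & x = ?po + (?N\<^sup>2 + (c * ?N + j)))"
    by (auto simp: Y_def own_c_def)
   then show ?thesis using 2(1) by simp
  qed
  have XN: "r < ?N & c < ?N" if "(r, c) \<in> X" for r c using X[OF that] nr nc by auto
  have YN: "c < ?N & j < ?N" if "Y c j" for c j using that nc n0 by (auto simp: Y_def)
  have X1: "\<forall>i<?N. \<forall>j<?N. pm u1 (?po + i * ?N + j) = of_bool ((i, j) \<in> X)"
  proof (intro allI impI)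
   fix i j assume ij: "i < ?N" "j < ?N"
   have "\<not> (\<exists>c j'. Y c j' & ?po + i * ?N + j = ?po + (?N\<^sup>2 + (c * ?N + j')))" using lt[OF ij] by auto
   then have "pm u1 (?po + i * ?N + j) = pm s (?po + i * ?N + j)" unfolding pm1 by (rule if_not_P)
   also have "\<dots> = of_bool (\<exists>r c. (r, c) \<in> X & ?po + i * ?N + j = ?po + (r * ?N + c))" by (rule pms) simp
   also have "(\<exists>r c. (r, c) \<in> X & ?po + i * ?N + j = ?po + (r * ?N + c)) \<longleftrightarrow> (i, j) \<in> X"
   proof
    assume "\<exists>r c. (r, c) \<in> X & ?po + i * ?N + j = ?po + (r * ?N + c)"
    then obtain r c where rc: "(r, c) \<in> X" "i * ?N + j = r * ?N + c" by auto
    then show "(i, j) \<in> X" using inj[of j c i r] ij XN[OF rc(1)] by auto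
   qed auto
   finally show "pm u1 (?po + i * ?N + j) = of_bool ((i, j) \<in> X)" .
  qed
  have Y1: "\<forall>i<?N. \<forall>j<?N. pm u1 (?po + ?N\<^sup>2 + i * ?N + j) = of_bool (Y i j)"
  proof (intro allI impI)
   fix i j assume ij: "i < ?N" "j < ?N"
   have "(\<exists>c j'. Y c j' & ?po + ?N\<^sup>2 + i * ?N + j = ?po + (?N\<^sup>2 + (c * ?N + j'))) \<longleftrightarrow> Y i j"
   proof
    assume "\<exists>c j'. Y c j' & ?po + ?N\<^sup>2 + i * ?N + j = ?po + (?N\<^sup>2 + (c * ?N + j'))"
    then obtain c j' where cj: "Y c j'" "i * ?N + j = c * ?N + j'" by auto
    then show "Y i j" using inj[of j j' i c] ij YN[OF cj(1)] by auto
   qed auto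
   moreover have "pm s (?po + ?N\<^sup>2 + i * ?N + j) = 0"
   proof -
    have "\<not> (\<exists>r c. (r, c) \<in> X & ?po + ?N\<^sup>2 + i * ?N + j = ?po + (r * ?N + c))"
    proof
     assume "\<exists>r c. (r, c) \<in> X & ?po + ?N\<^sup>2 + i * ?N + j = ?po + (r * ?N + c)"
     then obtain r c where "(r, c) \<in> X" "?N\<^sup>2 + i * ?N + j = r * ?N + c" by auto
     then show False using lt[of r c] XN[of r c] by auto
    qed
    then show ?thesis using pms[of "?po + ?N\<^sup>2 + i * ?N + j"] by simp
   qed
   ultimately show "pm u1 (?po + ?N\<^sup>2 + i * ?N + j) = of_bool (Y i j)" using pm1 by simp
  qed
  have Z1: "\<forall>x\<ge>2 * ?N\<^sup>2. pm u1 (?po + x) = 0"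
  proof (intro allI impI)
   fix x assume x: "2 * ?N\<^sup>2 <= x"
   have "\<not> (\<exists>c j. Y c j & ?po + x = ?po + (?N\<^sup>2 + (c * ?N + j)))"
   proof
    assume "\<exists>c j. Y c j & ?po + x = ?po + (?N\<^sup>2 + (c * ?N + j))"
    then obtain c j where "Y c j" "x = ?N\<^sup>2 + (c * ?N + j)" by auto
    then show False using lt[of c j] YN[of c j] x by linarith
   qed
   moreover have "\<not> (\<exists>r c. (r, c) \<in> X & ?po + x = ?po + (r * ?N + c))"
   proof
    assume "\<exists>r c. (r, c) \<in> X & ?po + x = ?po + (r * ?N + c)"
    then obtain r c where "(r, c) \<in> X" "x = r * ?N + c" by auto
    then show False using lt[of r c] XN[of r c] x by linarith
   qed
   ultimately show "pm u1 (?po + x) = 0" using pm1 pms[of "?po + x"] by simp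
  qed
  have v1: "vr u1 2 = ?N" "vr u1 4 = ?po" using u1 v by auto
  show ?case
  proof (rule wp_conseq[OF mult_wp[OF v1 X1 Y1 Z1]], goal_cases)
   case (1 u2)
   then obtain t where t: "t <= TM" and u2: "vr u2 = (vr u1)(3 := t)" "ar u2 = ar s" "ck u2 = Suc (ck u1 + t)"
    and pm2: "\<forall>i<?N. \<forall>j<?N. pm u2 (?po + 2 * ?N\<^sup>2 + i * ?N + j) > 0 \<longleftrightarrow> (\<exists>l<?N. (i, l) \<in> X & Y l j)" "\<forall>x\<ge>?po + Sd. pm u2 x = 0"
    using u1(1) by auto
   have vr2: "vr u2 x = vr s x" if "x \<notin> {36,35,30,31,27,3}" for x using u2(1) u1(2) that by simp
   have ok2: "okC s u2" by (rule okC_cong[OF okC_refl[OF e]]) (use vr2 u2 in auto)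
   then have e2: "env u2" "sound u2" by (auto simp: okC_def)
   have cr2: "chunks u2 20 n (n*n) nr h A lb ub cnt" using cr chunks_cong[of 20 u2 s] u2 by simp
   have fs2: "flag_sum fl u2 = flag_sum fl s" for fl by (simp add: flag_sum_def u2)
   have pr1: "(26 = (26::nat) & 27 = (27::nat) & (\<lambda>x y. (x, y)) = (\<lambda>x y. (x::nat, y::nat))) \<or> (26 = (27::nat) & 27 = (26::nat) & (\<lambda>x y. (x, y)) = (\<lambda>x y. (y::nat, x::nat)))" by simp
   have HF: "val condF u = of_bool (H1 r j)" if "r < nr" "j < n" "\<forall>x. x \<notin> {36,35,29,31,26,27,37,32,28} --> vr u x = vr u2 x" "pm u = pm u2" "vr u 29 = r" "vr u 31 = j" for u r j
   proof -
    have "vr u 4 = ?po" "vr u 2 = ?N" using that(3) vr2 v by auto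
    then have "val condF u = of_bool (pm u2 (?po + (2 * (?N * ?N) + (r * ?N + j))) > 0)" using that by (simp add: condF_def)
    moreover have "?po + (2 * (?N * ?N) + (r * ?N + j)) = ?po + 2 * ?N\<^sup>2 + r * ?N + j" by (simp add: power2_eq_square)
    moreover have "r < ?N" "j < ?N" using that nr n0 by auto
    ultimately show ?thesis using pm2(1) unfolding H1_def by (simp only:)
   qed
   show ?case
   proof (rule wp_conseq[OF scan_wp[OF e2 pr1 cr2, where vx = 22 and fl = 12 and c = condF and H = H1]], goal_cases)
    case (9 u r j)
    then show ?case by (intro HF) auto
   next
    case (10 u3)
    have oreq: "ar s (20+1) = own_r" by (simp add: own_r_def)
    note c = 10(1)[unfolded oreq u2(2)]
     have ok3: "okC u2 u3" by (rule conjunct1[OF c])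
     have fl3: "\<forall>x<n*n. ar u3 12 x <= 1" "flag_sum 12 u2 <= flag_sum 12 u3" by (rule conjunct1[OF conjunct2[OF c]], rule conjunct1[OF conjunct2[OF conjunct2[OF c]]])
     have ck3: "ck u3 <= ck u2 + 3 + 6 * (nr * n) + (8 + 5 * h) * (flag_sum 12 u3 - flag_sum 12 u2)" by (rule conjunct1[OF conjunct2[OF conjunct2[OF conjunct2[OF c]]]])
     have F3: "\<And>k j. k < n ==> j < n ==> ar u3 12 (k * n + j) = 1 ==> ar s 12 (k * n + j) = 1 \<or>
       (\<exists>r<nr. own_r r = k & H1 r j & scanned 20 (\<lambda>x y. (x, y)) u3 r j)" by (rule conjunct1[OF conjunct2[OF conjunct2[OF conjunct2[OF conjunct2[OF c]]]], rule_format])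
     have S3: "\<And>r j. r < nr ==> j < n ==> H1 r j ==> ar s 12 (own_r r * n + j) = 1 \<or>
       (\<exists>r'\<le>r. own_r r' = own_r r & H1 r' j & scanned 20 (\<lambda>x y. (x, y)) u3 r' j)" by (rule conjunct2[OF conjunct2[OF conjunct2[OF conjunct2[OF conjunct2[OF c]]]], rule_format])
    have u3: "ar u3 a = ar s a" if "a \<notin> {12, 0}" for a using 10(2) that u2(2) by (auto simp: frame_def)
    have vr3: "vr u3 x = vr s x" if "x \<notin> {36,35,30,31,27,3,29,26,37,32,28}" for x using 10(2) vr2 that by (auto simp: frame_def)
    have vr33: "vr u3 3 = t" using 10(2) u2(1) by (auto simp: frame_def)
    have pm3: "pm u3 = pm u2" using 10(2) by (auto simp: frame_def)
    have okS3: "okC s u3" using okC_trans[OF ok2 ok3] .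
    have e3: "env u3" "sound u3" using ok3 by (auto simp: okC_def)
    have cc3: "chunks u3 30 n (n*n) nc h (\<lambda>k i. A i k) lb ub cnt" using cc' chunks_cong[of 30 u3 s] u3 by simp
    have fs3: "flag_sum 13 u3 = flag_sum 13 s" by (simp add: flag_sum_def u3)
    have sc3: "\<forall>x<ar s 22 r. Bm (ar s 23 (r * (n * n) + x)) j <= A (own_r r) (ar s 23 (r * (n * n) + x)) -->
      cc u3 (own_r r) j <= A (own_r r) (ar s 23 (r * (n * n) + x))" if "scanned 20 (\<lambda>x y. (x, y)) u3 r j" for r j
     using that unfolding scanned_def own_r_def by (simp add: u3)
    have row: "cc u3 (own_r r) j <= A (own_r r) (own_c c)" if rc: "(r, c) \<in> X" and j: "j < n" and le: "Bm (own_c c) j <= ar s 34 c" "Bm (own_c c) j <= A (own_r r) (own_c c)" for r c j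
    proof -
     obtain x where x: "x < ar s 22 r" "ar s 23 (r * (n * n) + x) = own_c c" using X[OF rc] by (auto simp: own_c_def)
     have r: "r < nr" "c < nc" using X[OF rc] by auto
     have "H1 r j" using rc le r j nc unfolding H1_def Y_def by (intro exI[of _ c]) auto
     from S3[OF r(1) j this] show ?thesis
     proof
      assume "ar s 12 (own_r r * n + j) = 1"
      then have "cc s (own_r r) j <= lb" using F1 own r j by blast
      moreover have "cc u3 (own_r r) j <= cc s (own_r r) j" using okS3 own r j by (simp add: okC_def)
      ultimately show ?thesis using crD(2,4)[OF r(1) x(1)] x by simp
     next
      assume "\<exists>r'\<le>r. own_r r' = own_r r & H1 r' j & scanned 20 (\<lambda>x y. (x, y)) u3 r' j"
      then obtain r' where r': "r' <= r" "own_r r' = own_r r" "H1 r' j" "scanned 20 (\<lambda>x y. (x, y)) u3 r' j" by blast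
      note sc = sc3[OF r'(4)]
      show ?thesis
      proof (cases "r' = r")
       case True then show ?thesis using sc x le by auto
      next
       case False
       then have "r' < r" using r' by simp
       have "cc u3 (own_r r') j <= ar s 25 r' & 0 < ar s 22 r'" by (rule hit) (use r' sc \<open>r' < r\<close> r j in auto)
       then show ?thesis using cr_ord[OF \<open>r' < r\<close> r(1) r'(2)] crD(2)[OF r(1) x(1)] x r'(2) by simp
      qed
     qed
    qed
    \<comment> \<open>This restores the condition on the flags of the result for the next batch,
      whose lower bound is \<open>ub\<close>.\<close>
    have flag3: "cc u3 i j <= ub" if "i < n" "j < n" "ar u3 12 (i * n + j) = 1" for i j
     using F3[OF that]
    proof
     assume "ar s 12 (i * n + j) = 1"
     then have "cc s i j <= lb" using F1 that by blast
     moreover have "cc u3 i j <= cc s i j" using okS3 that by (simp add: okC_def)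
     ultimately show ?thesis using h(3) by simp
    next
     assume "\<exists>r<nr. own_r r = i & H1 r j & scanned 20 (\<lambda>x y. (x, y)) u3 r j"
     then obtain r where r: "r < nr" "own_r r = i" "H1 r j" "scanned 20 (\<lambda>x y. (x, y)) u3 r j" by blast
     have "cc u3 (own_r r) j <= ar s 25 r & 0 < ar s 22 r" by (rule hit[OF r(1) that(2) r(3) sc3[OF r(4)]])
     then show ?thesis using crD(5)[OF r(1)] r(2) by fastforce
    qed
    have pr2: "(27 = (26::nat) & 26 = (27::nat) & (\<lambda>x y. (y, x)) = (\<lambda>x y. (x::nat, y::nat))) \<or> (27 = (27::nat) & 26 = (26::nat) & (\<lambda>x y. (y, x)) = (\<lambda>x y. (y::nat, x::nat)))" by simp
    have HG: "val condG u = of_bool (H2 r j)" if "r < nc" "j < n" "env u" "\<forall>a. a \<notin> {13, 0} --> ar u a = ar u3 a" "vr u 29 = r" "vr u 31 = j" "vr u 27 = ar u3 (30+1) r" for u r j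
    proof -
     have k: "vr u 27 = own_c r" using that(7) u3 by (simp add: own_c_def)
     have "ar u 0 (bB + (own_c r * s1 + j * s2)) = Bm (own_c r) j" using that(3) own(2)[OF that(1)] that(2) by (auto simp: env_def)
     moreover have "val eB u = bB + (own_c r * s1 + j * s2)" using k that(3,6) by (simp add: env_def)
     moreover have "ar u 34 = ar s 34" "ar u 35 = ar s 35" using that(4) u3 by auto
     ultimately show ?thesis using that(5) unfolding condG_def H2_def by (simp del: val.simps(3) add: val.simps)
    qed
    show ?case
    proof (rule wp_conseq[OF scan_wp[OF e3 pr2 cc3, where vx = 23 and fl = 13 and c = condG and H = H2]], goal_cases)
     case (9 u r j)
     then show ?case by (intro HG) auto
    next
     case (10 u4)
     have oceq: "ar u3 (30+1) = own_c" "ar u3 13 = ar s 13" by (simp_all add: u3 own_c_def)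
     note c = 10(1)[unfolded oceq]
     have ok4: "okC u3 u4" by (rule conjunct1[OF c])
     have fl4: "\<forall>x<n*n. ar u4 13 x <= 1" "flag_sum 13 u3 <= flag_sum 13 u4" by (rule conjunct1[OF conjunct2[OF c]], rule conjunct1[OF conjunct2[OF conjunct2[OF c]]])
     have ck4: "ck u4 <= ck u3 + 3 + 6 * (nc * n) + (8 + 5 * h) * (flag_sum 13 u4 - flag_sum 13 u3)" by (rule conjunct1[OF conjunct2[OF conjunct2[OF conjunct2[OF c]]]])
     have F4: "\<And>k j. k < n ==> j < n ==> ar u4 13 (k * n + j) = 1 ==> ar s 13 (k * n + j) = 1 \<or>
        (\<exists>r<nc. own_c r = k & H2 r j & scanned 30 (\<lambda>x y. (y, x)) u4 r j)" by (rule conjunct1[OF conjunct2[OF conjunct2[OF conjunct2[OF conjunct2[OF c]]]], rule_format])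
     have S4: "\<And>r j. r < nc ==> j < n ==> H2 r j ==> ar s 13 (own_c r * n + j) = 1 \<or>
        (\<exists>r'\<le>r. own_c r' = own_c r & H2 r' j & scanned 30 (\<lambda>x y. (y, x)) u4 r' j)" by (rule conjunct2[OF conjunct2[OF conjunct2[OF conjunct2[OF conjunct2[OF c]]]], rule_format])
     have u4: "ar u4 a = ar s a" if "a \<notin> {12, 13, 0}" for a using 10(2) that u3 by (auto simp: frame_def)
     have u412: "ar u4 12 = ar u3 12" using 10(2) by (auto simp: frame_def)
     have vr4: "vr u4 x = vr s x" if "x \<notin> {36,35,30,31,27,3,29,26,37,32,28}" for x using 10(2) vr3 that by (auto simp: frame_def)
     have vr43: "vr u4 3 = t" using 10(2) vr33 by (auto simp: frame_def)
     have pm4: "pm u4 = pm u2" using 10(2) pm3 by (auto simp: frame_def)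
     have okS4: "okC s u4" using okC_trans[OF okS3 ok4] .
     have sc4: "\<forall>x<ar s 32 c. Bm (own_c c) j <= A (ar s 33 (c * (n * n) + x)) (own_c c) -->
       cc u4 (ar s 33 (c * (n * n) + x)) j <= A (ar s 33 (c * (n * n) + x)) (own_c c)" if "scanned 30 (\<lambda>x y. (y, x)) u4 c j" for c j
      using that unfolding scanned_def own_c_def by (simp add: u4)
     have corr: "cc u4 (own_r r) j <= A (own_r r) (own_c c)" if rc: "(r, c) \<in> X" and j: "j < n" and le: "Bm (own_c c) j <= A (own_r r) (own_c c)" for r c j
     proof (cases "Bm (own_c c) j <= ar s 34 c")
      case True
      have "cc u4 (own_r r) j <= cc u3 (own_r r) j" using ok4 own X[OF rc] j by (simp add: okC_def)
      then show ?thesis using row[OF rc j True le] by simp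
     next
      case False
      have c: "c < nc" using X[OF rc] by auto
      obtain y where y: "y < ar s 32 c" "ar s 33 (c * (n * n) + y) = own_r r" using X[OF rc] by (auto simp: own_r_def)
      have "H2 c j" using False ccD(3)[OF c y(1)] y le unfolding H2_def by simp
      from S4[OF c j this] show ?thesis
      proof
       assume "ar s 13 (own_c c * n + j) = 1"
       then have "Bm (own_c c) j <= lb" using F2 own c j by blast
       then show ?thesis using False ccD(4)[OF c y(1)] by simp
      next
       assume "\<exists>r'\<le>c. own_c r' = own_c c & H2 r' j & scanned 30 (\<lambda>x y. (y, x)) u4 r' j"
       then obtain c' where c': "c' <= c" "own_c c' = own_c c" "H2 c' j" "scanned 30 (\<lambda>x y. (y, x)) u4 c' j" by blast
       show ?thesis
       proof (cases "c' = c")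
        case True then show ?thesis using sc4[OF c'(4)] y le by auto
       next
        case False
        \<comment> \<open>An empty chunk has both bounds 0 and is never hit. A nonempty earlier one
          would bound \<open>Bm\<close> by its greatest value, hence by the least value of chunk
          \<open>c\<close>, against the case assumption.\<close>
        then have "c' < c" using c' by simp
        have "0 < ar s 32 c'" using cc_empty[of c'] c'(3) \<open>c' < c\<close> c unfolding H2_def by (cases "ar s 32 c'") auto
        then have "ar s 35 c' <= ar s 34 c" using cc_ord[OF \<open>c' < c\<close> c c'(2)] y by auto
        then show ?thesis using c'(2,3) \<open>\<not> Bm (own_c c) j <= ar s 34 c\<close> unfolding H2_def by simp
       qed
      qed
     qed
     have flag4: "Bm k j <= ub" if "k < n" "j < n" "ar u4 13 (k * n + j) = 1" for k j
      using F4[OF that]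
     proof
      assume "ar s 13 (k * n + j) = 1"
      then show ?thesis using F2 that h(3) le_trans by blast
     next
      assume "\<exists>r<nc. own_c r = k & H2 r j & scanned 30 (\<lambda>x y. (y, x)) u4 r j"
      then obtain c where c: "c < nc" "own_c c = k" "H2 c j" by blast
      have "ar s 35 c <= ub" using cc' c(1) unfolding chunks_def by auto
      then show ?thesis using c unfolding H2_def by simp
     qed
     have flag4': "cc u4 i j <= ub" if "i < n" "j < n" "ar u4 12 (i * n + j) = 1" for i j
     proof -
      have "cc u4 i j <= cc u3 i j" using ok4 that by (simp add: okC_def)
      then show ?thesis using flag3[of i j] that u412 by simp
     qed
     define h' where "h' = (if n * (h * h) < t then 2 * h else h)"
     define u5 where "u5 = setv 4 (?po + Sd) u4"
     define u6 where "u6 = (if n * (h * h) < t then setv 20 (2 * h) (tck u5) else tck (tck u5))"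
     have v46: "vr u4 4 = ?po" "vr u4 9 = Sd" "vr u4 5 = n" "vr u4 20 = h" using vr4 v e by (auto simp: env_def)
     have u6: "ar u6 = ar u4" "pm u6 = pm u2" "vr u6 5 = n" "vr u6 4 = ?po + Sd" "vr u6 20 = h'" "ck u6 = ck u4 + 3"
       "\<And>x. x \<notin> {4, 20} ==> vr u6 x = vr u4 x"
      using v46 pm4 by (auto simp: u6_def u5_def h'_def)
     have fin: "wp B J reset ?Q u6"
     proof (rule wp_conseq[OF reset_wp[OF u6(3) nleB(1), of J "n*n" h' A ub ub "\<lambda>k i. A i k"]], goal_cases)
      case (1 u)
      have u: "ar u a = ar u4 a" if "a \<notin> {20,21,22,24,25,30,31,32,34,35}" for a using 1(2) u6(1) that by (auto simp: frame_def)
      have vru: "vr u x = vr u6 x" if "x \<notin> {22,23,21,35}" for x using 1(2) that by (auto simp: frame_def)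
      have pmu: "pm u = pm u2" using 1(2) u6 by (auto simp: frame_def)
      have oku: "okC s u" by (rule okC_cong[OF okS4]) (use vru u6(7) u in auto)
      have ccu: "cc u = cc u4" by (rule cc_cong) (use u in auto)
      have fsu: "flag_sum 12 u = flag_sum 12 u3" "flag_sum 13 u = flag_sum 13 u4" by (simp_all add: flag_sum_def u u412)
      have vu4: "vr u 4 = ?po + Sd" using vru u6 by simp
      have pz: "pm u x = 0" if "vr u 4 <= x" for x using that pm2(2) pmu vu4 by simp
      have "env u" "sound u" using oku by (auto simp: okC_def)
      moreover have "vr u 20 = h'" "vr u 2 = 2 * n" "vr u 9 = Sd" using vru u6 vr4 v by auto
      moreover have "0 < h'" using h by (simp add: h'_def)
      moreover have "\<forall>x<n*n. ar u 12 x <= 1 & ar u 13 x <= 1" using fl3 fl4 u u412 by simp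
      moreover have "\<forall>i<n. \<forall>j<n. ar u 12 (i * n + j) = 1 --> cc u i j <= ub" using flag4' u ccu by simp
      moreover have "\<forall>k<n. \<forall>j<n. ar u 13 (k * n + j) = 1 --> Bm k j <= ub" using flag4 u by simp
      ultimately have pt: "part u n n h' ub ub 0 {}" using 1(1) pz unfolding part_def by simp
      have "n <= n * n" "1 <= n * n" using n1 by auto
      have k1: "nr * n <= 2 * (n * n)" "nc * n <= 2 * (n * n)" using capB(2) nr nc by auto
      have "ck u <= ck u6 + 5 + 12 * n" using 1(1) by simp
      then have "ck u <= ck s + t + (20 + 12 * n + 6 * (nc * n) + 6 * (nr * n) + 6 * (nc * n)) +
        (8 + 5 * h) * (flag_sum 12 u - flag_sum 12 s) + (8 + 5 * h) * (flag_sum 13 u - flag_sum 13 s)"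
       using ck1 u2(3) ck3 ck4 u6(6) unfolding fsu fs2 fs3 by linarith
      moreover have "20 + 12 * n + 6 * (nc * n) + 6 * (nr * n) + 6 * (nc * n) <= 100 * (n * n)" using k1 \<open>n <= n * n\<close> \<open>1 <= n * n\<close> by linarith
      ultimately have ckf: "ck u <= ck s + t + 100 * (n * n) + (8 + 5 * h) * ((flag_sum 12 u - flag_sum 12 s) + (flag_sum 13 u - flag_sum 13 s))"
       unfolding distrib_left by linarith
      show ?case
       by (rule exI[of _ h'], rule exI[of _ t])
         (use t pt oku ckf corr fl3 fl4 vru u6 in \<open>auto simp: h'_def ccu fsu fs2 fs3 own_r_def own_c_def\<close>)
     qed
     have c1: "val (Plus (Var 4) (Var 9)) u4 = ?po + Sd" using v46 by simp
     have u5v: "vr u5 5 = n" "vr u5 20 = h" "vr u5 3 = t" using v46 vr43 by (auto simp: u5_def)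
     have "wp B J (Asg 4 (Plus (Var 4) (Var 9))) (wp B J (Cond (Less (Times (Var 5) (Times (Var 20) (Var 20))) (Var 3)) (Asg 20 (Times (Num 2) (Var 20))) Nop)
       (wp B J reset Q)) u4" if "wp B J reset Q u6" for Q
      using that hB unfolding wp_simps c1 u5_def[symmetric] u6_def by (simp add: u5v split: if_splits)
     then show ?case using fin by blast
    qed (use vr3 v capB nc hB fl u3 in auto)
   qed (use vr2 v capB nr hB fl u2 in auto)
  qed
 qed
qed

end

section \<open>Filling the batches\<close>

definition addel :: com where
 "addel = chunk_open 20 22 26 29;; chunk_push 20 27 29;; chunk_open 30 23 27 30;; chunk_push 30 26 30;;
   PSet (Plus (Var 4) (Plus (Times (Var 29) (Var 2)) (Var 30)));; Asg 21 (Plus (Var 21) (Num 1))"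

text \<open>A batch is closed when it holds \<open>n * h\<close> entries or when the entries are
  exhausted. The flags in arrays 12 and 13 are cleared once for the whole half product, so their
  number bounds the scans of all batches together.\<close>

definition halfprod :: "ram_com => nat => com" where
 "halfprod P d = csort;; For 35 7 (Sto 12 (Var 35) (Num 0);; Sto 13 (Var 35) (Num 0));; Asg 20 (Var 10);; reset;;
   For 24 7 (Asg 35 (Rd 11 (Var 24));; geta;; addel;;
    Cond (Less (Var 21) (Times (Var 5) (Var 20))) (Cond (Less (Plus (Var 24) (Num 1)) (Var 7)) Nop (flush P d)) (flush P d))"

lemma mv_chunk [simp]:
 "mv (chunk_open q nx vk r) = {r, nx}" "ma (chunk_open q nx vk r) = {q,q+1,q+2,q+4,q+5}" "mp (chunk_open q nx vk r) = False"
 "mv (chunk_push q vm r) = {}" "ma (chunk_push q vm r) = {q+2,q+3,q+4,q+5}" "mp (chunk_push q vm r) = False"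
 by (auto simp: chunk_open_def chunk_push_def)

lemma mv_addel [simp]: "mv addel = {29,22,30,23,21}" "ma addel = {20,21,22,23,24,25,30,31,32,33,34,35}"
 by (auto simp: addel_def)

lemma mv_halfprod [simp]:
 "mv (halfprod P d) = {36,35,26,27,28,20,22,23,21,24,29,30,31,3,37,32,4}"
 "ma (halfprod P d) = {0,10,11,12,13,20,21,22,23,24,25,30,31,32,33,34,35}"
 by (auto simp: halfprod_def)

lemma wf_halfprod [simp]: "wf_com (halfprod P d)"
 by (auto simp: halfprod_def addel_def chunk_open_def chunk_push_def geta_def reset_def resetc_def)

text \<open>The bookkeeping of \<open>halfprod_wp\<close> in isolation: entries of the batch,
  doublings and new flags together absorb the cost of closing a batch.\<close>

lemma flush_account:
 fixes z :: nat
 assumes "z <= w4 + t + m + f2" "u4 <= C + 60 * p + 35 + x + y + f1" "w4 <= u4 + 2" "f1 + f2 <= f3" "x + y + t + m <= x' + y' + i"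
 shows "z <= C + 60 * Suc p + x' + y' + f3 + i"
proof -
 have "z + f1 <= C + 60 * p + 37 + (x + y + t + m) + (f1 + f2) + f1" using assms(1-3) by linarith
 then have "z <= C + 60 * p + 37 + (x + y + t + m) + (f1 + f2)" by linarith
 then show ?thesis using assms(4,5) unfolding mult_Suc_right by linarith
qed

context halfm
begin

text \<open>Opening and filling chunks keeps the keys and members of the older ones, so the pairs
  already in \<open>X\<close> remain justified; the new entry adds one pair.\<close>

lemma addel_wp:
 assumes p: "part s nr nc h lb ub cnt X" and v: "vr s 26 = i" "vr s 27 = k" "vr s 28 = A i k" "i < n" "k < n" "ub <= A i k"
  and cnt: "cnt < n * h" "cnt < n * n"
 shows "wp B J addel (\<lambda>u. \<exists>nr' nc' r c. part u nr' nc' h lb (A i k) (cnt + 1) (insert (r, c) X) & ar u 21 r = i & ar u 31 c = k &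
   (\<forall>r c. (r, c) \<in> X --> ar u 21 r = ar s 21 r & ar u 31 c = ar s 31 c) & ck u <= ck s + 30) s"
proof -
 let ?N = "2 * n"
 have e: "env s" "sound s" and vs: "vr s 22 = nr" "vr s 23 = nc" "vr s 20 = h" "vr s 21 = cnt" "vr s 2 = ?N" "vr s 9 = Sd"
  and cr: "chunks s 20 n (n*n) nr h A lb ub cnt" and cc': "chunks s 30 n (n*n) nc h (\<lambda>k i. A i k) lb ub cnt"
  and h: "cnt <= n * h" "0 < h" "lb <= ub"
  and X: "\<And>r c. (r, c) \<in> X ==> r < nr & c < nc & (\<exists>x<ar s 22 r. ar s 23 (r * (n * n) + x) = ar s 31 c) &
    (\<exists>x<ar s 32 c. ar s 33 (c * (n * n) + x) = ar s 21 r)"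
  and fl: "\<forall>x<n*n. ar s 12 x <= 1 & ar s 13 x <= 1"
  and F1: "\<forall>i<n. \<forall>j<n. ar s 12 (i * n + j) = 1 --> cc s i j <= lb"
  and F2: "\<forall>k<n. \<forall>j<n. ar s 13 (k * n + j) = 1 --> Bm k j <= lb"
  and pms: "\<forall>x\<ge>vr s 4. pm s x = of_bool (\<exists>r c. (r, c) \<in> X & x = vr s 4 + (r * ?N + c))"
  using p unfolding part_def by blast+
 have v7: "vr s 7 = n * n" using e by (simp add: env_def)
 have cap: "nx + 1 <= B" if "chunks s' q n (n*n) nx h w lb ub' cnt" for s' q nx w ub'
 proof -
  have "(nx - n) * h <= n * h" using chunks_le(1)[OF that] h(1) by linarith
  then have "nx - n <= n" using h(2) by simp
  moreover have "n <= n * n" by simp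
  ultimately show ?thesis using nB by linarith
 qed
 have AB: "A i k <= B" "k <= B" "i <= B" "cnt + 1 <= B" using Ainf[OF v(4,5)] infB v nleB cnt by linarith+
 show ?thesis
  unfolding addel_def wp_simps(5)
 proof (rule wp_conseq[OF chunk_open_wp[OF cr vs(1) v(1,4) vs(3) h(2)]], goal_cases)
  case (7 u1)
  then obtain nr' where nr': "vr u1 22 = nr'" "vr u1 29 = ar u1 20 i" "nr <= nr'" "ar u1 (20+2) (ar u1 20 i) < h"
   "chunks u1 20 n (n*n) nr' h A lb ub cnt" "ck u1 <= ck s + 9" "ar u1 (20+3) = ar s (20+3)"
   "\<forall>r<nr. ar u1 (20+1) r = ar s (20+1) r & ar u1 (20+2) r = ar s (20+2) r" by blast
  have u1: "\<And>x. x \<notin> {29,22} ==> vr u1 x = vr s x" "\<And>a. a \<notin> {20,21,22,24,25} ==> ar u1 a = ar s a" "pm u1 = pm s"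
   using 7(2) by (auto simp: frame_def)
  show ?case
  proof (rule wp_conseq[OF chunk_push_wp[OF nr'(5) v(4) nr'(2,4) _ v(5) _ v(6) h(3) cnt(2)]], goal_cases)
   case (7 u2)
   then have u2: "chunks u2 20 n (n*n) nr' h A lb (A i k) (cnt+1)" "ck u2 <= ck u1 + 5" "ar u2 (20+1) = ar u1 (20+1)"
    "\<exists>x<ar u2 (20+2) (ar u1 20 i). ar u2 (20+3) (ar u1 20 i * (n*n) + x) = k"
    "\<forall>r<nr'. ar u1 (20+2) r <= ar u2 (20+2) r & (\<forall>x<ar u1 (20+2) r. ar u2 (20+3) (r * (n*n) + x) = ar u1 (20+3) (r * (n*n) + x))" by blast+
   have u2': "vr u2 = vr u1" "\<And>a. a \<notin> {22,23,24,25} ==> ar u2 a = ar u1 a" "pm u2 = pm u1" using 7(2) by (auto simp: frame_def)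
   have cc2: "chunks u2 30 n (n*n) nc h (\<lambda>k i. A i k) lb ub cnt" using cc' chunks_cong[of 30 u2 s] u1 u2' by simp
   have v2: "vr u2 23 = nc" "vr u2 27 = k" "vr u2 20 = h" "vr u2 26 = i" "vr u2 28 = A i k" "vr u2 7 = n * n" using u1 u2' vs v v7 by auto
   show ?case
   proof (rule wp_conseq[OF chunk_open_wp[OF cc2 v2(1,2) v(5) v2(3) h(2)]], goal_cases)
    case (7 u3)
    then obtain nc' where nc': "vr u3 23 = nc'" "vr u3 30 = ar u3 30 k" "nc <= nc'" "ar u3 (30+2) (ar u3 30 k) < h"
     "chunks u3 30 n (n*n) nc' h (\<lambda>k i. A i k) lb ub cnt" "ck u3 <= ck u2 + 9" "ar u3 (30+3) = ar u2 (30+3)"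
     "\<forall>r<nc. ar u3 (30+1) r = ar u2 (30+1) r & ar u3 (30+2) r = ar u2 (30+2) r" by blast
    have u3: "\<And>x. x \<notin> {30,23} ==> vr u3 x = vr u2 x" "\<And>a. a \<notin> {30,31,32,34,35} ==> ar u3 a = ar u2 a" "pm u3 = pm u2"
     using 7(2) by (auto simp: frame_def)
    show ?case
    proof (rule wp_conseq[OF chunk_push_wp[OF nc'(5) v(5) nc'(2,4) _ v(4) _ v(6) h(3) cnt(2)]], goal_cases)
     case (7 u4)
     then have u4: "chunks u4 30 n (n*n) nc' h (\<lambda>k i. A i k) lb (A i k) (cnt+1)" "ck u4 <= ck u3 + 5" "ar u4 (30+1) = ar u3 (30+1)"
      "\<exists>x<ar u4 (30+2) (ar u3 30 k). ar u4 (30+3) (ar u3 30 k * (n*n) + x) = i"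
      "\<forall>r<nc'. ar u3 (30+2) r <= ar u4 (30+2) r & (\<forall>x<ar u3 (30+2) r. ar u4 (30+3) (r * (n*n) + x) = ar u3 (30+3) (r * (n*n) + x))" by blast+
     have u4': "vr u4 = vr u3" "\<And>a. a \<notin> {32,33,34,35} ==> ar u4 a = ar u3 a" "pm u4 = pm u3" using 7(2) by (auto simp: frame_def)
     define r c where "r = ar u1 20 i" and "c = ar u3 30 k"
     have rc: "r < nr'" "c < nc'" "ar u1 21 r = i" "ar u3 31 c = k"
      using chunks_le(3,4)[OF nr'(5) v(4)] chunks_le(3,4)[OF nc'(5) v(5)] by (auto simp: r_def c_def)
     let ?u = "setv 21 (cnt + 1) (setp (vr s 4 + (r * ?N + c)) u4)"
     have a0: "ar u4 a = ar s a" if "a \<notin> {20..25} \<union> {30..35}" for a using that u4' u3 u2' u1 by auto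
     have arR: "ar u4 20 = ar u2 20" "ar u4 21 = ar u1 21" "ar u4 22 = ar u2 22" "ar u4 23 = ar u2 23" "ar u4 24 = ar u2 24" "ar u4 25 = ar u2 25"
      using u4' u3 u2(3) by auto
     have vr4: "vr u4 x = vr s x" if "x \<notin> {29,22,30,23}" for x using that u4' u3 u2' u1 by auto
     have v4: "vr u4 29 = r" "vr u4 30 = c" "vr u4 22 = nr'" "vr u4 23 = nc'"
      using u4' u3 u2' nr' nc' by (auto simp: r_def c_def)
     have own: "ar u4 21 r' = ar s 21 r' & ar u4 31 c' = ar s 31 c'" if "r' < nr" "c' < nc" for r' c'
      using that nr'(8) nc'(8) arR(2) u4(3) u2'(2)[of 31] u1(2)[of 31] by auto
     have memR: "ar s 22 r' <= ar u4 22 r' & (\<forall>x<ar s 22 r'. ar u4 23 (r' * (n*n) + x) = ar s 23 (r' * (n*n) + x))" if "r' < nr" for r'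
     proof -
      have "r' < nr'" using that nr'(3) by simp
      then show ?thesis using u2(5)[THEN spec[of _ r']] nr'(8)[THEN spec[of _ r']] that nr'(7) arR by auto
     qed
     have memC: "ar s 32 c' <= ar u4 32 c' & (\<forall>x<ar s 32 c'. ar u4 33 (c' * (n*n) + x) = ar s 33 (c' * (n*n) + x))" if "c' < nc" for c'
     proof -
      have "c' < nc'" using that nc'(3) by simp
      then show ?thesis using u4(5)[THEN spec[of _ c']] nc'(8)[THEN spec[of _ c']] that nc'(7) u2'(2)[of 32] u2'(2)[of 33] u1(2)[of 32] u1(2)[of 33] by auto
     qed
     have newX: "(\<exists>x<ar u4 22 r. ar u4 23 (r * (n*n) + x) = k)" "(\<exists>x<ar u4 32 c. ar u4 33 (c * (n*n) + x) = i)"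
      using u2(4) u4(4) arR by (auto simp: r_def c_def)
     have ownrc: "ar u4 21 r = i" "ar u4 31 c = k" using rc arR(2) u4(3) by auto
     have oldX: "r' < nr' & c' < nc' & (\<exists>x<ar u4 22 r'. ar u4 23 (r' * (n * n) + x) = ar u4 31 c') &
      (\<exists>x<ar u4 32 c'. ar u4 33 (c' * (n * n) + x) = ar u4 21 r')" if "(r', c') \<in> X" for r' c'
     proof -
      from X[OF that] obtain x y where xy: "r' < nr" "c' < nc" "x < ar s 22 r'" "ar s 23 (r' * (n * n) + x) = ar s 31 c'"
       "y < ar s 32 c'" "ar s 33 (c' * (n * n) + y) = ar s 21 r'" by blast
      have "x < ar u4 22 r'" "ar u4 23 (r' * (n * n) + x) = ar u4 31 c'" using memR[OF xy(1)] own[OF xy(1,2)] xy(3,4) by auto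
      moreover have "y < ar u4 32 c'" "ar u4 33 (c' * (n * n) + y) = ar u4 21 r'" using memC[OF xy(2)] own[OF xy(1,2)] xy(5,6) by auto
      ultimately show ?thesis using xy(1,2) nr'(3) nc'(3) by (meson less_le_trans)
     qed
     have "okC s ?u" by (rule okC_cong[OF okC_refl[OF e]]) (use vr4 a0 in auto)
     then have eu: "env ?u" "sound ?u" by (auto simp: okC_def)
     have ccu: "cc ?u = cc s" by (rule cc_cong) (use a0 in auto)
     have chR: "chunks ?u 20 n (n*n) nr' h A lb (A i k) (cnt+1)"
     proof (subst chunks_cong)
      fix a :: nat assume "a \<in> {20..20+5}"
      then have "a = 20 \<or> a = 21 \<or> a = 22 \<or> a = 23 \<or> a = 24 \<or> a = 25" by auto
      then show "ar ?u a = ar u2 a" using arR u2(3) by auto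
     qed (rule u2(1))
     have chC: "chunks ?u 30 n (n*n) nc' h (\<lambda>k i. A i k) lb (A i k) (cnt+1)" using u4(1) chunks_cong[of 30 ?u u4] by auto
     have pmu: "\<forall>x\<ge>vr ?u 4. pm ?u x = of_bool (\<exists>r' c'. (r', c') \<in> insert (r, c) X & x = vr ?u 4 + (r' * ?N + c'))"
      using pms vr4 u4'(3) u3(3) u2'(3) u1(3) by auto
     have Xu: "\<forall>r' c'. (r', c') \<in> insert (r, c) X --> r' < nr' & c' < nc' & (\<exists>x<ar ?u 22 r'. ar ?u 23 (r' * (n * n) + x) = ar ?u 31 c') &
      (\<exists>x<ar ?u 32 c'. ar ?u 33 (c' * (n * n) + x) = ar ?u 21 r')"
      using oldX rc newX ownrc by auto
     have pt: "part ?u nr' nc' h lb (A i k) (cnt + 1) (insert (r, c) X)"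
      unfolding part_def using eu chR chC pmu Xu v4 vr4 vs h cnt fl F1 F2 ccu a0 v(6) by simp
     have post: "\<exists>nr' nc' r c. part ?u nr' nc' h lb (A i k) (cnt + 1) (insert (r, c) X) & ar ?u 21 r = i & ar ?u 31 c = k &
      (\<forall>r c. (r, c) \<in> X --> ar ?u 21 r = ar s 21 r & ar ?u 31 c = ar s 31 c) & ck ?u <= ck s + 30"
      by (rule exI[of _ nr'], rule exI[of _ nc'], rule exI[of _ r], rule exI[of _ c])
        (use pt ownrc own X nr'(6) u2(2) nc'(6) u4(2) in auto)
     have "val (Plus (Var 4) (Plus (Times (Var 29) (Var 2)) (Var 30))) u4 = vr s 4 + (r * ?N + c)" using v4 vr4 vs by simp
     moreover have "val (Plus (Var 21) (Num 1)) (setp (vr s 4 + (r * ?N + c)) u4) = cnt + 1" using vr4 vs by simp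
     ultimately show ?case unfolding wp_simps using post AB by (simp only:)
    qed (use v2 u3 AB in auto)
   qed (use cap[OF cc2] in auto)
  qed (use u1 v v7 AB in auto)
 qed (use cap[OF cr] in auto)
qed

text \<open>In the coefficient of \<open>n * n * h\<close>, 101 stems from products charged to the
  entries of full batches and 10 from the scans: \<open>2 * n * n\<close> flags at
  \<open>5 * h\<close> steps.\<close>

definition half_time :: "nat => nat => nat" where
 "half_time h lev = 300 + 400 * (n * n) + 10 * inf + 111 * (n * n * h) + lev * (TM + 100 * (n * n)) + 101 * (n * (h * h))"

text \<open>Every batch contains an entry, so at most \<open>n * n\<close> windows of length
  \<open>Sd\<close> are used up. The number \<open>lev\<close> of doublings is part of the
  conclusion because the time is bounded through it.\<close>

lemma halfprod_wp:
 assumes e: "env s" "sound s" and v: "vr s 2 = 2 * n" "vr s 9 = Sd" "vr s 10 = h0" "0 < h0" "n <= h0 * h0"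
  and pm: "\<forall>x\<ge>vr s 4. pm s x = 0" and bB: "vr s 4 + n * n * Sd <= B" "2 * h0 <= B" "8 * TM <= B"
 shows "wp B J (halfprod P d) (\<lambda>u. okC s u & (\<forall>i<n. \<forall>k<n. \<forall>j<n. Bm k j <= A i k --> cc u i j <= A i k) &
   vr u 4 <= vr s 4 + n * n * Sd & (\<forall>x\<ge>vr u 4. pm u x = 0) &
   (\<exists>h lev. h = h0 * 2 ^ lev & (lev = 0 \<or> n * (h * h) < 4 * TM) & ck u <= ck s + half_time h lev)) s"
proof -
 let ?nn = "n * n"
 let ?Q = "\<lambda>u. okC s u & (\<forall>i<n. \<forall>k<n. \<forall>j<n. Bm k j <= A i k --> cc u i j <= A i k) &
   vr u 4 <= vr s 4 + n * n * Sd & (\<forall>x\<ge>vr u 4. pm u x = 0) &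
   (\<exists>h lev. h = h0 * 2 ^ lev & (lev = 0 \<or> n * (h * h) < 4 * TM) & ck u <= ck s + half_time h lev)"
 have nn1: "1 <= ?nn" "n <= ?nn" using n1 by auto
 \<comment> \<open>The reason for starting with a chunk size of about the square root of
   \<open>n\<close>: the \<open>n * n\<close> steps of overhead of a batch then stay within
   \<open>n * (h * h)\<close>.\<close>
 have h0nn: "?nn <= n * (h * h)" if "h0 <= h" for h
 proof -
  have "h0 * h0 <= h * h" using that by (intro mult_mono) auto
  then have "n <= h * h" using v(5) by linarith
  then show ?thesis by simp
 qed
 \<comment> \<open>After a doubling, the slow product that caused it bounds
   \<open>n * (h * h)\<close>, so the chunk size stays polynomial.\<close>
 have hB: "2 * h <= B" if "h = h0 * 2 ^ lev" "lev = 0 \<or> n * (h * h) < 4 * TM" for h lev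
 proof (cases "lev = 0")
  case True then show ?thesis using that bB by simp
 next
  case False
  then have "n * (h * h) < 4 * TM" using that by auto
  moreover have "h <= h * h" by simp
  moreover have "1 * (h * h) <= n * (h * h)" using n1 by (rule mult_right_mono) simp
  ultimately show ?thesis using bB(3) by linarith
 qed
 show ?thesis
  unfolding halfprod_def wp_simps(5)
 proof (rule wp_conseq[OF csort_wp[OF e(1)]], goal_cases)
  case (1 u1)
  define ord where "ord = ar u1 11"
  have ord: "bij_betw ord {..<?nn} {..<?nn}" "\<And>p p'. p <= p' ==> p' < ?nn ==> w (ord p) <= w (ord p')"
   and ck1: "ck u1 <= ck s + 20 + 20 * ?nn + 10 * inf" using 1(1) by (auto simp: ord_def)
  have u1: "\<And>x. x \<notin> {36,35,26,27,28} ==> vr u1 x = vr s x" "\<And>a. a \<notin> {10,11} ==> ar u1 a = ar s a" "pm u1 = pm s"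
   using 1(2) by (auto simp: frame_def)
  have ordn: "ord p < ?nn" if "p < ?nn" for p using ord(1) that by (auto simp: bij_betw_def)
  have s7: "vr s 7 = ?nn" "vr s 5 = n" "vr s 8 = inf" using e by (auto simp: env_def)
  show ?case
  proof (rule wp_For[where I = "\<lambda>l u. ck u <= ck u1 + 3 * l & (\<forall>x<l. ar u 12 x = 0 & ar u 13 x = 0)"], goal_cases)
   case (2 l u)
   then show ?case by (auto simp: less_Suc_eq)
  next
   case (3 u)
   have l: "vr u1 7 = ?nn" using u1 s7 by simp
   define u2 where "u2 = setv 20 h0 (setv 35 ?nn u)"
   have u: "\<And>x. x \<notin> {36,35,26,27,28} ==> vr u x = vr s x" "\<And>a. a \<notin> {10,11,12,13} ==> ar u a = ar s a" "pm u = pm s" "ar u 11 = ord"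
    using 3(2) u1 by (auto simp: frame_def ord_def)
   have u2: "\<And>x. x \<notin> {36,35,26,27,28,20} ==> vr u2 x = vr s x" "\<And>a. a \<notin> {10,11,12,13} ==> ar u2 a = ar s a" "pm u2 = pm s" "ar u2 11 = ord" "vr u2 20 = h0"
    "\<And>x. x < ?nn ==> ar u2 12 x = 0 & ar u2 13 x = 0" "ck u2 <= ck s + 22 + 23 * ?nn + 10 * inf"
    using u 3(1) l ck1 by (auto simp: u2_def)
   have v25: "vr u2 5 = n" using u2 s7 by simp
   have "wp B J reset (wp B J (For 24 7 (Asg 35 (Rd 11 (Var 24));; geta;; addel;;
     Cond (Less (Var 21) (Times (Var 5) (Var 20))) (Cond (Less (Plus (Var 24) (Num 1)) (Var 7)) Nop (flush P d)) (flush P d))) ?Q) u2"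
   proof (rule wp_conseq[OF reset_wp[OF v25 nleB(1), of J ?nn h0 A 0 0 "\<lambda>k i. A i k"]], goal_cases)
    case (1 u3)
    have u3: "\<And>x. x \<notin> {36,35,26,27,28,20,22,23,21} ==> vr u3 x = vr s x" "vr u3 20 = h0" "pm u3 = pm s" "ar u3 11 = ord"
     "\<And>x. x < ?nn ==> ar u3 12 x = 0 & ar u3 13 x = 0" "ar u3 0 = ar s 0"
     using 1 u2 by (auto simp: frame_def)
    have "ck u3 <= ck u2 + 5 + 12 * n" using 1(1) by blast
    then have ck3: "ck u3 <= ck s + 27 + 35 * ?nn + 10 * inf" using u2(7) nn1(2) by linarith
    have ok3: "okC s u3" by (rule okC_cong[OF okC_refl[OF e]]) (use u3 in auto)
    have lt: "k * n + j < ?nn" if "k < n" "j < n" for k j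
    proof -
     have "k * n + j < (k + 1) * n" using that by simp
     also have "\<dots> <= n * n" using that by (intro mult_right_mono) auto
     finally show ?thesis .
    qed
    have p3: "part u3 n n h0 0 0 0 {}"
     unfolding part_def using 1(1) ok3 u3 v pm lt by (auto simp: okC_def)
    let ?C = "ck s + 27 + 35 * ?nn + 10 * inf"
    \<comment> \<open>In the sorted order, the entries before \<open>p - cnt\<close> are finished
      and the last \<open>cnt\<close> ones form the open batch. A batch that keeps \<open>h\<close>
      is charged with \<open>101 * h\<close> to each of its entries, one that doubles
      \<open>h\<close> is charged to \<open>lev\<close>, and the possibly short final batch has a
      term of its own.\<close>
    define MM where "MM p u nr nc h lev lb ub cnt X \<longleftrightarrow> part u nr nc h lb ub cnt X & cnt <= p & (cnt = 0 --> X = {}) & okC s u &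
      (\<forall>q. p - cnt <= q --> q < p --> (\<exists>r c. (r, c) \<in> X & ar u 21 r = ord q div n & ar u 31 c = ord q mod n)) &
      (\<forall>q j. q < p - cnt --> j < n --> Bm (ord q mod n) j <= w (ord q) --> cc u (ord q div n) j <= w (ord q)) &
      (\<forall>q. p <= q --> q < ?nn --> ub <= w (ord q)) & cnt < n * h & (p = ?nn --> cnt = 0) &
      h = h0 * 2 ^ lev & (lev = 0 \<or> n * (h * h) < 4 * TM) & vr u 4 <= vr s 4 + p * Sd &
      ck u <= ?C + 60 * p + 101 * ((p - cnt) * h) + lev * (TM + 100 * ?nn) + (8 + 5 * h) * (flag_sum 12 u + flag_sum 13 u) +
       (if p = ?nn then 101 * (n * (h * h)) else 0)" for p and u :: st and nr nc h lev lb ub cnt X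
    define M where "M p u \<longleftrightarrow> (\<exists>nr nc h lev lb ub cnt X. MM p u nr nc h lev lb ub cnt X)" for p u
    have l3: "vr u3 7 = ?nn" using u3 s7 by simp
    show ?case
    proof (rule wp_For[where I = M], goal_cases)
     case 1
     have "M 0 u3"
      unfolding M_def MM_def
      by (rule exI[of _ n], rule exI[of _ n], rule exI[of _ h0], rule exI[of _ 0], rule exI[of _ 0], rule exI[of _ 0], rule exI[of _ 0], rule exI[of _ "{}"])
        (use p3 ok3 u3 ck3 v n1 in auto)
     then show ?case .
    next
     case (2 p u)
     have p: "p < ?nn" using 2(1) l3 by simp
     from 2(2) obtain nr nc h lev lb ub cnt X where mm: "MM p u nr nc h lev lb ub cnt X" unfolding M_def by blast
     have m0: "p \<noteq> ?nn" using p by simp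
     note m = mm[unfolded MM_def if_not_P[OF m0] add_0_right]
     have pt: "part u nr nc h lb ub cnt X" by (rule conjunct1[OF m])
     have cnt: "cnt <= p" "cnt < n * h" by (rule conjunct1[OF conjunct2[OF m]], rule conjunct1[OF conjunct2[OF conjunct2[OF conjunct2[OF conjunct2[OF conjunct2[OF conjunct2[OF conjunct2[OF m]]]]]]]])
     have ok: "okC s u" by (rule conjunct1[OF conjunct2[OF conjunct2[OF conjunct2[OF m]]]])
     have cov: "\<And>q. p - cnt <= q ==> q < p ==> (\<exists>r c. (r, c) \<in> X & ar u 21 r = ord q div n & ar u 31 c = ord q mod n)" by (rule conjunct1[OF conjunct2[OF conjunct2[OF conjunct2[OF conjunct2[OF m]]]], rule_format])
     have don: "\<And>q j. q < p - cnt ==> j < n ==> Bm (ord q mod n) j <= w (ord q) ==> cc u (ord q div n) j <= w (ord q)" by (rule conjunct1[OF conjunct2[OF conjunct2[OF conjunct2[OF conjunct2[OF conjunct2[OF m]]]]], rule_format])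
     have nxt: "\<And>q. p <= q ==> q < ?nn ==> ub <= w (ord q)" by (rule conjunct1[OF conjunct2[OF conjunct2[OF conjunct2[OF conjunct2[OF conjunct2[OF conjunct2[OF m]]]]]], rule_format])
     have h: "h = h0 * 2 ^ lev" "lev = 0 \<or> n * (h * h) < 4 * TM" by (rule conjunct1[OF conjunct2[OF conjunct2[OF conjunct2[OF conjunct2[OF conjunct2[OF conjunct2[OF conjunct2[OF conjunct2[OF conjunct2[OF m]]]]]]]]]], rule conjunct1[OF conjunct2[OF conjunct2[OF conjunct2[OF conjunct2[OF conjunct2[OF conjunct2[OF conjunct2[OF conjunct2[OF conjunct2[OF conjunct2[OF m]]]]]]]]]]])
     have po: "vr u 4 <= vr s 4 + p * Sd" using m by (elim conjE)
     have ck: "ck u <= ?C + 60 * p + 101 * ((p - cnt) * h) + lev * (TM + 100 * ?nn) + (8 + 5 * h) * (flag_sum 12 u + flag_sum 13 u)" using m by (elim conjE)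
     define e' where "e' = ord p"
     have e': "e' < ?nn" using ordn[OF p] by (simp add: e'_def)
     have u11: "ar u 11 = ord" using 2(3) u3(4) by (auto simp: frame_def)
     have e35: "val (Rd 11 (Var 24)) (setv 24 p u) = e'" by (simp add: u11 e'_def)
     let ?u = "setv 28 (w e') (setv 27 (e' mod n) (setv 26 (e' div n) (setv 35 e' (setv 24 p u))))"
     have dm: "e' div n < n" "e' mod n < n" using e_dm[OF e'] by auto
     have wA: "w e' = A (e' div n) (e' mod n)" by (simp add: w_def)
     have ptu: "part ?u nr nc h lb ub cnt X"
     proof -
      have "okC s ?u" by (rule okC_cong[OF ok]) auto
      moreover have "cc ?u = cc u" by (rule cc_cong) auto
      moreover have "chunks ?u q n ?nn x h w' lb ub cnt = chunks u q n ?nn x h w' lb ub cnt" for q x w' by (rule chunks_cong) simp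
      ultimately show ?thesis using pt unfolding part_def okC_def by auto
     qed
     have enu: "env (setv 35 e' (setv 24 p u))" by (rule env_cong[of u]) (use ok in \<open>auto simp: okC_def\<close>)
     have cntn: "cnt < n * n" using cnt(1) p by simp
     have ubw: "ub <= A (e' div n) (e' mod n)" using nxt[of p] p wA by (simp add: e'_def)
     have main: "wp B J addel (wp B J (Cond (Less (Var 21) (Times (Var 5) (Var 20)))
       (Cond (Less (Plus (Var 24) (Num 1)) (Var 7)) Nop (flush P d)) (flush P d)) (M (Suc p))) ?u"
     proof (rule wp_conseq[OF addel_wp[OF ptu _ _ _ dm ubw cnt(2) cntn]], goal_cases)
      case (4 u4)
      then obtain nr' nc' r c where b: "part u4 nr' nc' h lb (A (e' div n) (e' mod n)) (cnt + 1) (insert (r, c) X)"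
       "ar u4 21 r = e' div n" "ar u4 31 c = e' mod n"
       "\<forall>r c. (r, c) \<in> X --> ar u4 21 r = ar ?u 21 r & ar u4 31 c = ar ?u 31 c" "ck u4 <= ck ?u + 30" by blast
      then have a: "part u4 nr' nc' h lb (w e') (cnt + 1) (insert (r, c) X)" "ar u4 21 r = e' div n" "ar u4 31 c = e' mod n"
       "\<And>r c. (r, c) \<in> X ==> ar u4 21 r = ar u 21 r & ar u4 31 c = ar u 31 c" "ck u4 <= ck u + 35" unfolding wA by simp_all
      have u4: "\<And>a. a \<notin> {20,21,22,23,24,25,30,31,32,33,34,35} ==> ar u4 a = ar u a" "\<And>x. x \<notin> {26,27,28,24,35,29,22,30,23,21} ==> vr u4 x = vr u x" "vr u4 24 = p"
       using 4(2) by (auto simp: frame_def)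
      have vu4: "vr u4 21 = cnt + 1" "vr u4 20 = h" "vr u4 5 = n" "vr u4 7 = ?nn" using a(1) by (auto simp: part_def env_def)
      have ok4: "okC s u4"
      proof -
       have "env u4" "sound u4" using a(1) by (auto simp: part_def)
       then show ?thesis using ok cc_cong[of u4 u] u4(1)[of 0] unfolding okC_def by auto
      qed
      have cc4: "cc u4 = cc u" by (rule cc_cong) (use u4 in auto)
      have cov4: "\<exists>r' c'. (r', c') \<in> insert (r, c) X & ar u4 21 r' = ord q div n & ar u4 31 c' = ord q mod n" if "Suc p - (cnt + 1) <= q" "q < Suc p" for q
      proof (cases "q = p")
       case True then show ?thesis using a(2,3) unfolding e'_def by blast
      next
       case False
       then have "p - cnt <= q" "q < p" using that by auto
       from cov[OF this] show ?thesis using a(4) by (metis insertI2)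
      qed
      have nxt4: "w e' <= w (ord q)" if "Suc p <= q" "q < ?nn" for q using ord(2)[of p q] that by (simp add: e'_def)
      have po4: "vr u4 4 <= vr s 4 + p * Sd" using u4(2) po by simp
      have fs4: "flag_sum 12 u4 = flag_sum 12 u" "flag_sum 13 u4 = flag_sum 13 u" by (simp_all add: flag_sum_def u4)
      have ck4: "ck u4 <= ?C + 60 * p + 35 + 101 * ((p - cnt) * h) + lev * (TM + 100 * ?nn) + (8 + 5 * h) * (flag_sum 12 u4 + flag_sum 13 u4)"
       using ck a(5) unfolding fs4 by linarith
      have noflush: "M (Suc p) (tck (tck (tck u4)))" if "cnt + 1 < n * h" "Suc p < ?nn"
      proof -
       let ?w = "tck (tck (tck u4))"
       have "part ?w nr' nc' h lb (w e') (cnt + 1) (insert (r, c) X)"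
       proof -
        have "okC s ?w" by (rule okC_cong[OF ok4]) auto
        moreover have "cc ?w = cc u4" by (rule cc_cong) auto
        moreover have "chunks ?w q n ?nn x h w' lb ub cnt = chunks u4 q n ?nn x h w' lb ub cnt" for q x w' ub cnt by (rule chunks_cong) simp
        ultimately show ?thesis using a(1) unfolding part_def okC_def by auto
       qed
       moreover have "okC s ?w" by (rule okC_cong[OF ok4]) auto
       moreover have "cc ?w = cc u" using cc_cong[of ?w u4] cc4 by simp
       moreover have "flag_sum fl ?w = flag_sum fl u4" for fl by (simp add: flag_sum_def)
       ultimately show ?thesis unfolding M_def MM_def
        apply -
        apply (rule exI[of _ nr'], rule exI[of _ nc'], rule exI[of _ h], rule exI[of _ lev], rule exI[of _ lb], rule exI[of _ "w e'"], rule exI[of _ "cnt + 1"], rule exI[of _ "insert (r, c) X"])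
        using cov4 don nxt4 that h po4 ck4 cnt by (intro conjI) auto
      qed
      have hl: "h0 <= h" using h(1) by simp
      have flu: "wp B J (flush P d) (M (Suc p)) w4" if w4: "w4 = tck u4 \<or> w4 = tck (tck u4)" and full: "cnt + 1 = n * h \<or> Suc p = ?nn" for w4
      proof -
       have wq: "vr w4 = vr u4" "ar w4 = ar u4" "pm w4 = pm u4" "ck w4 <= ck u4 + 2" using w4 by auto
       have okw: "okC s w4" by (rule okC_cong[OF ok4]) (use wq in auto)
       have ccw: "cc w4 = cc u4" by (rule cc_cong) (use wq in auto)
       have ptw: "part w4 nr' nc' h lb (w e') (cnt + 1) (insert (r, c) X)"
       proof -
        have "chunks w4 q n ?nn x h w' lb ub cnt = chunks u4 q n ?nn x h w' lb ub cnt" for q x w' ub cnt by (rule chunks_cong) (simp add: wq)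
        then show ?thesis using a(1) okw ccw unfolding part_def okC_def by (auto simp: wq)
       qed
       have pB: "vr w4 4 + Sd <= B"
       proof -
        have "(p + 1) * Sd <= ?nn * Sd" using p by (intro mult_right_mono) auto
        then show ?thesis using po4 bB(1) wq by (simp add: algebra_simps)
       qed
       have fsw: "flag_sum fl w4 = flag_sum fl u4" for fl by (simp add: flag_sum_def wq)
       show ?thesis
       proof (rule wp_conseq[OF flush_wp[OF ptw hB[OF h] pB]], goal_cases)
        case (1 z)
        then obtain h' t where z: "t <= TM" "h' = (if n * (h * h) < t then 2 * h else h)" "part z n n h' (w e') (w e') 0 {}"
         "vr z 4 = vr w4 4 + Sd" "okC w4 z"
         and zc: "\<And>r' c' j. (r', c') \<in> insert (r, c) X ==> j < n ==> Bm (ar u4 31 c') j <= A (ar u4 21 r') (ar u4 31 c') ==> cc z (ar u4 21 r') j <= A (ar u4 21 r') (ar u4 31 c')"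
         and zf: "flag_sum 12 u4 <= flag_sum 12 z" "flag_sum 13 u4 <= flag_sum 13 z"
         and zk: "ck z <= ck w4 + t + 100 * (n * n) + (8 + 5 * h) * ((flag_sum 12 z - flag_sum 12 u4) + (flag_sum 13 z - flag_sum 13 u4))"
         unfolding wq fsw by blast
        have okz: "okC s z" by (rule okC_trans[OF okw z(5)])
        define lev' where "lev' = (if n * (h * h) < t then Suc lev else lev)"
        \<comment> \<open>The product that triggers a doubling took more than
          \<open>n * (h * h)\<close> and at most \<open>TM\<close> steps; for the doubled chunk size
          this becomes a bound by \<open>4 * TM\<close>.\<close>
        have h': "h' = h0 * 2 ^ lev'" "lev' = 0 \<or> n * (h' * h') < 4 * TM" "h <= h'"
         using z(1,2) h by (auto simp: lev'_def)
        have donz: "cc z (ord q div n) j <= w (ord q)" if q: "q < Suc p" "j < n" "Bm (ord q mod n) j <= w (ord q)" for q j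
        proof (cases "q < p - cnt")
         case True
         have "q < ?nn" using q p by simp
         then have "ord q div n < n" using e_dm ordn by blast
         then have "cc z (ord q div n) j <= cc w4 (ord q div n) j" using z(5) q by (simp add: okC_def)
         then show ?thesis using don[OF True q(2,3)] ccw cc4 by simp
        next
         case False
         then obtain r' c' where "(r', c') \<in> insert (r, c) X" "ar u4 21 r' = ord q div n" "ar u4 31 c' = ord q mod n"
          using cov4[of q] q by auto
         then show ?thesis using zc[of r' c' j] q unfolding w_def by auto
        qed
        have fsum: "(8 + 5 * h) * (flag_sum 12 u4 + flag_sum 13 u4) + (8 + 5 * h) * ((flag_sum 12 z - flag_sum 12 u4) + (flag_sum 13 z - flag_sum 13 u4))
          <= (8 + 5 * h') * (flag_sum 12 z + flag_sum 13 z)"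
        proof -
         have "(flag_sum 12 u4 + flag_sum 13 u4) + ((flag_sum 12 z - flag_sum 12 u4) + (flag_sum 13 z - flag_sum 13 u4)) = flag_sum 12 z + flag_sum 13 z"
          using zf by simp
         then have "(8 + 5 * h) * (flag_sum 12 u4 + flag_sum 13 u4) + (8 + 5 * h) * ((flag_sum 12 z - flag_sum 12 u4) + (flag_sum 13 z - flag_sum 13 u4))
          = (8 + 5 * h) * (flag_sum 12 z + flag_sum 13 z)" by (metis distrib_left)
         also have "\<dots> <= (8 + 5 * h') * (flag_sum 12 z + flag_sum 13 z)" using h'(3) by (intro mult_right_mono) auto
         finally show ?thesis .
        qed
        have cost: "101 * ((p - cnt) * h) + lev * (TM + 100 * ?nn) + t + 100 * ?nn \<le>
          101 * (Suc p * h') + lev' * (TM + 100 * ?nn) + (if Suc p = ?nn then 101 * (n * (h' * h')) else 0)"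
        proof (cases "n * (h * h) < t")
         case True
         then have "lev' * (TM + 100 * ?nn) = lev * (TM + 100 * ?nn) + TM + 100 * ?nn" by (simp add: lev'_def)
         moreover have "(p - cnt) * h <= Suc p * h'" using h'(3) by (intro mult_mono) auto
         ultimately show ?thesis using z(1) by simp
        next
         case False
         then have eq: "lev' = lev" "h' = h" using z(2) by (auto simp: lev'_def)
         have t: "t + 100 * ?nn <= 101 * (n * (h * h))" using False h0nn[OF hl] by linarith
         show ?thesis
         proof (cases "Suc p = ?nn")
          case True
          have "(p - cnt) * h <= Suc p * h" by (intro mult_right_mono) auto
          then show ?thesis unfolding eq if_P[OF True] using t by linarith
         next
          case False
          then have "cnt + 1 = n * h" using full by simp
          then have "(p - cnt) * h + n * (h * h) = Suc p * h" using cnt(1)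
           by (metis Suc_eq_plus1 add_mult_distrib diff_Suc_Suc le_add_diff_inverse2 mult.assoc Suc_le_mono)
          then have "101 * ((p - cnt) * h) + 101 * (n * (h * h)) = 101 * (Suc p * h)" by (simp only: distrib_left[symmetric])
          then show ?thesis unfolding eq if_not_P[OF False] using t by linarith
         qed
        qed
        have ckz: "ck z <= ?C + 60 * Suc p + 101 * (Suc p * h') + lev' * (TM + 100 * ?nn) + (8 + 5 * h') * (flag_sum 12 z + flag_sum 13 z) +
          (if Suc p = ?nn then 101 * (n * (h' * h')) else 0)"
         by (rule flush_account[OF zk ck4 wq(4) fsum cost])
        have poz: "vr z 4 <= vr s 4 + Suc p * Sd" using z(4) po4 wq by simp
        show "M (Suc p) z"
         unfolding M_def MM_def
         apply (rule exI[of _ n], rule exI[of _ n], rule exI[of _ h'], rule exI[of _ lev'], rule exI[of _ "w e'"], rule exI[of _ "w e'"], rule exI[of _ 0], rule exI[of _ "{}"])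
         using z(3) okz donz nxt4 h' poz ckz hl v(4) n1 by (intro conjI) auto
       qed
      qed
      show ?case
      proof (cases "cnt + 1 < n * h")
       case True
       show ?thesis
       proof (cases "Suc p < ?nn")
        case False
        then show ?thesis using True flu[of "tck (tck u4)"] p vu4 u4(3) by simp
       qed (use True noflush vu4 u4(3) in simp)
      next
       case False
       then show ?thesis using flu[of "tck u4"] cnt(2) vu4 by simp
      qed
     qed (use wA in auto)
     have "e' <= B" using e' nleB by simp
     then show ?case unfolding wp_simps(5) wp_simps(1) e35
      by (intro conjI geta_wp[OF enu _ e']) (use main in auto)
    next
     case (3 u)
     have "M ?nn u" using 3(1) l3 by simp
     then obtain nr nc h lev lb ub cnt X where mm: "MM ?nn u nr nc h lev lb ub cnt X" unfolding M_def by blast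
     then have c0: "cnt = 0" "X = {}" unfolding MM_def by simp_all
     note m = mm[unfolded MM_def c0 if_P[OF refl] diff_zero]
     have pt: "part u nr nc h lb ub 0 {}" by (rule conjunct1[OF m])
     have ok: "okC s u" by (rule conjunct1[OF conjunct2[OF conjunct2[OF conjunct2[OF m]]]])
     have don: "\<And>q j. q < ?nn ==> j < n ==> Bm (ord q mod n) j <= w (ord q) ==> cc u (ord q div n) j <= w (ord q)" by (rule conjunct1[OF conjunct2[OF conjunct2[OF conjunct2[OF conjunct2[OF conjunct2[OF m]]]]], rule_format])
     have h: "h = h0 * 2 ^ lev" "lev = 0 \<or> n * (h * h) < 4 * TM" by (rule conjunct1[OF conjunct2[OF conjunct2[OF conjunct2[OF conjunct2[OF conjunct2[OF conjunct2[OF conjunct2[OF conjunct2[OF conjunct2[OF m]]]]]]]]]], rule conjunct1[OF conjunct2[OF conjunct2[OF conjunct2[OF conjunct2[OF conjunct2[OF conjunct2[OF conjunct2[OF conjunct2[OF conjunct2[OF conjunct2[OF m]]]]]]]]]]])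
     have po: "vr u 4 <= vr s 4 + ?nn * Sd" using m by (elim conjE)
     have ck: "ck u <= ?C + 60 * ?nn + 101 * (?nn * h) + lev * (TM + 100 * ?nn) + (8 + 5 * h) * (flag_sum 12 u + flag_sum 13 u) + 101 * (n * (h * h))" using m by (elim conjE)
     let ?w = "setv 24 (vr u3 7) u"
     have okw: "okC s ?w" by (rule okC_cong[OF ok]) auto
     have ccw: "cc ?w = cc u" by (rule cc_cong) auto
     have cor: "cc u i j <= A i k" if "i < n" "k < n" "j < n" "Bm k j <= A i k" for i k j
     proof -
      have "i * n + k \<in> ord ` {..<?nn}" using ord(1) lt[OF that(1,2)] by (simp add: bij_betw_def)
      then obtain q where q: "q < ?nn" "ord q = i * n + k" by auto
      have "(i * n + k) div n = i" "(i * n + k) mod n = k" using that by auto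
      then show ?thesis using don[OF q(1) that(3)] that(4) q(2) by (simp add: w_def)
     qed
     have pz: "pm u x = 0" if "vr u 4 <= x" for x using pt that unfolding part_def by simp
     have "flag_sum 12 u <= ?nn * 1" "flag_sum 13 u <= ?nn * 1"
      using pt sum_bounded_above[of "{..<?nn}" "ar u 12" 1] sum_bounded_above[of "{..<?nn}" "ar u 13" 1] unfolding part_def flag_sum_def by auto
     then have "(8 + 5 * h) * (flag_sum 12 u + flag_sum 13 u) <= (8 + 5 * h) * (2 * ?nn)" by (intro mult_left_mono) auto
     also have "\<dots> = 16 * ?nn + 10 * (?nn * h)" by (simp add: algebra_simps)
     finally have "ck ?w <= ck s + half_time h lev" using ck unfolding half_time_def by simp
     then show ?case using okw cor ccw po pz h by auto
    qed
   qed
   then show ?case using u s7 v bB l by (simp add: u2_def)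
  qed (use u1 in auto)
 qed
qed

end

section \<open>The full (min,max)-product\<close>

definition rdy :: "nat => nat => nat => st => bool" where
 "rdy n Sd h0 s \<longleftrightarrow> vr s 2 = 2 * n & vr s 9 = Sd & vr s 10 = h0 & (\<forall>x\<ge>vr s 4. pm s x = 0)"

definition prod_vars :: "nat set" where
 "prod_vars = {36,35,26,27,28,20,22,23,21,24,29,30,31,3,37,32,4,33,15,16,18,19}"

text \<open>The result is described through its comparisons with the values below \<open>iv\<close>,
  the form in which distance tables are read. \<open>inc\<close> bounds the window memory used up
  and \<open>TP\<close> the time, so the fast and the cubic program satisfy one
  specification.\<close>

definition prod_ok :: "nat => nat list => nat => nat => nat => nat => nat => nat => com => bool" where
 "prod_ok B J n iv Sd h0 inc TP pc \<longleftrightarrow> (\<forall>s bA bB bC A Bm.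
   vr s 5 = n --> vr s 7 = n * n --> vr s 8 = iv --> vr s 15 = bA --> vr s 16 = bB --> vr s 17 = bC -->
   bA + n * n <= bC --> bB + n * n <= bC --> bA <= B --> bB <= B -->
   (\<forall>i<n. \<forall>k<n. ar s 0 (bA + (i * n + k)) = A i k & ar s 0 (bB + (i * n + k)) = Bm i k & A i k <= iv & Bm i k <= iv) -->
   rdy n Sd h0 s --> vr s 4 + inc <= B -->
   wp B J pc (\<lambda>u. (\<forall>i<n. \<forall>j<n. ar u 0 (bC + (i * n + j)) <= iv &
     (\<forall>v<iv. ar u 0 (bC + (i * n + j)) <= v \<longleftrightarrow> (\<exists>k<n. A i k <= v & Bm k j <= v))) &
    (\<forall>x. x < bC \<or> bC + n * n <= x --> ar u 0 x = ar s 0 x) & rdy n Sd h0 u & vr u 4 <= vr s 4 + inc & ck u <= ck s + TP) s)"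

definition prod_fast :: "ram_com => nat => com" where
 "prod_fast P d = For 35 7 (Sto 0 (Plus (Var 17) (Var 35)) (Var 8));; Asg 18 (Var 5);; Asg 19 (Num 1);; halfprod P d;;
   Asg 33 (Var 15);; Asg 15 (Var 16);; Asg 16 (Var 33);; Asg 18 (Num 1);; Asg 19 (Var 5);; halfprod P d"

text \<open>For exponents above 3: there the cubic time is already below the claimed bound.\<close>

definition prod_naive :: com where
 "prod_naive = Asg 18 (Var 5);; Asg 19 (Num 1);;
   For 35 7 (Asg 26 (Quot (Var 35) (Var 5));; Asg 31 (Minus (Var 35) (Times (Var 26) (Var 5)));; Sto 0 eC (Var 8);;
    For 27 5 (Asg 28 (Rd 0 eA);; Cond (Less (Var 28) (Rd 0 eB)) (Asg 28 (Rd 0 eB)) Nop;;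
     Cond (Less (Var 28) (Rd 0 eC)) (Sto 0 eC (Var 28)) Nop))"

lemma mv_prod [simp]: "mv (prod_fast P d) = prod_vars" "wf_com (prod_fast P d)" "mv prod_naive \<subseteq> prod_vars" "wf_com prod_naive"
 "ma (prod_fast P d) = {0,10,11,12,13,20,21,22,23,24,25,30,31,32,33,34,35}" "ma prod_naive = {0}" "\<not> mp prod_naive"
 by (auto simp: prod_fast_def prod_naive_def prod_vars_def)

definition htime :: "nat => nat => nat => nat => nat => nat" where
 "htime n iv TM h lev = 300 + 400 * (n * n) + 10 * iv + 111 * (n * n * h) + lev * (TM + 100 * (n * n)) + 101 * (n * (h * h))"

text \<open>For each \<open>k\<close> one of \<open>A i k\<close> and \<open>B k j\<close> is the
  larger. The first half brings the result down to \<open>A i k\<close> where it dominates, the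
  second half, run on the transposed problem, to \<open>B k j\<close>; soundness passes from one to
  the other because both speak of the same cells.\<close>

lemma prod_fast_ok:
 assumes mm: "\<And>A' B'. (\<forall>i<2*n. \<forall>j<2*n. \<bar>A' i j\<bar> <= 1 & \<bar>B' i j\<bar> <= 1) ==>
   \<exists>t f. exec ((int (2*n) + 2) ^ d) P (matmul_input (2*n) A' B') t f & t <= TM &
    (\<forall>i<2*n. \<forall>j<2*n. mem f (2 * (2*n)\<^sup>2 + i * (2*n) + j) = (\<Sum>l<2*n. A' i l * B' l j))"
  and d1: "1 <= d" and Sd: "Sd = 2 * (2*n)\<^sup>2 + (2*n + 2) ^ d" and SdB: "Sd <= B" and TMB: "8 * TM <= B"
  and infB: "iv + 2 <= B" and nB: "2 * (n * n) + 1 <= B" and n1: "1 <= n" and h0: "0 < h0" "n <= h0 * h0" "2 * h0 <= B"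
  and TP: "\<And>h lev. h = h0 * 2 ^ lev ==> lev = 0 \<or> n * (h * h) < 4 * TM ==> 2 * htime n iv TM h lev + 2 * (n * n) + 20 <= TP"
 shows "prod_ok B J n iv Sd h0 (2 * (n * n * Sd)) TP (prod_fast P d)"
 unfolding prod_ok_def
proof (intro allI impI, goal_cases)
 case (1 s bA bB bC A Bm)
 let ?Q = "\<lambda>u. (\<forall>i<n. \<forall>j<n. ar u 0 (bC + (i * n + j)) <= iv &
     (\<forall>v<iv. ar u 0 (bC + (i * n + j)) <= v \<longleftrightarrow> (\<exists>k<n. A i k <= v & Bm k j <= v))) &
    (\<forall>x. x < bC \<or> bC + n * n <= x --> ar u 0 x = ar s 0 x) & rdy n Sd h0 u & vr u 4 <= vr s 4 + 2 * (n * n * Sd) & ck u <= ck s + TP"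
 note v = 1(1-6) and dj = 1(7,8) and tab = 1(11) and rd = 1(12) and inc = 1(13)
 have TMB': "TM <= B" using TMB by simp
 have nleB: "n <= B" using nB le_square[of n] by linarith
 interpret h1: halfm B J n A Bm bA bB bC n 1 iv P d TM Sd
  by unfold_locales (erule mm | use d1 Sd SdB TMB' infB nB n1 dj tab in \<open>auto; fail\<close>)+
 interpret h2: halfm B J n "\<lambda>j k. Bm k j" "\<lambda>k i. A i k" bB bA bC 1 n iv P d TM Sd
  by unfold_locales (erule mm | use d1 Sd SdB TMB' infB nB n1 dj tab in \<open>auto; fail\<close>)+
 have ht: "h1.half_time = htime n iv TM" "h2.half_time = htime n iv TM"
  by (simp_all add: fun_eq_iff h1.half_time_def h2.half_time_def htime_def)
 have lt: "i * n + k < n * n" if "i < n" "k < n" for i k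
 proof -
  have "i * n + k < (i + 1) * n" using that by simp
  also have "\<dots> <= n * n" using that by (intro mult_right_mono) auto
  finally show ?thesis .
 qed
 show ?case
  unfolding prod_fast_def wp_simps(5)
 proof (rule wp_For[where I = "\<lambda>l u. ck u <= ck s + 2 * l & (\<forall>x. ar u 0 x = (if bC <= x & x < bC + l then iv else ar s 0 x))"], goal_cases)
  case 1 then show ?case by simp
 next
  case (2 l u)
  then have "vr u 17 = bC" "vr u 8 = iv" using v by (auto simp: frame_def)
  then show ?case using 2 infB by auto
 next
  case (3 u)
  define u1 where "u1 = setv 19 1 (setv 18 n (setv 35 (n * n) u))"
  have u: "\<And>x. x \<noteq> 35 ==> vr u x = vr s x" "\<And>a. a \<noteq> 0 ==> ar u a = ar s a" "pm u = pm s" using 3(2) by (auto simp: frame_def)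
  have uc: "ck u <= ck s + 2 * (n * n)" "\<And>x. ar u 0 x = (if bC <= x & x < bC + n * n then iv else ar s 0 x)" using 3(1) v by auto
  have u1: "\<And>x. x \<notin> {35,18,19} ==> vr u1 x = vr s x" "ar u1 = ar u" "pm u1 = pm s" "ck u1 = ck u + 3" "vr u1 18 = n" "vr u1 19 = 1"
   using u by (auto simp: u1_def)
  have e1: "h1.env u1"
   unfolding h1.env_def
  proof (intro conjI allI impI)
   fix i k assume "i < n" "k < n"
   then show "ar u1 0 (bA + (i * n + k * 1)) = A i k" "ar u1 0 (bB + (i * n + k * 1)) = Bm i k"
    using tab lt[of i k] dj by (auto simp: u1 uc)
  qed (use u1 v in auto)
  have cc1: "h1.cc u1 i j = iv" if "i < n" "j < n" for i j unfolding h1.cc_def using lt[OF that] by (simp add: u1 uc)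
  have s1: "h1.sound u1" unfolding h1.sound_def using cc1 by auto
  have r1: "vr u1 2 = 2 * n" "vr u1 9 = Sd" "vr u1 10 = h0" "\<forall>x\<ge>vr u1 4. pm u1 x = 0" "vr u1 4 = vr s 4" using rd u1 by (auto simp: rdy_def)
  have i1: "vr u1 4 + n * n * Sd <= B" using inc r1 by simp
  have "wp B J (halfprod P d) (wp B J (Asg 33 (Var 15)) (wp B J (Asg 15 (Var 16)) (wp B J (Asg 16 (Var 33)) (wp B J (Asg 18 (Num 1)) (wp B J (Asg 19 (Var 5)) (wp B J (halfprod P d)
    ?Q)))))) u1"
  proof (rule wp_conseq[OF h1.halfprod_wp[OF e1 s1 r1(1,2,3) h0(1,2) r1(4) i1 h0(3) TMB]], goal_cases)
   case (1 u2)
   then obtain h lev where k2: "h = h0 * 2 ^ lev" "lev = 0 \<or> n * (h * h) < 4 * TM" "ck u2 <= ck u1 + htime n iv TM h lev"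
    and ok2: "h1.okC u1 u2" and cor2: "\<forall>i<n. \<forall>k<n. \<forall>j<n. Bm k j <= A i k --> h1.cc u2 i j <= A i k"
    and po2: "vr u2 4 <= vr u1 4 + n * n * Sd" "\<forall>x\<ge>vr u2 4. pm u2 x = 0" unfolding ht by blast
   define u3 where "u3 = setv 19 n (setv 18 1 (setv 16 bA (setv 15 bB (setv 33 bA u2))))"
   have v2: "vr u2 x = vr s x" if "x \<in> {2,5,7,8,9,10,15,16,17}" for x using 1(2) u1(1)[of x] that by (auto simp: frame_def)
   have u3: "\<And>x. x \<notin> {33,15,16,18,19} ==> vr u3 x = vr u2 x" "ar u3 = ar u2" "pm u3 = pm u2" "ck u3 = ck u2 + 5" by (auto simp: u3_def)
   have e3: "h2.env u3"
    unfolding h2.env_def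
   proof (intro conjI allI impI)
    fix i k assume ik: "i < n" "k < n"
    have "h1.env u2" using ok2 unfolding h1.okC_def by blast
    then have "ar u2 0 (bA + (k * n + i * 1)) = A k i" "ar u2 0 (bB + (k * n + i * 1)) = Bm k i" using ik unfolding h1.env_def by blast+
    then show "ar u3 0 (bB + (i * 1 + k * n)) = Bm k i" "ar u3 0 (bA + (i * 1 + k * n)) = A k i" by (simp_all add: u3 add.commute)
   qed (use v2 v in \<open>auto simp: u3_def\<close>)
   have cceq: "h2.cc z j i = h1.cc z i j" for z i j unfolding h1.cc_def h2.cc_def by (simp add: add.commute)
   have cc32: "h1.cc u3 = h1.cc u2" by (rule h1.cc_cong) (simp add: u3)
   have s3: "h2.sound u3" using ok2 unfolding h1.okC_def h1.sound_def h2.sound_def cceq cc32 by blast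
   have r3: "vr u3 2 = 2 * n" "vr u3 9 = Sd" "vr u3 10 = h0" "\<forall>x\<ge>vr u3 4. pm u3 x = 0" "vr u3 4 = vr u2 4" using rd v2 po2 u3 by (auto simp: rdy_def)
   have i3: "vr u3 4 + n * n * Sd <= B" using inc r1 r3 po2 by simp
   have "wp B J (halfprod P d) ?Q u3"
   proof (rule wp_conseq[OF h2.halfprod_wp[OF e3 s3 r3(1,2,3) h0(1,2) r3(4) i3 h0(3) TMB]], goal_cases)
    case (1 u4)
    then obtain h' lev' where k4: "h' = h0 * 2 ^ lev'" "lev' = 0 \<or> n * (h' * h') < 4 * TM" "ck u4 <= ck u3 + htime n iv TM h' lev'"
     and ok4: "h2.okC u3 u4" and cor4: "\<forall>i<n. \<forall>k<n. \<forall>j<n. A j k <= Bm k i --> h2.cc u4 i j <= Bm k i"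
     and po4: "vr u4 4 <= vr u3 4 + n * n * Sd" "\<forall>x\<ge>vr u4 4. pm u4 x = 0" unfolding ht by blast
    have snd4: "h1.cc u4 i j <= iv & (h1.cc u4 i j = iv \<or> (\<exists>k<n. A i k <= h1.cc u4 i j & Bm k j <= h1.cc u4 i j))" if "i < n" "j < n" for i j
     using ok4 that unfolding h2.okC_def h2.sound_def cceq by blast
    have mono: "h1.cc u4 i j <= h1.cc u2 i j" if "i < n" "j < n" for i j
     using ok4 that unfolding h2.okC_def cceq cc32 by blast
    have cmp: "h1.cc u4 i j <= max (A i k) (Bm k j)" if ijk: "i < n" "j < n" "k < n" for i j k
    proof (cases "Bm k j <= A i k")
     case True
     then have "h1.cc u2 i j <= A i k" using cor2 ijk by blast
     then show ?thesis using mono[OF ijk(1,2)] by simp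
    next
     case False
     then have "A i k <= Bm k j" by simp
     then have "h1.cc u4 i j <= Bm k j" using cor4 ijk unfolding cceq by blast
     then show ?thesis by simp
    qed
    have eqv: "h1.cc u4 i j <= v \<longleftrightarrow> (\<exists>k<n. A i k <= v & Bm k j <= v)" if ij: "i < n" "j < n" "v < iv" for i j v
    proof
     assume "h1.cc u4 i j <= v"
     then show "\<exists>k<n. A i k <= v & Bm k j <= v" using snd4[OF ij(1,2)] ij(3) by fastforce
    next
     assume "\<exists>k<n. A i k <= v & Bm k j <= v"
     then show "h1.cc u4 i j <= v" using cmp[OF ij(1,2)] by fastforce
    qed
    have ccx: "ar u4 0 (bC + (i * n + j)) = h1.cc u4 i j" for i j unfolding h1.cc_def by simp
    have out: "ar u4 0 x = ar s 0 x" if "x < bC \<or> bC + n * n <= x" for x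
    proof -
     have "ar u4 0 x = ar u3 0 x" "ar u2 0 x = ar u1 0 x" using ok4 ok2 that unfolding h1.okC_def h2.okC_def by blast+
     then show ?thesis using that by (auto simp: u3 u1 uc)
    qed
    have v4: "vr u4 x = vr u3 x" if "x \<in> {2,9,10}" for x using 1(2) that by (auto simp: frame_def)
    have "rdy n Sd h0 u4" using v4 r3 po4 by (simp add: rdy_def)
    moreover have "vr u4 4 <= vr s 4 + 2 * (n * n * Sd)" using po4(1) r3(5) po2(1) r1(5) by simp
    moreover have "ck u4 <= ck s + TP"
     using k4(3) u3(4) k2(3) u1(4) uc(1) TP[OF k2(1,2)] TP[OF k4(1,2)] by linarith
    ultimately show ?case using out snd4 eqv unfolding ccx by blast
   qed
   then have "wp B J (halfprod P d) ?Q
    (setv 19 n (setv 18 1 (setv 16 bA (setv 15 bB (setv 33 bA u2)))))" unfolding u3_def .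
   moreover have "vr u2 15 = bA" "vr u2 16 = bB" "vr u2 5 = n" using v2 v by auto
   moreover have "1 <= B" using n1 nleB by simp
   ultimately show ?case using \<open>bA <= B\<close> \<open>bB <= B\<close> nleB by simp
  qed
  moreover have "val (Var 5) (setv 35 (n * n) u) = n" using u(1)[of 5] v by simp
  moreover have "1 <= B" using n1 nleB by simp
  ultimately show ?case unfolding u1_def v(2) wp_simps(1)[of _ _ 18 "Var 5"] wp_simps(1)[of _ _ 19 "Num 1"] val.simps(1) using nleB by (simp only: simp_thms)
 qed
qed

lemma prod_naive_ok:
 assumes infB: "iv + 2 <= B" and nB: "2 * (n * n) + 1 <= B" and n1: "1 <= n"
 shows "prod_ok B J n iv Sd h0 inc (10 + 20 * (n * n * n)) prod_naive"
 unfolding prod_ok_def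
proof (intro allI impI, goal_cases)
 case (1 s bA bB bC A Bm)
 note v = 1(1-6) and dj = 1(7,8) and tab = 1(11) and rd = 1(12) and inc = 1(13)
 have nleB: "n <= B" using nB le_square[of n] by linarith
 have lt: "i * n + k < n * n" if "i < n" "k < n" for i k
 proof -
  have "i * n + k < (i + 1) * n" using that by simp
  also have "\<dots> <= n * n" using that by (intro mult_right_mono) auto
  finally show ?thesis .
 qed
 let ?s = "setv 19 1 (setv 18 n s)"
 define I0 where "I0 l u \<longleftrightarrow> (\<forall>x. x < bC \<or> bC + l <= x --> ar u 0 x = ar s 0 x) &
   (\<forall>e<l. ar u 0 (bC + e) <= iv & (\<forall>v<iv. ar u 0 (bC + e) <= v \<longleftrightarrow> (\<exists>k<n. A (e div n) k <= v & Bm k (e mod n) <= v)))" for l and u :: st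
 define I where "I l u \<longleftrightarrow> ck u <= ck s + 2 + l * (5 + 8 * n) & I0 l u" for l and u :: st
 have "wp B J (For 35 7 (Asg 26 (Quot (Var 35) (Var 5));; Asg 31 (Minus (Var 35) (Times (Var 26) (Var 5)));; Sto 0 eC (Var 8);;
    For 27 5 (Asg 28 (Rd 0 eA);; Cond (Less (Var 28) (Rd 0 eB)) (Asg 28 (Rd 0 eB)) Nop;;
     Cond (Less (Var 28) (Rd 0 eC)) (Sto 0 eC (Var 28)) Nop))) (\<lambda>u. I0 (n * n) u & ck u <= ck s + 3 + n * n * (5 + 8 * n)) ?s"
 proof (rule wp_For[where I = I], goal_cases)
  case 1 then show ?case by (simp add: I_def I0_def)
 next
  case (2 l u)
  have l: "l < n * n" using 2(1) v by simp
  define i j where "i = l div n" and "j = l mod n"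
  have ij: "i < n" "j < n" "l = i * n + j" using l n1 by (auto simp: i_def j_def less_mult_imp_div_less)
  have vu: "vr u 5 = n" "vr u 7 = n * n" "vr u 8 = iv" "vr u 15 = bA" "vr u 16 = bB" "vr u 17 = bC" "vr u 18 = n" "vr u 19 = 1"
   using 2(3) v by (auto simp: frame_def)
  let ?w = "seta 0 (bC + l) iv (setv 31 j (setv 26 i (setv 35 l u)))"
  have ll: "i * n + j = l" "l - i * n = j" "l div n = i" using ij(3) i_def by linarith+
  have st: "val (Quot (Var 35) (Var 5)) (setv 35 l u) = i" "val (Minus (Var 35) (Times (Var 26) (Var 5))) (setv 26 i (setv 35 l u)) = j"
   "val eC (setv 31 j (setv 26 i (setv 35 l u))) = bC + l" "val (Var 8) (setv 31 j (setv 26 i (setv 35 l u))) = iv"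
   by (simp_all add: vu ll)
  define INV where "INV k z \<longleftrightarrow> ck z <= ck u + 4 + 7 * k & (\<forall>x. x \<noteq> bC + l --> ar z 0 x = ar u 0 x) &
    ar z 0 (bC + l) <= iv & (\<forall>v<iv. ar z 0 (bC + l) <= v \<longleftrightarrow> (\<exists>k'<k. A i k' <= v & Bm k' j <= v))" for k and z :: st
  have inner: "wp B J (For 27 5 (Asg 28 (Rd 0 eA);; Cond (Less (Var 28) (Rd 0 eB)) (Asg 28 (Rd 0 eB)) Nop;;
     Cond (Less (Var 28) (Rd 0 eC)) (Sto 0 eC (Var 28)) Nop)) (I (Suc l)) ?w"
  proof (rule wp_For[where I = INV], goal_cases)
   case 1 then show ?case by (simp add: INV_def)
  next
   case (2 k z)
   have k: "k < n" using 2(1) vu by simp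
   have vz: "vr z 26 = i" "vr z 31 = j" "vr z 15 = bA" "vr z 16 = bB" "vr z 17 = bC" "vr z 18 = n" "vr z 19 = 1" using 2(3) vu by (auto simp: frame_def)
   have "bA + (i * n + k) < bC" "bB + (k * n + j) < bC" using lt[OF ij(1) k] lt[OF k ij(2)] dj by auto
   then have ab: "ar z 0 (bA + (i * n + k)) = A i k" "ar z 0 (bB + (k * n + j)) = Bm k j"
    using 2(2) \<open>I l u\<close> tab ij k unfolding I_def I0_def INV_def by auto
   have AB: "A i k <= B" "Bm k j <= B" using tab ij k infB by (meson add_leD1 le_trans)+
   have l': "bC + (i * n + j) = bC + l" using ll by simp
   have post: "INV (Suc k) z'" if z': "\<And>x. x \<noteq> bC + l ==> ar z' 0 x = ar z 0 x" "ar z' 0 (bC + l) = min (ar z 0 (bC + l)) (max (A i k) (Bm k j))" "ck z' <= ck z + 7" for z'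
    unfolding INV_def
   proof (intro conjI allI impI)
    fix v assume v: "v < iv"
    have "ar z 0 (bC + l) <= v \<longleftrightarrow> (\<exists>k'<k. A i k' <= v & Bm k' j <= v)" using 2(2) v unfolding INV_def by blast
    then show "ar z' 0 (bC + l) <= v \<longleftrightarrow> (\<exists>k'<Suc k. A i k' <= v & Bm k' j <= v)" unfolding z'(2) by (auto simp: less_Suc_eq min_le_iff_disj)
   qed (use 2(2) z' in \<open>auto simp: INV_def\<close>)
   let ?z = "setv 27 k z"
   have w1: "val (Rd 0 eA) ?z = A i k" "val (Rd 0 eB) (setv 28 (A i k) ?z) = Bm k j" "val (Rd 0 eB) (tck (setv 28 (A i k) ?z)) = Bm k j"
    using ab vz by simp_all
   have w2: "val eC y = bC + l" if "vr y = (vr z)(27 := k, 28 := a)" for y a using that vz l' by simp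
   show ?case
   proof (cases "A i k < Bm k j")
    case True
    then show ?thesis using AB unfolding wp_simps w1 by (auto simp: vz ab l' intro!: post)
   next
    case False
    then show ?thesis using AB unfolding wp_simps w1 by (auto simp: vz ab l' intro!: post)
   qed
  next
   case (3 z)
   have z: "ar z 0 (bC + l) <= iv" "\<forall>v<iv. ar z 0 (bC + l) <= v \<longleftrightarrow> (\<exists>k'<n. A i k' <= v & Bm k' j <= v)" "\<forall>x. x \<noteq> bC + l --> ar z 0 x = ar u 0 x"
     "ck z <= ck u + 4 + 7 * n" using 3(1) vu unfolding INV_def by auto
   show ?case using \<open>I l u\<close> z unfolding I_def I0_def by (auto simp: less_Suc_eq i_def j_def)
  qed
  have "i <= B" "j <= B" "iv <= B" using ij nleB infB by auto
  then show ?case unfolding wp_simps st using inner by simp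
 next
  case (3 u)
  then show ?case using v by (auto simp: I_def I0_def)
 qed
 then have "wp B J prod_naive (\<lambda>u. I0 (n * n) u & ck u <= ck s + 3 + n * n * (5 + 8 * n)) s"
  using v nleB n1 by (simp add: prod_naive_def)
 then show ?case
 proof (rule wp_conseq)
  fix u assume u: "I0 (n * n) u & ck u <= ck s + 3 + n * n * (5 + 8 * n)" and fr: "frame prod_naive s u"
  have "x \<notin> mv prod_naive" if "x \<in> {2,4,9,10}" for x using that by (auto simp: prod_naive_def)
  then have "vr u x = vr s x" if "x \<in> {2,4,9,10}" for x using fr that unfolding frame_def by blast
  moreover have "pm u = pm s" using fr by (auto simp: frame_def)
  ultimately have "rdy n Sd h0 u" "vr u 4 = vr s 4" using rd by (auto simp: rdy_def)
  moreover have "ck u <= ck s + (10 + 20 * (n * n * n))"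
  proof -
   have "n * n * (5 + 8 * n) = 5 * (n * n) + 8 * (n * n * n)" by (simp add: algebra_simps)
   moreover have "n * n * 1 <= n * n * n" using n1 by (intro mult_left_mono) auto
   ultimately show ?thesis using u by linarith
  qed
  moreover have "ar u 0 (bC + (i * n + j)) <= iv & (\<forall>v<iv. ar u 0 (bC + (i * n + j)) <= v \<longleftrightarrow> (\<exists>k<n. A i k <= v & Bm k j <= v))" if "i < n" "j < n" for i j
  proof -
   have "(i * n + j) div n = i" "(i * n + j) mod n = j" using that by auto
   then show ?thesis using u lt[OF that] unfolding I_def I0_def by metis
  qed
  ultimately show "(\<forall>i<n. \<forall>j<n. ar u 0 (bC + (i * n + j)) <= iv &
     (\<forall>v<iv. ar u 0 (bC + (i * n + j)) <= v \<longleftrightarrow> (\<exists>k<n. A i k <= v & Bm k j <= v))) &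
    (\<forall>x. x < bC \<or> bC + n * n <= x --> ar u 0 x = ar s 0 x) & rdy n Sd h0 u & vr u 4 <= vr s 4 + inc & ck u <= ck s + (10 + 20 * (n * n * n))"
   using u unfolding I_def I0_def by simp
 qed
qed

section \<open>Thresholds\<close>

definition rch :: "edge set => nat => nat => nat => bool" where
 "rch E l x y \<longleftrightarrow> (\<exists>k\<le>l. (x, y) \<in> E ^^ k)"

lemma rch_0 [simp]: "rch E 0 x y \<longleftrightarrow> x = y"
 by (auto simp: rch_def)

lemma rch_1: "rch E 1 x y \<longleftrightarrow> x = y \<or> (x, y) \<in> E"
proof
 assume "rch E 1 x y"
 then obtain k where k: "k <= 1" "(x, y) \<in> E ^^ k" by (auto simp: rch_def)
 then have "k = 0 \<or> k = 1" by auto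
 then show "x = y \<or> (x, y) \<in> E" using k by auto
next
 assume "x = y \<or> (x, y) \<in> E"
 then show "rch E 1 x y" unfolding rch_def by (metis One_nat_def le_numeral_extra(3,4) relpow_0_I relpow_1 zero_le_one)
qed

lemma relpow_verts: "(x, y) \<in> E ^^ k ==> E \<subseteq> {..<n} \<times> {..<n} ==> x < n ==> y < n"
 by (induction k arbitrary: y) auto

lemma rch_mono: "rch E l x y ==> l <= l' ==> rch E l' x y"
 unfolding rch_def using le_trans by blast

text \<open>Splitting a path at a vertex is what makes a threshold table a (min,max)-product: a
  prefix contains both parts if it reaches the larger of their indices, and the best vertex is
  chosen.\<close>

lemma rch_add:
 assumes "E \<subseteq> {..<n} \<times> {..<n}" "x < n"
 shows "rch E (a + b) x y \<longleftrightarrow> (\<exists>z<n. rch E a x z & rch E b z y)"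
proof
 assume "rch E (a + b) x y"
 then obtain k where k: "k <= a + b" "(x, y) \<in> E ^^ k" by (auto simp: rch_def)
 have "k = min k a + (k - min k a)" by simp
 then have "(x, y) \<in> E ^^ (min k a) O E ^^ (k - min k a)" using k(2) relpow_add by metis
 then obtain z where z: "(x, z) \<in> E ^^ (min k a)" "(z, y) \<in> E ^^ (k - min k a)" by blast
 have "z < n" using relpow_verts[OF z(1) assms] .
 moreover have "rch E a x z" using z(1) unfolding rch_def by (intro exI[of _ "min k a"]) auto
 moreover have "rch E b z y" using z(2) k(1) unfolding rch_def by (intro exI[of _ "k - min k a"]) auto
 ultimately show "\<exists>z<n. rch E a x z & rch E b z y" by blast
next
 assume "\<exists>z<n. rch E a x z & rch E b z y"
 then obtain z k k' where z: "k <= a" "(x, z) \<in> E ^^ k" "k' <= b" "(z, y) \<in> E ^^ k'" by (auto simp: rch_def)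
 then have "(x, y) \<in> E ^^ (k + k')" by (auto simp: relpow_add)
 then show "rch E (a + b) x y" using z unfolding rch_def by (intro exI[of _ "k + k'"]) auto
qed

text \<open>A shortest path uses no more steps than there are edges. The bound \<open>n * n\<close>
  is as good as \<open>n\<close> here, since it enters the time through its logarithm.\<close>

lemma relpow_short:
 assumes "E \<subseteq> {..<n} \<times> {..<n}" "(x, y) \<in> E ^^ k"
 shows "\<exists>l\<le>min k (n * n). (x, y) \<in> E ^^ l"
proof -
 define l where "l = (LEAST l. (x, y) \<in> E ^^ l)"
 have l: "(x, y) \<in> E ^^ l" "l <= k" using assms(2) unfolding l_def by (metis LeastI, metis Least_le)
 have "l <= n * n"
 proof (cases "l = 0")
  case False
  have fin: "finite E" using assms(1) finite_subset by blast
  have "E ^^ l \<subseteq> (\<Union>j\<in>{j. 0 < j & j <= card E}. E ^^ j)" using relpow_finite_bounded1[OF fin, of l] False by simp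
  then obtain j where "j <= card E" "(x, y) \<in> E ^^ j" using l by blast
  moreover have "l <= j" using \<open>(x, y) \<in> E ^^ j\<close> unfolding l_def by (rule Least_le)
  moreover have "card E <= card ({..<n} \<times> {..<n})" using assms(1) by (intro card_mono) auto
  ultimately show ?thesis by (simp add: card_cartesian_product)
 qed simp
 then show ?thesis using l by auto
qed

text \<open>The thresholds \<open>2^q (M + i)\<close>: consecutive ones differ by a factor of at most \<open>1 + 1/M\<close>, and each beyond \<open>2 M\<close> is the double of an earlier one.\<close>

function Lf :: "nat => nat => nat" where
 "Lf M k = (if M = 0 \<or> k <= 2 * M then k else 2 * Lf M (k - M))"
 by auto
termination by (relation "measure snd") auto

declare Lf.simps [simp del]

lemma Lf_small: "k <= 2 * M ==> Lf M k = k"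
 by (subst Lf.simps) simp

lemma Lf_double: "1 <= M ==> M <= k ==> Lf M (k + M) = 2 * Lf M k"
proof (cases "k = M")
 case True
 then show ?thesis by (simp add: Lf_small)
qed (subst Lf.simps, simp)

text \<open>Stated up to \<open>i = M\<close>, which coincides with \<open>i = 0\<close> of the next
  block, so that two consecutive thresholds always lie in a common block.\<close>

lemma Lf_form: "1 <= M ==> i <= M ==> Lf M (M + M * q + i) = 2 ^ q * (M + i)"
proof (induction q)
 case 0
 then show ?case by (simp add: Lf_small)
next
 case (Suc q)
 have "M + M * Suc q + i = (M + M * q + i) + M" by simp
 then show ?case using Suc Lf_double[of M "M + M * q + i"] by (simp add: ac_simps)
qed

lemma Lf_decomp:
 fixes M k :: nat
 assumes "1 <= M" "M <= k"
 obtains q i where "i < M" "k = M + M * q + i"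
proof
 show "(k - M) mod M < M" using assms by simp
 show "k = M + M * ((k - M) div M) + (k - M) mod M" using assms by simp
qed

lemma Lf_step:
 assumes "1 <= M"
 shows "Lf M k < Lf M (Suc k)" "M <= k ==> M * Lf M (Suc k) <= (M + 1) * Lf M k"
proof -
 have *: "Lf M k < Lf M (Suc k) & M * Lf M (Suc k) <= (M + 1) * Lf M k" if "M <= k"
 proof -
  from Lf_decomp[OF assms that] obtain q i where qi: "i < M" "k = M + M * q + i" .
  then have "Lf M k = 2 ^ q * (M + i)" "Lf M (Suc k) = 2 ^ q * (M + Suc i)"
   using Lf_form[OF assms, of i q] Lf_form[OF assms, of "Suc i" q] by auto
  moreover have "M * (M + Suc i) <= (M + 1) * (M + i)" by (simp add: algebra_simps)
  then have "2 ^ q * (M * (M + Suc i)) <= 2 ^ q * ((M + 1) * (M + i))" by simp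
  ultimately show ?thesis by (simp add: algebra_simps)
 qed
 show "Lf M k < Lf M (Suc k)"
 proof (cases "M <= k")
  case False
  then show ?thesis by (simp add: Lf_small)
 qed (use * in blast)
 show "M <= k ==> M * Lf M (Suc k) <= (M + 1) * Lf M k" using * by blast
qed

lemma Lf_mono: "1 <= M ==> k <= k' ==> Lf M k <= Lf M k'"
 using lift_Suc_mono_le[of "Lf M"] Lf_step(1) less_imp_le by metis

lemma Lf_last:
 assumes "1 <= M" "k = M * (lg + 2)"
 shows "Lf M k = 2 ^ (lg + 1) * M"
 using Lf_form[OF assms(1), of 0 "lg + 1"] assms(2) by (simp add: algebra_simps)

section \<open>Distance estimates from thresholds\<close>

definition est :: "nat => nat => nat => edge set => nat => nat => nat" where
 "est M K Z E x y = (if \<exists>k\<le>K. rch E (Lf M k) x y then Lf M (LEAST k. rch E (Lf M k) x y) else Z)"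

lemma est_sound:
 assumes "est M K Z E x y < Z"
 shows "rch E (est M K Z E x y) x y"
proof -
 from assms have ex: "\<exists>k\<le>K. rch E (Lf M k) x y" by (auto simp: est_def split: if_splits)
 then have "rch E (Lf M (LEAST k. rch E (Lf M k) x y)) x y" by (metis LeastI)
 then show ?thesis using ex by (simp add: est_def)
qed

text \<open>Up to \<open>2 * M\<close> all integers are thresholds and the estimate is exact. Beyond
  that, the threshold preceding the chosen one is below the distance, so the overshoot is a factor
  of at most \<open>1 + 1/M\<close>, written without fractions. The second bound keeps finite
  estimates below the value \<open>2 * (n * n) + 1\<close> that is used for unreachable
  vertices.\<close>

lemma est_complete:
 assumes M: "1 <= M" and E: "E \<subseteq> {..<n} \<times> {..<n}" and K: "n * n <= Lf M K" and path: "(x, y) \<in> E ^^ l"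
 shows "M * est M K Z E x y <= (M + 1) * l" "est M K Z E x y <= 2 * (n * n)"
proof -
 obtain l0 where l0: "l0 <= l" "l0 <= n * n" "(x, y) \<in> E ^^ l0" using relpow_short[OF E path] by auto
 define k where "k = (LEAST k. l0 <= Lf M k)"
 have kK: "l0 <= Lf M K" using l0 K by simp
 have k: "l0 <= Lf M k" "k <= K" using kK unfolding k_def by (metis (mono_tags) LeastI, metis (mono_tags) Least_le)
 have rk: "rch E (Lf M k) x y" using l0(3) k(1) unfolding rch_def by blast
 then have "est M K Z E x y = Lf M (LEAST k. rch E (Lf M k) x y)" using k(2) by (auto simp: est_def)
 moreover have "(LEAST k. rch E (Lf M k) x y) <= k" using rk by (rule Least_le)
 ultimately have e: "est M K Z E x y <= Lf M k" using Lf_mono[OF M] by simp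
 have "M * Lf M k <= (M + 1) * l0"
 proof (cases "k <= 2 * M")
  case True
  have "k <= l0"
  proof (rule ccontr)
   assume "\<not> k <= l0"
   then have "l0 <= Lf M l0" using True by (simp add: Lf_small)
   then have "k <= l0" unfolding k_def by (rule Least_le)
   then show False using \<open>\<not> k <= l0\<close> by simp
  qed
  then show ?thesis unfolding Lf_small[OF True] add_mult_distrib using mult_le_mono2[of k l0 M] by linarith
 next
  case False
  then obtain k' where k': "k = Suc k'" "M <= k'" by (cases k) auto
  have "Lf M k' < l0" using not_less_Least[of k' "\<lambda>k. l0 <= Lf M k"] k' unfolding k_def by simp
  have "M * Lf M k <= (M + 1) * Lf M k'" unfolding k'(1) by (rule Lf_step(2)[OF M k'(2)])
  also have "\<dots> <= (M + 1) * l0" using \<open>Lf M k' < l0\<close> by (intro mult_left_mono) auto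
  finally show ?thesis .
 qed
 then have 1: "M * est M K Z E x y <= (M + 1) * l0" using e mult_le_mono2[OF e, of M] by linarith
 also have "\<dots> <= (M + 1) * l" using l0 by (intro mult_left_mono) auto
 finally show "M * est M K Z E x y <= (M + 1) * l" .
 have "(M + 1) * l0 <= (2 * M) * (n * n)" using l0 M by (intro mult_mono) auto
 moreover have "(2 * M) * (n * n) = M * (2 * (n * n))" by simp
 ultimately have "M * est M K Z E x y <= M * (2 * (n * n))" using 1 by (metis order_trans)
 then show "est M K Z E x y <= 2 * (n * n)" using M by simp
qed

section \<open>Preprocessing\<close>

lemma wp_Sq: "wp B J (c;; d) Q = wp B J c (wp B J d Q)"
 by (rule ext) simp

primrec pwe :: "expr => nat => expr" where
 "pwe e 0 = Num 1"
| "pwe e (Suc c) = Times e (pwe e c)"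

lemma val_pwe [simp]: "val (pwe e c) s = val e s ^ c" "wfe (pwe e c) \<longleftrightarrow> c = 0 \<or> wfe e"
 by (induction c) auto

text \<open>Variable 10 becomes the initial chunk size, the rounded-up square root of
  \<open>n\<close>. Variable 39 is an exponent \<open>lg\<close> with
  \<open>n * n <= 2 ^ lg\<close>; it fixes the index of the last threshold in variable 11, and
  variable 12 is the number of bisection rounds over the thresholds. Variable 8 is one more than the
  number of edges and stands for \<open>never\<close>. Roots and logarithms are found by counting
  and doubling.\<close>

definition prepA :: "nat => nat => com" where
 "prepA d M = Asg 5 (Var 0);; Asg 6 (Var 1);; Asg 7 (Times (Var 5) (Var 5));; Asg 8 (Plus (Var 6) (Num 1));; Asg 2 (Times (Num 2) (Var 5));;
   Asg 9 (Plus (Times (Num 2) (Times (Var 2) (Var 2))) (pwe (Plus (Var 2) (Num 2)) d));; Asg 4 (Num 0);;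
   Asg 10 (Num 1);; For 35 5 (Cond (Less (Times (Var 10) (Var 10)) (Var 5)) (Asg 10 (Plus (Var 10) (Num 1))) Nop);;
   Asg 38 (Num 1);; Asg 39 (Num 0);;
   For 35 7 (Cond (Less (Var 38) (Var 7)) (Asg 38 (Times (Num 2) (Var 38));; Asg 39 (Plus (Var 39) (Num 1))) Nop);;
   Asg 11 (Times (Num M) (Plus (Var 39) (Num 2)));;
   Asg 38 (Num 1);; Asg 12 (Num 0);; Asg 40 (Plus (Var 11) (Num 2));;
   For 35 40 (Cond (Less (Var 38) (Var 40)) (Asg 38 (Times (Num 2) (Var 38));; Asg 12 (Plus (Var 12) (Num 1))) Nop)"

text \<open>Edges are numbered from 1, so that 0 in array 2 means that the pair is not a predicted
  edge.\<close>

definition prepE :: com where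
 "prepE = For 35 6 (Inp 26 (Times (Num 2) (Var 35));; Inp 27 (Plus (Times (Num 2) (Var 35)) (Num 1));; Asg 28 (Plus (Var 35) (Num 1));;
   Sto 3 (Var 28) (Var 26);; Sto 4 (Var 28) (Var 27);; Sto 2 (Plus (Times (Var 26) (Var 5)) (Var 27)) (Var 28))"

definition prepT :: com where
 "prepT = For 35 7 (Asg 26 (Quot (Var 35) (Var 5));; Asg 27 (Minus (Var 35) (Times (Var 26) (Var 5)));;
   Cond (Equal (Var 26) (Var 27)) (Sto 0 (Var 35) (Num 0);; Sto 0 (Plus (Var 7) (Var 35)) (Num 0))
    (Sto 0 (Var 35) (Var 8);; Cond (Equal (Rd 2 (Var 35)) (Num 0)) (Sto 0 (Plus (Var 7) (Var 35)) (Var 8)) (Sto 0 (Plus (Var 7) (Var 35)) (Rd 2 (Var 35)))));;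
   Sto 1 (Num 1) (Num 1)"

text \<open>Up to \<open>2 * M\<close> thresholds grow by one, so table \<open>k\<close> is the
  product of tables \<open>k - 1\<close> and 1; beyond, it is the square of table
  \<open>k - M\<close>. The final stores mark index 0 as inserted and empty the list of
  runs.\<close>

definition prepK :: "nat => com => com" where
 "prepK M pc = Asg 40 (Minus (Var 11) (Num 1));;
   For 41 40 (Asg 42 (Plus (Var 41) (Num 2));;
    Cond (Leq (Var 42) (Num (2 * M))) (Sto 1 (Var 42) (Var 42);; Asg 15 (Times (Plus (Var 41) (Num 1)) (Var 7));; Asg 16 (Var 7))
     (Sto 1 (Var 42) (Times (Num 2) (Rd 1 (Minus (Var 42) (Num M))));; Asg 15 (Times (Minus (Var 42) (Num M)) (Var 7));; Asg 16 (Var 15));;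
    Asg 17 (Times (Var 42) (Var 7));; pc);;
   Sto 5 (Num 0) (Num 1);; Asg 13 (Num 0)"

text \<open>The test sets \<open>n = 0\<close> aside, where the multiplication program promises
  nothing.\<close>

definition prep :: "nat => nat => com => com" where
 "prep d M pc = Cond (Less (Num 0) (Var 0)) (prepA d M;; prepE;; prepT;; prepK M pc) Nop"

lemma mv_prep [simp]:
 "mv (prepA d M) = {5,6,7,8,2,9,4,10,35,38,39,11,12,40}" "ma (prepA d M) = {}" "mp (prepA d M) = False"
 "mv prepE = {35,26,27,28}" "ma prepE = {2,3,4}" "mp prepE = False" "mv prepT = {35,26,27}" "ma prepT = {0,1}" "mp prepT = False"
 by (auto simp: prepA_def prepE_def prepT_def)

lemma wf_prep:
 assumes "wf_com pc" "mv pc \<subseteq> prod_vars"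
 shows "wf_com (prep d M pc)"
 using assms by (auto simp: prep_def prepA_def prepE_def prepT_def prepK_def prod_vars_def)

text \<open>\<open>h0\<close> and the powers of two are enclosed from both sides: the lower bounds
  make chunks and thresholds large enough, the upper ones enter the running times.\<close>

lemma prepA_wp:
 assumes v: "vr s 0 = n" "vr s 1 = m" and n1: "1 <= n" and M: "1 <= M" and pm: "\<forall>x. pm s x = 0"
  and B: "n + 1 <= B" "m + 1 <= B" "2 * (n * n) + 1 <= B" "2 * (2*n)\<^sup>2 + (2*n + 2) ^ d <= B" "2 * (M * (n * n + 2) + 2) <= B"
 shows "wp B J (prepA d M) (\<lambda>u. \<exists>h0 lg LG. vr u 5 = n & vr u 6 = m & vr u 7 = n * n & vr u 8 = m + 1 & vr u 4 = 0 &
   rdy n (2 * (2*n)\<^sup>2 + (2*n + 2) ^ d) h0 u & 0 < h0 & n <= h0 * h0 & (h0 - 1) * (h0 - 1) < n & h0 <= n + 1 &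
   n * n <= 2 ^ lg & 2 ^ lg <= 2 * (n * n) & lg <= n * n & vr u 11 = M * (lg + 2) & vr u 12 = LG & M * (lg + 2) + 2 <= 2 ^ LG & 2 ^ LG <= 2 * (M * (lg + 2) + 2) &
   ck u <= ck s + 30 + 10 * (n * n) + 5 * (M * (lg + 2))) s"
proof -
 let ?nn = "n * n"
 let ?Sd = "2 * (2*n)\<^sup>2 + (2*n + 2) ^ d"
 have nn: "n <= ?nn" "1 <= ?nn" using n1 by auto
 define u0 where "u0 = setv 10 1 (setv 4 0 (setv 9 ?Sd (setv 2 (2*n) (setv 8 (m+1) (setv 7 ?nn (setv 6 m (setv 5 n s)))))))"
 have u0: "vr u0 5 = n" "vr u0 7 = ?nn" "vr u0 10 = 1" "ck u0 = ck s + 8" "pm u0 = pm s" "vr u0 6 = m" "vr u0 8 = m + 1" "vr u0 2 = 2 * n" "vr u0 9 = ?Sd" "vr u0 4 = 0"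
  by (auto simp: u0_def)
 have two: "i < (2::nat) ^ i" for i by (rule less_exp)
 have L1: "wp B J (For 35 5 (Cond (Less (Times (Var 10) (Var 10)) (Var 5)) (Asg 10 (Plus (Var 10) (Num 1))) Nop))
   (\<lambda>u. \<exists>h0. vr u 10 = h0 & 0 < h0 & n <= h0 * h0 & (h0 - 1) * (h0 - 1) < n & h0 <= n + 1 & ck u <= ck s + 9 + 3 * n) u0"
 proof (rule wp_For[where I = "\<lambda>l u. ck u <= ck s + 8 + 3 * l & 0 < vr u 10 & vr u 10 <= l + 1 & (n <= vr u 10 * vr u 10 \<or> vr u 10 = l + 1) & (vr u 10 - 1) * (vr u 10 - 1) < n"], goal_cases)
  case 1 then show ?case using u0 n1 by auto
 next
  case (2 l u)
  have "l < n" "vr u 5 = n" using 2 u0 by (auto simp: frame_def)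
  then show ?case using 2(2) B by (auto split: if_splits)
 next
  case (3 u)
  have "n <= (n + 1) * (n + 1)" by simp
  then show ?case using 3(1) u0 by auto
 qed
 have L2: "wp B J (For 35 7 (Cond (Less (Var 38) (Var 7)) (Asg 38 (Times (Num 2) (Var 38));; Asg 39 (Plus (Var 39) (Num 1))) Nop))
   (\<lambda>u. \<exists>lg. vr u 39 = lg & ?nn <= 2 ^ lg & 2 ^ lg <= 2 * ?nn & lg <= ?nn & ck u <= ck w + 1 + 4 * ?nn) w"
  if w: "vr w 38 = 1" "vr w 39 = 0" "vr w 7 = ?nn" for w
 proof (rule wp_For[where I = "\<lambda>l u. ck u <= ck w + 4 * l & vr u 38 = 2 ^ vr u 39 & vr u 39 <= l & (?nn <= vr u 38 \<or> vr u 39 = l) & vr u 38 <= 2 * ?nn"], goal_cases)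
  case 1 then show ?case using w nn by auto
 next
  case (2 l u)
  have "l < ?nn" "vr u 7 = ?nn" using 2 w by (auto simp: frame_def)
  then show ?case using 2(2) B by (auto split: if_splits)
 next
  case (3 u)
  then show ?case using w two[of ?nn] by auto
 qed
 have L3: "wp B J (For 35 40 (Cond (Less (Var 38) (Var 40)) (Asg 38 (Times (Num 2) (Var 38));; Asg 12 (Plus (Var 12) (Num 1))) Nop))
   (\<lambda>u. \<exists>LG. vr u 12 = LG & k <= 2 ^ LG & 2 ^ LG <= 2 * k & ck u <= ck w + 1 + 4 * k) w"
  if w: "vr w 38 = 1" "vr w 12 = 0" "vr w 40 = k" "1 <= k" "2 * k <= B" for w k
 proof (rule wp_For[where I = "\<lambda>l u. ck u <= ck w + 4 * l & vr u 38 = 2 ^ vr u 12 & vr u 12 <= l & (k <= vr u 38 \<or> vr u 12 = l) & vr u 38 <= 2 * k"], goal_cases)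
  case 1 then show ?case using w by auto
 next
  case (2 l u)
  have "l < k" "vr u 40 = k" using 2 w by (auto simp: frame_def)
  then show ?case using 2(2) w by (auto split: if_splits)
 next
  case (3 u)
  then show ?case using w two[of k] by auto
 qed
 have start: "wp B J (prepA d M) Q s" if "wp B J (For 35 5 (Cond (Less (Times (Var 10) (Var 10)) (Var 5)) (Asg 10 (Plus (Var 10) (Num 1))) Nop);;
   Asg 38 (Num 1);; Asg 39 (Num 0);;
   For 35 7 (Cond (Less (Var 38) (Var 7)) (Asg 38 (Times (Num 2) (Var 38));; Asg 39 (Plus (Var 39) (Num 1))) Nop);;
   Asg 11 (Times (Num M) (Plus (Var 39) (Num 2)));;
   Asg 38 (Num 1);; Asg 12 (Num 0);; Asg 40 (Plus (Var 11) (Num 2));;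
   For 35 40 (Cond (Less (Var 38) (Var 40)) (Asg 38 (Times (Num 2) (Var 38));; Asg 12 (Plus (Var 12) (Num 1))) Nop)) Q u0" for Q
 proof -
  have "n <= B" "2 * n <= B" "m <= B" "?nn <= B" "1 <= B" using B nn by linarith+
  moreover have "2 * (2 * n * (2 * n)) + (2 * n + 2) ^ d = ?Sd" by (simp add: power2_eq_square)
  ultimately show ?thesis using that v B unfolding prepA_def u0_def by (simp add: power2_eq_square)
 qed
 show ?thesis
 proof (rule start, subst wp_simps(5), rule wp_conseq[OF L1], goal_cases)
  case (1 u1)
  then obtain h0 where h0: "vr u1 10 = h0" "0 < h0" "n <= h0 * h0" "(h0 - 1) * (h0 - 1) < n" "h0 <= n + 1" "ck u1 <= ck s + 9 + 3 * n" by auto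
  have u1: "\<And>x. x \<notin> {35,10} ==> vr u1 x = vr u0 x" "pm u1 = pm u0" using 1(2) by (auto simp: frame_def)
  define w where "w = setv 39 0 (setv 38 1 u1)"
  have w: "vr w 38 = 1" "vr w 39 = 0" "vr w 7 = ?nn" using u1 u0 by (auto simp: w_def)
  have "wp B J (For 35 7 (Cond (Less (Var 38) (Var 7)) (Asg 38 (Times (Num 2) (Var 38));; Asg 39 (Plus (Var 39) (Num 1))) Nop))
   (wp B J (Asg 11 (Times (Num M) (Plus (Var 39) (Num 2)));;
   Asg 38 (Num 1);; Asg 12 (Num 0);; Asg 40 (Plus (Var 11) (Num 2));;
   For 35 40 (Cond (Less (Var 38) (Var 40)) (Asg 38 (Times (Num 2) (Var 38));; Asg 12 (Plus (Var 12) (Num 1))) Nop))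
   (\<lambda>u. \<exists>h0 lg LG. vr u 5 = n & vr u 6 = m & vr u 7 = n * n & vr u 8 = m + 1 & vr u 4 = 0 &
   rdy n (2 * (2*n)\<^sup>2 + (2*n + 2) ^ d) h0 u & 0 < h0 & n <= h0 * h0 & (h0 - 1) * (h0 - 1) < n & h0 <= n + 1 &
   n * n <= 2 ^ lg & 2 ^ lg <= 2 * (n * n) & lg <= n * n & vr u 11 = M * (lg + 2) & vr u 12 = LG & M * (lg + 2) + 2 <= 2 ^ LG & 2 ^ LG <= 2 * (M * (lg + 2) + 2) &
   ck u <= ck s + 30 + 10 * (n * n) + 5 * (M * (lg + 2)))) w"
  proof (rule wp_conseq[OF L2[OF w]], goal_cases)
   case (1 u2)
   then obtain lg where lg: "vr u2 39 = lg" "?nn <= 2 ^ lg" "2 ^ lg <= 2 * ?nn" "lg <= ?nn" "ck u2 <= ck w + 1 + 4 * ?nn" by auto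
   let ?K = "M * (lg + 2)"
   have u2: "\<And>x. x \<notin> {35,38,39} ==> vr u2 x = vr w x" "pm u2 = pm w" using 1(2) by (auto simp: frame_def)
   define z where "z = setv 40 (?K + 2) (setv 12 0 (setv 38 1 (setv 11 ?K u2)))"
   have KB: "2 * (?K + 2) <= B"
   proof -
    have "?K <= M * (?nn + 2)" using lg by simp
    then have "2 * (?K + 2) <= 2 * (M * (?nn + 2) + 2)" by (rule mult_le_mono2[OF add_le_mono1])
    then show ?thesis using B(5) by (rule order_trans)
   qed
   have z: "vr z 38 = 1" "vr z 12 = 0" "vr z 40 = ?K + 2" "1 <= ?K + 2" "vr z 11 = ?K" "\<And>x. x \<notin> {35,38,39,40,12,11} ==> vr z x = vr w x" "pm z = pm s" "ck z = ck u2 + 4"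
    using u2 u1 u0 by (auto simp: z_def w_def)
   have "wp B J (For 35 40 (Cond (Less (Var 38) (Var 40)) (Asg 38 (Times (Num 2) (Var 38));; Asg 12 (Plus (Var 12) (Num 1))) Nop))
    (\<lambda>u. \<exists>h0 lg LG. vr u 5 = n & vr u 6 = m & vr u 7 = n * n & vr u 8 = m + 1 & vr u 4 = 0 &
   rdy n (2 * (2*n)\<^sup>2 + (2*n + 2) ^ d) h0 u & 0 < h0 & n <= h0 * h0 & (h0 - 1) * (h0 - 1) < n & h0 <= n + 1 &
   n * n <= 2 ^ lg & 2 ^ lg <= 2 * (n * n) & lg <= n * n & vr u 11 = M * (lg + 2) & vr u 12 = LG & M * (lg + 2) + 2 <= 2 ^ LG & 2 ^ LG <= 2 * (M * (lg + 2) + 2) &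
   ck u <= ck s + 30 + 10 * (n * n) + 5 * (M * (lg + 2))) z"
   proof (rule wp_conseq[OF L3[OF z(1,2,3,4) KB]], goal_cases)
    case (1 u3)
    then obtain LG where LG: "vr u3 12 = LG" "?K + 2 <= 2 ^ LG" "2 ^ LG <= 2 * (?K + 2)" "ck u3 <= ck z + 1 + 4 * (?K + 2)" by auto
    have u3: "\<And>x. x \<notin> {35,38,12} ==> vr u3 x = vr z x" "pm u3 = pm s" using 1(2) z(7) by (auto simp: frame_def)
    have vv: "vr u3 x = vr u0 x" if "x \<notin> {35,38,39,40,12,11,10}" for x using that u3 z(6) u1 by (auto simp: w_def)
    have v10: "vr u3 10 = h0" using u3 z(6) h0(1) by (auto simp: w_def)
    have v11: "vr u3 11 = ?K" using u3 z(5) by auto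
    have "rdy n ?Sd h0 u3" using vv u0 v10 u3(2) pm by (simp add: rdy_def)
    moreover have "ck u3 <= ck s + 30 + 10 * ?nn + 5 * ?K"
    proof -
     have "ck w = ck u1 + 2" by (simp add: w_def)
     moreover define kk where "kk = ?K"
     ultimately show ?thesis using LG(4) z(8) lg(5) h0(6) nn unfolding kk_def[symmetric] distrib_left by linarith
    qed
    ultimately show ?case
     by (intro exI[of _ h0] exI[of _ lg] exI[of _ LG]) (use vv u0 h0 lg LG v11 in auto)
   qed
   moreover have "k <= B & k + 2 <= B & 1 <= B" if "2 * (k + 2) <= B" for k using that by simp
   note this[OF KB]
   ultimately show ?case using lg(1) by (simp add: z_def)
  qed
  moreover have "1 <= B" using B by linarith
  ultimately show ?case by (simp add: w_def)
 qed
qed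

definition pred_input :: "edge list => nat list" where
 "pred_input pred = map (\<lambda>a. if even a then fst (pred ! (a div 2)) else snd (pred ! (a div 2))) [0..<2 * length pred]"

lemma pred_input:
 "length (pred_input pred) = 2 * length pred" "p < length pred ==> pred_input pred ! (2 * p) = fst (pred ! p)"
 "p < length pred ==> pred_input pred ! (2 * p + 1) = snd (pred ! p)"
 by (simp_all add: pred_input_def)

lemma idx_lt: "x < n ==> y < n ==> x * n + y < n * n" for x y n :: nat
proof -
 assume "x < n" "y < n"
 then have "x * n + y < (x + 1) * n" by simp
 also have "\<dots> <= n * n" using \<open>x < n\<close> by (intro mult_right_mono) auto
 finally show ?thesis .
qed

lemma idx_inj: "y < n ==> y' < n ==> x * n + y = x' * n + y' \<longleftrightarrow> x = x' & y = y'" for x y n :: nat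
proof
 assume "y < n" "y' < n" "x * n + y = x' * n + y'"
 moreover have "(x * n + y) div n = x" "(x' * n + y') div n = x'" using \<open>y < n\<close> \<open>y' < n\<close> by auto
 ultimately show "x = x' & y = y'" by auto
qed auto

lemma valid_length: "valid_prediction n pred ==> length pred <= n * n"
proof -
 assume "valid_prediction n pred"
 then have "distinct pred" "set pred \<subseteq> {..<n} \<times> {..<n}" by (auto simp: valid_prediction_def)
 then have "card (set pred) <= card ({..<n} \<times> {..<n})" by (intro card_mono) auto
 then show ?thesis using distinct_card[OF \<open>distinct pred\<close>] by simp
qed

lemma valid_nth: "valid_prediction n pred ==> p < length pred ==> fst (pred ! p) < n & snd (pred ! p) < n"
proof -
 assume *: "valid_prediction n pred" "p < length pred"
 then have "pred ! p \<in> {..<n} \<times> {..<n}" using nth_mem unfolding valid_prediction_def by blast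
 then show ?thesis by (cases "pred ! p") auto
qed

definition edge_tab :: "nat => edge list => nat => st => bool" where
 "edge_tab n pred l s \<longleftrightarrow> (\<forall>p<l. ar s 3 (p + 1) = fst (pred ! p) & ar s 4 (p + 1) = snd (pred ! p) &
   ar s 2 (fst (pred ! p) * n + snd (pred ! p)) = p + 1)"

lemma prepE_wp:
 assumes pr: "valid_prediction n pred" and v: "vr s 6 = length pred" "vr s 5 = n" and z: "\<forall>x. ar s 2 x = 0"
  and B: "length pred + 1 <= B" "n <= B"
 shows "wp B (pred_input pred) prepE (\<lambda>u. edge_tab n pred (length pred) u &
   (\<forall>x<n. \<forall>y<n. (x, y) \<notin> set pred --> ar u 2 (x * n + y) = 0) & ck u <= ck s + 1 + 7 * length pred) s"
proof (unfold prepE_def, rule wp_For[where I = "\<lambda>l u. ck u <= ck s + 7 * l & edge_tab n pred l u &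
   (\<forall>x<n. \<forall>y<n. (x, y) \<notin> set (take l pred) --> ar u 2 (x * n + y) = 0)"], goal_cases)
 case 1 then show ?case using z by (simp add: edge_tab_def)
next
 case (2 l u)
 have l: "l < length pred" using 2(1) v by simp
 let ?x = "fst (pred ! l)" and ?y = "snd (pred ! l)"
 have xy: "?x < n" "?y < n" using valid_nth[OF pr l] by auto
 have u5: "vr u 5 = n" using 2(3) v by (auto simp: frame_def)
 have tk: "set (take (Suc l) pred) = insert (?x, ?y) (set (take l pred))" using l by (simp add: take_Suc_conv_app_nth)
 let ?u = "seta 2 (?x * n + ?y) (l + 1) (seta 4 (l + 1) ?y (seta 3 (l + 1) ?x (setv 28 (l + 1) (setv 27 ?y (setv 26 ?x (setv 35 l u))))))"
 have ne: "fst (pred ! p) * n + snd (pred ! p) \<noteq> ?x * n + ?y" if "p < l" for p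
 proof
  have p: "p < length pred" using that l by simp
  assume "fst (pred ! p) * n + snd (pred ! p) = ?x * n + ?y"
  then have "pred ! p = pred ! l" using idx_inj[of "snd (pred ! p)" n ?y] valid_nth[OF pr p] xy by (simp add: prod_eq_iff)
  then show False using pr p l that by (simp add: valid_prediction_def nth_eq_iff_index_eq)
 qed
 have e: "edge_tab n pred (Suc l) ?u"
  unfolding edge_tab_def
 proof (intro allI impI)
  fix p assume "p < Suc l"
  then show "ar ?u 3 (p + 1) = fst (pred ! p) & ar ?u 4 (p + 1) = snd (pred ! p) & ar ?u 2 (fst (pred ! p) * n + snd (pred ! p)) = p + 1"
   using 2(2) ne[of p] unfolding edge_tab_def by (cases "p = l") auto
 qed
 have f: "ar ?u 2 (x * n + y) = 0" if "x < n" "y < n" "(x, y) \<notin> set (take (Suc l) pred)" for x y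
 proof -
  have "x * n + y \<noteq> ?x * n + ?y" using that idx_inj[of y n ?y x ?x] xy unfolding tk by auto
  then show ?thesis using 2(2) that unfolding tk by auto
 qed
 have "l + 1 <= B" "?x <= B" "?y <= B" using l B xy by linarith+
 moreover have "ck ?u <= ck s + 7 * Suc l" using 2(2) by simp
 moreover have i: "2 * l < 2 * length pred" "Suc (2 * l) < 2 * length pred" using l by auto
 moreover have "pred_input pred ! Suc (2 * l) = ?y" using pred_input(3)[OF l] by simp
 ultimately show ?case using e f pred_input(1)[of pred] pred_input(2)[OF l] by (simp add: u5)
next
 case (3 u)
 then show ?case using v by (simp add: edge_tab_def)
qed

lemma prepT_wp:
 assumes v: "vr s 5 = n" "vr s 7 = n * n" "vr s 8 = iv" and n1: "1 <= n" and B: "n <= B" "iv <= B" "\<forall>x<n*n. ar s 2 x <= B"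
  and z: "ar s 1 0 = 0"
 shows "wp B J prepT (\<lambda>u. (\<forall>x<n. \<forall>y<n. ar u 0 (x * n + y) = (if x = y then 0 else iv) &
   ar u 0 (n * n + (x * n + y)) = (if x = y then 0 else if ar s 2 (x * n + y) = 0 then iv else ar s 2 (x * n + y))) &
   ar u 1 0 = 0 & ar u 1 1 = 1 & ck u <= ck s + 2 + 7 * (n * n)) s"
proof -
 define I where "I l u \<longleftrightarrow> ck u <= ck s + 7 * l & (\<forall>e<l. ar u 0 e = (if e div n = e mod n then 0 else iv) &
   ar u 0 (n * n + e) = (if e div n = e mod n then 0 else if ar s 2 e = 0 then iv else ar s 2 e))" for l and u :: st
 have "wp B J (For 35 7 (Asg 26 (Quot (Var 35) (Var 5));; Asg 27 (Minus (Var 35) (Times (Var 26) (Var 5)));;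
   Cond (Equal (Var 26) (Var 27)) (Sto 0 (Var 35) (Num 0);; Sto 0 (Plus (Var 7) (Var 35)) (Num 0))
    (Sto 0 (Var 35) (Var 8);; Cond (Equal (Rd 2 (Var 35)) (Num 0)) (Sto 0 (Plus (Var 7) (Var 35)) (Var 8)) (Sto 0 (Plus (Var 7) (Var 35)) (Rd 2 (Var 35))))))
   (\<lambda>u. I (n * n) (u\<lparr>ck := ck u - 1\<rparr>) & 1 <= ck u) s"
 proof (rule wp_For[where I = I], goal_cases)
  case 1 then show ?case by (simp add: I_def)
 next
  case (2 l u)
  have l: "l < n * n" using 2(1) v by simp
  have u: "vr u 5 = n" "vr u 7 = n * n" "vr u 8 = iv" "ar u 2 = ar s 2" using 2(3) v by (auto simp: frame_def)
  define i j where "i = l div n" and "j = l mod n"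
  have "i < n" "j < n" using l n1 by (auto simp: i_def j_def less_mult_imp_div_less)
  then have ij: "i <= B" "j <= B" using B by auto
  have jj: "l - i * n = j" by (simp add: i_def j_def minus_div_mult_eq_mod)
  have sB: "ar s 2 l <= B" using B l by blast
  have post: "I (Suc l) z" if "ck z <= ck u + 7" "ar z 0 l = (if i = j then 0 else iv)" "ar z 0 (n * n + l) = (if i = j then 0 else if ar s 2 l = 0 then iv else ar s 2 l)"
   "\<And>x. x \<noteq> l ==> x \<noteq> n * n + l ==> ar z 0 x = ar u 0 x" for z
   unfolding I_def
  proof (intro conjI allI impI)
   show "ck z <= ck s + 7 * Suc l" using that(1) 2(2) by (simp add: I_def)
   fix e assume e: "e < Suc l"
   show "ar z 0 e = (if e div n = e mod n then 0 else iv)"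
    using that(2) that(4)[of e] e 2(2) l by (cases "e = l") (auto simp: I_def i_def j_def)
   show "ar z 0 (n * n + e) = (if e div n = e mod n then 0 else if ar s 2 e = 0 then iv else ar s 2 e)"
    using that(3) that(4)[of "n * n + e"] e 2(2) l by (cases "e = l") (auto simp: I_def i_def j_def)
  qed
  have q: "val (Quot (Var 35) (Var 5)) (setv 35 l u) = i" by (simp add: u i_def)
  show ?case unfolding wp_simps q using ij jj sB B l
   by (cases "i = j"; cases "ar s 2 l = 0") (auto simp: u intro!: post)
 next
  case (3 u)
  then show ?case using v by (simp add: I_def)
 qed
 then show ?thesis
  unfolding prepT_def wp_simps(5)
 proof (rule wp_conseq, goal_cases)
  case (1 u)
  have u1: "ar u 1 0 = 0" using 1(2) z by (auto simp: frame_def)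
  have "ar u 0 (x * n + y) = (if x = y then 0 else iv) &
   ar u 0 (n * n + (x * n + y)) = (if x = y then 0 else if ar s 2 (x * n + y) = 0 then iv else ar s 2 (x * n + y))" if "x < n" "y < n" for x y
  proof -
   have "(x * n + y) div n = x" "(x * n + y) mod n = y" using that by auto
   then show ?thesis using 1(1) idx_lt[OF that] unfolding I_def by auto
  qed
  moreover have "1 <= B" using n1 B by simp
  ultimately show ?case using 1(1) u1 by (auto simp: I_def)
 qed
qed

text \<open>Comparison with all \<open>j\<close> pins the entry down: it is the least length of a
  predicted prefix that connects \<open>x\<close> to \<open>y\<close> within \<open>Lf M k\<close>
  steps, and \<open>length pred + 1\<close> if there is none.\<close>

definition tab_ok :: "nat => edge list => nat => st => nat => bool" where
 "tab_ok n pred M s k \<longleftrightarrow> (\<forall>x<n. \<forall>y<n. ar s 0 (k * (n * n) + (x * n + y)) <= length pred + 1 &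
   (\<forall>j\<le>length pred. ar s 0 (k * (n * n) + (x * n + y)) <= j \<longleftrightarrow> rch (set (take j pred)) (Lf M k) x y))"

definition base :: "nat => edge list => nat => nat => nat => st => bool" where
 "base n pred M K LG s \<longleftrightarrow> vr s 5 = n & vr s 7 = n * n & vr s 11 = K & vr s 12 = LG & K + 2 <= 2 ^ LG & n * n <= Lf M K &
   (\<forall>k\<le>K. ar s 1 k = Lf M k & tab_ok n pred M s k) & edge_tab n pred (length pred) s"

text \<open>Each product uses up at most \<open>inc\<close> cells of \<open>pm\<close>, so
  \<open>K * inc\<close> cells suffice for all tables. Tables computed earlier survive because a
  product writes only into its own block of \<open>n * n\<close> cells of array 0.\<close>

lemma prepK_wp:
 assumes pr: "valid_prediction n pred" and n1: "1 <= n" and M: "1 <= M" and K: "K = M * (lg + 2)"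
  and v: "vr s 5 = n" "vr s 7 = n * n" "vr s 8 = length pred + 1" "vr s 11 = K" "vr s 4 = 0" "rdy n Sd h0 s"
  and L: "ar s 1 0 = 0" "ar s 1 1 = 1" and T: "tab_ok n pred M s 0" "tab_ok n pred M s 1" and E: "edge_tab n pred (length pred) s"
  and pc: "prod_ok B J n (length pred + 1) Sd h0 inc TP pc" "mv pc \<subseteq> prod_vars" "ma pc \<subseteq> {0,10,11,12,13,20,21,22,23,24,25,30,31,32,33,34,35}"
  and B: "(K + 1) * (n * n) <= B" "K * inc <= B" "Lf M K <= B" "K + 1 <= B"
 shows "wp B J (prepK M pc) (\<lambda>u. (\<forall>k\<le>K. ar u 1 k = Lf M k & tab_ok n pred M u k) & edge_tab n pred (length pred) u &
   ar u 5 = (ar s 5)(0 := 1) & vr u 13 = 0 & ck u <= ck s + 4 + K * (TP + 8)) s"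
proof -
 let ?nn = "n * n"
 have K2: "2 <= K" using K M by simp
 have mvpc: "5 \<notin> mv pc" "7 \<notin> mv pc" "8 \<notin> mv pc" "11 \<notin> mv pc" "12 \<notin> mv pc" using pc(2) by (auto simp: prod_vars_def)
 have mapc: "1 \<notin> ma pc" "Suc 0 \<notin> ma pc" "2 \<notin> ma pc" "3 \<notin> ma pc" "4 \<notin> ma pc" "5 \<notin> ma pc" "6 \<notin> ma pc" "7 \<notin> ma pc" using pc(3) by auto
 define I where "I l u \<longleftrightarrow> (\<forall>k<l + 2. ar u 1 k = Lf M k & tab_ok n pred M u k) & rdy n Sd h0 u & vr u 4 <= l * inc & ck u <= ck s + 1 + l * (TP + 8)" for l and u :: st
 have Lf1: "Lf M 0 = 0" "Lf M 1 = 1" using M by (simp_all add: Lf_small)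
 let ?body = "Asg 42 (Plus (Var 41) (Num 2));;
    Cond (Leq (Var 42) (Num (2 * M))) (Sto 1 (Var 42) (Var 42);; Asg 15 (Times (Plus (Var 41) (Num 1)) (Var 7));; Asg 16 (Var 7))
     (Sto 1 (Var 42) (Times (Num 2) (Rd 1 (Minus (Var 42) (Num M))));; Asg 15 (Times (Minus (Var 42) (Num M)) (Var 7));; Asg 16 (Var 15));;
    Asg 17 (Times (Var 42) (Var 7));; pc"
 have subE: "set (take j pred) \<subseteq> {..<n} \<times> {..<n}" for j using pr set_take_subset[of j pred] unfolding valid_prediction_def by blast
 have nnB: "k * ?nn <= B" if "k <= K" for k
 proof -
  have "k * ?nn <= (K + 1) * ?nn" using that by (intro mult_right_mono) auto
  then show ?thesis using B(1) by linarith
 qed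
 have "wp B J (For 41 40 ?body) (\<lambda>u. I (K - 1) (u\<lparr>ck := ck u - 1\<rparr>) & 1 <= ck u) (setv 40 (K - 1) s)"
 proof (rule wp_For[where I = I], goal_cases)
  case 1
  have "tab_ok n pred M (setv 40 (K - 1) s) k = tab_ok n pred M s k" for k by (simp add: tab_ok_def)
  moreover have "ar s 1 k = Lf M k & tab_ok n pred M s k" if "k < 0 + 2" for k
  proof -
   have "k = 0 \<or> k = 1" using that by auto
   then show ?thesis using L T Lf1 by auto
  qed
  ultimately show ?case using v by (simp add: I_def rdy_def)
 next
  case (2 l u)
  define k where "k = l + 2"
  have k: "k <= K" using 2(1) K2 by (simp add: k_def)
  have fr: "vr u 5 = n" "vr u 7 = ?nn" "vr u 8 = length pred + 1" using 2(3) v mvpc by (auto simp: frame_def)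
  have I: "I l u" by (rule 2(2))
  define a b where "a = (if k <= 2 * M then k - 1 else k - M)" and "b = (if k <= 2 * M then 1 else k - M)"
  have ab: "a < k" "b < k" "Lf M k = Lf M a + Lf M b"
  proof -
   show "a < k" "b < k" using M by (auto simp: a_def b_def k_def)
   show "Lf M k = Lf M a + Lf M b"
   proof (cases "k <= 2 * M")
    case True
    then show ?thesis using M by (simp add: a_def b_def Lf_small k_def)
   next
    case False
    then have "Lf M (k - M + M) = 2 * Lf M (k - M)" using M by (intro Lf_double) auto
    then show ?thesis using False by (simp add: a_def b_def)
   qed
  qed
  define w where "w = setv 17 (k * ?nn) (setv 16 (b * ?nn) (setv 15 (a * ?nn) (seta 1 k (Lf M k) (tck (setv 42 k (setv 41 l u))))))"
  have wv: "vr w 5 = n" "vr w 7 = ?nn" "vr w 8 = length pred + 1" "vr w 15 = a * ?nn" "vr w 16 = b * ?nn" "vr w 17 = k * ?nn"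
   "ar w = (ar u)(1 := (ar u 1)(k := Lf M k))" "pm w = pm u" "ck w = ck u + 7" "vr w 4 = vr u 4" "rdy n Sd h0 w"
   using fr I by (auto simp: w_def rdy_def I_def)
  have tabs: "tab_ok n pred M u a" "tab_ok n pred M u b" using I ab unfolding I_def k_def by auto
  have LkB: "Lf M k <= B" using Lf_mono[OF M k] B(3) by linarith
  have stp: "wp B J ?body Q (setv 41 l u)" if "wp B J pc Q w" for Q
  proof -
   have "k <= B" using k B(4) by linarith
   moreover have "a * ?nn <= B" "b * ?nn <= B" "k * ?nn <= B" using nnB ab k by auto
   moreover have "ar u 1 (k - M) = Lf M (k - M)" if "\<not> k <= 2 * M" using I that M unfolding I_def k_def by auto
   moreover have "2 * Lf M (k - M) = Lf M k" if "\<not> k <= 2 * M" using ab that by (simp add: a_def b_def)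
   moreover have "l + 1 = k - 1" by (simp add: k_def)
   moreover have "Lf M k = k" if "k <= 2 * M" using that by (rule Lf_small)
   ultimately show ?thesis using that LkB fr unfolding w_def a_def b_def
    by (cases "k <= 2 * M") (auto simp: k_def[symmetric])
  qed
  have pcw: "wp B J pc (\<lambda>z. (\<forall>i<n. \<forall>j<n. ar z 0 (k * ?nn + (i * n + j)) <= length pred + 1 &
     (\<forall>v<length pred + 1. ar z 0 (k * ?nn + (i * n + j)) <= v \<longleftrightarrow> (\<exists>q<n. ar u 0 (a * ?nn + (i * n + q)) <= v & ar u 0 (b * ?nn + (q * n + j)) <= v))) &
    (\<forall>x. x < k * ?nn \<or> k * ?nn + ?nn <= x --> ar z 0 x = ar w 0 x) & rdy n Sd h0 z & vr z 4 <= vr w 4 + inc & ck z <= ck w + TP) w"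
  proof (rule pc(1)[unfolded prod_ok_def, rule_format, where A = "\<lambda>i q. ar u 0 (a * ?nn + (i * n + q))" and Bm = "\<lambda>q j. ar u 0 (b * ?nn + (q * n + j))" and bA = "a * ?nn" and bB = "b * ?nn"], goal_cases)
   case 7
   have "(a + 1) * ?nn <= k * ?nn" using ab by (intro mult_right_mono) auto
   then show ?case by simp
  next
   case 8
   have "(b + 1) * ?nn <= k * ?nn" using ab by (intro mult_right_mono) auto
   then show ?case by simp
  next
   case (11 i q)
   then show ?case using wv tabs unfolding tab_ok_def by auto
  next
   case 13
   have "(l + 1) * inc <= K * inc" using k by (intro mult_right_mono) (auto simp: k_def)
   then show ?case using I B(2) wv unfolding I_def by simp
  qed (use wv nnB ab k in auto)
  show ?case
  proof (rule stp, rule wp_conseq[OF pcw], goal_cases)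
   case (1 z)
   have z1: "ar z 1 = (ar u 1)(k := Lf M k)" using 1(2) mapc wv by (auto simp: frame_def)
   have old: "tab_ok n pred M z k' = tab_ok n pred M u k'" if "k' < k" for k'
   proof -
    have "ar z 0 (k' * ?nn + (x * n + y)) = ar u 0 (k' * ?nn + (x * n + y))" if "x < n" "y < n" for x y
    proof -
     have "k' * ?nn + (x * n + y) < (k' + 1) * ?nn" using idx_lt[OF that] by simp
     also have "\<dots> <= k * ?nn" using \<open>k' < k\<close> by (intro mult_right_mono) auto
     finally show ?thesis using 1(1) wv by simp
    qed
    then show ?thesis by (simp add: tab_ok_def)
   qed
   have new: "tab_ok n pred M z k"
    unfolding tab_ok_def
   proof (intro allI impI conjI)
    fix x y assume xy: "x < n" "y < n"
    show "ar z 0 (k * ?nn + (x * n + y)) <= length pred + 1" using 1(1) xy by blast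
    fix j assume j: "j <= length pred"
    have "ar z 0 (k * ?nn + (x * n + y)) <= j \<longleftrightarrow> (\<exists>q<n. ar u 0 (a * ?nn + (x * n + q)) <= j & ar u 0 (b * ?nn + (q * n + y)) <= j)"
     using 1(1) xy j by (simp add: less_Suc_eq_le)
    also have "\<dots> \<longleftrightarrow> (\<exists>q<n. rch (set (take j pred)) (Lf M a) x q & rch (set (take j pred)) (Lf M b) q y)"
     using tabs xy j unfolding tab_ok_def by blast
    also have "\<dots> \<longleftrightarrow> rch (set (take j pred)) (Lf M k) x y" using rch_add[OF subE xy(1)] ab(3) by simp
    finally show "ar z 0 (k * ?nn + (x * n + y)) <= j \<longleftrightarrow> rch (set (take j pred)) (Lf M k) x y" .
   qed
   have "ar z 1 k' = Lf M k' & tab_ok n pred M z k'" if "k' < Suc l + 2" for k'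
   proof (cases "k' = k")
    case True then show ?thesis using new z1 by simp
   next
    case False
    then have "k' < k" using that by (simp add: k_def)
    then show ?thesis using old I z1 False unfolding I_def k_def by auto
   qed
   then show ?case using 1(1) wv I unfolding I_def by simp
  qed
 next
  case (3 u)
  then show ?case using v by (auto simp: I_def tab_ok_def rdy_def)
 qed
 then have "wp B J (For 41 40 ?body) (wp B J (Sto 5 (Num 0) (Num 1)) (wp B J (Asg 13 (Num 0)) (\<lambda>u. (\<forall>k\<le>K. ar u 1 k = Lf M k & tab_ok n pred M u k) & edge_tab n pred (length pred) u &
   ar u 5 = (ar s 5)(0 := 1) & vr u 13 = 0 & ck u <= ck s + 4 + K * (TP + 8)))) (setv 40 (K - 1) s)"
 proof (rule wp_conseq, goal_cases)
  case (1 u)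
  have a: "ar u x = ar s x" if "x \<in> {2,3,4,5}" for x using 1(2) mapc that by (auto simp: frame_def)
  have "(K - 1) * (TP + 8) <= K * (TP + 8)" by (intro mult_right_mono) auto
  moreover have "ck u - 1 <= ck s + 1 + (K - 1) * (TP + 8)" "1 <= ck u" using 1(1) unfolding I_def by simp_all
  ultimately have c: "ck u <= ck s + 2 + K * (TP + 8)" by linarith
  have t: "ar u 1 k = Lf M k & tab_ok n pred M u k" if "k <= K" for k
   using 1(1) that K2 unfolding I_def tab_ok_def by auto
  have e: "edge_tab n pred (length pred) u" using E a unfolding edge_tab_def by simp
  have "1 <= B" using B(4) by simp
  then show ?case using c t e a by (simp add: tab_ok_def edge_tab_def)
 qed
 moreover have "val (Minus (Var 11) (Num 1)) s = K - 1" using v by simp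
 ultimately show ?thesis using B(4) unfolding prepK_def wp_Sq wp_simps(1)[of _ _ 40] by simp
qed

lemma prep_wp:
 assumes pr: "valid_prediction n pred" and n1: "1 <= n" and M: "1 <= M"
  and v: "vr s 0 = n" "vr s 1 = length pred" and z: "\<forall>x. pm s x = 0" "\<forall>a x. ar s a x = 0"
  and pc: "\<And>h0. 0 < h0 ==> n <= h0 * h0 ==> (h0 - 1) * (h0 - 1) < n ==> h0 <= n + 1 ==>
    prod_ok B (pred_input pred) n (length pred + 1) (2 * (2*n)\<^sup>2 + (2*n + 2) ^ d) h0 inc TP pc"
   "mv pc \<subseteq> prod_vars" "ma pc \<subseteq> {0,10,11,12,13,20,21,22,23,24,25,30,31,32,33,34,35}"
  and B: "2 * (n * n) + 2 <= B" "2 * (2*n)\<^sup>2 + (2*n + 2) ^ d <= B" "2 * (M * (n * n + 2) + 2) <= B" "(M * (n * n + 2) + 1) * (n * n) <= B" "M * (n * n + 2) * inc <= B"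
   "4 * (n * n) * M <= B"
 shows "wp B (pred_input pred) (prep d M pc) (\<lambda>u. \<exists>lg LG. n * n <= 2 ^ lg & 2 ^ lg <= 2 * (n * n) & 2 ^ LG <= 2 * (M * (lg + 2) + 2) &
   base n pred M (M * (lg + 2)) LG u & vr u 13 = 0 & ar u 5 = (\<lambda>_. 0)(0 := 1) & ar u 6 = (\<lambda>_. 0) & ar u 7 = (\<lambda>_. 0) &
   ck u <= ck s + 50 + 30 * (n * n) + M * (lg + 2) * (TP + 20)) s"
proof -
 let ?nn = "n * n" and ?m = "length pred" and ?J = "pred_input pred"
 let ?Sd = "2 * (2*n)\<^sup>2 + (2*n + 2) ^ d"
 have nn: "n <= ?nn" "1 <= ?nn" using n1 by auto
 have m: "?m <= ?nn" by (rule valid_length[OF pr])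
 have mvpc: "5 \<notin> mv pc" "7 \<notin> mv pc" "8 \<notin> mv pc" "11 \<notin> mv pc" "12 \<notin> mv pc" using pc(2) by (auto simp: prod_vars_def)
 have mapc: "1 \<notin> ma pc" "Suc 0 \<notin> ma pc" "2 \<notin> ma pc" "3 \<notin> ma pc" "4 \<notin> ma pc" "5 \<notin> ma pc" "6 \<notin> ma pc" "7 \<notin> ma pc" using pc(3) by auto
 have nB: "n + 1 <= B" "?m + 1 <= B" "2 * ?nn + 1 <= B" using B(1) nn m by linarith+
 have t: "vr (tck s) 0 = n" "vr (tck s) 1 = ?m" "\<forall>x. pm (tck s) x = 0" using v z by auto
 have main: "wp B ?J (prepA d M) (wp B ?J prepE (wp B ?J prepT (wp B ?J (prepK M pc) (\<lambda>u. \<exists>lg LG. n * n <= 2 ^ lg & 2 ^ lg <= 2 * (n * n) & 2 ^ LG <= 2 * (M * (lg + 2) + 2) &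
   base n pred M (M * (lg + 2)) LG u & vr u 13 = 0 & ar u 5 = (\<lambda>_. 0)(0 := 1) & ar u 6 = (\<lambda>_. 0) & ar u 7 = (\<lambda>_. 0) &
   ck u <= ck s + 50 + 30 * (n * n) + M * (lg + 2) * (TP + 20))))) (tck s)"
 proof (rule wp_conseq[OF prepA_wp[OF t(1,2) n1 M t(3) nB B(2,3)]], goal_cases)
  case (1 u1)
  then obtain h0 lg LG where a: "vr u1 5 = n" "vr u1 6 = ?m" "vr u1 7 = ?nn" "vr u1 8 = ?m + 1" "vr u1 4 = 0" "rdy n ?Sd h0 u1"
   "0 < h0" "n <= h0 * h0" "(h0 - 1) * (h0 - 1) < n" "h0 <= n + 1" "?nn <= 2 ^ lg" "2 ^ lg <= 2 * ?nn" "lg <= ?nn" "vr u1 11 = M * (lg + 2)" "vr u1 12 = LG"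
   "M * (lg + 2) + 2 <= 2 ^ LG" "2 ^ LG <= 2 * (M * (lg + 2) + 2)" "ck u1 <= ck s + 31 + 10 * ?nn + 5 * (M * (lg + 2))" by auto
  have u1: "ar u1 = ar s" using 1(2) by (auto simp: frame_def)
  define K where "K = M * (lg + 2)"
  have KM: "K <= M * (?nn + 2)" using a(13) by (simp add: K_def)
  have z1: "\<forall>x. ar u1 2 x = 0" using u1 z by simp
  show ?case
  proof (rule wp_conseq[OF prepE_wp[OF pr a(2,1) z1 nB(2)]], goal_cases)
   case 1 then show ?case using nB by simp
  next
   case (2 u2)
   have u2: "\<And>x. x \<notin> {35,26,27,28} ==> vr u2 x = vr u1 x" "\<And>x. x \<notin> {2,3,4} ==> ar u2 x = ar s x" "pm u2 = pm u1" using 2(2) u1 by (auto simp: frame_def)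
   have e2: "edge_tab n pred ?m u2" "\<And>x y. x < n ==> y < n ==> (x, y) \<notin> set pred ==> ar u2 2 (x * n + y) = 0" "ck u2 <= ck u1 + 1 + 7 * ?m" using 2(1) by auto
   have cases2: "(\<exists>p<?m. pred ! p = (x, y) & ar u2 2 (x * n + y) = p + 1) \<or> ((x, y) \<notin> set pred & ar u2 2 (x * n + y) = 0)" if "x < n" "y < n" for x y
   proof (cases "(x, y) \<in> set pred")
    case True
    then obtain p where "p < ?m" "pred ! p = (x, y)" by (auto simp: in_set_conv_nth)
    then show ?thesis using e2(1) unfolding edge_tab_def by (metis fst_conv snd_conv)
   qed (use e2(2) that in blast)
   have le2: "\<forall>x<n*n. ar u2 2 x <= B"
   proof (intro allI impI)
    fix x assume x: "x < n * n"
    then have "x div n < n" "x mod n < n" using n1 by (auto simp: less_mult_imp_div_less)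
    from cases2[OF this] have "ar u2 2 x <= ?m" by auto
    then show "ar u2 2 x <= B" using nB by simp
   qed
   have v2: "vr u2 5 = n" "vr u2 7 = ?nn" "vr u2 8 = ?m + 1" using u2 a by auto
   show ?case
   proof (rule wp_conseq[OF prepT_wp[OF v2 n1 _ _ le2]], goal_cases)
    case 1 then show ?case using nB by simp
   next
    case 2 then show ?case using nB by simp
   next
    case 3 then show ?case using u2 z by simp
   next
    case (4 u3)
    have u3: "\<And>x. x \<notin> {35,26,27,28} ==> vr u3 x = vr u1 x" "\<And>x. x \<notin> {0,1,2,3,4} ==> ar u3 x = ar s x" "\<And>x. x \<in> {2,3,4} ==> ar u3 x = ar u2 x" "pm u3 = pm u1"
     using 4(2) u2 by (auto simp: frame_def)
    have T0: "tab_ok n pred M u3 0"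
     unfolding tab_ok_def using 4(1) by (auto simp: Lf_small)
    have T1: "tab_ok n pred M u3 1"
     unfolding tab_ok_def
    proof (intro allI impI)
     fix x y assume xy: "x < n" "y < n"
     have val: "ar u3 0 (1 * ?nn + (x * n + y)) = (if x = y then 0 else if ar u2 2 (x * n + y) = 0 then ?m + 1 else ar u2 2 (x * n + y))"
      using 4(1) xy by simp
     have L1: "Lf M 1 = 1" using M by (simp add: Lf_small)
     have "(x, y) \<in> set (take j pred) \<longleftrightarrow> p < j" if "p < ?m" "pred ! p = (x, y)" "j <= ?m" for p j
     proof
      assume "(x, y) \<in> set (take j pred)"
      then obtain q where "q < j" "q < ?m" "pred ! q = (x, y)" by (auto simp: in_set_conv_nth)
      then show "p < j" using that pr nth_eq_iff_index_eq[of pred p q] unfolding valid_prediction_def by auto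
     next
      assume "p < j"
      then show "(x, y) \<in> set (take j pred)" using that by (auto simp: in_set_conv_nth intro!: exI[of _ p])
     qed
     then show "ar u3 0 (1 * ?nn + (x * n + y)) <= ?m + 1 & (\<forall>j\<le>?m. ar u3 0 (1 * ?nn + (x * n + y)) <= j \<longleftrightarrow> rch (set (take j pred)) (Lf M 1) x y)"
      unfolding val L1 rch_1 using cases2[OF xy]
     proof (elim disjE exE conjE)
      fix p assume p: "p < ?m" "pred ! p = (x, y)" "ar u2 2 (x * n + y) = p + 1"
      assume *: "\<And>p j. p < ?m ==> pred ! p = (x, y) ==> j <= ?m ==> (x, y) \<in> set (take j pred) \<longleftrightarrow> p < j"
      show "(if x = y then 0 else if ar u2 2 (x * n + y) = 0 then ?m + 1 else ar u2 2 (x * n + y)) <= ?m + 1 &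
       (\<forall>j\<le>?m. ((if x = y then 0 else if ar u2 2 (x * n + y) = 0 then ?m + 1 else ar u2 2 (x * n + y)) <= j) = (x = y \<or> (x, y) \<in> set (take j pred)))"
       using p *[OF p(1,2)] by auto
     qed (auto simp: val L1 rch_1 dest: in_set_takeD)
    qed
    have E3: "edge_tab n pred ?m u3" using e2(1) u3(3) unfolding edge_tab_def by simp
    have r3: "rdy n ?Sd h0 u3" using a(6) u3 by (simp add: rdy_def)
    have v3: "vr u3 5 = n" "vr u3 7 = ?nn" "vr u3 8 = ?m + 1" "vr u3 11 = K" "vr u3 4 = 0" using u3 a by (auto simp: K_def)
    have LK: "Lf M K = 2 ^ (lg + 1) * M" by (rule Lf_last[OF M K_def])
    have B1: "(K + 1) * ?nn <= B" "K * inc <= B" "Lf M K <= B" "K + 1 <= B"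
    proof -
     have "(K + 1) * ?nn <= (M * (?nn + 2) + 1) * ?nn" using KM by (intro mult_right_mono) auto
     then show "(K + 1) * ?nn <= B" using B(4) by linarith
     have "K * inc <= M * (?nn + 2) * inc" using KM by (intro mult_right_mono) auto
     then show "K * inc <= B" using B(5) by linarith
     have "2 ^ (lg + 1) * M <= 4 * ?nn * M" using a(12) by (intro mult_right_mono) auto
     then show "Lf M K <= B" unfolding LK using B(6) by linarith
     have "k + 1 <= B" if "k <= x" "2 * (x + 2) <= B" for k x using that by simp
     from this[OF KM B(3)] show "K + 1 <= B" .
    qed
    have l3: "ar u3 1 0 = 0" "ar u3 1 1 = 1" using 4(1) by auto
    show ?case
    proof (rule wp_conseq[OF prepK_wp[OF pr n1 M K_def v3 r3 l3 T0 T1 E3 pc(1)[OF a(7,8,9,10)] pc(2,3) B1]], goal_cases)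
     case (1 u)
     have fr: "vr u x = vr u3 x" if "x \<in> {5,7,11,12}" for x using 1(2) mvpc that by (auto simp: frame_def prepK_def)
     have fa: "ar u x = ar s x" if "x \<in> {6,7}" for x using 1(2) mapc that u3(2)[of x] by (auto simp: frame_def prepK_def)
     have LKn: "?nn <= Lf M K"
     proof -
      have "?nn * 1 <= 2 ^ (lg + 1) * M" using a(11) M by (intro mult_mono) auto
      then show ?thesis unfolding LK by simp
     qed
     have "base n pred M K LG u" unfolding base_def using 1(1) fr v3 u3(1)[of 12] a(15,16) LKn by (auto simp: K_def)
     moreover have "ck u <= ck s + 50 + 30 * ?nn + K * (TP + 20)"
     proof -
      have "ck u3 <= ck u2 + 2 + 7 * ?nn" using 4(1) by blast
      moreover have "K * (TP + 20) = K * (TP + 8) + 12 * K" by (simp add: algebra_simps)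
      moreover have "ck u <= ck u3 + 4 + K * (TP + 8)" using 1(1) by blast
      ultimately show ?thesis using e2(3) a(18) m unfolding K_def[symmetric] by linarith
     qed
     moreover have "ar u 5 = (\<lambda>_. 0)(0 := 1)" "ar u 6 = (\<lambda>_. 0)" "ar u 7 = (\<lambda>_. 0)" using 1(1) fa u3(2) z by (auto simp: fun_eq_iff)
     ultimately show ?case using 1(1) a(11,12,17) by (intro exI[of _ lg] exI[of _ LG]) (auto simp: K_def)
    qed
   qed
  qed
 qed
 moreover have "val (Less (Num 0) (Var 0)) s > 0" using v n1 by simp
 ultimately show ?thesis unfolding prep_def wp_simps(6) wp_Sq by (simp only: if_True simp_thms)
qed

section \<open>Insertions\<close>

definition isrun :: "nat set => nat => nat => bool" where
 "isrun I a b \<longleftrightarrow> a <= b & {a..b} \<subseteq> I & Suc b \<notin> I & (a = 0 \<or> a - 1 \<notin> I)"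

text \<open>The run of 0 is left out: it represents the inserted prefix of the prediction, while the
  other runs contain exactly the edges that a query has to add.\<close>

definition starts :: "nat set => nat set" where
 "starts I = {a \<in> I. a \<noteq> 0 & a - 1 \<notin> I}"

lemma isrun_unique:
 assumes "isrun I a b" "isrun I a' b'" "a <= x" "x <= b" "a' <= x" "x <= b'"
 shows "a = a' & b = b'"
proof -
 have le: "a' <= a & b <= b'" if r: "isrun I a b" "isrun I a' b'" "a <= x" "x <= b" "a' <= x" "x <= b'" for a b a' b'
 proof
  show "a' <= a"
  proof (rule ccontr)
   assume "\<not> a' <= a"
   then have "a' - 1 \<in> {a..b}" "a' \<noteq> 0" using r by auto
   then show False using r unfolding isrun_def by blast
  qed
  show "b <= b'"
  proof (rule ccontr)
   assume "\<not> b <= b'"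
   then have "Suc b' \<in> {a..b}" using r by auto
   then show False using r unfolding isrun_def by blast
  qed
 qed
 show ?thesis using le[OF assms] le[OF assms(2,1,5,6,3,4)] by auto
qed

lemma isrun_left: "x \<in> I ==> Suc x \<notin> I ==> \<exists>a. isrun I a x"
proof -
 assume x: "x \<in> I" "Suc x \<notin> I"
 define a where "a = (LEAST a. a <= x & {a..x} \<subseteq> I)"
 have a: "a <= x & {a..x} \<subseteq> I" unfolding a_def by (rule LeastI[of _ x]) (use x in auto)
 have "a - 1 \<notin> I" if "a \<noteq> 0"
 proof
  assume "a - 1 \<in> I"
  have "{a - 1..x} \<subseteq> I"
  proof
   fix y assume "y \<in> {a - 1..x}"
   then show "y \<in> I" using a \<open>a - 1 \<in> I\<close> by (cases "y = a - 1") auto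
  qed
  then have "a - 1 <= x & {a - 1..x} \<subseteq> I" using a by auto
  then have "a <= a - 1" unfolding a_def by (rule Least_le)
  then show False using that by simp
 qed
 then show ?thesis using a x by (auto simp: isrun_def)
qed

lemma isrun_right:
 assumes "x \<in> I" "x = 0 \<or> x - 1 \<notin> I" "I \<subseteq> {..m}"
 shows "\<exists>b. isrun I x b"
proof -
 have ex: "\<exists>b. x <= b & Suc b \<notin> I" using assms by (intro exI[of _ "max x m"]) auto
 define b where "b = (LEAST b. x <= b & Suc b \<notin> I)"
 have b: "x <= b" "Suc b \<notin> I" using LeastI_ex[OF ex] unfolding b_def by auto
 have "y \<in> I" if y: "x <= y" "y <= b" for y
 proof (cases "y = x")
  case False
  then obtain z where z: "y = Suc z" "x <= z" using y by (cases y) auto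
  then have "z < b" using y by simp
  then show ?thesis using not_less_Least[of z "\<lambda>b. x <= b & Suc b \<notin> I"] z unfolding b_def by auto
 qed (use assms in simp)
 then have "{x..b} \<subseteq> I" by auto
 then show ?thesis using b assms unfolding isrun_def by blast
qed

text \<open>Apart from the run through \<open>p\<close>, the runs are old ones that share no end
  point with it. Overwriting the entries at \<open>a\<close> and \<open>b\<close> is therefore
  harmless for all others.\<close>

lemma isrun_insert:
 assumes p: "p \<notin> I" "p \<noteq> 0" and a: "if p - 1 \<in> I then isrun I a (p - 1) else a = p" and b: "if Suc p \<in> I then isrun I (Suc p) b else b = p"
 shows "isrun (insert p I) a b" "a <= p" "p <= b"
  "isrun (insert p I) a' b' ==> (a' = a & b' = b) \<or> (isrun I a' b' & a' \<noteq> a & b' \<noteq> b)"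
proof -
 show ab: "a <= p" "p <= b" using a b p by (auto simp: isrun_def split: if_splits)
 have sub: "y \<in> insert p I" if "a <= y" "y <= b" for y
 proof (cases "y < p")
  case True
  then have "p - 1 \<in> I" using a that by (auto split: if_splits)
  then have "isrun I a (p - 1)" using a by simp
  then show ?thesis using True that by (auto simp: isrun_def)
 next
  case False
  show ?thesis
  proof (cases "y = p")
   case False
   then have "p < y" using \<open>\<not> y < p\<close> by simp
   then have "Suc p \<in> I" using b that by (auto split: if_splits)
   then have "isrun I (Suc p) b" using b by simp
   then show ?thesis using \<open>p < y\<close> that by (auto simp: isrun_def)
  qed simp
 qed
 have "Suc b \<notin> insert p I" using b p ab by (auto simp: isrun_def split: if_splits)
 moreover have "a = 0 \<or> a - 1 \<notin> insert p I"
 proof (cases "p - 1 \<in> I")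
  case True
  then have r: "isrun I a (p - 1)" using a by simp
  then have "a - 1 \<noteq> p" using ab p by (auto simp: isrun_def)
  then show ?thesis using r by (auto simp: isrun_def)
 next
  case False
  then show ?thesis using a p by auto
 qed
 moreover have "{a..b} \<subseteq> insert p I" using sub by (intro subsetI) (simp only: atLeastAtMost_iff)
 ultimately show run: "isrun (insert p I) a b" using ab unfolding isrun_def by (intro conjI) auto
 show "(a' = a & b' = b) \<or> (isrun I a' b' & a' \<noteq> a & b' \<noteq> b)" if r: "isrun (insert p I) a' b'"
 proof (cases "a' <= p & p <= b'")
  case True
  then show ?thesis using isrun_unique[OF r run, of p] ab by auto
 next
  case False
  then have "{a'..b'} \<subseteq> I" using r by (auto simp: isrun_def)
  then have r': "isrun I a' b'" using r by (auto simp: isrun_def)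
  have "a' \<noteq> a"
  proof
   assume "a' = a"
   then have "b' = b" using isrun_unique[OF r run, of a] r ab by (auto simp: isrun_def)
   then show False using False ab \<open>a' = a\<close> by simp
  qed
  moreover have "b' \<noteq> b"
  proof
   assume "b' = b"
   then have "a' = a" using isrun_unique[OF r run, of b] r ab by (auto simp: isrun_def)
   then show False using \<open>a' \<noteq> a\<close> by simp
  qed
  ultimately show ?thesis using r' by simp
 qed
qed

lemma starts_insert:
 assumes "p \<notin> I" "p \<noteq> 0"
 shows "starts (insert p I) = (if p - 1 \<in> I then starts I else insert p (starts I)) - {Suc p}"
 using assms by (auto simp: starts_def)

text \<open>An unordered list \<open>R\<close> of length \<open>c\<close> with an index
  \<open>P\<close> of positions, which allows deletion in constant time by moving the last element
  into the gap.\<close>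

definition lst :: "(nat => nat) => (nat => nat) => nat => nat set => bool" where
 "lst R P c S \<longleftrightarrow> R ` {..<c} = S & (\<forall>x<c. P (R x) = x)"

lemma lst_add: "lst R P c S ==> a \<notin> S ==> lst (R(c := a)) (P(a := c)) (Suc c) (insert a S)"
 unfolding lst_def by (auto simp: lessThan_Suc image_iff less_Suc_eq)

text \<open>If \<open>a\<close> is itself the last element, it is copied onto its own place and
  dropped by the shorter length; the same assignments cover this case.\<close>

lemma lst_del:
 assumes "lst R P c S" "a \<in> S"
 shows "lst (R(P a := R (c - 1))) (P(R (c - 1) := P a)) (c - 1) (S - {a})" "0 < c" "P a < c"
proof -
 from assms obtain q where q: "q < c" "R q = a" "P a = q" unfolding lst_def by auto
 then show "0 < c" "P a < c" by auto
 have inj: "R x = R y \<longleftrightarrow> x = y" if "x < c" "y < c" for x y using assms that unfolding lst_def by metis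
 have S: "S = R ` {..<c}" using assms by (simp add: lst_def)
 have c: "c - 1 < c" using q by simp
 have im: "(R(q := R (c - 1))) ` {..<c - 1} = S - {a}"
 proof
  show "(R(q := R (c - 1))) ` {..<c - 1} \<subseteq> S - {a}"
  proof
   fix y assume "y \<in> (R(q := R (c - 1))) ` {..<c - 1}"
   then obtain x where x: "x < c - 1" "y = (if x = q then R (c - 1) else R x)" by auto
   then show "y \<in> S - {a}" using S q inj[of x q] inj[of "c - 1" q] c by (cases "x = q") auto
  qed
  show "S - {a} \<subseteq> (R(q := R (c - 1))) ` {..<c - 1}"
  proof
   fix y assume "y \<in> S - {a}"
   then obtain x where x: "x < c" "y = R x" "x \<noteq> q" using S q by auto
   show "y \<in> (R(q := R (c - 1))) ` {..<c - 1}"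
   proof (cases "x = c - 1")
    case True
    then have "q < c - 1" using x q by simp
    then show ?thesis using x True by (intro image_eqI[of _ _ q]) auto
   next
    case False
    then show ?thesis using x by (intro image_eqI[of _ _ x]) auto
   qed
  qed
 qed
 have "(P(R (c - 1) := q)) ((R(q := R (c - 1))) x) = x" if "x < c - 1" for x
  using assms(1) that inj[of x "c - 1"] c unfolding lst_def by auto
 then show "lst (R(P a := R (c - 1))) (P(R (c - 1) := P a)) (c - 1) (S - {a})" using im q by (simp add: lst_def)
qed

text \<open>Arrays 6 and 7 are meaningful at the ends of runs only: a start knows its end and an end
  its start, while entries inside a run may be outdated. This is what makes merging runs a constant
  number of stores.\<close>

definition rinv :: "nat set => st => bool" where
 "rinv I s \<longleftrightarrow> (\<forall>x. ar s 5 x = of_bool (x \<in> I)) & (\<forall>a b. isrun I a b --> ar s 6 a = b & ar s 7 b = a) &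
   lst (ar s 8) (ar s 9) (vr s 13) (starts I)"

definition ins :: com where
 "ins = Asg 43 (Rd 2 (Plus (Times (Var 0) (Var 5)) (Var 1)));; Asg 44 (Minus (Var 43) (Num 1));; Asg 45 (Plus (Var 43) (Num 1));;
   Cond (Rd 5 (Var 44)) (Asg 46 (Rd 7 (Var 44)))
    (Asg 46 (Var 43);; Sto 8 (Var 13) (Var 43);; Sto 9 (Var 43) (Var 13);; Asg 13 (Plus (Var 13) (Num 1)));;
   Cond (Rd 5 (Var 45)) (Asg 47 (Rd 6 (Var 45));; Asg 48 (Rd 9 (Var 45));; Asg 13 (Minus (Var 13) (Num 1));; Asg 49 (Rd 8 (Var 13));;
     Sto 8 (Var 48) (Var 49);; Sto 9 (Var 49) (Var 48))
    (Asg 47 (Var 43));;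
   Sto 5 (Var 43) (Num 1);; Sto 6 (Var 46) (Var 47);; Sto 7 (Var 47) (Var 46)"

lemma mv_ins [simp]: "mv ins = {43,44,45,46,13,47,48,49}" "ma ins = {5,6,7,8,9}" "wf_com ins"
 by (auto simp: ins_def)

lemma base_cong:
 assumes "base n pred M K LG s" "\<And>x. x \<in> {5,7,11,12} ==> vr u x = vr s x" "\<And>a. a \<in> {0,1,2,3,4} ==> ar u a = ar s a"
 shows "base n pred M K LG u"
 using assms by (simp add: base_def tab_ok_def edge_tab_def)

text \<open>A new index merges with at most the run ending just before it and the run starting just
  after it. Since 0 is always present, an index of an edge has a left neighbour to inspect.\<close>

lemma ins_wp:
 assumes b: "base n pred M K LG s" and r: "rinv I s" and I: "0 \<in> I" "I \<subseteq> {..length pred}" and bd: "bounded B s" "length pred + 2 <= B"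
  and e: "q < length pred" "Suc q \<notin> I" "vr s 0 = fst (pred ! q)" "vr s 1 = snd (pred ! q)"
 shows "wp B J ins (\<lambda>u. base n pred M K LG u & rinv (insert (Suc q) I) u & ck u <= ck s + 20) s"
proof -
 let ?p = "Suc q"
 have ap: "ar s 2 (vr s 0 * vr s 5 + vr s 1) = ?p" using b e unfolding base_def edge_tab_def by auto
 have r1: "\<And>x. ar s 5 x = of_bool (x \<in> I)" and r2: "\<And>a b. isrun I a b ==> ar s 6 a = b & ar s 7 b = a"
  and r3: "lst (ar s 8) (ar s 9) (vr s 13) (starts I)" using r by (auto simp: rinv_def)
 have c: "vr s 13 <= length pred"
 proof -
  have "inj_on (ar s 8) {..<vr s 13}" using r3 unfolding lst_def by (intro inj_onI) (metis lessThan_iff)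
  then have "vr s 13 = card (starts I)" using r3 card_image unfolding lst_def by fastforce
  also have "\<dots> <= card {1..length pred}" using I by (intro card_mono) (auto simp: starts_def)
  finally show ?thesis by simp
 qed
 have arB: "ar s a x <= B" for a x using bd by (simp add: bounded_def)
 define a where "a = (if q \<in> I then ar s 7 q else ?p)"
 define b' where "b' = (if Suc ?p \<in> I then ar s 6 (Suc ?p) else ?p)"
 have A: "if ?p - 1 \<in> I then isrun I a (?p - 1) else a = ?p"
 proof (cases "q \<in> I")
  case True
  from isrun_left[OF True e(2)] obtain z where "isrun I z q" by auto
  then show ?thesis using r2 True by (auto simp: a_def)
 qed (simp add: a_def)
 have B': "if Suc ?p \<in> I then isrun I (Suc ?p) b' else b' = ?p"
 proof (cases "Suc ?p \<in> I")
  case True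
  from isrun_right[OF True _ I(2)] e(2) obtain z where "isrun I (Suc ?p) z" by auto
  then show ?thesis using r2 True by (auto simp: b'_def)
 qed (simp add: b'_def)
 have p0: "?p \<noteq> 0" by simp
 note ri = isrun_insert[OF e(2) p0 A B']
 have a0: "a <= ?p" "?p <= b'" using ri by auto
 have fin: "rinv (insert ?p I) u" if u: "ar u 5 = (ar s 5)(?p := 1)" "ar u 6 = (ar s 6)(a := b')" "ar u 7 = (ar s 7)(b' := a)"
   "lst (ar u 8) (ar u 9) (vr u 13) (starts (insert ?p I))" for u
  unfolding rinv_def
 proof (intro conjI allI impI)
  fix x show "ar u 5 x = of_bool (x \<in> insert ?p I)" using r1 by (simp add: u)
 next
  fix a' c assume "isrun (insert ?p I) a' c"
  from ri(4)[OF this] show "ar u 6 a' = c" "ar u 7 c = a'" using r2 by (auto simp: u)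
 qed (use u in auto)
 have bas: "base n pred M K LG u" if "\<And>x. x \<notin> {43,44,45,46,13,47,48,49} ==> vr u x = vr s x" "\<And>x. x \<notin> {5,6,7,8,9} ==> ar u x = ar s x" for u
  by (rule base_cong[OF b]) (use that in auto)
 have pB: "?p <= B" "Suc ?p <= B" "q <= B" "Suc (vr s 13) <= B" "vr s 13 <= B" "1 <= B" using e bd c by auto
 have b'B: "b' <= B" "a <= B" using arB pB by (auto simp: b'_def a_def)
 have st: "starts (insert ?p I) = (if q \<in> I then starts I else insert ?p (starts I)) - {Suc ?p}" using starts_insert[OF e(2) p0] by simp
 have pS: "?p \<notin> starts I" using e by (simp add: starts_def)
 have ns: "S - {Suc ?p} = S" if "Suc ?p \<notin> I" "S = starts I \<or> S = insert ?p (starts I)" for S using that by (auto simp: starts_def)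
 have ys: "Suc ?p \<in> S" if "Suc ?p \<in> I" "S = starts I \<or> S = insert ?p (starts I)" for S using that e by (auto simp: starts_def)
 \<comment> \<open>The list after the conditional for the left neighbour, which adds
   \<open>Suc q\<close> as a start unless that neighbour is present.\<close>
 define R1 where "R1 = (if q \<in> I then ar s 8 else (ar s 8)(vr s 13 := ?p))"
 define P1 where "P1 = (if q \<in> I then ar s 9 else (ar s 9)(?p := vr s 13))"
 define c1 where "c1 = (if q \<in> I then vr s 13 else Suc (vr s 13))"
 define S1 where "S1 = (if q \<in> I then starts I else insert ?p (starts I))"
 have l1: "lst R1 P1 c1 S1" using r3 lst_add[OF r3 pS] by (simp add: R1_def P1_def c1_def S1_def)
 have S1: "S1 = starts I \<or> S1 = insert ?p (starts I)" by (simp add: S1_def)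
 have bd1: "R1 x <= B" "P1 x <= B" for x using arB pB by (auto simp: R1_def P1_def)
 define w where "w = (if q \<in> I then setv 46 a (tck (setv 45 (Suc ?p) (setv 44 q (setv 43 ?p s))))
   else setv 13 (Suc (vr s 13)) (seta 9 ?p (vr s 13) (seta 8 (vr s 13) ?p (setv 46 a (tck (setv 45 (Suc ?p) (setv 44 q (setv 43 ?p s))))))))"
 have w: "vr w 43 = ?p" "vr w 45 = Suc ?p" "vr w 46 = a" "vr w 13 = c1" "ar w 8 = R1" "ar w 9 = P1" "ck w <= ck s + 8"
   "\<And>x. x \<notin> {43,44,45,46,13} ==> vr w x = vr s x" "\<And>x. x \<notin> {8,9} ==> ar w x = ar s x"
  by (auto simp: w_def c1_def R1_def P1_def)
 have second: "wp B J (Cond (Rd 5 (Var 45)) (Asg 47 (Rd 6 (Var 45));; Asg 48 (Rd 9 (Var 45));; Asg 13 (Minus (Var 13) (Num 1));; Asg 49 (Rd 8 (Var 13));;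
     Sto 8 (Var 48) (Var 49);; Sto 9 (Var 49) (Var 48)) (Asg 47 (Var 43));;
   Sto 5 (Var 43) (Num 1);; Sto 6 (Var 46) (Var 47);; Sto 7 (Var 47) (Var 46)) (\<lambda>u. rinv (insert ?p I) u & ck u <= ck s + 20) w"
 proof (cases "Suc ?p \<in> I")
  case True
  note del = lst_del[OF l1 ys[OF True S1]]
  have "c1 - 1 <= B" using pB by (auto simp: c1_def)
  moreover have "b' = ar s 6 (Suc ?p)" using True by (simp add: b'_def)
  ultimately show ?thesis using True w r1 b'B pB bd1 del(1)
   by (auto simp: st S1_def[symmetric] intro!: fin)
 next
  case False
  then have "b' = ?p" by (simp add: b'_def)
  then show ?thesis using False w r1 b'B pB l1 ns[OF False S1]
   by (auto simp: st S1_def[symmetric] intro!: fin)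
 qed
 have v2: "val (Rd 2 (Plus (Times (Var 0) (Var 5)) (Var 1))) s = ?p" using ap by simp
 have "wp B J ins (\<lambda>u. rinv (insert ?p I) u & ck u <= ck s + 20) s"
 proof (cases "q \<in> I")
  case True
  then have "w = setv 46 (ar s 7 q) (tck (setv 45 (Suc ?p) (setv 44 q (setv 43 ?p s))))" by (simp add: w_def a_def)
  then show ?thesis using second True r1 pB b'B unfolding ins_def wp_Sq wp_simps(1)[of _ _ 43] v2 by (simp add: a_def)
 next
  case False
  then have "w = setv 13 (Suc (vr s 13)) (seta 9 ?p (vr s 13) (seta 8 (vr s 13) ?p (setv 46 ?p (tck (setv 45 (Suc ?p) (setv 44 q (setv 43 ?p s)))))))" by (simp add: w_def a_def)
  then show ?thesis using second False r1 pB b'B unfolding ins_def wp_Sq wp_simps(1)[of _ _ 43] v2 by simp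
 qed
 then show ?thesis
 proof (rule wp_conseq, intro conjI)
  fix u assume "frame ins s u"
  then show "base n pred M K LG u" by (intro bas) (auto simp: frame_def)
 qed auto
qed

section \<open>Queries\<close>

text \<open>The upper end \<open>K + 1\<close> of the search interval means that no threshold
  suffices; the answer is then \<open>2 * (n * n) + 1\<close>, above every finite estimate. The
  number of rounds is fixed in advance, and rounds after the interval has shrunk to a point do
  nothing.\<close>

definition lookup :: com where
 "lookup = Asg 54 (Num 0);; Asg 55 (Plus (Var 11) (Num 1));;
   For 57 12 (Cond (Less (Var 54) (Var 55)) (Asg 56 (Quot (Plus (Var 54) (Var 55)) (Num 2));;
    Cond (Leq (Rd 0 (Plus (Times (Var 56) (Var 7)) (Plus (Times (Var 50) (Var 5)) (Var 51)))) (Var 52)) (Asg 55 (Var 56)) (Asg 54 (Plus (Var 56) (Num 1)))) Nop);;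
   Cond (Leq (Var 55) (Var 11)) (Asg 53 (Rd 1 (Var 55))) (Asg 53 (Plus (Times (Num 2) (Var 7)) (Num 1)))"

lemma mv_lookup [simp]: "mv lookup = {53,54,55,56,57}" "ma lookup = {}" "mp lookup = False" "wf_com lookup"
 by (auto simp: lookup_def)

text \<open>For a fixed prefix, reachability is monotone in the threshold, so bisection finds the
  least sufficient one; the length of the interval is below \<open>2 ^ (LG - l)\<close> after
  \<open>l\<close> rounds.\<close>

lemma lookup_wp:
 assumes b: "base n pred M K LG s" and M: "1 <= M" and xy: "vr s 50 = x" "vr s 51 = y" "x < n" "y < n" and j: "vr s 52 = j" "j <= length pred"
  and B: "2 * K + 2 <= B" "2 * (n * n) + 1 <= B" "\<And>i. ar s 1 i <= B"
 shows "wp B J lookup (\<lambda>u. vr u 53 = est M K (2 * (n * n) + 1) (set (take j pred)) x y & ck u <= ck s + 5 + 5 * LG) s"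
proof -
 let ?P = "\<lambda>k. rch (set (take j pred)) (Lf M k) x y"
 let ?s = "setv 55 (K + 1) (setv 54 0 s)"
 have v: "vr s 5 = n" "vr s 7 = n * n" "vr s 11 = K" "vr s 12 = LG" "K + 2 <= 2 ^ LG"
  and tab: "\<And>k. k <= K ==> ar s 1 k = Lf M k & tab_ok n pred M s k" using b by (auto simp: base_def)
 have T: "ar s 0 (k * (n * n) + (x * n + y)) <= j \<longleftrightarrow> ?P k" if "k <= K" for k
  using tab[OF that] xy(3,4) j(2) unfolding tab_ok_def by blast
 have mono: "?P k ==> k <= k' ==> ?P k'" for k k' using rch_mono Lf_mono[OF M] by blast
 define I where "I l u \<longleftrightarrow> ck u <= ck s + 2 + 5 * l & vr u 54 <= vr u 55 & vr u 55 <= K + 1 & (\<forall>k<vr u 54. \<not> ?P k) & (vr u 55 = K + 1 \<or> ?P (vr u 55)) &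
   vr u 55 - vr u 54 < 2 ^ (LG - l)" for l and u :: st
 have "wp B J (For 57 12 (Cond (Less (Var 54) (Var 55)) (Asg 56 (Quot (Plus (Var 54) (Var 55)) (Num 2));;
    Cond (Leq (Rd 0 (Plus (Times (Var 56) (Var 7)) (Plus (Times (Var 50) (Var 5)) (Var 51)))) (Var 52)) (Asg 55 (Var 56)) (Asg 54 (Plus (Var 56) (Num 1)))) Nop))
   (\<lambda>u. I LG (u\<lparr>ck := ck u - 1\<rparr>) & 1 <= ck u) ?s"
 proof (rule wp_For[where I = I], goal_cases)
  case 1 then show ?case using v by (auto simp: I_def)
 next
  case (2 l u)
  have l: "l < LG" using 2(1) v by simp
  have u: "vr u 5 = n" "vr u 7 = n * n" "vr u 50 = x" "vr u 51 = y" "vr u 52 = j" "ar u = ar s" using 2(3) v xy j by (auto simp: frame_def)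
  define lo hi mid where "lo = vr u 54" and "hi = vr u 55" and "mid = (lo + hi) div 2"
  have i: "ck u <= ck s + 2 + 5 * l" "lo <= hi" "hi <= K + 1" "\<forall>k<lo. \<not> ?P k" "hi = K + 1 \<or> ?P hi" "hi - lo < 2 ^ (LG - l)"
   using 2(2) by (auto simp: I_def lo_def hi_def)
  have pw: "(2::nat) ^ (LG - l) = 2 * 2 ^ (LG - Suc l)" using l by (metis Suc_diff_Suc power_Suc)
  show ?case
  proof (cases "lo < hi")
   case False
   then have "I (Suc l) (tck (tck (setv 57 l u)))" using i pw by (auto simp: I_def lo_def hi_def)
   then show ?thesis using False by (simp add: lo_def hi_def)
  next
   case True
   have mid: "lo <= mid" "mid < hi" "mid <= K" using True i by (auto simp: mid_def)
   have len: "mid - lo < 2 ^ (LG - Suc l)" "hi - Suc mid < 2 ^ (LG - Suc l)" using i(6) True unfolding pw mid_def by arith+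
   have mB: "mid <= B" "Suc mid <= B" using mid B by auto
   let ?w = "setv 56 mid (tck (setv 57 l u))"
   have tv: "ar s 0 (mid * (n * n) + (x * n + y)) <= j \<longleftrightarrow> ?P mid" using T[OF mid(3)] .
   have "I (Suc l) (setv 55 mid (tck ?w))" if "?P mid" using i mid len that by (auto simp: I_def lo_def[symmetric])
   moreover have "I (Suc l) (setv 54 (Suc mid) (tck ?w))" if "\<not> ?P mid"
   proof -
    have "\<not> ?P k" if "k < Suc mid" for k using mono[of k mid] that \<open>\<not> ?P mid\<close> by auto
    then show ?thesis using i mid len by (auto simp: I_def hi_def[symmetric])
   qed
   moreover have "val (Quot (Plus (Var 54) (Var 55)) (Num 2)) (tck (setv 57 l u)) = mid" by (simp add: mid_def lo_def hi_def)
   ultimately show ?thesis using True mB tv unfolding wp_simps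
    by (simp add: u lo_def[symmetric] hi_def[symmetric])
  qed
 next
  case (3 u)
  then show ?case using v by (auto simp: I_def)
 qed
 then have "wp B J (For 57 12 (Cond (Less (Var 54) (Var 55)) (Asg 56 (Quot (Plus (Var 54) (Var 55)) (Num 2));;
    Cond (Leq (Rd 0 (Plus (Times (Var 56) (Var 7)) (Plus (Times (Var 50) (Var 5)) (Var 51)))) (Var 52)) (Asg 55 (Var 56)) (Asg 54 (Plus (Var 56) (Num 1)))) Nop))
   (wp B J (Cond (Leq (Var 55) (Var 11)) (Asg 53 (Rd 1 (Var 55))) (Asg 53 (Plus (Times (Num 2) (Var 7)) (Num 1))))
   (\<lambda>u. vr u 53 = est M K (2 * (n * n) + 1) (set (take j pred)) x y & ck u <= ck s + 5 + 5 * LG)) ?s"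
 proof (rule wp_conseq, goal_cases)
  case (1 u)
  have u: "vr u 7 = n * n" "vr u 11 = K" "ar u = ar s" using 1(2) v by (auto simp: frame_def)
  define hi where "hi = vr u 55"
  have i: "ck u <= ck s + 3 + 5 * LG" "hi <= K + 1" "\<forall>k<hi. \<not> ?P k" "hi = K + 1 \<or> ?P hi"
   using 1(1) unfolding I_def hi_def by auto
  have arB: "ar s 1 hi <= B" using B(3) by (simp add: bounded_def)
  show ?case
  proof (cases "hi <= K")
   case True
   then have "?P hi" using i by auto
   then have "(LEAST k. ?P k) = hi" using i(3) by (intro Least_equality) (auto simp: not_less[symmetric])
   then have "est M K (2 * (n * n) + 1) (set (take j pred)) x y = Lf M hi" using True \<open>?P hi\<close> by (auto simp: est_def)
   then show ?thesis using True u i(1) tab[OF True] arB by (simp add: hi_def[symmetric])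
  next
   case False
   then have "\<not> (\<exists>k\<le>K. ?P k)" using i by auto
   then show ?thesis using False u i(1) B(2) by (auto simp: hi_def[symmetric] est_def)
  qed
 qed
 moreover have "val (Plus (Var 11) (Num 1)) (setv 54 0 s) = K + 1" using v by simp
 ultimately show ?thesis using B(1) unfolding lookup_def wp_Sq wp_simps(1)[of _ _ 54] wp_simps(1)[of _ _ 55] by simp
qed

section \<open>Collecting the edges outside the predicted prefix\<close>

definition collect :: com where
 "collect = Asg 52 (Rd 6 (Num 0));; Asg 60 (Num 0);;
   For 61 13 (Asg 62 (Rd 8 (Var 61));; Asg 63 (Minus (Plus (Rd 6 (Var 62)) (Num 1)) (Var 62));;
    For 64 63 (Asg 65 (Plus (Var 62) (Var 64));; Sto 40 (Var 60) (Rd 3 (Var 65));; Sto 41 (Var 60) (Rd 4 (Var 65));; Asg 60 (Plus (Var 60) (Num 1))))"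

lemma mv_collect [simp]: "mv collect = {52,60,61,62,63,64,65}" "ma collect = {40,41}" "mp collect = False" "wf_com collect"
 by (auto simp: collect_def)

text \<open>Every run contains an index, so there are at most as many runs as collected edges, and
  the time is linear in the number of these edges.\<close>

lemma collect_wp:
 assumes b: "base n pred M K LG s" and r: "rinv I s" and I: "0 \<in> I" "I \<subseteq> {..length pred}" and B: "bounded B s" "2 * length pred + 2 <= B"
  and j: "isrun I 0 j"
 shows "wp B J collect (\<lambda>u. vr u 52 = j & vr u 60 = card {p \<in> I. j < p} &
   (\<lambda>y. (ar u 40 y, ar u 41 y)) ` {..<vr u 60} = (\<lambda>p. pred ! (p - 1)) ` {p \<in> I. j < p} & ck u <= ck s + 3 + 10 * vr u 60) s"
proof -
 have r2: "\<And>a b. isrun I a b ==> ar s 6 a = b" and r3: "lst (ar s 8) (ar s 9) (vr s 13) (starts I)" using r by (auto simp: rinv_def)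
 have et: "\<And>p. p < length pred ==> ar s 3 (p + 1) = fst (pred ! p) & ar s 4 (p + 1) = snd (pred ! p)" using b by (auto simp: base_def edge_tab_def)
 define st where "st = ar s 8"
 define en where "en x = ar s 6 (st x)" for x
 have inj: "st x = st y \<longleftrightarrow> x = y" if "x < vr s 13" "y < vr s 13" for x y using r3 that unfolding lst_def st_def by metis
 have run: "isrun I (st x) (en x)" "st x \<noteq> 0" if "x < vr s 13" for x
 proof -
  have "st x \<in> starts I" using r3 that by (auto simp: lst_def st_def)
  then have s: "st x \<in> I" "st x \<noteq> 0" "st x - 1 \<notin> I" by (auto simp: starts_def)
  then obtain b where "isrun I (st x) b" using isrun_right[of "st x" I] I by auto
  then show "isrun I (st x) (en x)" "st x \<noteq> 0" using r2 s by (auto simp: en_def)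
 qed
 \<comment> \<open>The indices covered by the first \<open>k\<close> listed runs. Runs are disjoint,
   hence the counter in variable 60 counts every index once.\<close>
 define X where "X k = (\<Union>x<k. {st x..en x})" for k
 have Xsub: "X k \<subseteq> {1..length pred}" if "k <= vr s 13" for k
 proof
  fix p assume "p \<in> X k"
  then obtain x where x: "x < k" "st x <= p" "p <= en x" by (auto simp: X_def)
  then have "p \<in> I" "p \<noteq> 0" using run[of x] that by (auto simp: isrun_def)
  then show "p \<in> {1..length pred}" using I by auto
 qed
 have Xfin: "finite (X k)" for k by (auto simp: X_def)
 have disj: "p \<notin> X k" if "k < vr s 13" "st k <= p" "p <= en k" for k p
 proof
  assume "p \<in> X k"
  then obtain x where x: "x < k" "st x <= p" "p <= en x" by (auto simp: X_def)
  then have "st x = st k" using isrun_unique[OF run(1)[of x] run(1)[of k], of p] that by auto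
  then show False using inj[of x k] x that by auto
 qed
 have Xend: "X (vr s 13) = {p \<in> I. j < p}"
 proof
  show "X (vr s 13) \<subseteq> {p \<in> I. j < p}"
  proof
   fix p assume "p \<in> X (vr s 13)"
   then obtain x where x: "x < vr s 13" "st x <= p" "p <= en x" by (auto simp: X_def)
   have "p \<in> I" using run(1)[OF x(1)] x by (auto simp: isrun_def)
   moreover have "j < p"
   proof (rule ccontr)
    assume "\<not> j < p"
    then have "st x = 0" using isrun_unique[OF run(1)[OF x(1)] j, of p] x by auto
    then show False using run(2)[OF x(1)] by simp
   qed
   ultimately show "p \<in> {p \<in> I. j < p}" by simp
  qed
  show "{p \<in> I. j < p} \<subseteq> X (vr s 13)"
  proof
   fix p assume p: "p \<in> {p \<in> I. j < p}"
   \<comment> \<open>Cutting the index set at \<open>p\<close> makes \<open>p\<close> a right end,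
     so that \<open>isrun_left\<close> yields the start of the run through \<open>p\<close>. This
     start is not 0, because \<open>Suc j\<close> is missing.\<close>
   define I' where "I' = {x \<in> I. x <= p}"
   have "\<exists>a. isrun I' a p" by (rule isrun_left) (use p in \<open>auto simp: I'_def\<close>)
   then obtain a where a: "isrun I' a p" by auto
   have aI: "a \<in> I" "a <= p" "{a..p} \<subseteq> I" using a by (auto simp: isrun_def I'_def)
   have "a \<noteq> 0"
   proof
    assume "a = 0"
    then have "Suc j \<in> {a..p}" using p by auto
    then show False using aI(3) j by (auto simp: isrun_def)
   qed
   moreover have "a - 1 \<notin> I" using a \<open>a \<noteq> 0\<close> aI(2) by (auto simp: isrun_def I'_def)
   ultimately have "a \<in> starts I" using aI by (simp add: starts_def)
   then have "a \<in> st ` {..<vr s 13}" using r3 by (simp add: lst_def st_def)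
   then obtain x where x: "x < vr s 13" "st x = a" by auto
   have "p <= en x"
   proof (rule ccontr)
    assume "\<not> p <= en x"
    then have "Suc (en x) \<in> {a..p}" using run(1)[OF x(1)] x by (auto simp: isrun_def)
    then show False using aI(3) run(1)[OF x(1)] by (auto simp: isrun_def)
   qed
   then show "p \<in> X (vr s 13)" using x aI by (auto simp: X_def)
  qed
 qed
 let ?e = "\<lambda>p. pred ! (p - 1)"
 define Q where "Q Y u \<longleftrightarrow> vr u 60 = card Y & (\<lambda>y. (ar u 40 y, ar u 41 y)) ` {..<vr u 60} = ?e ` Y" for Y and u :: st
 have cardX: "card (X k) <= length pred" if "k <= vr s 13" for k using card_mono[OF _ Xsub[OF that]] by simp
 let ?inner = "For 64 63 (Asg 65 (Plus (Var 62) (Var 64));; Sto 40 (Var 60) (Rd 3 (Var 65));; Sto 41 (Var 60) (Rd 4 (Var 65));; Asg 60 (Plus (Var 60) (Num 1)))"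
 let ?s = "setv 60 0 (setv 52 j s)"
 have "wp B J (For 61 13 (Asg 62 (Rd 8 (Var 61));; Asg 63 (Minus (Plus (Rd 6 (Var 62)) (Num 1)) (Var 62));; ?inner))
   (\<lambda>u. vr u 52 = j & Q (X (vr s 13)) u & ck u <= ck s + 3 + 10 * vr u 60) ?s"
 proof (rule wp_For[where I = "\<lambda>k u. Q (X k) u & k <= vr u 60 & ck u <= ck s + 2 + 5 * k + 5 * vr u 60"], goal_cases)
  case 1 then show ?case by (simp add: Q_def X_def)
 next
  case (2 k u)
  have k: "k < vr s 13" using 2(1) by simp
  have u: "\<And>a. a \<notin> {40,41} ==> ar u a = ar s a" using 2(3) by (auto simp: frame_def)
  define a len where "a = st k" and "len = en k + 1 - a"
  have ab: "a <= en k" "0 < len" "{a..en k} \<subseteq> I" using run(1)[OF k] by (auto simp: isrun_def a_def len_def)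
  have em: "en k <= length pred" using ab I by auto
  define w where "w = setv 63 len (setv 62 a (setv 61 k u))"
  have w: "vr w 62 = a" "vr w 63 = len" "\<And>a. a \<notin> {40,41} ==> ar w a = ar s a" "vr w 60 = vr u 60" "ck w = ck u + 3" using u by (auto simp: w_def)
  have qw: "Q (X k) w" using 2(2) by (auto simp: Q_def w_def)
  have inner: "wp B J ?inner (\<lambda>z. Q (X (Suc k)) z & Suc k <= vr z 60 & ck z <= ck s + 2 + 5 * Suc k + 5 * vr z 60) w"
  proof (rule wp_For[where I = "\<lambda>x z. Q (X k \<union> {a..<a + x}) z & vr z 60 = vr u 60 + x & ck z <= ck w + 5 * x"], goal_cases)
   case 1 then show ?case using qw w by simp
  next
   case (2 x z)
   have x: "x < len" using 2(1) w by simp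
   have z: "vr z 62 = a" "\<And>a. a \<notin> {40,41} ==> ar z a = ar s a" using 2(3) w by (auto simp: frame_def)
   let ?Y = "X k \<union> {a..<a + x}"
   let ?q = "vr z 60"
   have p: "a + x <= en k" "a + x \<notin> ?Y" using x disj[OF k, of "a + x"] ab by (auto simp: len_def a_def)
   have pm: "a + x - 1 < length pred" "a + x - 1 + 1 = a + x" using p em run(2)[OF k] by (auto simp: a_def)
   have e: "ar s 3 (a + x) = fst (pred ! (a + x - 1))" "ar s 4 (a + x) = snd (pred ! (a + x - 1))" using et[OF pm(1)] unfolding pm(2) by auto
   have Y': "X k \<union> {a..<a + Suc x} = insert (a + x) ?Y" by auto
   have finY: "finite ?Y" using Xfin by simp
   have q: "?q = card ?Y" "(\<lambda>y. (ar z 40 y, ar z 41 y)) ` {..<?q} = ?e ` ?Y" using 2(2) by (auto simp: Q_def)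
   let ?z = "setv 60 (Suc ?q) (seta 41 ?q (ar s 4 (a + x)) (seta 40 ?q (ar s 3 (a + x)) (setv 65 (a + x) (setv 64 x z))))"
   have im: "(\<lambda>y. (ar ?z 40 y, ar ?z 41 y)) ` {..<Suc ?q} = insert (?e (a + x)) ((\<lambda>y. (ar z 40 y, ar z 41 y)) ` {..<?q})"
    by (auto simp: lessThan_Suc e image_def)
   have Q: "Q (X k \<union> {a..<a + Suc x}) ?z"
    unfolding Y' Q_def using q im p(2) finY by simp
   have qB: "Suc ?q <= B"
   proof -
    have "?Y \<subseteq> {1..length pred}" using Xsub[of k] k run(2)[OF k] p em by (auto simp: a_def)
    then have "card ?Y <= length pred" using card_mono[of "{1..length pred}" ?Y] by simp
    then show ?thesis using q B by simp
   qed
   have aB: "a + x <= B" "ar s 3 (a + x) <= B" "ar s 4 (a + x) <= B" using p em B by (auto simp: bounded_def)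
   show ?case using Q qB aB 2(2) by (simp add: z)
  next
   case (3 z)
   have eq: "X k \<union> {a..<a + len} = X (Suc k)" using ab by (auto simp: X_def lessThan_Suc len_def a_def)
   have z: "Q (X (Suc k)) z" "vr z 60 = vr u 60 + len" "ck z <= ck w + 5 * len" using 3(1) w eq by auto
   have "Suc k <= vr z 60" using z(2) 2(2) ab by simp
   then show ?case using z w 2(2) by (auto simp: Q_def)
  qed
  have "a <= B" "len <= B" "en k + 1 <= B" using ab em B by (auto simp: len_def)
  moreover have "ar u 8 k = a" "ar u 6 a = en k" using u by (simp_all add: a_def st_def en_def)
  ultimately show ?case using inner by (simp add: w_def len_def)
 next
  case (3 u)
  have "vr u 52 = j" using 3(2) by (auto simp: frame_def)
  then show ?case using 3(1) by (auto simp: Q_def)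
 qed
 then have "wp B J (For 61 13 (Asg 62 (Rd 8 (Var 61));; Asg 63 (Minus (Plus (Rd 6 (Var 62)) (Num 1)) (Var 62));; ?inner))
  (\<lambda>u. vr u 52 = j & vr u 60 = card {p \<in> I. j < p} &
   (\<lambda>y. (ar u 40 y, ar u 41 y)) ` {..<vr u 60} = (\<lambda>p. pred ! (p - 1)) ` {p \<in> I. j < p} & ck u <= ck s + 3 + 10 * vr u 60) ?s"
  by (rule wp_conseq) (auto simp: Q_def Xend)
 moreover have "ar s 6 0 = j" using r2[OF j] .
 moreover have "j <= B" using calculation(2) B(1) by (metis bounded_def)
 ultimately show ?thesis unfolding collect_def by simp
qed

section \<open>Shortest paths through the additional edges\<close>

lemma rch_trans: "rch E a x z ==> rch E b z y ==> rch E (a + b) x y"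
proof -
 assume "rch E a x z" "rch E b z y"
 then obtain k k' where z: "k <= a" "(x, z) \<in> E ^^ k" "k' <= b" "(z, y) \<in> E ^^ k'" by (auto simp: rch_def)
 then have "(x, y) \<in> E ^^ (k + k')" by (auto simp: relpow_add)
 then show ?thesis using z unfolding rch_def by (intro exI[of _ "k + k'"]) auto
qed

lemma relpow_subset: "(x, y) \<in> E ^^ k ==> E \<subseteq> F ==> (x, y) \<in> F ^^ k" for E F :: "('a \<times> 'a) set"
 by (induction k arbitrary: y) (auto intro: relcompI)

lemma rch_subset: "rch E l x y ==> E \<subseteq> F ==> rch F l x y"
 using relpow_subset unfolding rch_def by metis

lemma est_le:
 assumes "1 <= M" "E \<subseteq> {..<n} \<times> {..<n}" "n * n <= Lf M K"
 shows "est M K (2 * (n * n) + 1) E x y <= 2 * (n * n) + 1"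
proof (cases "\<exists>k\<le>K. rch E (Lf M k) x y")
 case True
 then obtain l where "(x, y) \<in> E ^^ l" by (auto simp: rch_def)
 then show ?thesis using est_complete(2)[OF assms, of x y l] by (simp add: le_Suc_eq)
qed (auto simp: est_def)

text \<open>Dijkstra's algorithm on the inserted edges \<open>U y \<rightarrow> W y\<close> outside the predicted prefix: \<open>d y\<close> is the tentative distance of \<open>W y\<close>, \<open>X\<close> the set of settled edges.\<close>

locale dijkstra =
 fixes n M K q :: nat and Ep :: "edge set" and U W :: "nat => nat" and s t :: nat
 assumes M1: "1 <= M" and Ep: "Ep \<subseteq> {..<n} \<times> {..<n}" and Kbig: "n * n <= Lf M K"
  and UW: "\<And>y. y < q ==> U y < n & W y < n"
begin

definition "Z = 2 * (n * n) + 1"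
definition "D x y = est M K Z Ep x y"
definition "E = Ep \<union> (\<lambda>y. (U y, W y)) ` {..<q}"

lemma D_le: "D x y <= Z"
 unfolding D_def Z_def by (rule est_le[OF M1 Ep Kbig])

lemma D_sound: "D x y < Z ==> rch E (D x y) x y"
 unfolding D_def using est_sound[of M K Z Ep x y] rch_subset[of Ep _ x y E] by (auto simp: E_def)

lemma D_complete: "(x, y) \<in> Ep ^^ l ==> M * D x y <= (M + 1) * l"
 unfolding D_def by (rule est_complete(1)[OF M1 Ep Kbig])

text \<open>The estimates \<open>D\<close> may violate the triangle inequality; the invariant relies
  on their being nonnegative. Settled edges have been relaxed against all edges, and
  \<open>b\<close> is at most the direct estimate and every connection to \<open>t\<close> through a
  settled edge.\<close>

definition inv :: "nat set => (nat => nat) => nat => bool" where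
 "inv X d b \<longleftrightarrow> X \<subseteq> {..<q} & (\<forall>x\<in>X. \<forall>y<q. d y <= d x + D (W x) (U y) + 1) & (\<forall>x\<in>X. \<forall>y<q. y \<notin> X --> d x <= d y) &
   (\<forall>y<q. d y <= D s (U y) + 1) & (\<forall>x\<in>X. b <= d x + D (W x) t) & b <= D s t &
   (\<forall>y<q. d y < Z --> rch E (d y) s (W y)) & (b < Z --> rch E b s t)"

lemma edge_E: "y < q ==> rch E a x (U y) ==> rch E (a + 1) x (W y)"
 using rch_trans[of E a x "U y" 1 "W y"] unfolding rch_1 by (auto simp: E_def)

lemma inv_init: "(\<And>y. y < q ==> d y = D s (U y) + 1) ==> inv {} d (D s t)"
 unfolding inv_def using edge_E D_sound by auto

lemma inv_step:
 assumes i: "inv X d b" and x: "x < q" "x \<notin> X" "\<And>y. y < q ==> y \<notin> X ==> d x <= d y"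
  and d': "\<And>y. y < q ==> d' y = min (d y) (d x + D (W x) (U y) + 1)"
 shows "inv (insert x X) d' (min b (d x + D (W x) t))"
proof -
 have i1: "X \<subseteq> {..<q}" and i2: "\<And>x y. x \<in> X ==> y < q ==> d y <= d x + D (W x) (U y) + 1" and i3: "\<And>x y. x \<in> X ==> y < q ==> y \<notin> X ==> d x <= d y"
  and i4: "\<And>y. y < q ==> d y <= D s (U y) + 1" and i5: "\<And>x. x \<in> X ==> b <= d x + D (W x) t" and i6: "b <= D s t"
  and i7: "\<And>y. y < q ==> d y < Z ==> rch E (d y) s (W y)" and i8: "b < Z ==> rch E b s t"
  using i unfolding inv_def by blast+
 \<comment> \<open>Relaxing with \<open>x\<close> leaves settled edges unchanged: their values are
   at most that of \<open>x\<close>, since \<open>x\<close> was unsettled when they were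
   chosen.\<close>
 have old: "d' z = d z" if "z \<in> insert x X" for z
 proof -
  have "z < q" "d z <= d x" using that i1 i3[of z x] x by auto
  then show ?thesis using d' by simp
 qed
 have le: "d' y <= d y" if "y < q" for y using d'[OF that] by simp
 show ?thesis unfolding inv_def
 proof (intro conjI ballI allI impI)
  show "insert x X \<subseteq> {..<q}" using i1 x by auto
 next
  fix z y assume z: "z \<in> insert x X" and y: "y < q"
  show "d' y <= d' z + D (W z) (U y) + 1" unfolding old[OF z] using z d'[OF y] i2[of z y] y by auto
 next
  fix z y assume z: "z \<in> insert x X" and y: "y < q" "y \<notin> insert x X"
  have "d z <= d y" "d z <= d x" using z y x i3[of z y] i3[of z x] by auto
  then show "d' z <= d' y" unfolding old[OF z] d'[OF y(1)] by simp
 next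
  fix y assume "y < q" then show "d' y <= D s (U y) + 1" using le i4 by (meson order_trans)
 next
  fix z assume z: "z \<in> insert x X"
  show "min b (d x + D (W x) t) <= d' z + D (W z) t" unfolding old[OF z] using z i5[of z] by auto
 next
  show "min b (d x + D (W x) t) <= D s t" using i6 by simp
 next
  fix y assume y: "y < q" "d' y < Z"
  show "rch E (d' y) s (W y)"
  proof (cases "d y <= d x + D (W x) (U y) + 1")
   case True
   then show ?thesis using d'[OF y(1)] y i7 by simp
  next
   case False
   then have e: "d' y = d x + D (W x) (U y) + 1" using d'[OF y(1)] by simp
   have "rch E (d x + D (W x) (U y)) s (U y)"
    by (rule rch_trans[where z = "W x"]) (use y e x i7 D_sound in auto)
   then show ?thesis unfolding e by (rule edge_E[OF y(1)])
  qed
 next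
  assume m: "min b (d x + D (W x) t) < Z"
  show "rch E (min b (d x + D (W x) t)) s t"
  proof (cases "b <= d x + D (W x) t")
   case True
   then show ?thesis using m i8 by simp
  next
   case False
   then have e: "min b (d x + D (W x) t) = d x + D (W x) t" by simp
   show ?thesis unfolding e
    by (rule rch_trans[where z = "W x"]) (use m e x i7 D_sound in auto)
  qed
 qed
qed

text \<open>A path consists of pieces inside the prefix and of additional edges. The pieces are
  overestimated by a factor of at most \<open>1 + 1/M\<close>, the additional edges are counted
  exactly, so the sum is within the same factor, however many pieces there are.\<close>

lemma inv_final:
 assumes i: "inv {..<q} d b" and p: "(s, t) \<in> E ^^ k"
 shows "M * b <= (M + 1) * k" "b < Z"
proof -
 have i2: "\<And>x y. x < q ==> y < q ==> d y <= d x + D (W x) (U y) + 1"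
  and i4: "\<And>y. y < q ==> d y <= D s (U y) + 1" and i5: "\<And>x. x < q ==> b <= d x + D (W x) t" and i6: "b <= D s t"
  using i unfolding inv_def by auto
 \<comment> \<open>Either the walk stays in the prefix, or \<open>x\<close> is the last additional
   edge used and \<open>l\<close> the number of steps since.\<close>
 have ind: "(\<exists>l\<le>k. (s, v) \<in> Ep ^^ l) \<or> (\<exists>x l. x < q & (W x, v) \<in> Ep ^^ l & M * d x + (M + 1) * l <= (M + 1) * k)"
  if "(s, v) \<in> E ^^ k" for v k using that
 proof (induction k arbitrary: v)
  case 0 then show ?case by auto
 next
  case (Suc k)
  then obtain w where w: "(s, w) \<in> E ^^ k" "(w, v) \<in> E" by auto
  show ?case
  proof (cases "(w, v) \<in> Ep")
   case True
   from Suc.IH[OF w(1)] show ?thesis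
   proof (elim disjE exE conjE)
    fix l assume "l <= k" "(s, w) \<in> Ep ^^ l"
    then have "(s, v) \<in> Ep ^^ Suc l" "Suc l <= Suc k" using True by auto
    then show ?thesis by blast
   next
    fix x l assume a: "x < q" "(W x, w) \<in> Ep ^^ l" "M * d x + (M + 1) * l <= (M + 1) * k"
    then have "(W x, v) \<in> Ep ^^ Suc l" "M * d x + (M + 1) * Suc l <= (M + 1) * Suc k" using True by auto
    then show ?thesis using a by blast
   qed
  next
   case False
   then obtain y where y: "y < q" "w = U y" "v = W y" using w(2) by (auto simp: E_def)
   have "M * d y <= (M + 1) * k + M"
    using Suc.IH[OF w(1)]
   proof (elim disjE exE conjE)
    fix l assume l: "l <= k" "(s, w) \<in> Ep ^^ l"
    have "M * d y <= M * (D s w + 1)" unfolding y(2) by (rule mult_le_mono2[OF i4[OF y(1)]])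
    also have "\<dots> <= (M + 1) * l + M" using D_complete[OF l(2)] by simp
    also have "\<dots> <= (M + 1) * k + M" using mult_le_mono2[OF l(1), of "M + 1"] by (simp only: add_le_cancel_right)
    finally show ?thesis .
   next
    fix x l assume a: "x < q" "(W x, w) \<in> Ep ^^ l" "M * d x + (M + 1) * l <= (M + 1) * k"
    have "M * d y <= M * (d x + D (W x) w + 1)" unfolding y(2) by (rule mult_le_mono2[OF i2[OF a(1) y(1)]])
    also have "\<dots> = M * d x + M * D (W x) w + M" by (simp add: distrib_left)
    also have "\<dots> <= (M + 1) * k + M" using D_complete[OF a(2)] a(3) by linarith
    finally show ?thesis .
   qed
   then have "M * d y + (M + 1) * 0 <= (M + 1) * Suc k" by simp
   moreover have "(W y, v) \<in> Ep ^^ 0" using y by simp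
   ultimately show ?thesis using y by blast
  qed
 qed
 have main: "M * b <= (M + 1) * k" if "(s, t) \<in> E ^^ k" for k
  using ind[OF that]
 proof (elim disjE exE conjE)
  fix l assume l: "l <= k" "(s, t) \<in> Ep ^^ l"
  have "M * b <= M * D s t" using i6 by simp
  also have "\<dots> <= (M + 1) * l" by (rule D_complete[OF l(2)])
  also have "\<dots> <= (M + 1) * k" by (rule mult_le_mono2[OF l(1)])
  finally show ?thesis .
 next
  fix x l assume a: "x < q" "(W x, t) \<in> Ep ^^ l" "M * d x + (M + 1) * l <= (M + 1) * k"
  have "M * b <= M * (d x + D (W x) t)" using i5[OF a(1)] by simp
  also have "\<dots> = M * d x + M * D (W x) t" by (simp add: distrib_left)
  also have "\<dots> <= (M + 1) * k" using D_complete[OF a(2)] a(3) by linarith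
  finally show ?thesis .
 qed
 show "M * b <= (M + 1) * k" by (rule main[OF p])
 have "E \<subseteq> {..<n} \<times> {..<n}" using Ep UW by (auto simp: E_def)
 \<comment> \<open>The given path may be long; one with at most \<open>n * n\<close> steps shows
   that \<open>b\<close> is below the value for unreachable vertices.\<close>
 then obtain l where l: "l <= n * n" "(s, t) \<in> E ^^ l" using relpow_short[OF _ p] by auto
 have "M * b <= (M + 1) * l" by (rule main[OF l(2)])
 also have "\<dots> <= (2 * M) * (n * n)" using l M1 by (intro mult_mono) auto
 also have "\<dots> = M * (2 * (n * n))" by simp
 finally show "b < Z" using M1 by (simp add: Z_def)
qed

end

section \<open>The query program\<close>

definition findmin :: com where
 "findmin = Asg 67 (Var 60);; For 64 60 (Cond (Equal (Rd 43 (Var 64)) (Num 0))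
   (Cond (Less (Var 67) (Var 60)) (Cond (Less (Rd 42 (Var 64)) (Rd 42 (Var 67))) (Asg 67 (Var 64)) Nop) (Asg 67 (Var 64))) Nop)"

definition relax_all :: com where
 "relax_all = For 64 60 (Asg 51 (Rd 40 (Var 64));; lookup;; Asg 68 (Plus (Plus (Rd 42 (Var 67)) (Var 53)) (Num 1));;
   Cond (Less (Var 68) (Rd 42 (Var 64))) (Sto 42 (Var 64) (Var 68)) Nop)"

definition settle :: com where
 "settle = findmin;; Sto 43 (Var 67) (Num 1);; Asg 50 (Rd 41 (Var 67));; Asg 51 (Var 59);; lookup;;
   Asg 68 (Plus (Rd 42 (Var 67)) (Var 53));; Cond (Less (Var 68) (Var 66)) (Asg 66 (Var 68)) Nop;; relax_all"

definition dinit :: com where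
 "dinit = Asg 50 (Var 58);; Asg 51 (Var 59);; lookup;; Asg 66 (Var 53);;
   For 61 60 (Asg 51 (Rd 40 (Var 61));; lookup;; Sto 42 (Var 61) (Plus (Var 53) (Num 1));; Sto 43 (Var 61) (Num 0))"

text \<open>Variable 0 is register 0, where the numerator is expected. Register 1 holds no variable,
  so the denominator is left in variable 69, that is register 207, from which
  \<open>pred_apsp\<close> copies it; it is 0 for an unreachable target.\<close>

definition query :: com where
 "query = Asg 58 (Var 0);; Asg 59 (Var 1);; collect;; dinit;; For 61 60 settle;;
   Cond (Less (Times (Num 2) (Var 7)) (Var 66)) (Asg 69 (Num 0)) (Asg 69 (Num 1));; Asg 0 (Var 66)"

lemma mv_findmin [simp]: "mv findmin = {64,67}" "ma findmin = {}" "mp findmin = False" "wf_com findmin"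
 by (auto simp: findmin_def)
lemma mv_relax_all [simp]: "mv relax_all = {51,53,54,55,56,57,64,68}" "ma relax_all = {42}" "mp relax_all = False" "wf_com relax_all"
 by (auto simp: relax_all_def)
lemma mv_settle [simp]: "mv settle = {50,51,53,54,55,56,57,64,66,67,68}" "ma settle = {42,43}" "mp settle = False" "wf_com settle"
 by (auto simp: settle_def)
lemma mv_dinit [simp]: "mv dinit = {50,51,53,54,55,56,57,61,66}" "ma dinit = {42,43}" "mp dinit = False" "wf_com dinit"
 by (auto simp: dinit_def)
lemma mv_query [simp]: "mv query = {0,69} \<union> {50..68}" "ma query = {40,41,42,43}" "mp query = False" "wf_com query"
 unfolding query_def by (simp_all add: atLeastAtMost_insertL[symmetric] numeral_eq_Suc) auto

text \<open>The value \<open>q\<close> of variable 67 means that no unsettled edge has been met so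
  far.\<close>

lemma findmin_wp:
 assumes v: "vr s 60 = q" and B: "q <= B" and ex: "\<exists>y<q. ar s 43 y = 0"
 shows "wp B J findmin (\<lambda>u. vr u 67 < q & ar s 43 (vr u 67) = 0 & (\<forall>y<q. ar s 43 y = 0 --> ar s 42 (vr u 67) <= ar s 42 y) & ck u <= ck s + 2 + 5 * q) s"
proof -
 define I where "I l u \<longleftrightarrow> ck u <= ck s + 1 + 5 * l & ((vr u 67 = q & (\<forall>y<l. ar s 43 y \<noteq> 0)) \<or>
  (vr u 67 < l & ar s 43 (vr u 67) = 0 & (\<forall>y<l. ar s 43 y = 0 --> ar s 42 (vr u 67) <= ar s 42 y)))" for l and u :: st
 have "wp B J (For 64 60 (Cond (Equal (Rd 43 (Var 64)) (Num 0))
   (Cond (Less (Var 67) (Var 60)) (Cond (Less (Rd 42 (Var 64)) (Rd 42 (Var 67))) (Asg 67 (Var 64)) Nop) (Asg 67 (Var 64))) Nop))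
   (\<lambda>u. vr u 67 < q & ar s 43 (vr u 67) = 0 & (\<forall>y<q. ar s 43 y = 0 --> ar s 42 (vr u 67) <= ar s 42 y) & ck u <= ck s + 2 + 5 * q) (setv 67 q s)"
 proof (rule wp_For[where I = I], goal_cases)
  case 1 then show ?case by (simp add: I_def)
 next
  case (2 l u)
  have l: "l < q" using 2(1) v by simp
  have u: "vr u 60 = q" "ar u = ar s" using 2(3) v by (auto simp: frame_def)
  have lB: "l <= B" using l B by simp
  note iu = 2(2)[unfolded I_def]
  show ?case
  proof (cases "ar s 43 l = 0")
   case False
   then show ?thesis using iu by (simp add: u I_def less_Suc_eq) auto
  next
   case True
   show ?thesis
   proof (cases "vr u 67 < q")
    case False
    then have "\<forall>y<l. ar s 43 y \<noteq> 0" "ck u <= ck s + 1 + 5 * l" using iu l by auto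
    then show ?thesis using True False lB by (auto simp: u I_def less_Suc_eq)
   next
    case T: True
    then have "vr u 67 < l" "ar s 43 (vr u 67) = 0" "\<forall>y<l. ar s 43 y = 0 --> ar s 42 (vr u 67) <= ar s 42 y" "ck u <= ck s + 1 + 5 * l"
     using iu by auto
    then show ?thesis using True T lB by (auto simp: u I_def less_Suc_eq)
   qed
  qed
 next
  case (3 u)
  then show ?case using v ex by (auto simp: I_def)
 qed
 then show ?thesis using v B by (simp add: findmin_def)
qed

lemma vertex_le: "x < n ==> 4 * (n * n) + 6 <= B ==> x <= B" for x n B :: nat
 using le_square[of n] by linarith

locale qstate = dijkstra n M K q Ep U W s t for n M K q :: nat and Ep :: "edge set" and U W :: "nat => nat" and s t :: nat +
 fixes pred :: "edge list" and LG j B :: nat and J :: "nat list"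
 assumes Epj: "Ep = set (take j pred)" "j <= length pred" and st: "s < n" "t < n"
  and Bq: "2 * K + 2 <= B" "4 * (n * n) + 6 <= B" "q <= B"
begin

definition ctx :: "st => bool" where
 "ctx u \<longleftrightarrow> base n pred M K LG u & (\<forall>i. ar u 1 i <= B) & vr u 52 = j & vr u 58 = s & vr u 59 = t & vr u 60 = q & ar u 40 = U & ar u 41 = W"

lemma ctx_cong: "ctx u ==> (\<And>x. x \<in> {5,7,11,12,52,58,59,60} ==> vr w x = vr u x) ==> (\<And>a. a \<in> {0,1,2,3,4,40,41} ==> ar w a = ar u a) ==> ctx w"
 unfolding ctx_def by (intro conjI) (auto intro: base_cong)

lemma lookup_D:
 assumes c: "ctx u" and xy: "vr u 50 = x" "vr u 51 = y" "x < n" "y < n"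
  and Q: "\<And>w. vr w 53 = D x y ==> frame lookup u w ==> ck w <= ck u + 5 + 5 * LG ==> Q w"
 shows "wp B J lookup Q u"
proof -
 have b: "base n pred M K LG u" "\<And>i. ar u 1 i <= B" "vr u 52 = j" using c unfolding ctx_def by auto
 have B: "2 * (n * n) + 1 <= B" using Bq(2) by simp
 show ?thesis by (rule wp_conseq[OF lookup_wp[OF b(1) M1 xy b(3) Epj(2) Bq(1) B b(2)]]) (rule Q, auto simp: D_def Z_def Epj(1)[symmetric])
qed

lemma sum_B: "a <= Z + 1 ==> a + D x y + 1 <= B"
 using D_le[of x y] Bq(2) by (simp add: Z_def)

lemma relax_all_wp:
 assumes c: "ctx u0" and x: "vr u0 67 = x" "x < q" "vr u0 50 = wx" "wx < n" and d: "\<And>y. y < q ==> ar u0 42 y <= Z + 1"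
 shows "wp B J relax_all (\<lambda>u. (\<forall>y<q. ar u 42 y = min (ar u0 42 y) (ar u0 42 x + D wx (U y) + 1)) & ck u <= ck u0 + 1 + (10 + 5 * LG) * q) u0"
proof -
 let ?d = "ar u0 42"
 define I where "I l u \<longleftrightarrow> (\<forall>y. ar u 42 y = (if y < l then min (?d y) (?d x + D wx (U y) + 1) else ?d y)) & ck u <= ck u0 + (10 + 5 * LG) * l" for l and u :: st
 have vq: "vr u0 60 = q" using c by (simp add: ctx_def)
 show ?thesis unfolding relax_all_def
 proof (rule wp_For[where I = I], goal_cases)
  case 1 then show ?case by (simp add: I_def)
 next
  case (2 l u)
  have l: "l < q" using 2(1) vq by simp
  have u: "vr u 67 = x" "vr u 50 = wx" using 2(3) x by (auto simp: frame_def)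
  have cu: "ctx u" by (rule ctx_cong[OF c]) (use 2(3) in \<open>auto simp: frame_def\<close>)
  let ?u = "setv 51 (U l) (setv 64 l u)"
  have cu': "ctx ?u" by (rule ctx_cong[OF cu]) auto
  have UB: "U l <= B" "ar u 40 = U" using vertex_le[OF _ Bq(2)] UW[OF l] cu by (auto simp: ctx_def)
  have "wp B J lookup (wp B J (Asg 68 (Plus (Plus (Rd 42 (Var 67)) (Var 53)) (Num 1));;
   Cond (Less (Var 68) (Rd 42 (Var 64))) (Sto 42 (Var 64) (Var 68)) Nop) (I (Suc l))) ?u"
  proof (rule lookup_D[OF cu', of wx "U l"])
   fix w assume w: "vr w 53 = D wx (U l)" "frame lookup ?u w" "ck w <= ck ?u + 5 + 5 * LG"
   have wv: "vr w 67 = x" "vr w 64 = l" "ar w = ar u" using w(2) u by (auto simp: frame_def)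
   have iu: "ar u 42 y = (if y < l then min (?d y) (?d x + D wx (U y) + 1) else ?d y)" "ck u <= ck u0 + (10 + 5 * LG) * l" for y using 2(2) by (auto simp: I_def)
   have ux: "ar u 42 x = ?d x" using iu(1)[of x] by simp
   have sB: "?d x + D wx (U l) + 1 <= B" by (rule sum_B[OF d[OF x(2)]])
   have ul: "ar u 42 l = ?d l" using iu(1)[of l] by simp
   have t: "ck w <= ck u0 + (10 + 5 * LG) * l + 7 + 5 * LG" using w(3) iu(2) by simp
   show "wp B J (Asg 68 (Plus (Plus (Rd 42 (Var 67)) (Var 53)) (Num 1));;
    Cond (Less (Var 68) (Rd 42 (Var 64))) (Sto 42 (Var 64) (Var 68)) Nop) (I (Suc l)) w"
    using sB t by (auto simp: wv w(1) ux ul I_def iu(1) less_Suc_eq)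
  qed (use u x UW l in auto)
  then show ?case using UB by simp
 next
  case (3 u) then show ?case using vq by (auto simp: I_def)
 qed
qed

definition rI :: "nat => nat => st => bool" where
 "rI T k u \<longleftrightarrow> (\<exists>X. card X = k & X \<subseteq> {..<q} & (\<forall>y<q. ar u 43 y = of_bool (y \<in> X)) & inv X (ar u 42) (vr u 66)) & ck u <= T + (q + 1) * (15 + 5 * LG) * k"

text \<open>Tentative values are bounded by the direct estimate from \<open>s\<close> plus one edge,
  hence by \<open>Z + 1\<close> even for unreachable edges. Their sum with one further estimate
  therefore remains a bounded word.\<close>

lemma inv_le: "inv X d b ==> y < q ==> d y <= Z + 1" "inv X d b ==> b <= Z"
 unfolding inv_def using D_le[of s "U y"] D_le[of s t] by (meson add_le_mono1 order_trans, meson order_trans)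

lemma settle_wp:
 assumes c: "ctx u0" and i: "rI T k u0" and k: "k < q"
 shows "wp B J settle (rI T (Suc k)) (setv 61 k u0)"
proof -
 from i obtain X where X: "card X = k" "X \<subseteq> {..<q}" "\<And>y. y < q ==> ar u0 43 y = of_bool (y \<in> X)" "inv X (ar u0 42) (vr u0 66)"
  and ck0: "ck u0 <= T + (q + 1) * (15 + 5 * LG) * k" by (auto simp: rI_def)
 let ?d = "ar u0 42" and ?b = "vr u0 66"
 let ?u1 = "setv 61 k u0"
 have c1: "ctx ?u1" by (rule ctx_cong[OF c]) auto
 have "X \<noteq> {..<q}" using X(1) k by auto
 then have "\<exists>y<q. y \<notin> X" using X(2) by auto
 then have ex: "\<exists>y<q. ar ?u1 43 y = 0" using X(3) by auto
 have vq: "vr ?u1 60 = q" using c1 by (simp add: ctx_def)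
 let ?rest = "Sto 43 (Var 67) (Num 1);; Asg 50 (Rd 41 (Var 67));; Asg 51 (Var 59);; lookup;;
   Asg 68 (Plus (Rd 42 (Var 67)) (Var 53));; Cond (Less (Var 68) (Var 66)) (Asg 66 (Var 68)) Nop;; relax_all"
 have "wp B J findmin (wp B J ?rest (rI T (Suc k))) ?u1"
 proof (rule wp_conseq[OF findmin_wp[OF vq Bq(3) ex]], goal_cases)
  case (1 u)
  define x where "x = vr u 67"
  have x: "x < q" "x \<notin> X" "\<And>y. y < q ==> y \<notin> X ==> ?d x <= ?d y" "ck u <= ck u0 + 3 + 5 * q" using 1(1) X(3) by (auto simp: x_def)
  have u: "ar u = ar u0" "vr u 59 = t" "vr u 66 = ?b" using 1(2) c1 by (auto simp: frame_def ctx_def)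
  have cu: "ctx u" by (rule ctx_cong[OF c1]) (use 1(2) in \<open>auto simp: frame_def\<close>)
  define u2 where "u2 = setv 51 t (setv 50 (W x) (seta 43 x 1 u))"
  have c2: "ctx u2" unfolding u2_def by (rule ctx_cong[OF cu]) auto
  have W: "W x < n" "ar u 41 = W" using UW[OF x(1)] cu by (auto simp: ctx_def)
  have WB: "W x <= B" "t <= B" "1 <= B" using vertex_le[OF _ Bq(2)] W st Bq by auto
  let ?b' = "min ?b (?d x + D (W x) t)"
  have "wp B J lookup (wp B J (Asg 68 (Plus (Rd 42 (Var 67)) (Var 53));; Cond (Less (Var 68) (Var 66)) (Asg 66 (Var 68)) Nop;; relax_all) (rI T (Suc k))) u2"
  proof (rule lookup_D[OF c2, of "W x" t])
   fix w assume w: "vr w 53 = D (W x) t" "frame lookup u2 w" "ck w <= ck u2 + 5 + 5 * LG"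
   have wv: "vr w 67 = x" "vr w 50 = W x" "vr w 66 = ?b" "ar w 42 = ?d" "ar w 43 = (ar u0 43)(x := 1)" using w(2) u by (auto simp: frame_def u2_def x_def)
   have cw: "ctx w" by (rule ctx_cong[OF c2]) (use w(2) in \<open>auto simp: frame_def\<close>)
   have sB: "?d x + D (W x) t + 1 <= B" by (rule sum_B[OF inv_le(1)[OF X(4) x(1)]])
   have rel: "wp B J relax_all (rI T (Suc k)) z" if z: "ctx z" "vr z 67 = x" "vr z 50 = W x" "vr z 66 = ?b'" "ar z 42 = ?d" "ar z 43 = (ar u0 43)(x := 1)" "ck z <= ck w + 3" for z
   proof (rule wp_conseq[OF relax_all_wp[OF z(1,2) x(1) z(3) W(1)]], goal_cases)
    case (1 y) then show ?case using inv_le(1)[OF X(4)] z(5) by simp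
   next
    case (2 v)
    have v: "ar v 43 = (ar u0 43)(x := 1)" "vr v 66 = ?b'" using 2(2) z by (auto simp: frame_def)
    have "inv (insert x X) (ar v 42) ?b'" by (rule inv_step[OF X(4) x(1,2,3)]) (use 2(1) z(5) in auto)
    moreover have "card (insert x X) = Suc k" using X(1,2) x(2) finite_subset[of X "{..<q}"] by auto
    moreover have "\<forall>y<q. ar v 43 y = of_bool (y \<in> insert x X)" using X(3) v by auto
    moreover have "ck v <= T + (q + 1) * (15 + 5 * LG) * Suc k"
    proof -
     have "ck v <= ck u0 + 3 + 5 * q + 3 + 5 + 5 * LG + 3 + 1 + (10 + 5 * LG) * q" using 2(1) z(7) w(3) x(4) by (simp add: u2_def)
     also have "\<dots> <= ck u0 + (q + 1) * (15 + 5 * LG)" by (simp add: algebra_simps)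
     finally show ?thesis using ck0 by (simp add: algebra_simps)
    qed
    ultimately show ?case unfolding rI_def using X(2) x(1) v(2) by (intro conjI exI[of _ "insert x X"]) auto
   qed
   let ?w = "setv 68 (?d x + D (W x) t) w"
   have "wp B J relax_all (rI T (Suc k)) (setv 66 (?d x + D (W x) t) (tck ?w))" if "?d x + D (W x) t < ?b"
    by (rule rel, rule ctx_cong[OF cw]) (use that in \<open>auto simp: wv\<close>)
   moreover have "wp B J relax_all (rI T (Suc k)) (tck (tck ?w))" if "\<not> ?d x + D (W x) t < ?b"
    by (rule rel, rule ctx_cong[OF cw]) (use that in \<open>auto simp: wv\<close>)
   ultimately show "wp B J (Asg 68 (Plus (Rd 42 (Var 67)) (Var 53));; Cond (Less (Var 68) (Var 66)) (Asg 66 (Var 68)) Nop;; relax_all) (rI T (Suc k)) w"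
    using sB by (simp add: wv w(1))
  qed (use W st in \<open>auto simp: u2_def\<close>)
  then show ?case using WB by (simp add: x_def[symmetric] u W(2)[unfolded u(1)] u2_def)
 qed
 then show ?thesis unfolding settle_def wp_Sq .
qed

lemma dinit_wp:
 assumes c: "ctx u0"
 shows "wp B J dinit (\<lambda>u. rI (ck u0 + (q + 1) * (15 + 5 * LG)) 0 u) u0"
proof -
 let ?T = "ck u0 + 8 + 5 * LG"
 let ?loop = "For 61 60 (Asg 51 (Rd 40 (Var 61));; lookup;; Sto 42 (Var 61) (Plus (Var 53) (Num 1));; Sto 43 (Var 61) (Num 0))"
 have loop: "wp B J ?loop (\<lambda>u. rI (ck u0 + (q + 1) * (15 + 5 * LG)) 0 u) z" if z: "ctx z" "vr z 66 = D s t" "vr z 50 = s" "ck z <= ?T" for z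
 proof -
  define I where "I l u \<longleftrightarrow> (\<forall>y<l. ar u 42 y = D s (U y) + 1 & ar u 43 y = 0) & ck u <= ?T + (10 + 5 * LG) * l" for l and u :: st
  have vq: "vr z 60 = q" using z by (simp add: ctx_def)
  show ?thesis
  proof (rule wp_For[where I = I], goal_cases)
   case 1 then show ?case using z by (simp add: I_def)
  next
   case (2 l u)
   have l: "l < q" using 2(1) vq by simp
   have u: "vr u 50 = s" using 2(3) z by (auto simp: frame_def)
   have cu: "ctx u" by (rule ctx_cong[OF z(1)]) (use 2(3) in \<open>auto simp: frame_def\<close>)
   let ?u = "setv 51 (U l) (setv 61 l u)"
   have cu': "ctx ?u" by (rule ctx_cong[OF cu]) auto
   have UB: "U l <= B" "ar u 40 = U" using vertex_le[OF _ Bq(2)] UW[OF l] cu by (auto simp: ctx_def)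
   have "wp B J lookup (wp B J (Sto 42 (Var 61) (Plus (Var 53) (Num 1));; Sto 43 (Var 61) (Num 0)) (I (Suc l))) ?u"
   proof (rule lookup_D[OF cu', of s "U l"])
    fix w assume w: "vr w 53 = D s (U l)" "frame lookup ?u w" "ck w <= ck ?u + 5 + 5 * LG"
    have wv: "vr w 61 = l" "ar w = ar u" using w(2) by (auto simp: frame_def)
    have "D s (U l) + 1 <= B" using sum_B[of 0 s "U l"] by simp
    then show "wp B J (Sto 42 (Var 61) (Plus (Var 53) (Num 1));; Sto 43 (Var 61) (Num 0)) (I (Suc l)) w"
     using 2(2) w by (auto simp: I_def wv less_Suc_eq)
   qed (use u st UW l in auto)
   then show ?case using UB by simp
  next
   case (3 u)
   have b: "vr u 66 = D s t" using 3(2) z by (auto simp: frame_def)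
   have "inv {} (ar u 42) (D s t)" by (rule inv_init) (use 3(1) vq in \<open>auto simp: I_def\<close>)
   then show ?case using 3(1) vq b unfolding rI_def I_def by (intro conjI exI[of _ "{}"]) (auto simp: algebra_simps)
  qed
 qed
 let ?u = "setv 51 t (setv 50 s u0)"
 have c1: "ctx ?u" by (rule ctx_cong[OF c]) auto
 have "wp B J lookup (wp B J (Asg 66 (Var 53);; ?loop) (\<lambda>u. rI (ck u0 + (q + 1) * (15 + 5 * LG)) 0 u)) ?u"
 proof (rule lookup_D[OF c1, of s t])
  fix w assume w: "vr w 53 = D s t" "frame lookup ?u w" "ck w <= ck ?u + 5 + 5 * LG"
  have wv: "vr w 50 = s" using w(2) by (auto simp: frame_def)
  have cw: "ctx w" by (rule ctx_cong[OF c1]) (use w(2) in \<open>auto simp: frame_def\<close>)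
  have "wp B J ?loop (\<lambda>u. rI (ck u0 + (q + 1) * (15 + 5 * LG)) 0 u) (setv 66 (D s t) w)"
   by (rule loop, rule ctx_cong[OF cw]) (use wv w(3) in auto)
  moreover have "D s t <= B" using sum_B[of 0 s t] by simp
  ultimately show "wp B J (Asg 66 (Var 53);; ?loop) (\<lambda>u. rI (ck u0 + (q + 1) * (15 + 5 * LG)) 0 u) w" by (simp add: w(1))
 qed (use st in auto)
 moreover have "s <= B" "t <= B" using vertex_le[OF _ Bq(2)] st by auto
 moreover have "vr u0 58 = s" "vr u0 59 = t" using c by (auto simp: ctx_def)
 ultimately show ?thesis by (simp add: dinit_def)
qed

text \<open>The initialisation and each of the \<open>q\<close> settlements perform
  \<open>q + 1\<close> lookups, which gives the factor \<open>(q + 1)\<close> squared.\<close>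

lemma dijkstra_wp:
 assumes c: "ctx u0"
 shows "wp B J (dinit;; For 61 60 settle;; Cond (Less (Times (Num 2) (Var 7)) (Var 66)) (Asg 69 (Num 0)) (Asg 69 (Num 1));; Asg 0 (Var 66))
  (\<lambda>u. vr u 69 = of_bool (vr u 0 < Z) & (vr u 0 < Z --> rch E (vr u 0) s t) & (\<forall>k. (s, t) \<in> E ^^ k --> M * vr u 0 <= (M + 1) * k & vr u 0 < Z) &
   ck u <= ck u0 + (q + 1) * (15 + 5 * LG) * (q + 1) + 4) u0"
 unfolding wp_Sq
proof (rule wp_conseq[OF dinit_wp[OF c]], goal_cases)
 case (1 z)
 let ?T = "ck u0 + (q + 1) * (15 + 5 * LG)"
 have cz: "ctx z" by (rule ctx_cong[OF c]) (use 1(2) in \<open>auto simp: frame_def\<close>)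
 have vq: "vr z 60 = q" using cz by (simp add: ctx_def)
 show ?case
 proof (rule wp_For[where I = "rI ?T"], goal_cases)
  case 1 then show ?case using \<open>rI ?T 0 z\<close> .
 next
  case (2 k u)
  have cu: "ctx u" by (rule ctx_cong[OF cz]) (use 2(3) in \<open>auto simp: frame_def\<close>)
  show ?case by (rule settle_wp[OF cu 2(2)]) (use 2(1) vq in simp)
 next
  case (3 u)
  have cu: "ctx u" by (rule ctx_cong[OF cz]) (use 3(2) in \<open>auto simp: frame_def\<close>)
  have v7: "vr u 7 = n * n" using cu by (auto simp: ctx_def base_def)
  from 3(1) obtain X where X: "card X = q" "X \<subseteq> {..<q}" "inv X (ar u 42) (vr u 66)" and t: "ck u <= ?T + (q + 1) * (15 + 5 * LG) * q"
   unfolding rI_def vq by blast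
  have "X = {..<q}" using X(1,2) card_subset_eq[of "{..<q}" X] by simp
  then have i: "inv {..<q} (ar u 42) (vr u 66)" using X by simp
  have fin: "\<And>k. (s, t) \<in> E ^^ k ==> M * vr u 66 <= (M + 1) * k & vr u 66 < Z" using inv_final[OF i] by blast
  have so: "vr u 66 < Z ==> rch E (vr u 66) s t" using i unfolding inv_def by blast
  have bB: "vr u 66 <= B" "1 <= B" using inv_le(2)[OF i] Bq by (auto simp: Z_def)
  have lt: "2 * (n * n) < vr u 66 \<longleftrightarrow> \<not> vr u 66 < Z" by (auto simp: Z_def)
  have t': "ck u + 4 <= ck u0 + (q + 1) * (15 + 5 * LG) * (q + 1) + 4" using t by (simp add: algebra_simps)
  show ?case using bB lt fin so t' by (auto simp: v7)
 qed
qed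

end

lemma query_wp:
 assumes pr: "valid_prediction n pred" and M: "1 <= M" and b: "base n pred M K LG u0" and r: "rinv I u0" and I: "0 \<in> I" "I \<subseteq> {..length pred}"
  and j: "isrun I 0 j" and q: "q = card {p \<in> I. j < p}" and st: "vr u0 0 = s" "vr u0 1 = t" "s < n" "t < n"
  and B: "bounded B u0" "2 * K + 2 <= B" "4 * (n * n) + 6 <= B" and E: "E = (\<lambda>p. pred ! (p - 1)) ` (I - {0})"
 shows "wp B J query (\<lambda>u. base n pred M K LG u & rinv I u & vr u 69 = of_bool (vr u 0 <= 2 * (n * n)) &
   (vr u 0 <= 2 * (n * n) --> rch E (vr u 0) s t) & (\<forall>k. (s, t) \<in> E ^^ k --> M * vr u 0 <= (M + 1) * k & vr u 0 <= 2 * (n * n)) &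
   ck u <= ck u0 + (q + 1) * (25 + 5 * LG) * (q + 1)) u0"
proof -
 have m: "length pred <= n * n" by (rule valid_length[OF pr])
 have jm: "j <= length pred" using j I by (auto simp: isrun_def)
 let ?u = "setv 59 t (setv 58 s u0)"
 have bu: "base n pred M K LG ?u" by (rule base_cong[OF b]) auto
 have ru: "rinv I ?u" using r by (simp add: rinv_def)
 have sB: "s <= B" "t <= B" using vertex_le[OF _ B(3)] st by auto
 have bd: "bounded B ?u" using B(1) sB by (auto simp: bounded_def)
 have mB: "2 * length pred + 2 <= B" using m B by simp
 have qm: "q <= length pred"
 proof -
  have "card {p \<in> I. j < p} <= card {1..length pred}" using I by (intro card_mono) auto
  then show ?thesis by (simp add: q)
 qed
 let ?rest = "dinit;; For 61 60 settle;; Cond (Less (Times (Num 2) (Var 7)) (Var 66)) (Asg 69 (Num 0)) (Asg 69 (Num 1));; Asg 0 (Var 66)"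
 let ?Q = "\<lambda>u. vr u 69 = of_bool (vr u 0 <= 2 * (n * n)) &
   (vr u 0 <= 2 * (n * n) --> rch E (vr u 0) s t) & (\<forall>k. (s, t) \<in> E ^^ k --> M * vr u 0 <= (M + 1) * k & vr u 0 <= 2 * (n * n)) &
   ck u <= ck u0 + (q + 1) * (25 + 5 * LG) * (q + 1)"
 have "wp B J collect (wp B J ?rest ?Q) ?u"
 proof (rule wp_conseq[OF collect_wp[OF bu ru I bd mB j]], goal_cases)
  case (1 w)
  define U W where "U = ar w 40" and "W = ar w 41"
  have w1: "vr w 52 = j" "vr w 60 = q" and w2: "(\<lambda>y. (U y, W y)) ` {..<q} = (\<lambda>p. pred ! (p - 1)) ` {p \<in> I. j < p}" and w3: "ck w <= ck u0 + 5 + 10 * q"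
   using 1(1) q by (auto simp: U_def W_def)
  have wv: "vr w 58 = s" "vr w 59 = t" and wa: "ar w 1 = ar u0 1" using 1(2) by (auto simp: frame_def)
  have bw: "base n pred M K LG w" by (rule base_cong[OF bu]) (use 1(2) in \<open>auto simp: frame_def\<close>)
  have en: "pred ! (p - 1) \<in> {..<n} \<times> {..<n}" if "p \<in> I" "p \<noteq> 0" for p
   using valid_nth[OF pr, of "p - 1"] I that by (auto simp: mem_Times_iff)
  interpret qstate n M K q "set (take j pred)" U W s t pred LG j B J
  proof
   show "set (take j pred) \<subseteq> {..<n} \<times> {..<n}" using pr set_take_subset[of j pred] by (auto simp: valid_prediction_def)
   show "n * n <= Lf M K" using b by (simp add: base_def)
   fix y assume "y < q"
   then have "(U y, W y) \<in> (\<lambda>p. pred ! (p - 1)) ` {p \<in> I. j < p}" using w2 by blast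
   then obtain p where "p \<in> I" "j < p" "(U y, W y) = pred ! (p - 1)" by auto
   then show "U y < n & W y < n" using en[of p] by auto
  next
   show "q <= B" using qm mB by simp
  qed (use M st jm B in auto)
  have c: "ctx w" unfolding ctx_def using bw w1 wv B(1) wa by (simp add: U_def W_def bounded_def)
  have "set (take j pred) = (\<lambda>p. pred ! (p - 1)) ` {1..j}"
  proof -
   have "set (take j pred) = (!) pred ` {..<j}" using nth_image[OF jm] by (simp add: lessThan_atLeast0)
   also have "{..<j} = (\<lambda>p. p - 1) ` {1..j}" by (force simp: image_iff intro: bexI[of _ "Suc _"])
   finally show ?thesis by (simp add: image_image)
  qed
  moreover have "I - {0} = {1..j} \<union> {p \<in> I. j < p}" using j by (auto simp: isrun_def not_less)
  ultimately have EE: "dijkstra.E q (set (take j pred)) U W = E" unfolding E_def E w2 by (simp add: image_Un)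
  show ?case
  proof (rule wp_conseq[OF dijkstra_wp[OF c]], goal_cases)
   case (1 u)
   have "ck u <= ck u0 + 5 + 10 * q + (q + 1) * (15 + 5 * LG) * (q + 1) + 4" using 1(1) w3 by linarith
   also have "\<dots> <= ck u0 + (q + 1) * (25 + 5 * LG) * (q + 1)" by (simp add: algebra_simps)
   finally have t: "ck u <= ck u0 + (q + 1) * (25 + 5 * LG) * (q + 1)" .
   show ?case using 1(1) t unfolding EE Z_def by (simp add: less_Suc_eq_le)
  qed
 qed
 then have "wp B J query ?Q u0" using st sB unfolding query_def by simp
 then show ?thesis
 proof (rule wp_conseq, goal_cases)
  case (1 u)
  have "base n pred M K LG u" by (rule base_cong[OF b]) (use 1(2) in \<open>auto simp: frame_def\<close>)
  moreover have "rinv I u" using r 1(2) by (auto simp: rinv_def frame_def)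
  ultimately show ?case using 1(1) by blast
 qed
qed

section \<open>The dynamic algorithm\<close>

lemma insertions_append: "insertions (xs @ ys) = insertions xs @ insertions ys"
proof (induction xs)
 case (Cons r rs) then show ?case by (cases r) auto
qed simp

lemma time_of_nth:
 assumes "distinct es" "p < length es"
 shows "time_of es (es ! p) = p + 1"
 unfolding time_of_def
proof (rule the_equality)
 fix i assume i: "i \<in> {1..length es} & es ! (i - 1) = es ! p"
 then have "i - 1 < length es" by auto
 then have "i - 1 = p" using i assms nth_eq_iff_index_eq by metis
 then show "i = p + 1" using i by auto
qed (use assms in auto)

text \<open>Index \<open>p + 1\<close> stands for the edge \<open>pred ! p\<close>. The additional 0
  turns the inserted prefix into the run that starts at 0, also when this prefix is empty.\<close>

definition idx :: "edge list => edge set => nat set" where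
 "idx pred S = insert 0 (Suc ` {p. p < length pred & pred ! p \<in> S})"

lemma idx_sub: "0 \<in> idx pred S" "idx pred S \<subseteq> {..length pred}"
 by (auto simp: idx_def)

lemma idx_insert: "distinct pred ==> q < length pred ==> idx pred (insert (pred ! q) S) = insert (Suc q) (idx pred S)"
 by (auto simp: idx_def nth_eq_iff_index_eq)

lemma idx_edges: "S \<subseteq> set pred ==> (\<lambda>p. pred ! (p - 1)) ` (idx pred S - {0}) = S"
 by (force simp: idx_def image_iff in_set_conv_nth)

lemma card_idx:
 assumes "distinct pred" "S \<subseteq> set pred"
 shows "card (idx pred S) = Suc (card S)"
proof -
 let ?P = "{p. p < length pred & pred ! p \<in> S}"
 have "(!) pred ` ?P = S" using assms(2) by (force simp: image_iff in_set_conv_nth)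
 moreover have "inj_on ((!) pred) ?P" using assms(1) by (auto simp: inj_on_def nth_eq_iff_index_eq)
 ultimately have "card ?P = card S" using card_image by fastforce
 moreover have "card (Suc ` ?P) = card ?P" by (rule card_image) simp
 ultimately show ?thesis by (simp add: idx_def)
qed

text \<open>After \<open>i\<close> insertions the index set has \<open>i + 1\<close> elements. The
  indices from 0 to \<open>j\<close> form the prefix, so \<open>i - j\<close> edges lie outside it,
  and that number is the prediction error.\<close>

lemma eta_bar_idx:
 assumes d: "distinct pred" "distinct es" and e: "set es \<subseteq> set pred" "i <= length es"
  and j: "isrun (idx pred (set (take i es))) 0 j"
 shows "Max {j. j <= length pred & set (take j pred) \<subseteq> set (take i es)} = j"
  "card {p \<in> idx pred (set (take i es)). j < p} = eta_bar pred es i"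
proof -
 let ?S = "set (take i es)"
 let ?I = "idx pred ?S"
 have jl: "j <= length pred" using j idx_sub(2)[of pred ?S] by (auto simp: isrun_def)
 have sub: "set (take l pred) \<subseteq> ?S \<longleftrightarrow> l <= j" if l: "l <= length pred" for l
 proof
  assume a: "set (take l pred) \<subseteq> ?S"
  show "l <= j"
  proof (rule ccontr)
   assume "\<not> l <= j"
   then have "pred ! j \<in> set (take l pred)" "j < length pred" using l by (auto simp: in_set_conv_nth intro!: exI[of _ j])
   then have "Suc j \<in> ?I" using a by (auto simp: idx_def)
   then show False using j by (simp add: isrun_def)
  qed
 next
  assume "l <= j"
  show "set (take l pred) \<subseteq> ?S"
  proof
   fix e assume "e \<in> set (take l pred)"
   then obtain p where p: "p < l" "e = pred ! p" by (auto simp: in_set_conv_nth)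
   then have "Suc p \<in> {0..j}" using \<open>l <= j\<close> by simp
   then have "Suc p \<in> ?I" using j unfolding isrun_def by blast
   then show "e \<in> ?S" using p by (auto simp: idx_def)
  qed
 qed
 have "{j. j <= length pred & set (take j pred) \<subseteq> ?S} = {..j}"
 proof (rule set_eqI)
  fix x show "x \<in> {j. j <= length pred & set (take j pred) \<subseteq> ?S} \<longleftrightarrow> x \<in> {..j}"
   using sub[of x] jl by (cases "x <= length pred") simp_all
 qed
 then show M: "Max {j. j <= length pred & set (take j pred) \<subseteq> ?S} = j" using Max_eqI[of "{..j}" j] by simp
 have "card ?S = i" using distinct_card[of "take i es"] d e by simp
 then have c: "card ?I = Suc i" using card_idx[OF d(1), of ?S] e(1) set_take_subset[of i es] by auto
 have fin: "finite ?I" using idx_sub(2)[of pred ?S] finite_subset by blast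
 have "{p \<in> ?I. j < p} = ?I - {0..j}" by auto
 moreover have "{0..j} \<subseteq> ?I" using j by (simp add: isrun_def)
 ultimately have "card {p \<in> ?I. j < p} = Suc i - Suc j" using c card_Diff_subset[of "{0..j}" ?I] by simp
 then show "card {p \<in> ?I. j < p} = eta_bar pred es i" unfolding eta_bar_def M by simp
qed

text \<open>The first predicted edge missing after \<open>i\<close> insertions has predicted time
  \<open>j + 1\<close> and actual time above \<open>i\<close>, so its error is at least
  \<open>i - j\<close>. If none is missing, \<open>i - j\<close> is 0.\<close>

lemma eta_bar_le_eta_inf:
 assumes d: "distinct pred" "distinct es" and e: "set es = set pred" "i <= length es"
 shows "eta_bar pred es i <= eta_inf pred es"
proof -
 let ?I = "idx pred (set (take i es))"
 obtain j where j: "isrun ?I 0 j" using isrun_right[of 0 ?I "length pred"] idx_sub[of pred "set (take i es)"] by auto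
 have M: "eta_bar pred es i = i - j" unfolding eta_bar_def using eta_bar_idx(1)[OF d _ e(2) j] e by simp
 have len: "length es = length pred" using d e distinct_card by metis
 show ?thesis
 proof (cases "j < length pred")
  case True
  let ?e = "pred ! j"
  have "?e \<in> set es" using True e by simp
  then obtain p where p: "p < length es" "es ! p = ?e" by (auto simp: in_set_conv_nth)
  have "i <= p"
  proof (rule ccontr)
   assume "\<not> i <= p"
   then have "?e \<in> set (take i es)" using p e(2) by (auto simp: in_set_conv_nth intro!: exI[of _ p])
   then have "Suc j \<in> ?I" using True by (simp add: idx_def)
   then show False using j by (simp add: isrun_def)
  qed
  have "time_of es ?e = p + 1" "time_of pred ?e = j + 1" using time_of_nth d p True by metis+
  then have "i - j <= nat \<bar>int (time_of es ?e) - int (time_of pred ?e)\<bar>" using \<open>i <= p\<close> by simp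
  also have "\<dots> <= eta_inf pred es" unfolding eta_inf_def by (rule Max_ge) (use \<open>?e \<in> set es\<close> in auto)
  finally show ?thesis using M by simp
 next
  case False
  then show ?thesis using M e(2) len by simp
 qed
qed

text \<open>The integer inequality bounds the answer by \<open>1 + 1/M\<close> times the distance,
  and \<open>1/M\<close> is at most \<epsilon>. An answer above \<open>Z\<close> excludes every
  path, which matches denominator 0.\<close>

lemma approx_answer:
 assumes e: "0 < \<epsilon>" and M: "1 <= M" "1 <= \<epsilon> * real M" and Z: "a <= Z ==> rch E a s t" and c: "\<And>k. (s, t) \<in> E ^^ k ==> M * a <= (M + 1) * k & a <= Z"
  and r: "reg \<sigma> 0 = int a" "reg \<sigma> 1 = of_bool (a <= Z)"
 shows "approx_dist \<epsilon> (graph_dist E s t) (answer \<sigma>)"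
proof (cases "a <= Z")
 case False
 then have "{k. (s, t) \<in> E ^^ k} = {}" using c by blast
 then have "graph_dist E s t = \<infinity>" unfolding graph_dist_def by (simp add: top_enat_def)
 then show ?thesis using False r e by (simp add: approx_dist_def answer_def)
next
 case True
 then obtain k where k: "k <= a" "(s, t) \<in> E ^^ k" using Z by (auto simp: rch_def)
 define l where "l = (LEAST k. (s, t) \<in> E ^^ k)"
 have l: "(s, t) \<in> E ^^ l" unfolding l_def by (rule LeastI[of _ k]) (rule k(2))
 have lk: "l <= k'" if "(s, t) \<in> E ^^ k'" for k' unfolding l_def using that by (rule Least_le)
 have g: "graph_dist E s t = enat l" unfolding graph_dist_def
  by (rule antisym) (use l lk in \<open>auto intro: INF_lower INF_greatest\<close>)
 have la: "l <= a" using lk[OF k(2)] k(1) by simp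
 have "real (M * a) <= real ((M + 1) * l)" using c[OF l] by (simp only: of_nat_le_iff)
 then have "real M * real a <= real M * real l + 1 * real l" by (simp add: algebra_simps)
 also have "\<dots> <= real M * real l + (\<epsilon> * real M) * real l" using M(2) by (intro add_left_mono mult_right_mono) auto
 also have "\<dots> = real M * ((1 + \<epsilon>) * real l)" by (simp add: algebra_simps)
 finally have "real a <= (1 + \<epsilon>) * real l" using M(1) by simp
 then show ?thesis using True r g la by (simp add: approx_dist_def answer_def)
qed

section \<open>Interface to the machine\<close>

lemma rel_init: "rel (pred_input pred) \<lparr>vr = (\<lambda>_. 0)(0 := n, 1 := length pred), ar = \<lambda>_ _. 0, pm = \<lambda>_. 0, ck = 0\<rparr>
  (set_reg 4 (2 * int (length pred)) (set_reg 3 (int (length pred)) (prediction_input n pred)))"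
 by (auto simp: rel_def set_reg_def prediction_input_def pred_input_def)

definition give :: "nat => nat => st => st" where
 "give u v s = s\<lparr>vr := (vr s)(0 := u, 1 := v)\<rparr>"

lemma give_simps [simp]: "vr (give u v s) = (vr s)(0 := u, 1 := v)" "ar (give u v s) = ar s" "pm (give u v s) = pm s" "ck (give u v s) = ck s"
 by (simp_all add: give_def)

lemma rel_give: "rel J s \<sigma> ==> rel J (give u v s) (set_reg 3 (int v) (set_reg 1 (int v) (set_reg 0 (int u) \<sigma>)))"
 by (auto simp: rel_def set_reg_def)

lemma bounded_give: "bounded B s ==> u <= B ==> v <= B ==> bounded B (give u v s)"
 by (auto simp: bounded_def)

lemma rel_reg1: "rel J s \<sigma> ==> rel J s (set_reg 1 x \<sigma>)"
 by (auto simp: rel_def set_reg_def)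

lemma exec_Or_same: "\<bar>reg s a\<bar> < W ==> exec W (Op Or r a a) s 1 (set_reg r (reg s a) s)"
 by (rule exec_Op) auto

text \<open>Arguments arrive in registers 0 and 1, whereas variable 1 lives in register 3; hence the
  leading copy. Preprocessing also puts the input length, two numbers per edge, into register
  4.\<close>

definition pred_apsp :: "com => algorithm" where
 "pred_apsp c = \<lparr>preprocess = Seq (Op Or 3 1 1) (Seq (Op Add 4 1 1) (comp c)), on_insert = Seq (Op Or 3 1 1) (comp ins),
   on_query = Seq (Op Or 3 1 1) (Seq (comp query) (Op Or 1 207 207))\<rparr>"

text \<open>The query time is still expressed by the number \<open>LG\<close> of bisection rounds;
  the two inequalities from which the doubly logarithmic bound follows are carried along.\<close>

definition served :: "real => nat => nat => nat => edge list => request list => nat => nat => ram_state => bool" where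
 "served \<epsilon> M R n pred rs k t \<sigma> \<longleftrightarrow> (case rs ! k of Insert u v => t <= 1 + R * 20
   | Query x y => approx_dist \<epsilon> (graph_dist (set (insertions (take k rs))) x y) (answer \<sigma>) &
     (\<exists>lg LG q. 2 ^ lg <= 2 * (n * n) & 2 ^ LG <= 2 * (M * (lg + 2) + 2) &
      q = eta_bar pred (insertions rs) (length (insertions (take k rs))) & t <= 2 + R * ((q + 1) * (25 + 5 * LG) * (q + 1))))"

locale machine =
 fixes n :: nat and pred :: "edge list" and M K LG B R D :: nat and W :: int and c :: com
 assumes pr: "valid_prediction n pred" and M1: "1 <= M" and ci: "compiles D R ins" and cq: "compiles D R query"
  and BW: "2 <= B" "int B ^ D <= W" "int B < W" and BB: "2 * K + 2 <= B" "4 * (n * n) + 6 <= B"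
begin

abbreviation "J \<equiv> pred_input pred"

text \<open>The abstract state is hidden behind the machine state, so that requests can be chained
  by machine states alone.\<close>

definition Inv :: "edge set => ram_state => bool" where
 "Inv S \<sigma> \<longleftrightarrow> (\<exists>s. rel J s \<sigma> & bounded B s & base n pred M K LG s & rinv (idx pred S) s)"

lemma len: "length pred <= n * n"
 by (rule valid_length[OF pr])

lemma J_ok: "length J <= B" "\<forall>x\<in>set J. x <= B"
proof -
 show "length J <= B" using len BB(2) by (simp add: pred_input(1))
 have "fst (pred ! (a div 2)) <= B & snd (pred ! (a div 2)) <= B" if "a < 2 * length pred" for a
  using valid_nth[OF pr, of "a div 2"] that vertex_le[OF _ BB(2)] by auto
 then show "\<forall>x\<in>set J. x <= B" by (auto simp: pred_input_def)
qed

lemma call: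
 assumes cp: "compiles D R p" and s: "bounded B s" "rel J s \<sigma>" and w: "wp B J p Q s"
 shows "\<exists>t \<sigma>' s'. exec W (comp p) \<sigma> t \<sigma>' & rel J s' \<sigma>' & bounded B s' & Q s' & t <= R * (ck s' - ck s)"
proof -
 from w obtain s' where r: "run B J p s s'" "Q s'" by (auto simp: wp_def)
 from compilesE[OF cp BW(1) J_ok s r(1) BW(2)] obtain t \<sigma>' where "exec W (comp p) \<sigma> t \<sigma>'" "rel J s' \<sigma>'" "bounded B s'" "t <= R * (ck s' - ck s)" .
 then show ?thesis using r(2) by blast
qed

lemma enter:
 assumes "rel J s \<sigma>" "bounded B s" "u < n" "v < n"
 shows "exec W (Op Or 3 1 1) (set_reg 1 (int v) (set_reg 0 (int u) \<sigma>)) 1 (set_reg 3 (int v) (set_reg 1 (int v) (set_reg 0 (int u) \<sigma>)))"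
  "rel J (give u v s) (set_reg 3 (int v) (set_reg 1 (int v) (set_reg 0 (int u) \<sigma>)))" "bounded B (give u v s)"
proof -
 have le: "u <= B" "v <= B" using assms(3,4) vertex_le[OF _ BB(2)] by auto
 have "\<bar>int v\<bar> < W" using le(2) BW(3) by linarith
 then show "exec W (Op Or 3 1 1) (set_reg 1 (int v) (set_reg 0 (int u) \<sigma>)) 1 (set_reg 3 (int v) (set_reg 1 (int v) (set_reg 0 (int u) \<sigma>)))"
  using exec_Or_same[of "set_reg 1 (int v) (set_reg 0 (int u) \<sigma>)" 1 W 3] by (simp add: set_reg_def)
 show "rel J (give u v s) (set_reg 3 (int v) (set_reg 1 (int v) (set_reg 0 (int u) \<sigma>)))" by (rule rel_give[OF assms(1)])
 show "bounded B (give u v s)" by (rule bounded_give[OF assms(2) le])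
qed

lemma step_insert:
 assumes i: "Inv S \<sigma>" and e: "(u, v) \<in> set pred" "(u, v) \<notin> S"
 shows "\<exists>t \<sigma>'. handle W (pred_apsp c) (Insert u v) \<sigma> t \<sigma>' & Inv (insert (u, v) S) \<sigma>' & t <= 1 + R * 20"
proof -
 have d: "distinct pred" using pr by (simp add: valid_prediction_def)
 from e(1) obtain q where q: "q < length pred" "pred ! q = (u, v)" by (auto simp: in_set_conv_nth)
 have uv: "u < n" "v < n" using valid_nth[OF pr q(1)] q(2) by auto
 from i obtain s where s: "rel J s \<sigma>" "bounded B s" "base n pred M K LG s" "rinv (idx pred S) s" by (auto simp: Inv_def)
 note en = enter[OF s(1,2) uv]
 have b: "base n pred M K LG (give u v s)" by (rule base_cong[OF s(3)]) auto
 have r: "rinv (idx pred S) (give u v s)" using s(4) by (simp add: rinv_def)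
 have nq: "Suc q \<notin> idx pred S" using e(2) q by (auto simp: idx_def)
 have mB: "length pred + 2 <= B" using len BB(2) by simp
 have "wp B J ins (\<lambda>u'. base n pred M K LG u' & rinv (insert (Suc q) (idx pred S)) u' & ck u' <= ck (give u v s) + 20) (give u v s)"
  by (rule ins_wp[OF b r idx_sub en(3) mB q(1) nq]) (use q(2) in auto)
 from call[OF ci en(3,2) this] obtain t \<sigma>' s' where t: "exec W (comp ins) (set_reg 3 (int v) (set_reg 1 (int v) (set_reg 0 (int u) \<sigma>))) t \<sigma>'"
  "rel J s' \<sigma>'" "bounded B s'" "base n pred M K LG s'" "rinv (insert (Suc q) (idx pred S)) s'" "ck s' <= ck (give u v s) + 20" "t <= R * (ck s' - ck (give u v s))" by blast
 have "Inv (insert (u, v) S) \<sigma>'" unfolding Inv_def using t(2-5) idx_insert[OF d q(1), of S] q(2) by auto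
 moreover have "t <= R * 20"
 proof -
  have "ck s' - ck (give u v s) <= 20" using t(6) by linarith
  then show ?thesis using t(7) mult_le_mono2 order_trans by blast
 qed
 moreover have "handle W (pred_apsp c) (Insert u v) \<sigma> (1 + t) \<sigma>'" unfolding handle.simps pred_apsp_def using exec_Seq[OF en(1) t(1)] by simp
 ultimately show ?thesis by (intro exI[of _ "1 + t"] exI[of _ \<sigma>']) auto
qed

lemma step_query:
 assumes i: "Inv S \<sigma>" and S: "S \<subseteq> set pred" and uv: "u < n" "v < n" and j: "isrun (idx pred S) 0 j" and q: "q = card {p \<in> idx pred S. j < p}"
  and e: "0 < \<epsilon>" "1 <= \<epsilon> * real M"
 shows "\<exists>t \<sigma>'. handle W (pred_apsp c) (Query u v) \<sigma> t \<sigma>' & Inv S \<sigma>' & approx_dist \<epsilon> (graph_dist S u v) (answer \<sigma>') & t <= 2 + R * ((q + 1) * (25 + 5 * LG) * (q + 1))"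
proof -
 from i obtain s where s: "rel J s \<sigma>" "bounded B s" "base n pred M K LG s" "rinv (idx pred S) s" by (auto simp: Inv_def)
 note en = enter[OF s(1,2) uv]
 let ?\<sigma> = "set_reg 3 (int v) (set_reg 1 (int v) (set_reg 0 (int u) \<sigma>))" and ?s = "give u v s"
 have b: "base n pred M K LG ?s" by (rule base_cong[OF s(3)]) auto
 have r: "rinv (idx pred S) ?s" using s(4) by (simp add: rinv_def)
 have w: "wp B J query (\<lambda>u'. base n pred M K LG u' & rinv (idx pred S) u' & vr u' 69 = of_bool (vr u' 0 <= 2 * (n * n)) &
   (vr u' 0 <= 2 * (n * n) --> rch S (vr u' 0) u v) & (\<forall>k. (u, v) \<in> S ^^ k --> M * vr u' 0 <= (M + 1) * k & vr u' 0 <= 2 * (n * n)) &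
   ck u' <= ck ?s + (q + 1) * (25 + 5 * LG) * (q + 1)) ?s"
  by (rule query_wp[OF pr M1 b r idx_sub j q _ _ uv en(3) BB]) (use idx_edges[OF S] in auto)
 from call[OF cq en(3,2) w] obtain t \<sigma>' s' where t: "exec W (comp query) ?\<sigma> t \<sigma>'" "rel J s' \<sigma>'" "bounded B s'" "base n pred M K LG s'" "rinv (idx pred S) s'"
  "vr s' 69 = of_bool (vr s' 0 <= 2 * (n * n))" "vr s' 0 <= 2 * (n * n) --> rch S (vr s' 0) u v" "\<forall>k. (u, v) \<in> S ^^ k --> M * vr s' 0 <= (M + 1) * k & vr s' 0 <= 2 * (n * n)"
  "ck s' <= ck ?s + (q + 1) * (25 + 5 * LG) * (q + 1)" "t <= R * (ck s' - ck ?s)" by blast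
 let ?f = "set_reg 1 (reg \<sigma>' 207) \<sigma>'"
 have rg: "reg \<sigma>' (3 * x) = int (vr s' x)" for x using t(2) by (simp add: rel_def)
 have r207: "reg \<sigma>' 207 = of_bool (vr s' 0 <= 2 * (n * n))" "reg \<sigma>' 0 = int (vr s' 0)" using rg[of 69] rg[of 0] t(6) by auto
 have "\<bar>reg \<sigma>' 207\<bar> < W" using r207 BW by auto
 from exec_Or_same[OF this, of 1] have x: "exec W (Op Or 1 207 207) \<sigma>' 1 ?f" .
 have "handle W (pred_apsp c) (Query u v) \<sigma> (1 + (t + 1)) ?f" unfolding handle.simps pred_apsp_def using exec_Seq[OF en(1) exec_Seq[OF t(1) x]] by simp
 moreover have "Inv S ?f" unfolding Inv_def using rel_reg1[OF t(2)] t(3-5) by blast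
 moreover have "approx_dist \<epsilon> (graph_dist S u v) (answer ?f)"
  by (rule approx_answer[OF e(1) M1 e(2), of "vr s' 0" "2 * (n * n)"]) (use t(7,8) r207 in \<open>auto simp: set_reg_def\<close>)
 moreover have "t <= R * ((q + 1) * (25 + 5 * LG) * (q + 1))"
 proof -
  have "ck s' - ck ?s <= (q + 1) * (25 + 5 * LG) * (q + 1)" using t(9) by linarith
  then show ?thesis using t(10) mult_le_mono2 order_trans by blast
 qed
 ultimately show ?thesis by (intro exI[of _ "1 + (t + 1)"] exI[of _ ?f]) auto
qed

lemma all_requests:
 assumes v: "valid_requests n pred rs" and i: "Inv {} s0" and e: "0 < \<epsilon>" "1 <= \<epsilon> * real M"
  and lg: "2 ^ lg <= 2 * (n * n)" "2 ^ LG <= 2 * (M * (lg + 2) + 2)"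
 shows "\<exists>\<sigma> \<tau>. \<sigma> 0 = s0 & (\<forall>k<length rs. handle W (pred_apsp c) (rs ! k) (\<sigma> k) (\<tau> k) (\<sigma> (Suc k)) &
   served \<epsilon> M R n pred rs k (\<tau> k) (\<sigma> (Suc k)))"
proof -
 let ?es = "insertions rs" and ?S = "\<lambda>k. set (insertions (take k rs))"
 let ?eb = "\<lambda>k. eta_bar pred ?es (length (insertions (take k rs)))"
 have d: "distinct pred" using pr by (simp add: valid_prediction_def)
 have ms: "mset ?es = mset pred" using v by (simp add: valid_requests_def)
 have de: "distinct ?es" using d ms mset_eq_imp_distinct_iff by blast
 have se: "set ?es = set pred" using ms by (metis set_mset_mset)
 have split: "?es = insertions (take k rs) @ insertions (drop k rs)" for k by (metis append_take_drop_id insertions_append)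
 have tk: "take (length (insertions (take k rs))) ?es = insertions (take k rs)" for k by (subst split[of k]) simp
 have sub: "?S k \<subseteq> set pred" for k using split[of k] se by (metis Un_upper1 set_append)
 define ok where "ok k \<sigma> t \<sigma>' \<longleftrightarrow> handle W (pred_apsp c) (rs ! k) \<sigma> t \<sigma>' & served \<epsilon> M R n pred rs k t \<sigma>'" for k \<sigma> t \<sigma>'
 have step: "\<exists>t \<sigma>'. ok k \<sigma> t \<sigma>' & Inv (?S (Suc k)) \<sigma>'" if k: "k < length rs" and I: "Inv (?S k) \<sigma>" for k \<sigma>
 proof (cases "rs ! k")
  case (Insert u v)
  have "insertions rs = insertions (take k rs) @ (u, v) # insertions (drop (Suc k) rs)"
   using split[of k] Cons_nth_drop_Suc[OF k] Insert by (metis insertions.simps(2))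
  then have "(u, v) \<in> set pred" "(u, v) \<notin> ?S k" using de se by auto
  moreover have "?S (Suc k) = insert (u, v) (?S k)" using k Insert by (simp add: take_Suc_conv_app_nth insertions_append)
  ultimately show ?thesis using step_insert[OF I, of u v] Insert by (auto simp: ok_def served_def)
 next
  case (Query u v)
  have "Query u v \<in> set rs" using k Query nth_mem by metis
  then have uv: "u < n" "v < n" using v by (auto simp: valid_requests_def)
  let ?I = "idx pred (?S k)"
  obtain j where j: "isrun ?I 0 j" using isrun_right[of 0 ?I "length pred"] idx_sub[of pred "?S k"] by auto
  have "card {p \<in> ?I. j < p} = ?eb k" using eta_bar_idx(2)[OF d de, of "length (insertions (take k rs))" j] j split[of k] se
   unfolding tk by (metis le_add1 length_append order_refl)
  moreover have "?S (Suc k) = ?S k" using k Query by (simp add: take_Suc_conv_app_nth insertions_append)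
  ultimately obtain t \<sigma>' where "handle W (pred_apsp c) (Query u v) \<sigma> t \<sigma>'" "Inv (?S (Suc k)) \<sigma>'" "approx_dist \<epsilon> (graph_dist (?S k) u v) (answer \<sigma>')"
   "t <= 2 + R * ((?eb k + 1) * (25 + 5 * LG) * (?eb k + 1))" using step_query[OF I sub uv j refl e] by auto
  then show ?thesis unfolding ok_def served_def Query request.case using lg by blast
 qed
 have "\<exists>f. \<forall>k. ((k <= length rs --> Inv (?S k) (f k)) & (k = 0 --> f k = s0)) & (k < length rs --> (\<exists>t. ok k (f k) t (f (Suc k))))"
 proof (rule dependent_nat_choice)
  show "\<exists>x. (0 <= length rs --> Inv (?S 0) x) & (0 = 0 --> x = s0)" using i by simp
 next
  fix x k assume a: "(k <= length rs --> Inv (?S k) x) & (k = 0 --> x = s0)"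
  show "\<exists>y. ((Suc k <= length rs --> Inv (?S (Suc k)) y) & (Suc k = 0 --> y = s0)) & (k < length rs --> (\<exists>t. ok k x t y))"
  proof (cases "k < length rs")
   case True
   then show ?thesis using step[of k x] a by auto
  qed auto
 qed
 then obtain f where f: "f 0 = s0" "\<And>k. k < length rs ==> \<exists>t. ok k (f k) t (f (Suc k))" by blast
 define \<tau> where "\<tau> k = (SOME t. ok k (f k) t (f (Suc k)))" for k
 have "ok k (f k) (\<tau> k) (f (Suc k))" if "k < length rs" for k unfolding \<tau>_def using f(2)[OF that] by (rule someI_ex)
 then show ?thesis using f(1) unfolding ok_def by blast
qed

end

lemma compiles_mono: "compiles D R c ==> D <= D' ==> R <= R' ==> compiles D' R' c"
 unfolding compiles_def
proof (intro allI impI, goal_cases)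
 case (1 B J s s' \<sigma> W)
 then obtain t \<sigma>' where t: "exec W (comp c) \<sigma> t \<sigma>'" "rel J s' \<sigma>'" "bounded B s'" "t <= R * (ck s' - ck s)"
  using power_W[OF 1(10) 1(4) 1(2)] by blast
 then have "t <= R' * (ck s' - ck s)" using 1(3) mult_le_mono1 order_trans by blast
 then show ?case using t by blast
qed

lemma lg_le: "2 ^ lg <= 2 * m ==> lg <= m" for lg m :: nat
proof (cases lg)
 case (Suc l)
 assume "2 ^ lg <= 2 * m"
 then have "2 ^ l <= m" using Suc by simp
 moreover have "l < 2 ^ l" by (rule less_exp)
 ultimately show ?thesis using Suc by linarith
qed simp

lemma rinv_init:
 assumes "vr u 13 = 0" "ar u 5 = (\<lambda>_. 0)(0 := 1)" "ar u 6 = (\<lambda>_. 0)" "ar u 7 = (\<lambda>_. 0)"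
 shows "rinv (idx pred {}) u"
proof -
 have "a = 0 & b = 0" if "isrun {0} a b" for a b using that unfolding isrun_def by (metis atLeastAtMost_iff empty_iff insert_iff order_refl subset_iff)
 then show ?thesis using assms by (auto simp: rinv_def idx_def lst_def starts_def)
qed

text \<open>Separates the construction from the asymptotics: all times are still explicit natural
  numbers, with a constant \<open>R\<close> for the compiled code.\<close>

definition promise :: "real => (nat => nat) => nat => nat => algorithm => nat => nat => edge list => bool" where
 "promise \<epsilon> TP M R A wd n pred \<longleftrightarrow> (\<exists>t0 s0. exec ((int n + 2) ^ wd) (preprocess A) (prediction_input n pred) t0 s0 &
   (1 <= n --> (\<exists>lg. 2 ^ lg <= 2 * (n * n) & t0 <= 2 + R * (50 + 30 * (n * n) + M * (lg + 2) * (TP n + 20)))) &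
   (\<forall>rs. valid_requests n pred rs --> (\<exists>\<sigma> \<tau>. \<sigma> 0 = s0 & (\<forall>k<length rs.
    handle ((int n + 2) ^ wd) A (rs ! k) (\<sigma> k) (\<tau> k) (\<sigma> (Suc k)) & served \<epsilon> M R n pred rs k (\<tau> k) (\<sigma> (Suc k))))))"

text \<open>All stored values are bounded by one power of \<open>n + 2\<close>. Compiled code of
  fixed degree then needs words bounded by a power of that power, that is, again by a fixed power of
  \<open>n + 2\<close>.\<close>

lemma solution:
 assumes M: "1 <= M" "0 < \<epsilon>" "1 <= \<epsilon> * real M" and wf: "wf_com pc" "mv pc \<subseteq> prod_vars" "ma pc \<subseteq> {0,10,11,12,13,20,21,22,23,24,25,30,31,32,33,34,35}"
  and pc: "\<And>n pred h0. 1 <= n ==> valid_prediction n pred ==> 0 < h0 ==> n <= h0 * h0 ==> (h0 - 1) * (h0 - 1) < n ==> h0 <= n + 1 ==>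
    prod_ok ((n + 2) ^ b) (pred_input pred) n (length pred + 1) (2 * (2*n)\<^sup>2 + (2*n + 2) ^ d) h0 (inc n) (TP n) pc"
  and B: "\<And>n::nat. 4 * (n * n) + 6 <= (n + 2) ^ b" "\<And>n::nat. 2 * (2*n)\<^sup>2 + (2*n + 2) ^ d <= (n + 2) ^ b" "\<And>n::nat. 2 * (M * (n * n + 2) + 2) <= (n + 2) ^ b"
   "\<And>n::nat. (M * (n * n + 2) + 1) * (n * n) <= (n + 2) ^ b" "\<And>n::nat. M * (n * n + 2) * inc n <= (n + 2) ^ b" "\<And>n::nat. 4 * (n * n) * M <= (n + 2) ^ b"
 shows "\<exists>A c R. \<forall>n pred. valid_prediction n pred --> promise \<epsilon> TP M R A c n pred"
proof -
 let ?p = "prep d M pc"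
 obtain D1 R1 D2 R2 D3 R3 where c: "compiles D1 R1 ?p" "compiles D2 R2 ins" "compiles D3 R3 query"
  using compiles[OF wf_prep[OF wf(1,2), of d M]] compiles[of ins] compiles[of query] mv_ins mv_query by blast
 define D R where "D = D1 + D2 + D3" and "R = R1 + R2 + R3"
 have cs: "compiles D R ?p" "compiles D R ins" "compiles D R query"
  by (rule compiles_mono[OF c(1)] compiles_mono[OF c(2)] compiles_mono[OF c(3)]; simp add: D_def R_def)+
 \<comment> \<open>With this exponent the word bound is the value bound raised to
   \<open>D + 2\<close>: degree \<open>D\<close> for the compiled code, and 2 more so that the value
   bound itself lies strictly below it.\<close>
 let ?c = "b * (D + 2)" and ?A = "pred_apsp ?p"
 show ?thesis
 proof (rule exI[of _ ?A], rule exI[of _ ?c], rule exI[of _ R], intro allI impI)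
  fix n pred assume pr: "valid_prediction n pred"
  define Bd where "Bd = (n + 2) ^ b"
  define W where "W = (int n + 2) ^ ?c"
  have W: "W = int Bd ^ (D + 2)" unfolding W_def Bd_def power_mult by (simp only: of_nat_power of_nat_add of_nat_numeral)
  have B2: "2 <= Bd" using B(1)[of n] by (simp add: Bd_def)
  have W1: "int Bd ^ D <= W" unfolding W by (rule power_increasing) (use B2 in auto)
  have "int Bd < int Bd ^ 2" using B2 by (simp add: power2_eq_square)
  also have "\<dots> <= W" unfolding W by (rule power_increasing) (use B2 in auto)
  finally have W2: "int Bd < W" .
  have B1: "4 * (n * n) + 6 <= Bd" using B(1) by (simp add: Bd_def)
  have mach: "machine n pred M K Bd R D W" if "2 * K + 2 <= Bd" for K
   by unfold_locales (use pr M(1) cs B2 W1 W2 B1 that in auto)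
  interpret m0: machine n pred M 0 LG Bd R D W ?p for LG using mach[of 0] B2 by simp
  let ?m = "length pred"
  let ?s = "\<lparr>vr = (\<lambda>_. 0)(0 := n, 1 := ?m), ar = \<lambda>_ _. 0, pm = \<lambda>_. 0, ck = 0\<rparr>"
  let ?\<sigma> = "set_reg 4 (2 * int ?m) (set_reg 3 (int ?m) (prediction_input n pred))"
  have mB: "2 * ?m <= Bd" "n <= Bd" using m0.len B1 le_square[of n] by linarith+
  have bd: "bounded Bd ?s" using mB by (auto simp: bounded_def)
  have e1: "exec W (Op Or 3 1 1) (prediction_input n pred) 1 (set_reg 3 (int ?m) (prediction_input n pred))"
   using exec_Or_same[of "prediction_input n pred" 1 W 3] mB W2 by (simp add: prediction_input_def)
  have e2: "exec W (Op Add 4 1 1) (set_reg 3 (int ?m) (prediction_input n pred)) 1 ?\<sigma>"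
   by (rule exec_Op) (use mB W2 in \<open>auto simp: prediction_input_def set_reg_def\<close>)
  have pre: "exec W (preprocess ?A) (prediction_input n pred) (1 + (1 + t)) \<sigma>'" if "exec W (comp ?p) ?\<sigma> t \<sigma>'" for t \<sigma>'
   using exec_Seq[OF e1 exec_Seq[OF e2 that]] by (simp add: pred_apsp_def)
  show "promise \<epsilon> TP M R ?A ?c n pred"
  proof (cases "n = 0")
   case True
   have "wp Bd m0.J ?p (\<lambda>_. True) ?s" using True by (simp add: prep_def)
   from m0.call[OF cs(1) bd rel_init this] obtain t \<sigma>' where t: "exec W (comp ?p) ?\<sigma> t \<sigma>'" by blast
   \<comment> \<open>Without vertices there is neither an edge nor a query, so the empty request
     sequence is the only valid one.\<close>
   have "pred = []" using valid_length[OF pr] True by simp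
   have nil: "rs = []" if v: "valid_requests n pred rs" for rs
   proof (cases rs)
    case (Cons r rs')
    then show ?thesis using v True \<open>pred = []\<close> by (cases r) (auto simp: valid_requests_def)
   qed
   show ?thesis unfolding promise_def
   proof (rule exI[of _ "1 + (1 + t)"], rule exI[of _ \<sigma>'], intro conjI allI impI, goal_cases)
    case 1 then show ?case using pre[OF t] unfolding W_def .
   next
    case 2 then show ?case using True by simp
   next
    case (3 rs)
    then have "rs = []" by (rule nil)
    then show ?case by (intro exI[of _ "\<lambda>_. \<sigma>'"]) simp
   qed
  next
   case False
   then have n1: "1 <= n" by simp
   have pB: "2 * (n * n) + 2 <= Bd" using B1 by simp
   have "wp Bd (pred_input pred) ?p (\<lambda>u. \<exists>lg LG. n * n <= 2 ^ lg & 2 ^ lg <= 2 * (n * n) & 2 ^ LG <= 2 * (M * (lg + 2) + 2) &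
     base n pred M (M * (lg + 2)) LG u & vr u 13 = 0 & ar u 5 = (\<lambda>_. 0)(0 := 1) & ar u 6 = (\<lambda>_. 0) & ar u 7 = (\<lambda>_. 0) &
     ck u <= ck ?s + 50 + 30 * (n * n) + M * (lg + 2) * (TP n + 20)) ?s"
    by (rule prep_wp[OF pr n1 M(1) _ _ _ _ pc[OF n1 pr, folded Bd_def] wf(2,3) pB B(2-6)[of n, folded Bd_def]]) auto
   from m0.call[OF cs(1) bd rel_init this] obtain t \<sigma>' s' lg LG where t: "exec W (comp ?p) ?\<sigma> t \<sigma>'" "rel m0.J s' \<sigma>'" "bounded Bd s'"
     "2 ^ lg <= 2 * (n * n)" "2 ^ LG <= 2 * (M * (lg + 2) + 2)" "base n pred M (M * (lg + 2)) LG s'"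
     "vr s' 13 = 0" "ar s' 5 = (\<lambda>_. 0)(0 := 1)" "ar s' 6 = (\<lambda>_. 0)" "ar s' 7 = (\<lambda>_. 0)"
     "ck s' <= ck ?s + 50 + 30 * (n * n) + M * (lg + 2) * (TP n + 20)" "t <= R * (ck s' - ck ?s)"
    by blast
   have "lg <= n * n" by (rule lg_le[OF t(4)])
   then have "M * (lg + 2) <= M * (n * n + 2)" by simp
   then have KB: "2 * (M * (lg + 2)) + 2 <= Bd" using B(3)[of n] unfolding Bd_def
   proof -
    have "2 * a + 2 <= m" if "a <= k" "2 * (k + 2) <= m" for a k m :: nat using that by simp
    then show "2 * (M * (lg + 2)) + 2 <= (n + 2) ^ b" using B(3)[of n] \<open>M * (lg + 2) <= M * (n * n + 2)\<close> by blast
   qed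
   interpret m: machine n pred M "M * (lg + 2)" LG Bd R D W ?p by (rule mach[OF KB])
   have "m.Inv {} \<sigma>'" unfolding m.Inv_def using t(2,3,6) rinv_init[OF t(7-10)] by blast
   note rq = m.all_requests[OF _ this M(2,3) t(4,5)]
   have "t <= R * (50 + 30 * (n * n) + M * (lg + 2) * (TP n + 20))"
   proof -
    have "ck s' - ck ?s <= 50 + 30 * (n * n) + M * (lg + 2) * (TP n + 20)" using t(11) by simp
    then show ?thesis using t(12) mult_le_mono2 order_trans by blast
   qed
   then have "\<exists>lg. 2 ^ lg <= 2 * (n * n) & 1 + (1 + t) <= 2 + R * (50 + 30 * (n * n) + M * (lg + 2) * (TP n + 20))"
    using t(4) by (intro exI[of _ lg]) auto
   then show ?thesis using pre[OF t(1)] rq unfolding W_def promise_def by blast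
  qed
 qed
qed

section \<open>Running times\<close>

text \<open>From \<open>n = 4\<close> on, the logarithm is at least 2 and the iterated logarithm at
  least 1, which lets all additive constants be absorbed into factors.\<close>

lemma time_bounds:
 fixes \<epsilon> \<omega> c :: real
 assumes M: "1 <= M" and w: "1 <= \<omega>" and c: "0 <= c" and TP: "\<And>n. 1 <= n ==> real (TP n) <= c * real n powr ((3 + \<omega>) / 2) * (1 + log 2 (real n))"
  and sol: "\<forall>n pred. valid_prediction n pred --> promise \<epsilon> TP M R A wd n pred"
 shows "\<exists>N C. solves_incremental_APSP \<epsilon> A wd N
   (\<lambda>n. C * real n powr ((3 + \<omega>) / 2) * (log 2 (real n))\<^sup>2)
   (\<lambda>n. C * log 2 (real n))
   (\<lambda>n pred es i t.
    real t <= C * (max 1 (real (eta_bar pred es i)))\<^sup>2 * log 2 (log 2 (real n)) &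
    real t <= C * (max 1 (real (eta_inf pred es)))\<^sup>2 * log 2 (log 2 (real n)))"
proof -
 define C1 C2 C3 where "C1 = 2 + real R * (80 + real M * (5 * (2 * c + 20)))" and "C2 = 1 + 20 * real R"
  and "C3 = 2 + real R * (4 * (25 + 5 * (14 * real M + 1)))"
 define C where "C = C1 + C2 + C3"
 have Cn: "0 <= C1" "0 <= C2" "0 <= C3" using c by (auto simp: C1_def C2_def C3_def)
 have CC: "C1 <= C" "C2 <= C" "C3 <= C" using Cn by (auto simp: C_def)
 have lgb: "real lg + 2 <= 5 * log 2 (real n)" "2 <= log 2 (real n)" if "4 <= n" "2 ^ lg <= 2 * (n * n)" for n lg :: nat
 proof -
  have x: "4 <= real n" using that by simp
  have "log 2 4 = (2::real)" using log_nat_power[of 2 2 2] by simp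
  then show L: "2 <= log 2 (real n)" using log_le_cancel_iff[of 2 4 "real n"] x by simp
  have "real (2 ^ lg) <= real (2 * (n * n))" using that(2) by (simp only: of_nat_le_iff)
  then have "log 2 (2 ^ lg) <= log 2 (2 * (real n * real n))" using x by (subst log_le_cancel_iff) auto
  also have "\<dots> = 1 + 2 * log 2 (real n)" using x by (simp add: log_mult)
  finally have "real lg <= 1 + 2 * log 2 (real n)" by simp
  then show "real lg + 2 <= 5 * log 2 (real n)" using L by linarith
 qed
 have pre: "real t0 <= C * real n powr ((3 + \<omega>) / 2) * (log 2 (real n))\<^sup>2"
  if n: "4 <= n" "2 ^ lg <= 2 * (n * n)" and t: "t0 <= 2 + R * (50 + 30 * (n * n) + M * (lg + 2) * (TP n + 20))" for n lg t0
 proof -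
  define X L where "X = real n powr ((3 + \<omega>) / 2)" and "L = log 2 (real n)"
  have x: "1 <= real n" using n by simp
  have L: "real lg + 2 <= 5 * L" "2 <= L" using lgb[OF n] by (auto simp: L_def)
  have "real n powr 2 <= X" unfolding X_def by (rule powr_mono) (use w x in auto)
  then have X: "real n * real n <= X" using x by (simp add: power2_eq_square powr_numeral)
  have "1 <= real n * real n" using x mult_mono[of 1 "real n" 1 "real n"] by simp
  then have X1: "1 <= X" using X by linarith
  have L2: "1 <= L\<^sup>2" "L <= L\<^sup>2" using L(2) one_le_power[of L 2] mult_right_mono[of 1 L L] by (auto simp: power2_eq_square)
  have XL: "1 <= X * L\<^sup>2" "X <= X * L\<^sup>2" "1 <= X * L" using X1 L2 L mult_mono[of 1 X 1 "L\<^sup>2"] mult_left_mono[of 1 "L\<^sup>2" X] mult_mono[of 1 X 1 L] by auto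
  have "real (TP n) + 20 <= c * X * (1 + L) + 20" using TP[of n] n by (simp add: X_def L_def)
  also have "c * X * (1 + L) <= c * X * (2 * L)" using c X1 L by (intro mult_left_mono) auto
  also have "c * X * (2 * L) + 20 <= c * X * (2 * L) + 20 * (X * L)" using XL by simp
  also have "\<dots> = (2 * c + 20) * (X * L)" by (simp add: algebra_simps)
  finally have tp: "real (TP n) + 20 <= (2 * c + 20) * (X * L)" by simp
  have "(real lg + 2) * (real (TP n) + 20) <= (5 * L) * ((2 * c + 20) * (X * L))" using L tp by (intro mult_mono) auto
  also have "\<dots> = 5 * (2 * c + 20) * (X * L\<^sup>2)" by (simp add: power2_eq_square)
  finally have "real M * ((real lg + 2) * (real (TP n) + 20)) <= real M * (5 * (2 * c + 20) * (X * L\<^sup>2))" by (intro mult_left_mono) auto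
  moreover have "50 + 30 * (real n * real n) <= 80 * (X * L\<^sup>2)" using X XL by linarith
  ultimately have s: "50 + 30 * (real n * real n) + real M * ((real lg + 2) * (real (TP n) + 20)) <= (80 + real M * (5 * (2 * c + 20))) * (X * L\<^sup>2)"
   by (simp add: algebra_simps)
  have "real t0 <= real (2 + R * (50 + 30 * (n * n) + M * (lg + 2) * (TP n + 20)))" using t by (simp only: of_nat_le_iff)
  also have "\<dots> = 2 + real R * (50 + 30 * (real n * real n) + real M * ((real lg + 2) * (real (TP n) + 20)))" by (simp add: algebra_simps)
  also have "\<dots> <= 2 * (X * L\<^sup>2) + real R * ((80 + real M * (5 * (2 * c + 20))) * (X * L\<^sup>2))" using XL s by (intro add_mono mult_left_mono) auto
  also have "\<dots> = C1 * (X * L\<^sup>2)" by (simp add: C1_def algebra_simps)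
  also have "\<dots> <= C * (X * L\<^sup>2)" using CC XL by (intro mult_right_mono) auto
  finally show ?thesis by (simp add: X_def L_def mult.assoc)
 qed
 have ins: "real t <= C * log 2 (real n)" if "4 <= n" "t <= 1 + R * 20" for n t
 proof -
  have "1 <= n * n" using that(1) mult_le_mono[of 1 n 1 n] by simp
  then have L: "1 <= log 2 (real n)" using lgb(2)[of n 0] that by auto
  have "real t <= real (1 + R * 20)" using that(2) by (simp only: of_nat_le_iff)
  also have "\<dots> = C2 * 1" by (simp add: C2_def)
  also have "\<dots> <= C * log 2 (real n)" using CC Cn L by (intro mult_mono) auto
  finally show ?thesis .
 qed
 have qry: "real t <= C * (max 1 (real e'))\<^sup>2 * log 2 (log 2 (real n))"
  if n: "4 <= n" "2 ^ lg <= 2 * (n * n)" "2 ^ LG <= 2 * (M * (lg + 2) + 2)" and t: "t <= 2 + R * ((e + 1) * (25 + 5 * LG) * (e + 1))" and e: "e <= e'" for n lg LG t e e'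
 proof -
  define L where "L = log 2 (real n)"
  define Y where "Y = log 2 L"
  have L: "real lg + 2 <= 5 * L" "2 <= L" using lgb[OF n(1,2)] by (auto simp: L_def)
  have Y: "1 <= Y" unfolding Y_def using L(2) by (simp add: le_log_iff)
  have M': "1 <= real M" using M by simp
  have "1 <= real M * L" using M' L mult_mono[of 1 "real M" 1 L] by simp
  \<comment> \<open>\<open>2 ^ LG\<close> is at most a constant multiple of \<open>M\<close> times
    the logarithm of \<open>n\<close>, so \<open>LG\<close> is the iterated logarithm up to a
    constant that depends on \<open>M\<close>.\<close>
  have "real (2 ^ LG) <= real (2 * (M * (lg + 2) + 2))" using n(3) by (simp only: of_nat_le_iff)
  also have "\<dots> = 2 * (real M * (real lg + 2) + 2)" by (simp add: algebra_simps)
  also have "\<dots> <= 2 * (real M * (5 * L) + 2)" using L by (intro mult_left_mono add_right_mono) auto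
  also have "\<dots> <= 14 * real M * L" using \<open>1 <= real M * L\<close> by (simp add: mult.commute)
  finally have "2 ^ LG <= 14 * real M * L" by simp
  then have "log 2 (2 ^ LG) <= log 2 (14 * real M * L)" using M' L by (subst log_le_cancel_iff) auto
  also have "\<dots> = log 2 (14 * real M) + Y" using M' L by (simp add: log_mult Y_def)
  also have "log 2 (14 * real M) <= log 2 (2 ^ (14 * M))"
  proof -
   have "real (14 * M) <= real (2 ^ (14 * M))" using less_exp[of "14 * M"] by (simp only: of_nat_le_iff)
   then show ?thesis using M' by (subst log_le_cancel_iff) auto
  qed
  also have "log 2 (2 ^ (14 * M)) = 14 * real M" by (subst log_nat_power) auto
  finally have "real LG <= 14 * real M + Y" by simp
  also have "\<dots> <= (14 * real M + 1) * Y" using Y M' mult_left_mono[of 1 Y "14 * real M"] by (simp add: algebra_simps)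
  finally have LG: "25 + 5 * real LG <= (25 + 5 * (14 * real M + 1)) * Y" using Y by (simp add: algebra_simps)
  define m where "m = max 1 (real e')"
  have m: "real e + 1 <= 2 * m" "1 <= m" using e by (auto simp: m_def)
  have m2: "1 <= m\<^sup>2" using m(2) by (simp add: one_le_power)
  have "(real e + 1) * (25 + 5 * real LG) * (real e + 1) <= (2 * m) * ((25 + 5 * (14 * real M + 1)) * Y) * (2 * m)"
   using m LG Y by (intro mult_mono) auto
  also have "\<dots> = 4 * (25 + 5 * (14 * real M + 1)) * (m\<^sup>2 * Y)" by (simp add: power2_eq_square)
  finally have s: "(real e + 1) * (25 + 5 * real LG) * (real e + 1) <= 4 * (25 + 5 * (14 * real M + 1)) * (m\<^sup>2 * Y)" .
  have mY: "1 <= m\<^sup>2 * Y" using m2 Y mult_mono[of 1 "m\<^sup>2" 1 Y] by simp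
  have "real t <= real (2 + R * ((e + 1) * (25 + 5 * LG) * (e + 1)))" using t by (simp only: of_nat_le_iff)
  also have "\<dots> = 2 + real R * ((real e + 1) * (25 + 5 * real LG) * (real e + 1))" by (simp add: algebra_simps)
  also have "\<dots> <= 2 * (m\<^sup>2 * Y) + real R * (4 * (25 + 5 * (14 * real M + 1)) * (m\<^sup>2 * Y))" using mY s by (intro add_mono mult_left_mono) auto
  also have "\<dots> = C3 * (m\<^sup>2 * Y)" by (simp add: C3_def algebra_simps)
  also have "\<dots> <= C * (m\<^sup>2 * Y)" using CC mY by (intro mult_right_mono) auto
  finally show ?thesis by (simp add: m_def Y_def L_def mult.assoc)
 qed
 show ?thesis unfolding solves_incremental_APSP_def
 proof (rule exI[of _ 4], rule exI[of _ C], intro allI impI, goal_cases)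
  case (1 n pred)
  from sol[rule_format, OF 1, unfolded promise_def] obtain t0 s0 where e: "exec ((int n + 2) ^ wd) (preprocess A) (prediction_input n pred) t0 s0"
   and t0: "1 <= n ==> \<exists>lg. 2 ^ lg <= 2 * (n * n) & t0 <= 2 + R * (50 + 30 * (n * n) + M * (lg + 2) * (TP n + 20))"
   and rq: "\<And>rs. valid_requests n pred rs ==> \<exists>\<sigma> \<tau>. \<sigma> 0 = s0 & (\<forall>k<length rs.
    handle ((int n + 2) ^ wd) A (rs ! k) (\<sigma> k) (\<tau> k) (\<sigma> (Suc k)) & served \<epsilon> M R n pred rs k (\<tau> k) (\<sigma> (Suc k)))"
   by blast
  note pr = 1
  show ?case
  proof (rule exI[of _ t0], rule exI[of _ s0], intro conjI allI impI e, goal_cases)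
   case 1 then show ?case using t0 pre[OF 1] by fastforce
  next
   case (2 rs)
   from rq[OF 2] obtain \<sigma> \<tau> where s: "\<sigma> 0 = s0" and st: "\<And>k. k < length rs ==> handle ((int n + 2) ^ wd) A (rs ! k) (\<sigma> k) (\<tau> k) (\<sigma> (Suc k))"
    "\<And>k. k < length rs ==> served \<epsilon> M R n pred rs k (\<tau> k) (\<sigma> (Suc k))" by blast
   have ms: "mset (insertions rs) = mset pred" using 2 by (simp add: valid_requests_def)
   have d: "distinct pred" "distinct (insertions rs)" using pr ms mset_eq_imp_distinct_iff by (auto simp: valid_prediction_def)
   have se: "set (insertions rs) = set pred" using ms by (metis set_mset_mset)
   have le: "length (insertions (take k rs)) <= length (insertions rs)" for k by (metis append_take_drop_id insertions_append length_append le_add1)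
   note eta = eta_bar_le_eta_inf[OF d se le]
   show ?case
   proof (rule exI[of _ \<sigma>], rule exI[of _ \<tau>], intro conjI allI impI s, goal_cases)
    case (1 k) then show ?case by (rule st(1))
   next
    case (2 k)
    show ?case
    proof (cases "rs ! k")
     case (Insert u v) then show ?thesis using st(2)[OF 2] ins by (simp add: served_def)
    next
     case (Query x y)
     from st(2)[OF 2, unfolded served_def Query request.case] obtain lg LG where a: "approx_dist \<epsilon> (graph_dist (set (insertions (take k rs))) x y) (answer (\<sigma> (Suc k)))"
      and b: "2 ^ lg <= 2 * (n * n)" "2 ^ LG <= 2 * (M * (lg + 2) + 2)" "\<tau> k <= 2 + R * ((eta_bar pred (insertions rs) (length (insertions (take k rs))) + 1) *
       (25 + 5 * LG) * (eta_bar pred (insertions rs) (length (insertions (take k rs))) + 1))" by blast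
     show ?thesis unfolding Query request.case by (intro conjI impI a qry[OF _ b] order_refl eta)
    qed
   qed
  qed
 qed
qed

section \<open>The exponent of matrix multiplication\<close>

text \<open>Every store is a step of its own, so \<open>t\<close> steps change at most
  \<open>t\<close> cells.\<close>

lemma exec_changes: "exec W P s t s' ==> \<exists>F. finite F & card F <= t & (\<forall>x. x \<notin> F --> mem s' x = mem s x)"
proof (induction rule: exec.induct)
 case (exec_Store s a r)
 then show ?case by (intro exI[of _ "{nat (reg s a)}"]) (auto simp: set_mem_def)
next
 case (exec_Seq P s t s' Q t' s'')
 then obtain F F' where "finite F" "card F <= t" "\<forall>x. x \<notin> F --> mem s' x = mem s x" "finite F'" "card F' <= t'" "\<forall>x. x \<notin> F' --> mem s'' x = mem s' x" by auto
 then show ?case using card_Un_le[of F F'] by (intro exI[of _ "F \<union> F'"]) auto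
next
 case (exec_WhileTrue s r P t s' t' s'')
 then obtain F F' where "finite F" "card F <= t" "\<forall>x. x \<notin> F --> mem s' x = mem s x" "finite F'" "card F' <= t'" "\<forall>x. x \<notin> F' --> mem s'' x = mem s' x" by auto
 then show ?case using card_Un_le[of F F'] by (intro exI[of _ "F \<union> F'"]) auto
next
 case (exec_IfTrue s r P t s' Q)
 then obtain F where "finite F" "card F <= t" "\<forall>x. x \<notin> F --> mem s' x = mem s x" by auto
 then show ?case by (intro exI[of _ F]) auto
next
 case (exec_IfFalse s r Q t s' P)
 then obtain F where "finite F" "card F <= t" "\<forall>x. x \<notin> F --> mem s' x = mem s x" by auto
 then show ?case by (intro exI[of _ F]) auto
qed (rule exI[of _ "{}"], simp add: set_reg_def)+

text \<open>The product of two all-one matrices has \<open>n * n\<close> entries different from the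
  zeros initially found there, and each of them takes a store. With an exponent below 2, a positive
  power of \<open>n\<close> would be bounded.\<close>

lemma matmul_exponent_ge_2:
 assumes "matmul_exponent \<omega>"
 shows "2 <= \<omega>"
proof (rule ccontr)
 assume w: "\<not> 2 <= \<omega>"
 from assms[unfolded matmul_exponent_def, rule_format, of 0] obtain P c C where mm: "\<forall>n\<ge>1. \<forall>A B. (\<forall>i<n. \<forall>j<n. \<bar>A i j\<bar> <= int n ^ 0 & \<bar>B i j\<bar> <= int n ^ 0) -->
   (\<exists>t s. exec ((int n + 2) ^ c) P (matmul_input n A B) t s & real t <= C * real n powr \<omega> &
       (\<forall>i<n. \<forall>j<n. mem s (2 * n\<^sup>2 + i * n + j) = (\<Sum>l<n. A i l * B l j)))" by blast
 have bd: "real n powr (2 - \<omega>) <= C" if n: "1 <= n" for n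
 proof -
  from mm[rule_format, OF n, of "\<lambda>_ _. 1" "\<lambda>_ _. 1"] obtain t s where e: "exec ((int n + 2) ^ c) P (matmul_input n (\<lambda>_ _. 1) (\<lambda>_ _. 1)) t s" "real t <= C * real n powr \<omega>"
   and p: "\<And>i j. i < n ==> j < n ==> mem s (2 * n\<^sup>2 + i * n + j) = int n" by auto
  from exec_changes[OF e(1)] obtain F where F: "finite F" "card F <= t" "\<And>x. x \<notin> F ==> mem s x = mem (matmul_input n (\<lambda>_ _. 1) (\<lambda>_ _. 1)) x" by blast
  have "{2 * n\<^sup>2..<3 * n\<^sup>2} \<subseteq> F"
  proof
   fix x assume x: "x \<in> {2 * n\<^sup>2..<3 * n\<^sup>2}"
   define y where "y = x - 2 * n\<^sup>2"
   have y: "x = 2 * n\<^sup>2 + y" "y < n * n" using x by (auto simp: y_def power2_eq_square)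
   have "y div n < n" "y mod n < n" using y(2) n by (auto simp: less_mult_imp_div_less)
   then have "mem s (2 * n\<^sup>2 + (y div n) * n + y mod n) = int n" by (rule p)
   moreover have "2 * n\<^sup>2 + (y div n) * n + y mod n = x" using y(1) div_mult_mod_eq[of y n] by linarith
   ultimately have "mem s x = int n" by simp
   moreover have "mem (matmul_input n (\<lambda>_ _. 1) (\<lambda>_ _. 1)) x = 0" using x by (simp add: matmul_input_def)
   ultimately show "x \<in> F" using F(3)[of x] n by auto
  qed
  then have "n\<^sup>2 <= t" using card_mono[OF F(1), of "{2 * n\<^sup>2..<3 * n\<^sup>2}"] F(2) by simp
  then have "real (n\<^sup>2) <= C * real n powr \<omega>" using e(2) by (meson of_nat_le_iff order_trans)
  moreover have "real (n\<^sup>2) = real n powr (2 - \<omega>) * real n powr \<omega>" using n by (simp add: powr_add[symmetric] powr_numeral)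
  ultimately show ?thesis using n by simp
 qed
 \<comment> \<open>Chosen such that its power with exponent \<open>2 - \<omega>\<close> is at least
   \<open>\<bar>C\<bar> + 1\<close>.\<close>
 define n where "n = nat \<lceil>(\<bar>C\<bar> + 1) powr (1 / (2 - \<omega>))\<rceil> + 1"
 have n: "1 <= n" by (simp add: n_def)
 have "(\<bar>C\<bar> + 1) powr (1 / (2 - \<omega>)) <= real n" by (simp add: n_def) linarith
 then have "((\<bar>C\<bar> + 1) powr (1 / (2 - \<omega>))) powr (2 - \<omega>) <= real n powr (2 - \<omega>)" using w by (intro powr_mono2) auto
 then have "\<bar>C\<bar> + 1 <= real n powr (2 - \<omega>)" using w by (simp add: powr_powr)
 then show False using bd[OF n] by linarith
qed

section \<open>Parameters of the preprocessing\<close>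

text \<open>Polynomial growth, with base \<open>n + 2\<close> so that constants are covered and
  small \<open>n\<close> are no exception.\<close>

definition pb :: "(nat => nat) => bool" where
 "pb f \<longleftrightarrow> (\<exists>b. \<forall>n. f n <= (n + 2) ^ b)"

lemma pb_const: "pb (\<lambda>n. k)"
 unfolding pb_def
proof (intro exI[of _ k] allI)
 fix n :: nat
 have "k <= 2 ^ k" using less_exp[of k] by simp
 also have "\<dots> <= (n + 2) ^ k" by (rule power_mono) auto
 finally show "k <= (n + 2) ^ k" .
qed

lemma pb_id: "pb (\<lambda>n. n)"
 unfolding pb_def by (intro exI[of _ 1]) auto

lemma pb_mult: "pb f ==> pb g ==> pb (\<lambda>n. f n * g n)"
proof -
 assume "pb f" "pb g"
 then obtain a b where "\<forall>n. f n <= (n + 2) ^ a" "\<forall>n. g n <= (n + 2) ^ b" by (auto simp: pb_def)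
 then have "\<forall>n. f n * g n <= (n + 2) ^ (a + b)" unfolding power_add by (auto intro: mult_le_mono)
 then show ?thesis unfolding pb_def by blast
qed

lemma pb_add: "pb f ==> pb g ==> pb (\<lambda>n. f n + g n)"
proof -
 assume "pb f" "pb g"
 then obtain a b where ab: "\<forall>n. f n <= (n + 2) ^ a" "\<forall>n. g n <= (n + 2) ^ b" by (auto simp: pb_def)
 have "f n + g n <= (n + 2) ^ (a + b + 1)" for n
 proof -
  have "(n + 2) ^ a <= (n + 2) ^ (a + b)" "(n + 2) ^ b <= (n + 2) ^ (a + b)" by (rule power_increasing; simp)+
  then have "f n + g n <= 2 * (n + 2) ^ (a + b)" using ab[rule_format, of n] by linarith
  also have "\<dots> <= (n + 2) ^ (a + b + 1)" by simp
  finally show ?thesis .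
 qed
 then show ?thesis unfolding pb_def by blast
qed

lemma pb_pow: "pb f ==> pb (\<lambda>n. f n ^ d)"
 by (induction d) (auto intro: pb_const[of 1, simplified] pb_mult)

lemmas pb_intros = pb_const pb_id pb_add pb_mult pb_pow

text \<open>For the time of a matrix product, which is a real power: the exponent is rounded up, and
  the base \<open>2 * n + 1\<close> is positive for \<open>n = 0\<close> as well.\<close>

lemma pb_powr:
 fixes C \<omega> :: real
 assumes "0 <= C"
 shows "pb (\<lambda>n. nat \<lfloor>C * (2 * real n) powr \<omega>\<rfloor>)"
proof -
 define k where "k = nat \<lceil>\<omega>\<rceil>"
 have "nat \<lfloor>C * (2 * real n) powr \<omega>\<rfloor> <= nat \<lceil>C\<rceil> * (2 * n + 1) ^ k" for n
 proof -
  have "(2 * real n) powr \<omega> <= real ((2 * n + 1) ^ k)"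
  proof (cases "n = 0")
   case False
   have "(2 * real n) powr \<omega> <= (2 * real n) powr real k" by (rule powr_mono) (use False in \<open>auto simp: k_def\<close>, linarith)
   also have "\<dots> = (2 * real n) ^ k" using False by (simp add: powr_realpow)
   also have "\<dots> <= (2 * real n + 1) ^ k" by (rule power_mono) auto
   finally show ?thesis by (simp add: add.commute)
  qed simp
  moreover have "C <= real (nat \<lceil>C\<rceil>)" by linarith
  ultimately have "C * (2 * real n) powr \<omega> <= real (nat \<lceil>C\<rceil>) * real ((2 * n + 1) ^ k)" using assms by (intro mult_mono) auto
  then have "C * (2 * real n) powr \<omega> <= real (nat \<lceil>C\<rceil> * (2 * n + 1) ^ k)" by simp
  then show ?thesis by linarith
 qed
 moreover have "pb (\<lambda>n. nat \<lceil>C\<rceil> * (2 * n + 1) ^ k)" by (intro pb_intros)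
 ultimately show ?thesis unfolding pb_def by (meson order_trans)
qed

text \<open>\<open>n\<^sup>2 h\<close> pays for the chunks of size \<open>h\<close> scanned for newly set flags, \<open>n h\<^sup>2\<close> for the last matrix product, and \<open>lev * TM\<close> for
 the products that were too slow and therefore doubled \<open>h\<close>; the cost of every other product is charged to the \<open>n h\<close> elements before it.\<close>

lemma product_time:
 fixes \<omega> C :: real
 assumes w: "2 <= \<omega>" "\<omega> <= 3" and C: "1 <= C"
 shows "\<exists>c\<ge>0. \<forall>n iv h0 h lev. 1 <= n --> iv <= n * n + 1 --> 0 < h0 --> (h0 - 1) * (h0 - 1) < n --> h = h0 * 2 ^ lev -->
   (lev = 0 \<or> n * (h * h) < 4 * nat \<lfloor>C * (2 * real n) powr \<omega>\<rfloor>) -->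
   real (2 * htime n iv (nat \<lfloor>C * (2 * real n) powr \<omega>\<rfloor>) h lev + 2 * (n * n) + 20) <= c * real n powr ((3 + \<omega>) / 2) * (1 + log 2 (real n))"
proof -
 define C2 where "C2 = C * 2 powr \<omega>"
 have "2 powr 0 <= 2 powr \<omega>" by (rule powr_mono) (use w in auto)
 then have C2: "1 <= C2" unfolding C2_def using C mult_mono[of 1 C 1 "2 powr \<omega>"] by simp
 define c3 where "c3 = max 0 (log 2 (4 * C2)) + 3"
 define c where "c = 1482 + 1696 * C2 + 2 * c3 * (C2 + 100)"
 have c3: "3 <= c3" by (simp add: c3_def)
 show ?thesis
 proof (intro exI[of _ c] conjI allI impI)
  show "0 <= c" using C2 c3 by (simp add: c_def)
  fix n iv h0 h lev :: nat
  assume n: "1 <= n" and iv: "iv <= n * n + 1" and h0: "0 < h0" "(h0 - 1) * (h0 - 1) < n" and h: "h = h0 * 2 ^ lev"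
   and lev: "lev = 0 \<or> n * (h * h) < 4 * nat \<lfloor>C * (2 * real n) powr \<omega>\<rfloor>"
  define x X L H T where "x = real n" and "X = x powr ((3 + \<omega>) / 2)" and "L = log 2 x" and "H = real h" and "T = real (nat \<lfloor>C * (2 * real n) powr \<omega>\<rfloor>)"
  have x: "1 <= x" using n by (simp add: x_def)
  have L: "0 <= L" using x by (simp add: L_def)
  have pw: "x powr a <= X" if "a <= (3 + \<omega>) / 2" for a unfolding X_def by (rule powr_mono) (use that x in auto)
  have xx: "x * x <= X" using pw[of 2] w x by (simp add: power2_eq_square powr_numeral)
  have X1: "1 <= X" using pw[of 0] w x by simp
  have "C * (2 * x) powr \<omega> = C2 * x powr \<omega>" using x by (simp add: C2_def powr_mult)
  moreover have "T <= C * (2 * x) powr \<omega>" unfolding T_def x_def using C by (simp add: of_nat_floor)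
  ultimately have Tw: "T <= C2 * x powr \<omega>" by simp
  also have "\<dots> <= C2 * X" using pw[of \<omega>] w C2 by (intro mult_left_mono) auto
  finally have T: "T <= C2 * X" .
  have X2: "X * X = x * x * x * x powr \<omega>"
  proof -
   have "X * X = x powr (3 + \<omega>)" unfolding X_def by (simp add: powr_add[symmetric])
   also have "\<dots> = x powr 3 * x powr \<omega>" by (simp add: powr_add)
   also have "x powr 3 = x * x * x" using x by (simp add: powr_numeral power3_eq_cube)
   finally show ?thesis .
  qed
  \<comment> \<open>If \<open>h\<close> was never doubled, it is about the square root of
    \<open>n\<close>, and \<open>n\<close> to the power 5/2 is at most \<open>X\<close> because
    \<omega> is at least 2. Otherwise the last doubling bounds \<open>n * (h * h)\<close> by
    \<open>4 * TM\<close>; squaring \<open>n * n * h\<close> produces this term times the cube of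
    \<open>n\<close>, which by \<open>X2\<close> is within a constant factor of the square of
    \<open>X\<close>.\<close>
  have "x * x * H <= 4 * C2 * X & x * (H * H) <= 4 * C2 * X & real lev <= c3 * (1 + L)"
  proof (cases "lev = 0")
   case True
   then have hh: "h = h0" using h by simp
   have s: "1 <= sqrt x" "sqrt x * sqrt x = x" using x by auto
   have "real (h0 - 1) * real (h0 - 1) <= x" using h0(2) unfolding x_def by (metis less_imp_le of_nat_le_iff of_nat_mult)
   then have "real (h0 - 1) <= sqrt x" by (simp add: real_le_rsqrt power2_eq_square)
   moreover have "real (h0 - 1) = real h0 - 1" using h0(1) by (simp add: of_nat_diff)
   ultimately have Hs: "H <= 2 * sqrt x" using s(1) unfolding H_def hh by linarith
   have H0: "0 <= H" by (simp add: H_def)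
   have "x * x * H <= x * x * (2 * sqrt x)" using Hs x by (intro mult_left_mono) auto
   also have "\<dots> = 2 * (x powr 2 * x powr (1/2))" using x by (simp add: powr_numeral power2_eq_square powr_half_sqrt)
   also have "\<dots> = 2 * x powr (5/2)" by (simp add: powr_add[symmetric])
   also have "\<dots> <= 2 * X" using pw[of "5/2"] w by simp
   also have "\<dots> <= 4 * C2 * X" using C2 X1 by (intro mult_right_mono) auto
   finally have 1: "x * x * H <= 4 * C2 * X" .
   have "H * H <= (2 * sqrt x) * (2 * sqrt x)" using Hs H0 s by (intro mult_mono) auto
   also have "\<dots> = 4 * x" using s(2) by simp
   finally have "x * (H * H) <= x * (4 * x)" using x by (intro mult_left_mono) auto
   also have "\<dots> <= 4 * X" using xx by simp
   also have "\<dots> <= 4 * C2 * X" using C2 X1 by (intro mult_right_mono) auto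
   finally show ?thesis using 1 True c3 L by simp
  next
   case False
   then have "n * (h * h) <= 4 * nat \<lfloor>C * (2 * real n) powr \<omega>\<rfloor>" using lev by simp
   then have "real (n * (h * h)) <= real (4 * nat \<lfloor>C * (2 * real n) powr \<omega>\<rfloor>)" by (simp only: of_nat_le_iff)
   then have "x * (H * H) <= 4 * T" by (simp add: x_def H_def T_def)
   then have xH: "x * (H * H) <= 4 * C2 * x powr \<omega>" using Tw by simp
   have "(x * x * H)\<^sup>2 = x * x * x * (x * (H * H))" by (simp add: power2_eq_square)
   also have "\<dots> <= x * x * x * (4 * C2 * x powr \<omega>)" using xH x by (intro mult_left_mono) auto
   also have "\<dots> = 4 * C2 * (X * X)" unfolding X2 by simp
   also have "\<dots> <= (4 * C2) * (4 * C2) * (X * X)" using C2 mult_mono[of 1 "4 * C2" "4 * C2" "4 * C2"] by (intro mult_right_mono) auto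
   also have "\<dots> = (4 * C2 * X)\<^sup>2" by (simp add: power2_eq_square)
   finally have 1: "x * x * H <= 4 * C2 * X" by (rule power2_le_imp_le) (use C2 X1 in auto)
   have 2: "x * (H * H) <= 4 * C2 * X"
   proof -
    have "4 * C2 * x powr \<omega> <= 4 * C2 * X" using pw[of \<omega>] w C2 by (intro mult_left_mono) auto
    then show ?thesis using xH by linarith
   qed
   \<comment> \<open>Each doubling doubles \<open>h\<close>, and \<open>h\<close> is polynomial in
     \<open>n\<close>, so the number of doublings is logarithmic.\<close>
   have "2 ^ lev <= h" using h h0 by simp
   then have "2 ^ lev <= H" unfolding H_def by (metis of_nat_le_iff of_nat_numeral of_nat_power)
   moreover have "1 <= H" using \<open>2 ^ lev <= H\<close> one_le_power[of "2::real" lev] by linarith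
   moreover have "H * 1 <= H * H" using \<open>1 <= H\<close> by (intro mult_left_mono) auto
   moreover have "1 * (H * H) <= x * (H * H)" using x by (intro mult_right_mono) auto
   ultimately have "2 ^ lev <= x * (H * H)" by linarith
   then have "2 ^ lev <= 4 * C2 * x powr \<omega>" using xH by linarith
   then have "log 2 (2 ^ lev) <= log 2 (4 * C2 * x powr \<omega>)" using C2 x by (subst log_le_cancel_iff) auto
   also have "\<dots> = log 2 (4 * C2) + \<omega> * L" using C2 x by (simp add: log_mult log_powr L_def)
   also have "\<dots> <= max 0 (log 2 (4 * C2)) + 3 * L" using w L by (intro add_mono mult_right_mono) auto
   also have "\<dots> <= c3 * (1 + L)"
   proof -
    define a where "a = max 0 (log 2 (4 * C2))"
    have "0 <= a * L" using L by (simp add: a_def)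
    then show ?thesis unfolding c3_def a_def[symmetric] by (simp add: algebra_simps)
   qed
   finally show ?thesis using 1 2 by simp
  qed
  then have b: "x * x * H <= 4 * C2 * X" "x * (H * H) <= 4 * C2 * X" "real lev <= c3 * (1 + L)" by auto
  define Y where "Y = X * (1 + L)"
  have "X * 1 <= X * (1 + L)" using X1 L by (intro mult_left_mono) auto
  then have Y: "X <= Y" "1 <= Y" unfolding Y_def using X1 by linarith+
  have "real lev * (T + 100 * (x * x)) <= (c3 * (1 + L)) * (C2 * X + 100 * X)" using b(3) T xx c3 L by (intro mult_mono) (auto simp: T_def x_def)
  also have "\<dots> = c3 * (C2 + 100) * Y" by (simp add: Y_def algebra_simps)
  finally have lv: "real lev * (T + 100 * (x * x)) <= c3 * (C2 + 100) * Y" .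
  have ivr: "real iv <= x * x + 1"
  proof -
   have "real iv <= real (n * n + 1)" using iv by (simp only: of_nat_le_iff)
   then show ?thesis by (simp add: x_def)
  qed
  have C2Y: "C2 * X <= C2 * Y" using Y C2 by (intro mult_left_mono) auto
  have "real (2 * htime n iv (nat \<lfloor>C * (2 * real n) powr \<omega>\<rfloor>) h lev + 2 * (n * n) + 20) =
   620 + 802 * (x * x) + 20 * real iv + 222 * (x * x * H) + 2 * (real lev * (T + 100 * (x * x))) + 202 * (x * (H * H))"
   by (simp add: htime_def x_def H_def T_def algebra_simps)
  also have "\<dots> <= 620 * Y + 802 * Y + 40 * Y + 222 * (4 * (C2 * Y)) + 2 * (c3 * (C2 + 100) * Y) + 202 * (4 * (C2 * Y))"
   using Y xx ivr b(1,2) lv C2Y by (intro add_mono) linarith+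
  also have "\<dots> <= c * Y" using Y by (simp add: c_def algebra_simps)
  finally show "real (2 * htime n iv (nat \<lfloor>C * (2 * real n) powr \<omega>\<rfloor>) h lev + 2 * (n * n) + 20) <= c * real n powr ((3 + \<omega>) / 2) * (1 + log 2 (real n))"
   by (simp add: Y_def X_def L_def x_def mult.assoc)
 qed
qed

text \<open>\<open>M\<close> is the inverse of \<epsilon>, rounded up. The sum \<open>G\<close>
  dominates all size requirements at once, which yields one exponent \<open>b\<close> for the bound
  on stored values.\<close>

lemma assemble:
 fixes \<epsilon> \<omega> c :: real
 assumes e: "0 < \<epsilon>" and w: "1 <= \<omega>" and c: "0 <= c" and TP: "\<And>n. 1 <= n ==> real (TP n) <= c * real n powr ((3 + \<omega>) / 2) * (1 + log 2 (real n))"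
  and wf: "wf_com pc" "mv pc \<subseteq> prod_vars" "ma pc \<subseteq> {0,10,11,12,13,20,21,22,23,24,25,30,31,32,33,34,35}" and pb: "pb F" "pb inc"
  and pc: "\<And>B n pred h0. F n <= B ==> 1 <= n ==> valid_prediction n pred ==> 0 < h0 ==> n <= h0 * h0 ==> (h0 - 1) * (h0 - 1) < n ==> h0 <= n + 1 ==>
    prod_ok B (pred_input pred) n (length pred + 1) (2 * (2*n)\<^sup>2 + (2*n + 2) ^ d) h0 (inc n) (TP n) pc"
 shows "\<exists>(A::algorithm) (c::nat) (N::nat) (C::real). solves_incremental_APSP \<epsilon> A c N
   (\<lambda>n. C * real n powr ((3 + \<omega>) / 2) * (log 2 (real n))\<^sup>2) (\<lambda>n. C * log 2 (real n))
   (\<lambda>n pred es i t. real t <= C * (max 1 (real (eta_bar pred es i)))\<^sup>2 * log 2 (log 2 (real n)) &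
    real t <= C * (max 1 (real (eta_inf pred es)))\<^sup>2 * log 2 (log 2 (real n)))"
proof -
 define M where "M = nat \<lceil>1 / \<epsilon>\<rceil>"
 have "1 / \<epsilon> <= real M" unfolding M_def by linarith
 then have Me: "1 <= \<epsilon> * real M" using e by (simp add: divide_le_eq mult.commute)
 then have M: "1 <= M" by (cases M) auto
 define G where "G n = F n + (4 * (n * n) + 6) + (2 * (2*n)\<^sup>2 + (2*n + 2) ^ d) + 2 * (M * (n * n + 2) + 2) +
  (M * (n * n + 2) + 1) * (n * n) + M * (n * n + 2) * inc n + 4 * (n * n) * M" for n
 have "pb G" unfolding G_def by (intro pb_intros pb)
 then obtain b where b: "\<And>n. G n <= (n + 2) ^ b" by (auto simp: pb_def)
 have "a <= s & a2 <= s & a3 <= s & a4 <= s & a5 <= s & a6 <= s & a7 <= s" if "a + a2 + a3 + a4 + a5 + a6 + a7 <= s" for a a2 a3 a4 a5 a6 a7 s :: nat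
  using that by simp
 note bs' = this[OF b[unfolded G_def]]
 have bs: "\<And>n. F n <= (n + 2) ^ b" "\<And>n::nat. 4 * (n * n) + 6 <= (n + 2) ^ b" "\<And>n::nat. 2 * (2*n)\<^sup>2 + (2*n + 2) ^ d <= (n + 2) ^ b" "\<And>n::nat. 2 * (M * (n * n + 2) + 2) <= (n + 2) ^ b"
   "\<And>n::nat. (M * (n * n + 2) + 1) * (n * n) <= (n + 2) ^ b" "\<And>n::nat. M * (n * n + 2) * inc n <= (n + 2) ^ b" "\<And>n::nat. 4 * (n * n) * M <= (n + 2) ^ b"
  using bs' by blast+
 from solution[OF M e Me wf pc[OF bs(1)] bs(2-7)] obtain A wd R where "\<forall>n pred. valid_prediction n pred --> promise \<epsilon> TP M R A wd n pred" by blast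
 from time_bounds[OF M w c TP this] show ?thesis by blast
qed

theorem theorem3p1:
  fixes \<epsilon> \<omega> :: real
  assumes "\<epsilon> > 0"
    and "matmul_exponent \<omega>"
  shows "\<exists>(A::algorithm) (c::nat) (N::nat) (C::real).
    solves_incremental_APSP \<epsilon> A c N
      (\<lambda>n. C * real n powr ((3 + \<omega>) / 2) * (log 2 (real n))\<^sup>2)
      (\<lambda>n. C * log 2 (real n))
      (\<lambda>n pred es i t.
        real t \<le> C * (max 1 (real (eta_bar pred es i)))\<^sup>2 * log 2 (log 2 (real n)) \<and>
        real t \<le> C * (max 1 (real (eta_inf pred es)))\<^sup>2 * log 2 (log 2 (real n)))"
proof (cases "\<omega> \<le> 3")
  \<comment> \<open>The analysis of the fast product needs \<open>n powr \<omega>\<close> to be at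
    most \<open>n powr ((3 + \<omega>) / 2)\<close>, that is \<omega> at most 3. For larger
    exponents the cubic product meets the bound.\<close>
  case False
  let ?TP = "\<lambda>n::nat. 10 + 20 * (n * n * n)"
  have TP: "real (?TP n) \<le> 30 * real n powr ((3 + \<omega>) / 2) * (1 + log 2 (real n))" if n: "1 \<le> n" for n
  proof -
    have x: "1 \<le> real n" using n by simp
    have "real n powr 3 \<le> real n powr ((3 + \<omega>) / 2)" by (rule powr_mono) (use False x in auto)
    then have X: "real n * real n * real n \<le> real n powr ((3 + \<omega>) / 2)" using x by (simp add: powr_numeral power3_eq_cube)
    have "1 \<le> real n powr ((3 + \<omega>) / 2)" using x False by (intro ge_one_powr_ge_zero) auto
    then have "real (?TP n) \<le> 30 * real n powr ((3 + \<omega>) / 2) * 1" using X by simp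
    also have "\<dots> \<le> 30 * real n powr ((3 + \<omega>) / 2) * (1 + log 2 (real n))" using x by (intro mult_left_mono) auto
    finally show ?thesis .
  qed
  show ?thesis
  proof (rule assemble[OF assms(1) _ _ TP, where pc = prod_naive and F = "\<lambda>n. 2 * (n * n) + 3" and inc = "\<lambda>_. 0" and d = 1])
    fix B n h0 :: nat and pred assume a: "2 * (n * n) + 3 \<le> B" "1 \<le> n" "valid_prediction n pred"
    show "prod_ok B (pred_input pred) n (length pred + 1) (2 * (2 * n)\<^sup>2 + (2 * n + 2) ^ 1) h0 0 (?TP n) prod_naive"
      by (rule prod_naive_ok) (use a valid_length[OF a(3)] in auto)
  qed (use False mv_prod in \<open>auto intro!: pb_intros\<close>)
next
  case True
  have w2: "2 \<le> \<omega>" by (rule matmul_exponent_ge_2[OF assms(2)])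
  \<comment> \<open>Degree 0 bounds the entries by 1, which suffices because only matrices of bits
    are multiplied.\<close>
  from assms(2)[unfolded matmul_exponent_def, rule_format, of 0] obtain P d0 C0 where mm: "\<forall>n\<ge>1. \<forall>A B. (\<forall>i<n. \<forall>j<n. \<bar>A i j\<bar> \<le> int n ^ 0 \<and> \<bar>B i j\<bar> \<le> int n ^ 0) \<longrightarrow>
      (\<exists>t s. exec ((int n + 2) ^ d0) P (matmul_input n A B) t s \<and> real t \<le> C0 * real n powr \<omega> \<and>
             (\<forall>i<n. \<forall>j<n. mem s (2 * n\<^sup>2 + i * n + j) = (\<Sum>l<n. A i l * B l j)))" by blast
  \<comment> \<open>Raising the exponent ensures that the dimension fits into a word, and
    \<open>exec_mono\<close> admits the larger word bound; \<open>C\<close> is made at least 1 for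
    the estimates in \<open>product_time\<close>.\<close>
  define d C where "d = d0 + 1" and "C = max 1 C0"
  define TM where "TM n = nat \<lfloor>C * (2 * real n) powr \<omega>\<rfloor>" for n :: nat
  have C: "1 \<le> C" by (simp add: C_def)
  have mm': "\<exists>t f. exec ((int (2*n) + 2) ^ d) P (matmul_input (2*n) A' B') t f \<and> t \<le> TM n \<and>
       (\<forall>i<2*n. \<forall>j<2*n. mem f (2 * (2*n)\<^sup>2 + i * (2*n) + j) = (\<Sum>l<2*n. A' i l * B' l j))"
    if n: "1 \<le> n" and A: "\<forall>i<2*n. \<forall>j<2*n. \<bar>A' i j\<bar> \<le> 1 \<and> \<bar>B' i j\<bar> \<le> 1" for n A' B'
  proof -
    from mm[rule_format, of "2 * n" A' B'] n A obtain t f where t: "exec ((int (2*n) + 2) ^ d0) P (matmul_input (2*n) A' B') t f" "real t \<le> C0 * real (2*n) powr \<omega>"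
      "\<forall>i<2*n. \<forall>j<2*n. mem f (2 * (2*n)\<^sup>2 + i * (2*n) + j) = (\<Sum>l<2*n. A' i l * B' l j)" by auto
    have "(int (2*n) + 2) ^ d0 \<le> (int (2*n) + 2) ^ d" by (rule power_increasing) (auto simp: d_def)
    from exec_mono[OF t(1) this] have e: "exec ((int (2*n) + 2) ^ d) P (matmul_input (2*n) A' B') t f" .
    have "C0 * real (2*n) powr \<omega> \<le> C * real (2*n) powr \<omega>" by (intro mult_right_mono) (auto simp: C_def)
    then have "real t \<le> C * (2 * real n) powr \<omega>" using t(2) by simp
    then have "t \<le> TM n" unfolding TM_def by (rule le_nat_floor)
    then show ?thesis using e t(3) by blast
  qed
  obtain c where c: "0 \<le> c" and ct: "\<And>n iv h0 h lev. 1 \<le> n \<Longrightarrow> iv \<le> n * n + 1 \<Longrightarrow> 0 < h0 \<Longrightarrow> (h0 - 1) * (h0 - 1) < n \<Longrightarrow> h = h0 * 2 ^ lev \<Longrightarrow>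
     lev = 0 \<or> n * (h * h) < 4 * TM n \<Longrightarrow> real (2 * htime n iv (TM n) h lev + 2 * (n * n) + 20) \<le> c * real n powr ((3 + \<omega>) / 2) * (1 + log 2 (real n))"
    using product_time[OF w2 True C] unfolding TM_def by blast
  \<comment> \<open>The real bound is rounded down to a natural number, so that the time of a
    product becomes a parameter of the preprocessing program's specification.\<close>
  define TP where "TP n = nat \<lfloor>c * real n powr ((3 + \<omega>) / 2) * (1 + log 2 (real n))\<rfloor>" for n :: nat
  have TP: "real (TP n) \<le> c * real n powr ((3 + \<omega>) / 2) * (1 + log 2 (real n))" if "1 \<le> n" for n
    unfolding TP_def using c that by (intro of_nat_floor mult_nonneg_nonneg) auto
  let ?Sd = "\<lambda>n. 2 * (2 * n)\<^sup>2 + (2 * n + 2) ^ d"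
  show ?thesis
  proof (rule assemble[OF assms(1) _ c TP, where pc = "prod_fast P d" and F = "\<lambda>n. ?Sd n + 8 * TM n + (2 * (n * n) + 3) + 2 * (n + 1)"
        and inc = "\<lambda>n. 2 * (n * n * ?Sd n)" and d = d])
    fix B n h0 :: nat and pred
    assume B: "?Sd n + 8 * TM n + (2 * (n * n) + 3) + 2 * (n + 1) \<le> B" and n: "1 \<le> n" and pr: "valid_prediction n pred"
      and h0: "0 < h0" "n \<le> h0 * h0" "(h0 - 1) * (h0 - 1) < n" "h0 \<le> n + 1"
    have len: "length pred \<le> n * n" by (rule valid_length[OF pr])
    show "prod_ok B (pred_input pred) n (length pred + 1) (?Sd n) h0 (2 * (n * n * ?Sd n)) (TP n) (prod_fast P d)"
    proof (rule prod_fast_ok[OF mm'[OF n] _ refl])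
      fix h lev assume h: "h = h0 * 2 ^ lev" "lev = 0 \<or> n * (h * h) < 4 * TM n"
      show "2 * htime n (length pred + 1) (TM n) h lev + 2 * (n * n) + 20 \<le> TP n"
        unfolding TP_def by (rule le_nat_floor, rule ct[OF n _ h0(1,3) h]) (use len in simp)
    qed (use B n h0 len in \<open>auto simp: d_def\<close>)
  next
    show "pb (\<lambda>n. ?Sd n + 8 * TM n + (2 * (n * n) + 3) + 2 * (n + 1))"
      using pb_powr[of C \<omega>] C unfolding TM_def by (intro pb_intros) auto
    show "pb (\<lambda>n. 2 * (n * n * ?Sd n))" by (intro pb_intros)
  qed (use w2 in auto)
qed

end
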